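(* Let $k$ be a field of characteristic $0$ and let $H$ be a cocommutative pointed Hopf algebra over $k$. Suppose that $x\in H$ is a central group-like element of infinite order. If $M$ is a modular crossed module over $H$ with $\rho(m)=m\otimes x$ for all $m\in M$, then $$\mathrm{HC}_*(H,M)\simeq\mathrm{Tor}^{\overline H}_*(k,M),$$ where $\overline H:=H/(1-x)H$.
   Context: $\otimes=\otimes_k$; $H$ has comultiplication $\Delta(h)=\sum h_{(1)}\otimes h_{(2)}$, counit $\varepsilon$, antipode $S$. $H$ is pointed if all its simple subcoalgebras are one-dimensional. A crossed module over $H$ is a left $H$-module $M$ which is also a right $H$-comodule via $\rho(m)=\sum m_{\langle0\rangle}\otimes m_{\langle1\rangle}\in M\otimes H$ such that $\rho(hm)=\sum h_{(2)}m_{\langle0\rangle}\otimes h_{(3)}m_{\langle1\rangle}S(h_{(1)})$. It is modular if $\sum m_{\langle1\rangle}m_{\langle0\rangle}=m$ for all $m$. (So here $xm=m$ for all $m\in M$ and $M$ is a left $\overline H$-module; $k$ is a right $\overline H$-module via $\varepsilon$.) For a modular crossed module $M$ over $H$, $Z_*(H,M)$ is the cyclic object with $Z_n(H,M)=H^{\otimes(n+1)}\otimes_HM$, where $H^{\otimes(n+1)}$ is a right $H$-module by the diagonal action, faces $\delta_i((h^0,\ldots,h^n)\otimes_Hm)=\varepsilon(h^i)(h^0,\ldots,\widehat{h^i},\ldots,h^n)\otimes_Hm$, degeneracies $\sigma_i((h^0,\ldots,h^n)\otimes_Hm)=(h^0,\ldots,\Delta(h^i),\ldots,h^n)\otimes_Hm$,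 and cyclic operator $\tau_n((h^0,\ldots,h^n)\otimes_Hm)=\sum(h^nm_{\langle1\rangle},h^0,\ldots,h^{n-1})\otimes_Hm_{\langle0\rangle}$. $\mathrm{HC}_*(H,M)$ is its cyclic homology (homology of the total complex of the Tsygan double complex). *)

theory Defs
  imports "HOL-Algebra.Algebra"
begin

section \<open>Vector spaces by generators and relations\<close>

definition lin_hom ::
    "('k, 'e) ring_scheme \<Rightarrow> ('k, 'v, 'f) module_scheme \<Rightarrow> ('k, 'w, 'g) module_scheme \<Rightarrow> ('v \<Rightarrow> 'w) set" where
  "lin_hom k V W = {f \<in> carrier V \<rightarrow> carrier W.
     (\<forall>u\<in>carrier V. \<forall>v\<in>carrier V. f (u \<oplus>\<^bsub>V\<^esub> v) = f u \<oplus>\<^bsub>W\<^esub> f v) \<and>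
     (\<forall>a\<in>carrier k. \<forall>v\<in>carrier V. f (a \<odot>\<^bsub>V\<^esub> v) = a \<odot>\<^bsub>W\<^esub> f v)}"

definition lin_iso ::
    "('k, 'e) ring_scheme \<Rightarrow> ('k, 'v, 'f) module_scheme \<Rightarrow> ('k, 'w, 'g) module_scheme \<Rightarrow> bool" where
  "lin_iso k V W \<longleftrightarrow> (\<exists>f\<in>lin_hom k V W. bij_betw f (carrier V) (carrier W))"

definition base_mod :: "('k, 'e) ring_scheme \<Rightarrow> ('k, 'k) module" where
  "base_mod k = \<lparr>carrier = carrier k, monoid.mult = monoid.mult k, one = one k, ring.zero = ring.zero k, ring.add = ring.add k, smult = monoid.mult k\<rparr>"

definition mod_span ::
    "('k, 'e) ring_scheme \<Rightarrow> ('k, 'v, 'f) module_scheme \<Rightarrow> 'v set \<Rightarrow> 'v set" where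
  "mod_span k V A = \<Inter>{N. submodule N k V \<and> A \<subseteq> N}"

text \<open>The quotient \<open>V / N\<close> on cosets. The underlying ring structure is the one of \<^const>\<open>FactRing\<close>, so
  for an algebra \<open>V\<close> and a two-sided ideal \<open>N\<close> this is the quotient algebra; if \<open>V\<close> is only a vector
  space, the fields \<^const>\<open>monoid.mult\<close> and \<^const>\<open>one\<close> carry no meaning (here and below).\<close>

definition quot_mod :: "('k, 'v, 'e) module_scheme \<Rightarrow> 'v set \<Rightarrow> ('k, 'v set) module" where
  "quot_mod V N = ring.extend (V Quot N)
     (module.fields (\<lambda>a C. \<Union>v\<in>C. N +>\<^bsub>V\<^esub> (a \<odot>\<^bsub>V\<^esub> v)))"

definition free_mod :: "('k, 'e) ring_scheme \<Rightarrow> 'x set \<Rightarrow> ('k, 'x \<Rightarrow> 'k) module" where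
  "free_mod k B = \<lparr>
     carrier = {c. finite {x. c x \<noteq> \<zero>\<^bsub>k\<^esub>} \<and> (\<forall>x\<in>B. c x \<in> carrier k) \<and> (\<forall>x. x \<notin> B \<longrightarrow> c x = \<zero>\<^bsub>k\<^esub>)},
     monoid.mult = undefined, one = undefined,
     ring.zero = (\<lambda>x. \<zero>\<^bsub>k\<^esub>), ring.add = (\<lambda>c d x. c x \<oplus>\<^bsub>k\<^esub> d x), smult = (\<lambda>a c x. a \<otimes>\<^bsub>k\<^esub> c x)\<rparr>"

definition free_gen :: "('k, 'e) ring_scheme \<Rightarrow> 'x \<Rightarrow> 'x \<Rightarrow> 'k" where
  "free_gen k x = (\<lambda>y. if y = x then \<one>\<^bsub>k\<^esub> else \<zero>\<^bsub>k\<^esub>)"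

definition lin_ext ::
    "('k, 'e) ring_scheme \<Rightarrow> ('k, 'v, 'f) module_scheme \<Rightarrow> ('x \<Rightarrow> 'v) \<Rightarrow> ('x \<Rightarrow> 'k) \<Rightarrow> 'v" where
  "lin_ext k V f c = (\<Oplus>\<^bsub>V\<^esub>x\<in>{x. c x \<noteq> \<zero>\<^bsub>k\<^esub>}. c x \<odot>\<^bsub>V\<^esub> f x)"

definition pres_mod ::
    "('k, 'e) ring_scheme \<Rightarrow> 'x set \<Rightarrow> ('x \<Rightarrow> 'k) set \<Rightarrow> ('k, ('x \<Rightarrow> 'k) set) module" where
  "pres_mod k B Rel = quot_mod (free_mod k B) (mod_span k (free_mod k B) Rel)"

definition pres_gen ::
    "('k, 'e) ring_scheme \<Rightarrow> 'x set \<Rightarrow> ('x \<Rightarrow> 'k) set \<Rightarrow> 'x \<Rightarrow> ('x \<Rightarrow> 'k) set" where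
  "pres_gen k B Rel x = mod_span k (free_mod k B) Rel +>\<^bsub>free_mod k B\<^esub> free_gen k x"

text \<open>The linear map out of a presented vector space given on generators by \<open>f\<close>. It is meaningful
  when the linear extension of \<open>f\<close> kills the relations, for then it is constant on each coset.\<close>

definition pres_lift ::
    "('k, 'e) ring_scheme \<Rightarrow> ('k, 'v, 'f) module_scheme \<Rightarrow> ('x \<Rightarrow> 'v) \<Rightarrow> ('x \<Rightarrow> 'k) set \<Rightarrow> 'v" where
  "pres_lift k V f C = the_elem (lin_ext k V f ` C)"


section \<open>Tensor products\<close>

text \<open>The tensor power of degree \<open>n\<close>, generated by the lists of length \<open>n\<close> (so that all tensor powers
  have elements of the same type).\<close>

definition tpow_basis :: "('k, 'v, 'f) module_scheme \<Rightarrow> nat \<Rightarrow> 'v list set" where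
  "tpow_basis V n = {vs. length vs = n \<and> set vs \<subseteq> carrier V}"

definition tpow_rel ::
    "('k, 'e) ring_scheme \<Rightarrow> ('k, 'v, 'f) module_scheme \<Rightarrow> nat \<Rightarrow> ('v list \<Rightarrow> 'k) set" where
  "tpow_rel k V n = (let F = free_mod k (tpow_basis V n); g = free_gen k in
     {g (xs @ (u \<oplus>\<^bsub>V\<^esub> v) # ys) \<ominus>\<^bsub>F\<^esub> (g (xs @ u # ys) \<oplus>\<^bsub>F\<^esub> g (xs @ v # ys)) | xs ys u v.
        xs @ u # ys \<in> tpow_basis V n \<and> v \<in> carrier V} \<union>
     {g (xs @ (a \<odot>\<^bsub>V\<^esub> v) # ys) \<ominus>\<^bsub>F\<^esub> a \<odot>\<^bsub>F\<^esub> g (xs @ v # ys) | xs ys a v.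
        xs @ v # ys \<in> tpow_basis V n \<and> a \<in> carrier k})"

definition tpow ::
    "('k, 'e) ring_scheme \<Rightarrow> ('k, 'v, 'f) module_scheme \<Rightarrow> nat \<Rightarrow> ('k, ('v list \<Rightarrow> 'k) set) module" where
  "tpow k V n = pres_mod k (tpow_basis V n) (tpow_rel k V n)"

definition tpow_pure ::
    "('k, 'e) ring_scheme \<Rightarrow> ('k, 'v, 'f) module_scheme \<Rightarrow> 'v list \<Rightarrow> ('v list \<Rightarrow> 'k) set" where
  "tpow_pure k V vs = pres_gen k (tpow_basis V (length vs)) (tpow_rel k V (length vs)) vs"

definition bilin_rel ::
    "('k, 'e) ring_scheme \<Rightarrow> ('k, 'v, 'f) module_scheme \<Rightarrow> ('k, 'w, 'g) module_scheme \<Rightarrow> ('v \<times> 'w \<Rightarrow> 'k) set" where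
  "bilin_rel k V W = (let F = free_mod k (carrier V \<times> carrier W); g = free_gen k in
     {g (u \<oplus>\<^bsub>V\<^esub> v, w) \<ominus>\<^bsub>F\<^esub> (g (u, w) \<oplus>\<^bsub>F\<^esub> g (v, w)) | u v w.
        u \<in> carrier V \<and> v \<in> carrier V \<and> w \<in> carrier W} \<union>
     {g (v, w \<oplus>\<^bsub>W\<^esub> z) \<ominus>\<^bsub>F\<^esub> (g (v, w) \<oplus>\<^bsub>F\<^esub> g (v, z)) | v w z.
        v \<in> carrier V \<and> w \<in> carrier W \<and> z \<in> carrier W} \<union>
     {g (a \<odot>\<^bsub>V\<^esub> v, w) \<ominus>\<^bsub>F\<^esub> a \<odot>\<^bsub>F\<^esub> g (v, w) | a v w.
        a \<in> carrier k \<and> v \<in> carrier V \<and> w \<in> carrier W} \<union>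
     {g (v, a \<odot>\<^bsub>W\<^esub> w) \<ominus>\<^bsub>F\<^esub> a \<odot>\<^bsub>F\<^esub> g (v, w) | a v w.
        a \<in> carrier k \<and> v \<in> carrier V \<and> w \<in> carrier W})"

definition tensor ::
    "('k, 'e) ring_scheme \<Rightarrow> ('k, 'v, 'f) module_scheme \<Rightarrow> ('k, 'w, 'g) module_scheme
      \<Rightarrow> ('k, ('v \<times> 'w \<Rightarrow> 'k) set) module" where
  "tensor k V W = pres_mod k (carrier V \<times> carrier W) (bilin_rel k V W)"

definition tensor_pure ::
    "('k, 'e) ring_scheme \<Rightarrow> ('k, 'v, 'f) module_scheme \<Rightarrow> ('k, 'w, 'g) module_scheme
      \<Rightarrow> 'v \<Rightarrow> 'w \<Rightarrow> ('v \<times> 'w \<Rightarrow> 'k) set" where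
  "tensor_pure k V W v w = pres_gen k (carrier V \<times> carrier W) (bilin_rel k V W) (v, w)"


section \<open>Algebras, modules, balanced tensor products\<close>

locale assoc_algebra = BASE?: field k + VEC?: module k A + ALG?: ring A
  for k (structure) and A (structure) +
  assumes smult_mult_left: "\<lbrakk>a \<in> carrier k; x \<in> carrier A; y \<in> carrier A\<rbrakk> \<Longrightarrow>
      (a \<odot>\<^bsub>A\<^esub> x) \<otimes>\<^bsub>A\<^esub> y = a \<odot>\<^bsub>A\<^esub> (x \<otimes>\<^bsub>A\<^esub> y)"
    and smult_mult_right: "\<lbrakk>a \<in> carrier k; x \<in> carrier A; y \<in> carrier A\<rbrakk> \<Longrightarrow>
      x \<otimes>\<^bsub>A\<^esub> (a \<odot>\<^bsub>A\<^esub> y) = a \<odot>\<^bsub>A\<^esub> (x \<otimes>\<^bsub>A\<^esub> y)"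

record ('k, 'r, 'v) left_mod = "('k, 'v) module" +
  lact :: "'r \<Rightarrow> 'v \<Rightarrow> 'v"

record ('k, 'r, 'v) right_mod = "('k, 'v) module" +
  ract :: "'v \<Rightarrow> 'r \<Rightarrow> 'v"

locale left_module = assoc_algebra k R + ACTED: module k V
  for k :: "('k, 'e) ring_scheme" and R :: "('k, 'r, 'f) module_scheme" and V :: "('k, 'r, 'v, 'g) left_mod_scheme" +
  assumes lact_closed: "\<lbrakk>r \<in> carrier R; v \<in> carrier V\<rbrakk> \<Longrightarrow> lact V r v \<in> carrier V"
    and lact_l_distr: "\<lbrakk>r \<in> carrier R; s \<in> carrier R; v \<in> carrier V\<rbrakk> \<Longrightarrow>
      lact V (r \<oplus>\<^bsub>R\<^esub> s) v = lact V r v \<oplus>\<^bsub>V\<^esub> lact V s v"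
    and lact_r_distr: "\<lbrakk>r \<in> carrier R; v \<in> carrier V; w \<in> carrier V\<rbrakk> \<Longrightarrow>
      lact V r (v \<oplus>\<^bsub>V\<^esub> w) = lact V r v \<oplus>\<^bsub>V\<^esub> lact V r w"
    and lact_smult_l: "\<lbrakk>a \<in> carrier k; r \<in> carrier R; v \<in> carrier V\<rbrakk> \<Longrightarrow>
      lact V (a \<odot>\<^bsub>R\<^esub> r) v = a \<odot>\<^bsub>V\<^esub> lact V r v"
    and lact_smult_r: "\<lbrakk>a \<in> carrier k; r \<in> carrier R; v \<in> carrier V\<rbrakk> \<Longrightarrow>
      lact V r (a \<odot>\<^bsub>V\<^esub> v) = a \<odot>\<^bsub>V\<^esub> lact V r v"
    and lact_assoc: "\<lbrakk>r \<in> carrier R; s \<in> carrier R; v \<in> carrier V\<rbrakk> \<Longrightarrow>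
      lact V (r \<otimes>\<^bsub>R\<^esub> s) v = lact V r (lact V s v)"
    and lact_one: "v \<in> carrier V \<Longrightarrow> lact V \<one>\<^bsub>R\<^esub> v = v"

locale right_module = assoc_algebra k R + ACTED: module k V
  for k :: "('k, 'e) ring_scheme" and R :: "('k, 'r, 'f) module_scheme" and V :: "('k, 'r, 'v, 'g) right_mod_scheme" +
  assumes ract_closed: "\<lbrakk>v \<in> carrier V; r \<in> carrier R\<rbrakk> \<Longrightarrow> ract V v r \<in> carrier V"
    and ract_l_distr: "\<lbrakk>v \<in> carrier V; w \<in> carrier V; r \<in> carrier R\<rbrakk> \<Longrightarrow>
      ract V (v \<oplus>\<^bsub>V\<^esub> w) r = ract V v r \<oplus>\<^bsub>V\<^esub> ract V w r"
    and ract_r_distr: "\<lbrakk>v \<in> carrier V; r \<in> carrier R; s \<in> carrier R\<rbrakk> \<Longrightarrow>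
      ract V v (r \<oplus>\<^bsub>R\<^esub> s) = ract V v r \<oplus>\<^bsub>V\<^esub> ract V v s"
    and ract_smult_l: "\<lbrakk>a \<in> carrier k; v \<in> carrier V; r \<in> carrier R\<rbrakk> \<Longrightarrow>
      ract V (a \<odot>\<^bsub>V\<^esub> v) r = a \<odot>\<^bsub>V\<^esub> ract V v r"
    and ract_smult_r: "\<lbrakk>a \<in> carrier k; v \<in> carrier V; r \<in> carrier R\<rbrakk> \<Longrightarrow>
      ract V v (a \<odot>\<^bsub>R\<^esub> r) = a \<odot>\<^bsub>V\<^esub> ract V v r"
    and ract_assoc: "\<lbrakk>v \<in> carrier V; r \<in> carrier R; s \<in> carrier R\<rbrakk> \<Longrightarrow>
      ract V v (r \<otimes>\<^bsub>R\<^esub> s) = ract V (ract V v r) s"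
    and ract_one: "v \<in> carrier V \<Longrightarrow> ract V v \<one>\<^bsub>R\<^esub> = v"

definition right_hom ::
    "('k, 'e) ring_scheme \<Rightarrow> ('k, 'r, 'f) module_scheme \<Rightarrow> ('k, 'r, 'v, 'g) right_mod_scheme
      \<Rightarrow> ('k, 'r, 'w, 'h) right_mod_scheme \<Rightarrow> ('v \<Rightarrow> 'w) set" where
  "right_hom k R V W = {f \<in> lin_hom k V W.
     \<forall>v\<in>carrier V. \<forall>r\<in>carrier R. f (ract V v r) = ract W (f v) r}"

definition balanced_rel ::
    "('k, 'e) ring_scheme \<Rightarrow> ('k, 'r, 'f) module_scheme \<Rightarrow> ('k, 'r, 'v, 'g) right_mod_scheme
      \<Rightarrow> ('k, 'r, 'w, 'h) left_mod_scheme \<Rightarrow> ('v \<times> 'w \<Rightarrow> 'k) set" where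
  "balanced_rel k R V W =
     {free_gen k (ract V v r, w) \<ominus>\<^bsub>free_mod k (carrier V \<times> carrier W)\<^esub> free_gen k (v, lact W r w) | v r w.
        v \<in> carrier V \<and> r \<in> carrier R \<and> w \<in> carrier W}"

definition tensor_over ::
    "('k, 'e) ring_scheme \<Rightarrow> ('k, 'r, 'f) module_scheme \<Rightarrow> ('k, 'r, 'v, 'g) right_mod_scheme
      \<Rightarrow> ('k, 'r, 'w, 'h) left_mod_scheme \<Rightarrow> ('k, ('v \<times> 'w \<Rightarrow> 'k) set) module" where
  "tensor_over k R V W = pres_mod k (carrier V \<times> carrier W) (bilin_rel k V W \<union> balanced_rel k R V W)"

definition tensor_over_pure ::
    "('k, 'e) ring_scheme \<Rightarrow> ('k, 'r, 'f) module_scheme \<Rightarrow> ('k, 'r, 'v, 'g) right_mod_scheme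
      \<Rightarrow> ('k, 'r, 'w, 'h) left_mod_scheme \<Rightarrow> 'v \<Rightarrow> 'w \<Rightarrow> ('v \<times> 'w \<Rightarrow> 'k) set" where
  "tensor_over_pure k R V W v w =
     pres_gen k (carrier V \<times> carrier W) (bilin_rel k V W \<union> balanced_rel k R V W) (v, w)"


section \<open>Homology and Tor\<close>

text \<open>Chain complexes in nonnegative degrees; the differential \<open>d n\<close> goes from degree \<open>n\<close> to degree
  \<open>n - 1\<close>, and \<open>d 0\<close> is ignored (it stands for the zero map).\<close>

definition cycles :: "(nat \<Rightarrow> ('k, 'v, 'e) module_scheme) \<Rightarrow> (nat \<Rightarrow> 'v \<Rightarrow> 'v) \<Rightarrow> nat \<Rightarrow> 'v set" where
  "cycles C d n = {z \<in> carrier (C n). 0 < n \<longrightarrow> d n z = \<zero>\<^bsub>C (n - 1)\<^esub>}"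

definition homology ::
    "(nat \<Rightarrow> ('k, 'v, 'e) module_scheme) \<Rightarrow> (nat \<Rightarrow> 'v \<Rightarrow> 'v) \<Rightarrow> nat \<Rightarrow> ('k, 'v set) module" where
  "homology C d n = quot_mod ((C n)\<lparr>carrier := cycles C d n\<rparr>) (d (Suc n) ` carrier (C (Suc n)))"

text \<open>Projectivity as the lifting property against epimorphisms. The types allowed for the carriers of
  \<open>B\<close> and \<open>Y\<close> cost no generality: they contain the canonical epimorphism \<open>R\<^sup>(\<^sup>P\<^sup>) \<rightarrow> P\<close> from the free module
  on the set \<open>P\<close>, whose splitting makes \<open>P\<close> a direct summand of a free module.\<close>

definition projective ::
    "('k, 'e) ring_scheme \<Rightarrow> ('k, 'r, 'f) module_scheme \<Rightarrow> ('k, 'r, 'p) right_mod \<Rightarrow> bool" where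
  "projective k R P \<longleftrightarrow> right_module k R P \<and>
     (\<forall>(B :: ('k, 'r, 'p \<Rightarrow> 'r) right_mod) (Y :: ('k, 'r, 'p) right_mod) g f.
        right_module k R B \<and> right_module k R Y \<and>
        g \<in> right_hom k R B Y \<and> g ` carrier B = carrier Y \<and> f \<in> right_hom k R P Y \<longrightarrow>
        (\<exists>l\<in>right_hom k R P B. \<forall>p\<in>carrier P. g (l p) = f p))"

definition projective_resolution ::
    "('k, 'e) ring_scheme \<Rightarrow> ('k, 'r, 'f) module_scheme \<Rightarrow> ('k, 'r, 'a, 'g) right_mod_scheme
      \<Rightarrow> (nat \<Rightarrow> ('k, 'r, 'p) right_mod) \<Rightarrow> (nat \<Rightarrow> 'p \<Rightarrow> 'p) \<Rightarrow> ('p \<Rightarrow> 'a) \<Rightarrow> bool" where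
  "projective_resolution k R A P d aug \<longleftrightarrow> right_module k R A \<and>
     (\<forall>n. projective k R (P n)) \<and>
     (\<forall>n. d (Suc n) \<in> right_hom k R (P (Suc n)) (P n)) \<and>
     aug \<in> right_hom k R (P 0) A \<and>
     aug ` carrier (P 0) = carrier A \<and>
     {p \<in> carrier (P 0). aug p = \<zero>\<^bsub>A\<^esub>} = d 1 ` carrier (P 1) \<and>
     (\<forall>n. {p \<in> carrier (P (Suc n)). d (Suc n) p = \<zero>\<^bsub>P n\<^esub>} = d (Suc (Suc n)) ` carrier (P (Suc (Suc n))))"

text \<open>If \<open>(P, d)\<close> is a projective resolution of the right module \<open>A\<close>, this is \<open>Tor\<^sub>n\<^sup>R(A, B)\<close>, the homology
  of \<open>P \<otimes>\<^sub>R B\<close>; different resolutions yield isomorphic results.\<close>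

definition Tor ::
    "('k, 'e) ring_scheme \<Rightarrow> ('k, 'r, 'f) module_scheme \<Rightarrow> (nat \<Rightarrow> ('k, 'r, 'p) right_mod)
      \<Rightarrow> (nat \<Rightarrow> 'p \<Rightarrow> 'p) \<Rightarrow> ('k, 'r, 'b, 'g) left_mod_scheme \<Rightarrow> nat \<Rightarrow> ('k, ('p \<times> 'b \<Rightarrow> 'k) set set) module" where
  "Tor k R P d B = homology (\<lambda>n. tensor_over k R (P n) B)
     (\<lambda>n. pres_lift k (tensor_over k R (P (n - 1)) B)
            (\<lambda>(p, b). tensor_over_pure k R (P (n - 1)) B (d n p) b))"


section \<open>Cyclic objects and their cyclic homology\<close>

record ('k, 'z) cyclic_object =
  chains :: "nat \<Rightarrow> ('k, 'z) module"
  face :: "nat \<Rightarrow> nat \<Rightarrow> 'z \<Rightarrow> 'z"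
    \<comment> \<open>\<open>face Z n i\<close> is \<open>\<delta>\<^sub>i : Z\<^sub>n \<rightarrow> Z\<^bsub>n-1\<^esub>\<close>, for \<open>n \<ge> 1\<close> and \<open>i \<le> n\<close>\<close>
  degen :: "nat \<Rightarrow> nat \<Rightarrow> 'z \<Rightarrow> 'z"
    \<comment> \<open>\<open>degen Z n i\<close> is \<open>\<sigma>\<^sub>i : Z\<^sub>n \<rightarrow> Z\<^bsub>n+1\<^esub>\<close>, for \<open>i \<le> n\<close>\<close>
  cyc :: "nat \<Rightarrow> 'z \<Rightarrow> 'z"

definition alt_sign :: "('v, 'e) ring_scheme \<Rightarrow> nat \<Rightarrow> 'v \<Rightarrow> 'v" where
  "alt_sign V i v = (if even i then v else \<ominus>\<^bsub>V\<^esub> v)"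

definition cyc_b :: "('k, 'z) cyclic_object \<Rightarrow> nat \<Rightarrow> 'z \<Rightarrow> 'z" where
  "cyc_b Z n z = (\<Oplus>\<^bsub>chains Z (n - 1)\<^esub>i\<in>{..n}. alt_sign (chains Z (n - 1)) i (face Z n i z))"

definition cyc_b' :: "('k, 'z) cyclic_object \<Rightarrow> nat \<Rightarrow> 'z \<Rightarrow> 'z" where
  "cyc_b' Z n z = (\<Oplus>\<^bsub>chains Z (n - 1)\<^esub>i\<in>{..<n}. alt_sign (chains Z (n - 1)) i (face Z n i z))"

definition cyc_t :: "('k, 'z) cyclic_object \<Rightarrow> nat \<Rightarrow> 'z \<Rightarrow> 'z" where
  "cyc_t Z n z = alt_sign (chains Z n) n (cyc Z n z)"

definition cyc_norm :: "('k, 'z) cyclic_object \<Rightarrow> nat \<Rightarrow> 'z \<Rightarrow> 'z" where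
  "cyc_norm Z n z = (\<Oplus>\<^bsub>chains Z n\<^esub>i\<in>{..n}. (cyc_t Z n ^^ i) z)"

text \<open>Tsygan's double complex has \<open>Z\<^sub>q\<close> in each bidegree \<open>(p, q)\<close> with \<open>p, q \<ge> 0\<close>; the vertical
  differential is \<open>b\<close> in even and \<open>-b'\<close> in odd columns, the horizontal one is \<open>1 - t\<close> out of odd and
  the norm \<open>N\<close> out of even columns. An element of total degree \<open>n\<close> is a function of \<open>q \<le> n\<close>, its
  value at \<open>q\<close> being the component in bidegree \<open>(n - q, q)\<close>.\<close>

definition tsygan_tot :: "('k, 'z) cyclic_object \<Rightarrow> nat \<Rightarrow> ('k, nat \<Rightarrow> 'z) module" where
  "tsygan_tot Z n = \<lparr>
     carrier = (\<Pi>\<^sub>E q\<in>{..n}. carrier (chains Z q)),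
     monoid.mult = undefined, one = undefined,
     ring.zero = (\<lambda>q\<in>{..n}. \<zero>\<^bsub>chains Z q\<^esub>),
     ring.add = (\<lambda>f g. \<lambda>q\<in>{..n}. f q \<oplus>\<^bsub>chains Z q\<^esub> g q),
     smult = (\<lambda>a f. \<lambda>q\<in>{..n}. a \<odot>\<^bsub>chains Z q\<^esub> f q)\<rparr>"

definition tsygan_diff :: "('k, 'z) cyclic_object \<Rightarrow> nat \<Rightarrow> (nat \<Rightarrow> 'z) \<Rightarrow> nat \<Rightarrow> 'z" where
  "tsygan_diff Z n f = (\<lambda>q\<in>{..<n}.
     (if even (n - 1 - q) then cyc_b Z (Suc q) (f (Suc q))
      else \<ominus>\<^bsub>chains Z q\<^esub> cyc_b' Z (Suc q) (f (Suc q)))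
     \<oplus>\<^bsub>chains Z q\<^esub>
     (if even (n - q) then cyc_norm Z q (f q) else f q \<ominus>\<^bsub>chains Z q\<^esub> cyc_t Z q (f q)))"

definition HC :: "('k, 'z) cyclic_object \<Rightarrow> nat \<Rightarrow> ('k, (nat \<Rightarrow> 'z) set) module" where
  "HC Z = homology (tsygan_tot Z) (tsygan_diff Z)"


section \<open>Coalgebras and Hopf algebras\<close>

record ('k, 'c) coalg = "('k, 'c) module" +
  comult :: "'c \<Rightarrow> ('c list \<Rightarrow> 'k) set"
  counit :: "'c \<Rightarrow> 'k"

record ('k, 'h) hopf = "('k, 'h) coalg" +
  antipode :: "'h \<Rightarrow> 'h"

text \<open>The maps \<open>id \<otimes> \<Delta> \<otimes> id : C\<^sup>\<otimes>\<^sup>n \<rightarrow> C\<^sup>\<otimes>\<^sup>(\<^sup>n\<^sup>+\<^sup>1\<^sup>)\<close> and \<open>id \<otimes> \<epsilon> \<otimes> id : C\<^sup>\<otimes>\<^sup>(\<^sup>n\<^sup>+\<^sup>1\<^sup>) \<rightarrow> C\<^sup>\<otimes>\<^sup>n\<close>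
  acting on the factor at position \<open>i\<close> (counted from 0).\<close>

definition comult_at ::
    "('k, 'e) ring_scheme \<Rightarrow> ('k, 'c, 'f) coalg_scheme \<Rightarrow> nat \<Rightarrow> nat \<Rightarrow> ('c list \<Rightarrow> 'k) set \<Rightarrow> ('c list \<Rightarrow> 'k) set" where
  "comult_at k C n i = pres_lift k (tpow k C (Suc n)) (\<lambda>cs.
     pres_lift k (tpow k C (Suc n)) (\<lambda>ds. tpow_pure k C (take i cs @ ds @ drop (Suc i) cs)) (comult C (cs ! i)))"

definition counit_at ::
    "('k, 'e) ring_scheme \<Rightarrow> ('k, 'c, 'f) coalg_scheme \<Rightarrow> nat \<Rightarrow> nat \<Rightarrow> ('c list \<Rightarrow> 'k) set \<Rightarrow> ('c list \<Rightarrow> 'k) set" where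
  "counit_at k C n i = pres_lift k (tpow k C n) (\<lambda>cs.
     counit C (cs ! i) \<odot>\<^bsub>tpow k C n\<^esub> tpow_pure k C (take i cs @ drop (Suc i) cs))"

locale coalgebra = field k + CO: module k C
  for k :: "('k, 'e) ring_scheme" and C :: "('k, 'c, 'f) coalg_scheme" +
  assumes comult_linear: "comult C \<in> lin_hom k C (tpow k C 2)"
    and counit_linear: "counit C \<in> lin_hom k C (base_mod k)"
    and coassoc: "c \<in> carrier C \<Longrightarrow> comult_at k C 2 0 (comult C c) = comult_at k C 2 1 (comult C c)"
    and counit_left: "c \<in> carrier C \<Longrightarrow> counit_at k C 1 0 (comult C c) = tpow_pure k C [c]"
    and counit_right: "c \<in> carrier C \<Longrightarrow> counit_at k C 1 1 (comult C c) = tpow_pure k C [c]"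

definition cocommutative :: "('k, 'e) ring_scheme \<Rightarrow> ('k, 'c, 'f) coalg_scheme \<Rightarrow> bool" where
  "cocommutative k C \<longleftrightarrow> (\<forall>c\<in>carrier C.
     pres_lift k (tpow k C 2) (\<lambda>cs. tpow_pure k C (rev cs)) (comult C c) = comult C c)"

definition subcoalgebra :: "('k, 'e) ring_scheme \<Rightarrow> ('k, 'c, 'f) coalg_scheme \<Rightarrow> 'c set \<Rightarrow> bool" where
  "subcoalgebra k C D \<longleftrightarrow> submodule D k C \<and>
     comult C ` D \<subseteq> mod_span k (tpow k C 2) {tpow_pure k C [c, d] | c d. c \<in> D \<and> d \<in> D}"

definition simple_subcoalgebra :: "('k, 'e) ring_scheme \<Rightarrow> ('k, 'c, 'f) coalg_scheme \<Rightarrow> 'c set \<Rightarrow> bool" where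
  "simple_subcoalgebra k C D \<longleftrightarrow> subcoalgebra k C D \<and> D \<noteq> {\<zero>\<^bsub>C\<^esub>} \<and>
     (\<forall>E. subcoalgebra k C E \<and> E \<subseteq> D \<longrightarrow> E = {\<zero>\<^bsub>C\<^esub>} \<or> E = D)"

definition one_dimensional :: "('k, 'e) ring_scheme \<Rightarrow> ('k, 'v, 'f) module_scheme \<Rightarrow> 'v set \<Rightarrow> bool" where
  "one_dimensional k V D \<longleftrightarrow> (\<exists>v\<in>carrier V. v \<noteq> \<zero>\<^bsub>V\<^esub> \<and> D = {a \<odot>\<^bsub>V\<^esub> v | a. a \<in> carrier k})"

definition pointed :: "('k, 'e) ring_scheme \<Rightarrow> ('k, 'c, 'f) coalg_scheme \<Rightarrow> bool" where
  "pointed k C \<longleftrightarrow> (\<forall>D. simple_subcoalgebra k C D \<longrightarrow> one_dimensional k C D)"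

definition group_like :: "('k, 'e) ring_scheme \<Rightarrow> ('k, 'c, 'f) coalg_scheme \<Rightarrow> 'c \<Rightarrow> bool" where
  "group_like k C g \<longleftrightarrow> g \<in> carrier C \<and> comult C g = tpow_pure k C [g, g] \<and> counit C g = \<one>\<^bsub>k\<^esub>"

definition tpow_mult ::
    "('k, 'e) ring_scheme \<Rightarrow> ('k, 'a, 'f) module_scheme \<Rightarrow> nat
      \<Rightarrow> ('a list \<Rightarrow> 'k) set \<Rightarrow> ('a list \<Rightarrow> 'k) set \<Rightarrow> ('a list \<Rightarrow> 'k) set" where
  "tpow_mult k A n s t = pres_lift k (tpow k A n) (\<lambda>as.
     pres_lift k (tpow k A n) (\<lambda>bs. tpow_pure k A (map2 (monoid.mult A) as bs)) t) s"

locale hopf_algebra = assoc_algebra k H + coalgebra k H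
  for k :: "('k, 'e) ring_scheme" and H :: "('k, 'h, 'f) hopf_scheme" +
  assumes comult_mult: "\<lbrakk>g \<in> carrier H; h \<in> carrier H\<rbrakk> \<Longrightarrow>
      comult H (g \<otimes>\<^bsub>H\<^esub> h) = tpow_mult k H 2 (comult H g) (comult H h)"
    and comult_one: "comult H \<one>\<^bsub>H\<^esub> = tpow_pure k H [\<one>\<^bsub>H\<^esub>, \<one>\<^bsub>H\<^esub>]"
    and counit_mult: "\<lbrakk>g \<in> carrier H; h \<in> carrier H\<rbrakk> \<Longrightarrow>
      counit H (g \<otimes>\<^bsub>H\<^esub> h) = counit H g \<otimes>\<^bsub>k\<^esub> counit H h"
    and counit_one: "counit H \<one>\<^bsub>H\<^esub> = \<one>\<^bsub>k\<^esub>"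
    and antipode_linear: "antipode H \<in> lin_hom k H H"
    and antipode_left: "h \<in> carrier H \<Longrightarrow>
      pres_lift k H (\<lambda>hs. antipode H (hs ! 0) \<otimes>\<^bsub>H\<^esub> hs ! 1) (comult H h) = counit H h \<odot>\<^bsub>H\<^esub> \<one>\<^bsub>H\<^esub>"
    and antipode_right: "h \<in> carrier H \<Longrightarrow>
      pres_lift k H (\<lambda>hs. hs ! 0 \<otimes>\<^bsub>H\<^esub> antipode H (hs ! 1)) (comult H h) = counit H h \<odot>\<^bsub>H\<^esub> \<one>\<^bsub>H\<^esub>"

text \<open>The iterated comultiplication \<open>h \<mapsto> \<Sum> h\<^sub>(\<^sub>1\<^sub>) \<otimes> \<cdots> \<otimes> h\<^bsub>(n+1)\<^esub>\<close>.\<close>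

primrec comult_iter ::
    "('k, 'e) ring_scheme \<Rightarrow> ('k, 'c, 'f) coalg_scheme \<Rightarrow> nat \<Rightarrow> 'c \<Rightarrow> ('c list \<Rightarrow> 'k) set" where
  "comult_iter k C 0 h = tpow_pure k C [h]"
| "comult_iter k C (Suc n) h = comult_at k C (Suc n) 0 (comult_iter k C n h)"


section \<open>Crossed modules and the cyclic object \<open>Z\<^sub>*(H, M)\<close>\<close>

record ('k, 'h, 'm) crossed_mod = "('k, 'h, 'm) left_mod" +
  coact :: "'m \<Rightarrow> ('m \<times> 'h \<Rightarrow> 'k) set"

locale crossed_module = hopf_algebra k H + left_module k H M
  for k :: "('k, 'e) ring_scheme" and H :: "('k, 'h, 'f) hopf_scheme" and M :: "('k, 'h, 'm, 'g) crossed_mod_scheme" +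
  assumes coact_linear: "coact M \<in> lin_hom k M (tensor k M H)"
    and coact_coassoc: "m \<in> carrier M \<Longrightarrow>
      pres_lift k (tensor k (tensor k M H) H)
        (\<lambda>(m0, m1). tensor_pure k (tensor k M H) H (coact M m0) m1) (coact M m) =
      pres_lift k (tensor k (tensor k M H) H)
        (\<lambda>(m0, m1). pres_lift k (tensor k (tensor k M H) H)
           (\<lambda>hs. tensor_pure k (tensor k M H) H (tensor_pure k M H m0 (hs ! 0)) (hs ! 1)) (comult H m1))
        (coact M m)"
    and coact_counit: "m \<in> carrier M \<Longrightarrow>
      pres_lift k M (\<lambda>(m0, m1). counit H m1 \<odot>\<^bsub>M\<^esub> m0) (coact M m) = m"
    and coact_lact: "\<lbrakk>h \<in> carrier H; m \<in> carrier M\<rbrakk> \<Longrightarrow>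
      coact M (lact M h m) =
      pres_lift k (tensor k M H)
        (\<lambda>hs. pres_lift k (tensor k M H)
           (\<lambda>(m0, m1). tensor_pure k M H (lact M (hs ! 1) m0) (hs ! 2 \<otimes>\<^bsub>H\<^esub> m1 \<otimes>\<^bsub>H\<^esub> antipode H (hs ! 0)))
           (coact M m))
        (comult_iter k H 2 h)"

definition modular ::
    "('k, 'e) ring_scheme \<Rightarrow> ('k, 'h, 'm, 'f) crossed_mod_scheme \<Rightarrow> bool" where
  "modular k M \<longleftrightarrow> (\<forall>m\<in>carrier M. pres_lift k M (\<lambda>(m0, m1). lact M m1 m0) (coact M m) = m)"

text \<open>\<open>H\<^sup>\<otimes>\<^sup>n\<close> with the diagonal right action \<open>(h\<^sup>1, \<dots>, h\<^sup>n) h = \<Sum> (h\<^sup>1 h\<^sub>(\<^sub>1\<^sub>), \<dots>, h\<^sup>n h\<^bsub>(n)\<^esub>)\<close>; only used for \<open>n \<ge> 1\<close>.\<close>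

definition diag_mod ::
    "('k, 'e) ring_scheme \<Rightarrow> ('k, 'h, 'f) hopf_scheme \<Rightarrow> nat \<Rightarrow> ('k, 'h, ('h list \<Rightarrow> 'k) set) right_mod" where
  "diag_mod k H n = module.extend (tpow k H n)
     (right_mod.fields (\<lambda>t h. tpow_mult k H n t (comult_iter k H (n - 1) h)))"

text \<open>The map \<open>(h\<^sup>0, \<dots>, h\<^sup>n) \<mapsto> (h\<^sup>n g, h\<^sup>0, \<dots>, h\<^sup>n\<^sup>-\<^sup>1)\<close> on \<open>H\<^sup>\<otimes>\<^sup>(\<^sup>n\<^sup>+\<^sup>1\<^sup>)\<close>.\<close>

definition twist_rotate ::
    "('k, 'e) ring_scheme \<Rightarrow> ('k, 'h, 'f) hopf_scheme \<Rightarrow> nat \<Rightarrow> 'h \<Rightarrow> ('h list \<Rightarrow> 'k) set \<Rightarrow> ('h list \<Rightarrow> 'k) set" where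
  "twist_rotate k H n g = pres_lift k (tpow k H (Suc n)) (\<lambda>hs. tpow_pure k H ((last hs \<otimes>\<^bsub>H\<^esub> g) # butlast hs))"

definition hopf_chains ::
    "('k, 'e) ring_scheme \<Rightarrow> ('k, 'h, 'f) hopf_scheme \<Rightarrow> ('k, 'h, 'm, 'g) crossed_mod_scheme
      \<Rightarrow> nat \<Rightarrow> ('k, (('h list \<Rightarrow> 'k) set \<times> 'm \<Rightarrow> 'k) set) module" where
  "hopf_chains k H M n = tensor_over k H (diag_mod k H (Suc n)) M"

definition hopf_cyclic ::
    "('k, 'e) ring_scheme \<Rightarrow> ('k, 'h, 'f) hopf_scheme \<Rightarrow> ('k, 'h, 'm, 'g) crossed_mod_scheme
      \<Rightarrow> ('k, (('h list \<Rightarrow> 'k) set \<times> 'm \<Rightarrow> 'k) set) cyclic_object" where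
  "hopf_cyclic k H M = \<lparr>
     chains = hopf_chains k H M,
     face = (\<lambda>n i. pres_lift k (hopf_chains k H M (n - 1))
       (\<lambda>(t, m). tensor_over_pure k H (diag_mod k H n) M (counit_at k H n i t) m)),
     degen = (\<lambda>n i. pres_lift k (hopf_chains k H M (Suc n))
       (\<lambda>(t, m). tensor_over_pure k H (diag_mod k H (Suc (Suc n))) M (comult_at k H (Suc n) i t) m)),
     cyc = (\<lambda>n. pres_lift k (hopf_chains k H M n)
       (\<lambda>(t, m). pres_lift k (hopf_chains k H M n)
          (\<lambda>(m0, m1). tensor_over_pure k H (diag_mod k H (Suc n)) M (twist_rotate k H n m1 t) m0)
          (coact M m)))\<rparr>"


section \<open>The quotient \<open>H / (1 - x) H\<close> and its modules\<close>

definition one_minus_ideal :: "('h, 'f) ring_scheme \<Rightarrow> 'h \<Rightarrow> 'h set" where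
  "one_minus_ideal H x = {(\<one>\<^bsub>H\<^esub> \<ominus>\<^bsub>H\<^esub> x) \<otimes>\<^bsub>H\<^esub> h | h. h \<in> carrier H}"

text \<open>The two actions below are well defined on cosets only if \<open>(1 - x) H\<close> annihilates \<open>M\<close>, respectively
  lies in the kernel of the counit; for \<open>x\<close> central group-like and \<open>M\<close> modular with \<open>\<rho>(m) = m \<otimes> x\<close>
  both hold.\<close>

definition quot_left_mod ::
    "('k, 'h, 'm, 'f) left_mod_scheme \<Rightarrow> ('k, 'h set, 'm) left_mod" where
  "quot_left_mod M = module.extend (module.truncate M)
     (left_mod.fields (\<lambda>C m. the_elem ((\<lambda>h. lact M h m) ` C)))"

definition quot_trivial_right_mod ::
    "('k, 'e) ring_scheme \<Rightarrow> ('k, 'h, 'f) coalg_scheme \<Rightarrow> ('k, 'h set, 'k) right_mod" where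
  "quot_trivial_right_mod k H = module.extend (base_mod k)
     (right_mod.fields (\<lambda>a C. a \<otimes>\<^bsub>k\<^esub> the_elem (counit H ` C)))"

end

theory Submission
imports Defs
begin

text \<open>Why the theorem holds. Let \<open>z\<close> be the action of \<open>x\<close> on \<open>X\<^sub>n = H\<^sup>\<otimes>\<^sup>(\<^sup>n\<^sup>+\<^sup>1\<^sup>)\<close>. With the faces given by the
counit and the twisted rotation \<open>t\<close> (with its sign), \<open>X\<close> is a paracyclic object: all relations of a cyclic
object hold, except that \<open>t\<^sup>n\<^sup>+\<^sup>1 = z\<close>. Hence \<open>(1 - t) N = N (1 - t) = 1 - z\<close>, and Tsygan's total complex of
\<open>X\<close> has a differential \<open>D\<close> with \<open>D D = 1 - z\<close>, which is a differential modulo \<open>1 - x\<close>.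

The point is that \<open>1 - x\<close> acts injectively. On \<open>H\<close> this is \<open>no_fixed_vectors\<close>: if \<open>h x = h\<close>, then the
coefficient space of \<open>h\<close> is a finite-dimensional subcoalgebra stable under \<open>x\<close>; being pointed, it contains a
group-like \<open>g\<close> and so all \<open>g x\<^sup>i\<close>, which are linearly independent. It passes to \<open>X\<^sub>n\<close> because \<open>X\<^sub>n\<close> is a
free right \<open>H\<close>-module (\<open>diag_dual_basis\<close>). Then \<open>1 - t\<close> and \<open>N\<close> are injective, so the rows of the double
complex are exact modulo \<open>1 - x\<close>, while the column of the \<open>b\<close>-complex is contracted by prepending \<open>1\<close>.
Hence \<open>Tot X / (1 - x)\<close> is a projective resolution of \<open>k\<close> over \<open>H / (1 - x)H\<close> (\<open>res_exact_resolution\<close>).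

Tensoring it with \<open>M\<close> gives Tsygan's complex of the cyclic object of \<open>M\<close>, by \<open>[f] \<otimes> m \<mapsto> (f\<^sub>q \<otimes> m)\<^sub>q\<close>
(\<open>HC_as_homology_of_resolution\<close>), and the comparison theorem for projective resolutions (\<open>comparison\<close>)
identifies its homology with that of the given resolution.\<close>

section \<open>Notation\<close>

text \<open>Input notation for elements of a carrier and for operations of an explicit structure.\<close>

abbreviation (input) in_carrier (infix ".:" 50) where "v .: V \<equiv> v \<in> carrier V"
abbreviation (input) sub_carrier (infix "<:" 50) where "A <: V \<equiv> A \<subseteq> carrier V"
abbreviation (input) add_at ("_ +\<^sub>_ _" [65, 1000, 66] 65) where "u +\<^sub>V v \<equiv> u \<oplus>\<^bsub>V\<^esub> v"
abbreviation (input) minus_at ("_ -\<^sub>_ _" [65, 1000, 66] 65) where "u -\<^sub>V v \<equiv> u \<ominus>\<^bsub>V\<^esub> v"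
abbreviation (input) neg_at ("-\<^sub>_ _" [1000, 81] 80) where "-\<^sub>V v \<equiv> \<ominus>\<^bsub>V\<^esub> v"
abbreviation (input) mult_at ("_ **\<^sub>_ _" [70, 1000, 71] 70) where "u **\<^sub>R v \<equiv> u \<otimes>\<^bsub>R\<^esub> v"
abbreviation (input) smult_at ("_ \<odot>\<^sub>_ _" [70, 1000, 71] 70) where "a \<odot>\<^sub>V v \<equiv> a \<odot>\<^bsub>V\<^esub> v"
abbreviation (input) coset_at ("_ +>\<^sub>_ _" [60, 1000, 61] 60) where "N +>\<^sub>V v \<equiv> N +>\<^bsub>V\<^esub> v"
abbreviation (input) zero_at ("0\<^sub>_" [1000] 1000) where "0\<^sub>V \<equiv> \<zero>\<^bsub>V\<^esub>"
abbreviation (input) one_at ("1\<^sub>_" [1000] 1000) where "1\<^sub>R \<equiv> \<one>\<^bsub>R\<^esub>"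


section \<open>Linear maps and quotient spaces\<close>

lemma module_cring: "module k V ==> cring k" by (simp add: module_def)

lemma (in abelian_group) diff_zero [simp]: "u .: G ==> u \<ominus> \<zero> = u" by (simp add: minus_eq add.inv_one)

lemma (in abelian_group) diff_eq_zero_iff:
"u .: G ==> v .: G ==> u \<ominus> v = \<zero> \<longleftrightarrow> u = v" by (metis add.inv_closed add.inv_equality add.inv_inv minus_eq r_neg)

lemma lin_homI:
assumes "!!v. v .: V ==> f v .: W"
 and "!!u v. u .: V ==> v .: V ==> f (u +\<^sub>V v) = f u +\<^sub>W f v"
 and "!!a v. a .: k ==> v .: V ==> f (a \<odot>\<^sub>V v) = a \<odot>\<^sub>W f v"
shows "f : lin_hom k V W" using assms by (auto simp: lin_hom_def)

lemma lin_in: "f : lin_hom k V W ==> v .: V ==> f v .: W" by (auto simp: lin_hom_def)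

lemma lin_add:
"f : lin_hom k V W ==> u .: V ==> v .: V ==> f (u +\<^sub>V v) = f u +\<^sub>W f v" by (auto simp: lin_hom_def)

lemma lin_smult:
"f : lin_hom k V W ==> a .: k ==> v .: V ==> f (a \<odot>\<^sub>V v) = a \<odot>\<^sub>W f v" by (auto simp: lin_hom_def)

lemma lin_cong:
assumes "!!v. v .: V ==> f v = g v" and "module k V"
shows "f : lin_hom k V W \<longleftrightarrow> g : lin_hom k V W"
proof -
interpret V: module k V by fact
show ?thesis using assms by (auto simp: lin_hom_def Pi_def)
qed

lemma lin_zero:
assumes "f : lin_hom k V W" "module k V" "module k W"
shows "f 0\<^sub>V = 0\<^sub>W"
proof -
interpret V: module k V by fact
interpret W: module k W by fact
have "f (0\<^sub>k \<odot>\<^sub>V 0\<^sub>V) = 0\<^sub>k \<odot>\<^sub>W f 0\<^sub>V" using assms by (intro lin_smult) auto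
then show ?thesis using lin_in[OF assms(1) V.zero_closed] by simp
qed

lemma lin_minus:
assumes "f : lin_hom k V W" "module k V" "module k W" "v .: V"
shows "f (-\<^sub>V v) = -\<^sub>W f v"
proof -
interpret V: module k V by fact
interpret W: module k W by fact
have "f v +\<^sub>W f (-\<^sub>V v) = 0\<^sub>W" using assms by (simp add: lin_add[symmetric] V.r_neg lin_zero)
then show ?thesis by (metis W.minus_equality W.a_comm lin_in[OF assms(1)] assms(4) V.a_inv_closed)
qed

lemma lin_diff:
assumes "f : lin_hom k V W" "module k V" "module k W" "u .: V" "v .: V"
shows "f (u -\<^sub>V v) = f u -\<^sub>W f v"
proof -
interpret V: module k V by fact
interpret W: module k W by fact
show ?thesis using assms by (simp add: a_minus_def lin_add lin_minus)
qed

lemma lin_finsum: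
assumes f: "f : lin_hom k V W" and V: "module k V" and W: "module k W"
 and "finite A" and "g \<in> A \<rightarrow> carrier V"
shows "f (\<Oplus>\<^bsub>V\<^esub>i\<in>A. g i) = (\<Oplus>\<^bsub>W\<^esub>i\<in>A. f (g i))"
proof -
interpret V: module k V by fact
interpret W: module k W by fact
show ?thesis using assms(4,5)
proof (induction A)
 case empty then show ?case using lin_zero[OF f V W] by simp
next
 case (insert a A)
 then have "g a .: V" "g \<in> A \<rightarrow> carrier V" by auto
 then show ?case using insert f by (simp add: Pi_def lin_add[OF f] lin_in[OF f])
qed
qed

lemma lin_id [simp]: "(%v. v) : lin_hom k V V" by (auto simp: lin_hom_def)

lemma lin_comp:
"f : lin_hom k U V ==> g : lin_hom k V W ==> (%u. g (f u)) : lin_hom k U W" by (auto simp: lin_hom_def Pi_def)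

lemma lin_zero_map: "module k W ==> (%u. 0\<^sub>W) : lin_hom k V W"
proof -
assume "module k W"
then interpret W: module k W .
show ?thesis by (auto simp: lin_hom_def)
qed

lemma lin_sum:
assumes "f : lin_hom k V W" "g : lin_hom k V W" "module k W"
shows "(%v. f v +\<^sub>W g v) : lin_hom k V W"
proof -
interpret W: module k W by fact
show ?thesis using assms(1,2) by (intro lin_homI) (simp_all add: lin_hom_def Pi_def W.a_ac W.smult_r_distr)
qed

lemma lin_scale:
assumes "f : lin_hom k V W" "module k W" "a .: k"
shows "(%v. a \<odot>\<^sub>W f v) : lin_hom k V W"
proof -
interpret W: module k W by fact
have "a \<odot>\<^sub>W (c \<odot>\<^sub>W w) = c \<odot>\<^sub>W (a \<odot>\<^sub>W w)" if "c .: k" "w .: W" for c w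
 using that assms(3) by (metis W.smult_assoc1 W.R.m_comm)
then show ?thesis using assms(1,3) by (intro lin_homI) (simp_all add: lin_hom_def Pi_def W.smult_r_distr)
qed

lemma lin_neg:
assumes "f : lin_hom k V W" "module k W"
shows "(%v. -\<^sub>W f v) : lin_hom k V W"
proof -
interpret W: module k W by fact
show ?thesis using assms(1) by (intro lin_homI) (simp_all add: lin_hom_def Pi_def W.minus_add W.smult_r_minus)
qed

lemma lin_minus_map:
assumes "f : lin_hom k V W" "g : lin_hom k V W" "module k W"
shows "(%v. f v -\<^sub>W g v) : lin_hom k V W" unfolding a_minus_def by (intro lin_sum lin_neg assms)

lemma lin_finsum_map:
assumes W: "module k W" and "finite A" and "!!i. i \<in> A ==> f i : lin_hom k V W"
shows "(%v. \<Oplus>\<^bsub>W\<^esub>i\<in>A. f i v) : lin_hom k V W"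
proof -
interpret W: module k W by fact
show ?thesis
proof (rule lin_homI)
 fix v assume v: "v .: V"
 then have fv: "(%i. f i v) \<in> A \<rightarrow> carrier W" using lin_in[OF assms(3)] by auto
 then show "(\<Oplus>\<^bsub>W\<^esub>i\<in>A. f i v) .: W" by simp
 fix u assume u: "u .: V"
 then have fu: "(%i. f i u) \<in> A \<rightarrow> carrier W" using lin_in[OF assms(3)] by auto
 have "(\<Oplus>\<^bsub>W\<^esub>i\<in>A. f i (v +\<^sub>V u)) = (\<Oplus>\<^bsub>W\<^esub>i\<in>A. f i v +\<^sub>W f i u)"
 using u v fu fv by (intro W.finsum_cong') (auto simp: lin_add[OF assms(3)] Pi_def)
 then show "(\<Oplus>\<^bsub>W\<^esub>i\<in>A. f i (v +\<^sub>V u)) = (\<Oplus>\<^bsub>W\<^esub>i\<in>A. f i v) +\<^sub>W (\<Oplus>\<^bsub>W\<^esub>i\<in>A. f i u)"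
 using W.finsum_addf[OF fv fu] by simp
next
 fix a v assume v: "v .: V" and a: "a .: k"
 then have fv: "(%i. f i v) \<in> A \<rightarrow> carrier W" using lin_in[OF assms(3)] by auto
 have "(\<Oplus>\<^bsub>W\<^esub>i\<in>A. f i (a \<odot>\<^sub>V v)) = (\<Oplus>\<^bsub>W\<^esub>i\<in>A. a \<odot>\<^sub>W f i v)"
 using a v fv by (intro W.finsum_cong') (auto simp: lin_smult[OF assms(3)] Pi_def)
 then show "(\<Oplus>\<^bsub>W\<^esub>i\<in>A. f i (a \<odot>\<^sub>V v)) = a \<odot>\<^sub>W (\<Oplus>\<^bsub>W\<^esub>i\<in>A. f i v)"
 using W.finsum_smult_ldistr[OF assms(2) a fv] by simp
qed
qed

lemma submodule_equalizer:
assumes f: "f : lin_hom k V W" and g: "g : lin_hom k V W" and V: "module k V" and W: "module k W"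
shows "submodule {v \<in> carrier V. f v = g v} k V"
proof -
interpret V: module k V by fact
show ?thesis by (rule V.submoduleI) (auto simp: lin_zero[OF f V W] lin_zero[OF g V W]
 lin_minus[OF f V W] lin_minus[OF g V W] lin_add[OF f] lin_add[OF g]
 lin_smult[OF f] lin_smult[OF g])
qed

lemma submodule_kernel:
assumes f: "f : lin_hom k V W" and V: "module k V" and W: "module k W"
shows "submodule {v \<in> carrier V. f v = 0\<^sub>W} k V" by (rule submodule_equalizer[OF f lin_zero_map V W]) fact

lemma submodule_image:
assumes f: "f : lin_hom k V W" and V: "module k V" and W: "module k W" and S: "submodule S k V"
shows "submodule (f ` S) k W"
proof -
interpret V: module k V by fact
interpret W: module k W by fact
note S' = V.submoduleE[OF S]
have sub: "s \<in> S ==> s .: V" for s using S' by auto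
have z: "0\<^sub>V \<in> S" using S'(2,3,5) V.r_neg sub by (metis ex_in_conv)
show ?thesis
proof (rule W.submoduleI)
 show "f ` S <: W" using sub lin_in[OF f] by auto
 show "0\<^sub>W \<in> f ` S" using z lin_zero[OF f V W] by force
 show "!!a. a \<in> f ` S ==> -\<^sub>W a \<in> f ` S" using S'(3) sub lin_minus[OF f V W] by (auto simp: image_iff) metis
 show "!!a b. a \<in> f ` S ==> b \<in> f ` S ==> a +\<^sub>W b \<in> f ` S" using S'(5) sub lin_add[OF f] by (auto simp: image_iff) metis
 show "!!a x. a .: k ==> x \<in> f ` S ==> a \<odot>\<^sub>W x \<in> f ` S" using S'(4) sub lin_smult[OF f] by (auto simp: image_iff) metis
qed
qed

lemma submodule_zero: "module k V ==> submodule S k V ==> 0\<^sub>V \<in> S" using subgroup.one_closed[OF submodule.axioms(1), of S k V] by simp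

lemma submodule_sub: "module k V ==> submodule S k V ==> v \<in> S ==> v .: V" using module.submoduleE(1) by blast

lemma submodule_diff:
"module k V ==> submodule S k V ==> u \<in> S ==> v \<in> S ==> u -\<^sub>V v \<in> S" unfolding a_minus_def by (metis module.submoduleE(5,6))

lemma submodule_finsum:
assumes V: "module k V" and S: "submodule S k V" and "finite A" and "!!i. i \<in> A ==> g i \<in> S"
shows "(\<Oplus>\<^bsub>V\<^esub>i\<in>A. g i) \<in> S"
proof -
interpret V: module k V by fact
show ?thesis using assms(3,4)
proof (induction A)
 case empty then show ?case using submodule_zero[OF V S] by simp
next
 case (insert a A)
 then have "g \<in> A \<rightarrow> carrier V" "g a .: V" using submodule_sub[OF V S] by auto
 then show ?case using insert V.submoduleE(5)[OF S] by simp
qed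
qed

lemma submodule_Inter:
assumes V: "module k V" and "!!S. S \<in> \<S> ==> submodule S k V" and "\<S> ~= {}"
shows "submodule (\<Inter>\<S>) k V"
proof -
interpret V: module k V by fact
show ?thesis
proof (rule V.submoduleI)
 show "\<Inter>\<S> <: V" using assms(2,3) V.submoduleE(1) by blast
qed (use assms(2) submodule_zero[OF V] V.submoduleE(3,4,5) in blast)+
qed

lemma mod_span_sub:
assumes V: "module k V" and "A <: V"
shows "submodule (mod_span k V A) k V" unfolding mod_span_def using assms module.carrier_is_submodule[OF V] by (intro submodule_Inter) auto

lemma mod_span_superset: "A \<subseteq> mod_span k V A" by (auto simp: mod_span_def)

lemma mod_span_least: "submodule S k V ==> A \<subseteq> S ==> mod_span k V A \<subseteq> S" by (auto simp: mod_span_def)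

text \<open>A surjection that respects the operations carries the module axioms over to its target. All
quotients below get their module structure from this.\<close>

lemma module_surj_image:
fixes q :: "'v => 'w"
assumes V: "module k V" and q: "q : lin_hom k V W" and onto: "carrier W = q ` carrier V"
 and z: "0\<^sub>W = q 0\<^sub>V"
shows "module k W"
proof -
interpret V: module k V by fact
note l = lin_add[OF q, symmetric] lin_smult[OF q, symmetric]
have ag: "abelian_group W"
proof (rule abelian_groupI)
 show "\<exists>y\<in>carrier W. y +\<^sub>W x = 0\<^sub>W" if "x .: W" for x
 proof -
 obtain v where v: "v .: V" "x = q v" using \<open>x .: W\<close> unfolding onto by auto
 then have "q (-\<^sub>V v) +\<^sub>W x = 0\<^sub>W" by (simp add: l z V.l_neg)
 then show ?thesis using v onto by blast
 qed
qed (auto simp: onto z l V.a_ac)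
show ?thesis using ag by (intro moduleI V.R.cring_axioms) (auto simp: onto l V.smult_l_distr V.smult_r_distr V.smult_assoc1)
qed

lemma submodule_abelian_subgroup:
assumes V: "module k V" and N: "submodule N k V"
shows "abelian_subgroup N V"
proof -
interpret V: module k V by fact
show ?thesis using submodule.axioms(1)[OF N] V.abelian_group_axioms by (intro abelian_subgroupI3 additive_subgroup.intro) auto
qed

lemma coset_mem:
assumes V: "module k V" and N: "submodule N k V" and u: "u .: V"
shows "w \<in> N +>\<^sub>V u \<longleftrightarrow> w .: V & w -\<^sub>V u \<in> N"
proof -
interpret V: module k V by fact
interpret N: abelian_subgroup N V by (rule submodule_abelian_subgroup[OF V N])
show ?thesis using N.a_rcos_module[OF u] N.a_elemrcos_carrier[OF u] by (auto simp: a_minus_def)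
qed

lemma coset_self:
assumes V: "module k V" and N: "submodule N k V" and u: "u .: V"
shows "u \<in> N +>\<^sub>V u"
proof -
interpret N: abelian_subgroup N V by (rule submodule_abelian_subgroup[OF V N])
show ?thesis using N.a_rcos_self[OF u] .
qed

lemma coset_eq:
assumes V: "module k V" and N: "submodule N k V" and u: "u .: V" and w: "w .: V"
shows "N +>\<^sub>V u = N +>\<^sub>V w \<longleftrightarrow> u -\<^sub>V w \<in> N"
proof -
interpret V: module k V by fact
interpret N: abelian_subgroup N V by (rule submodule_abelian_subgroup[OF V N])
show ?thesis using coset_mem[OF V N w, of u] coset_self[OF V N u] N.a_repr_independence'[OF _ w, of u] u by auto
qed

lemma quot_carrier: "carrier (quot_mod V N) = (%v. N +>\<^sub>V v) ` carrier V"
by (simp add: quot_mod_def FactRing_def A_RCOSETS_def' ring.defs module.defs UNION_singleton_eq_range)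

lemma quot_proj:
assumes V: "module k V" and N: "submodule N k V"
shows "(%v. N +>\<^sub>V v) : lin_hom k V (quot_mod V N)"
proof (rule lin_homI)
interpret V: module k V by fact
interpret N: abelian_subgroup N V by (rule submodule_abelian_subgroup[OF V N])
fix u v assume uv: "u .: V" "v .: V"
show "N +>\<^sub>V v .: quot_mod V N" using uv by (simp add: quot_carrier)
show "N +>\<^sub>V (u +\<^sub>V v) = (N +>\<^sub>V u) +\<^sub>(quot_mod V N) (N +>\<^sub>V v)"
 using N.a_rcos_sum[OF uv] by (simp add: quot_mod_def FactRing_def ring.defs module.defs)
fix a assume a: "a .: k"
have "N +>\<^sub>V (a \<odot>\<^sub>V w) = N +>\<^sub>V (a \<odot>\<^sub>V v)" if "w \<in> N +>\<^sub>V v" for w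
proof -
 have w: "w .: V" "w -\<^sub>V v \<in> N" using that coset_mem[OF V N uv(2)] by auto
 have "a \<odot>\<^sub>V w -\<^sub>V a \<odot>\<^sub>V v = a \<odot>\<^sub>V (w -\<^sub>V v)"
 using a w uv by (simp add: a_minus_def V.smult_r_distr V.smult_r_minus)
 then show ?thesis using a w uv V.submoduleE(4)[OF N] by (simp add: coset_eq[OF V N])
qed
then have "(\<Union>w\<in>N +>\<^sub>V v. N +>\<^sub>V (a \<odot>\<^sub>V w)) = N +>\<^sub>V (a \<odot>\<^sub>V v)"
 using coset_self[OF V N uv(2)] by (intro UN_constant_eq ballI)
then show "N +>\<^sub>V (a \<odot>\<^sub>V v) = a \<odot>\<^sub>(quot_mod V N) (N +>\<^sub>V v)" by (simp add: quot_mod_def ring.defs module.defs)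
qed

lemma quot_zero:
assumes V: "module k V" and N: "submodule N k V"
shows "0\<^sub>(quot_mod V N) = N +>\<^sub>V 0\<^sub>V"
proof -
interpret V: module k V by fact
show ?thesis using V.submoduleE(1)[OF N] by (simp add: quot_mod_def FactRing_def ring.defs module.defs)
qed

lemma quot_module:
assumes "module k V" and "submodule N k V"
shows "module k (quot_mod V N)" using module_surj_image[OF assms(1) quot_proj[OF assms] quot_carrier quot_zero[OF assms]] .

lemma quot_eq_zero:
assumes V: "module k V" and N: "submodule N k V" and u: "u .: V"
shows "N +>\<^sub>V u = 0\<^sub>(quot_mod V N) \<longleftrightarrow> u \<in> N"
proof -
interpret V: module k V by fact
show ?thesis using u by (simp add: quot_zero[OF V N] coset_eq[OF V N])
qed

lemma the_elem_coset:
assumes V: "module k V" and N: "submodule N k V" and u: "u .: V"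
 and "!!w. w .: V ==> w -\<^sub>V u \<in> N ==> g w = g u"
shows "the_elem (g ` (N +>\<^sub>V u)) = g u"
proof -
have "g ` (N +>\<^sub>V u) = {g u}"
proof
 show "g ` (N +>\<^sub>V u) \<subseteq> {g u}" using assms(4) coset_mem[OF V N u] by blast
 show "{g u} \<subseteq> g ` (N +>\<^sub>V u)" using coset_self[OF V N u] by blast
qed
then show ?thesis by simp
qed

lemma quot_lift:
assumes V: "module k V" and N: "submodule N k V" and W: "module k W" and g: "g : lin_hom k V W"
 and kill: "!!n. n \<in> N ==> g n = 0\<^sub>W"
shows "(%C. the_elem (g ` C)) : lin_hom k (quot_mod V N) W"
 and "u .: V ==> the_elem (g ` (N +>\<^sub>V u)) = g u"
proof -
interpret V: module k V by fact
interpret W: module k W by fact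
have *: "the_elem (g ` (N +>\<^sub>V u)) = g u" if u: "u .: V" for u
proof (rule the_elem_coset[OF V N u])
 fix w assume "w .: V" "w -\<^sub>V u \<in> N"
 then show "g w = g u" using kill[of "w -\<^sub>V u"] lin_diff[OF g V W, of w u] u lin_in[OF g] by (simp add: W.diff_eq_zero_iff)
qed
then show "u .: V ==> the_elem (g ` (N +>\<^sub>V u)) = g u" .
note add = lin_add[OF quot_proj[OF V N], symmetric]
 and smult = lin_smult[OF quot_proj[OF V N], symmetric]
show "(%C. the_elem (g ` C)) : lin_hom k (quot_mod V N) W"
proof (rule lin_homI)
 fix C D assume "C .: quot_mod V N" "D .: quot_mod V N"
 then obtain u v where "C = N +>\<^sub>V u" "D = N +>\<^sub>V v" and uv: "u .: V" "v .: V" by (auto simp: quot_carrier)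
 then show "the_elem (g ` (C +\<^sub>(quot_mod V N) D)) = the_elem (g ` C) +\<^sub>W the_elem (g ` D)" by (simp add: add[OF uv] * lin_add[OF g])
next
 fix a C assume a: "a .: k" and "C .: quot_mod V N"
 then obtain u where "C = N +>\<^sub>V u" and u: "u .: V" by (auto simp: quot_carrier)
 then show "the_elem (g ` (a \<odot>\<^sub>(quot_mod V N) C)) = a \<odot>\<^sub>W the_elem (g ` C)"
 using a by (simp add: smult[OF a u] * lin_smult[OF g])
qed (auto simp: quot_carrier * lin_in[OF g])
qed

section \<open>Spaces given by generators and relations\<close>

lemma free_mod_simps:
"carrier (free_mod k B) = {c. finite {x. c x ~= 0\<^sub>k} & (\<forall>x\<in>B. c x .: k) & (\<forall>x. x \<notin> B --> c x = 0\<^sub>k)}"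
"0\<^sub>(free_mod k B) = (%x. 0\<^sub>k)"
"c +\<^sub>(free_mod k B) d = (%x. c x +\<^sub>k d x)"
"a \<odot>\<^sub>(free_mod k B) c = (%x. a **\<^sub>k c x)" by (simp_all add: free_mod_def)

lemma free_mod_coeff:
assumes "cring k" and "c .: free_mod k B"
shows "c x .: k"
proof -
interpret cring k by fact
show ?thesis using assms(2) by (cases "x \<in> B") (auto simp: free_mod_simps)
qed

lemma free_mod_module:
fixes k :: "('a, 'e) ring_scheme" and B :: "'b set"
assumes "cring k"
shows "module k (free_mod k B)"
proof -
interpret cring k by fact
have cc: "c x .: k" if "c .: free_mod k B" for c :: "'b => 'a" and x using free_mod_coeff[OF assms that] .
have add: "(%x. c x +\<^sub>k d x) .: free_mod k B"
 if "c .: free_mod k B" "d .: free_mod k B" for c d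
proof -
 have "finite {x. c x +\<^sub>k d x ~= 0\<^sub>k}"
 by (rule finite_subset[of _ "{x. c x ~= 0\<^sub>k} \<union> {x. d x ~= 0\<^sub>k}"]) (use that in "auto simp: free_mod_simps")
 then show ?thesis using that by (auto simp: free_mod_simps)
qed
have smult: "(%x. a **\<^sub>k c x) .: free_mod k B"
 if "c .: free_mod k B" "a .: k" for a c
proof -
 have "finite {x. a **\<^sub>k c x ~= 0\<^sub>k}" by (rule finite_subset[of _ "{x. c x ~= 0\<^sub>k}"]) (use that in "auto simp: free_mod_simps")
 then show ?thesis using that by (auto simp: free_mod_simps)
qed
show ?thesis
proof (rule moduleI)
 show "abelian_group (free_mod k B)"
 proof (rule abelian_groupI)
 fix c assume c: "c .: free_mod k B"
 show "\<exists>d\<in>carrier (free_mod k B). d +\<^sub>(free_mod k B) c = 0\<^sub>(free_mod k B)"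
 proof
  show "(%x. (-\<^sub>k 1\<^sub>k) **\<^sub>k c x) .: free_mod k B" using smult[OF c] by simp
  show "(%x. (-\<^sub>k 1\<^sub>k) **\<^sub>k c x) +\<^sub>(free_mod k B) c = 0\<^sub>(free_mod k B)"
  using cc[OF c] by (auto simp: free_mod_simps l_minus l_neg)
 qed
 qed (use add in \<open>simp_all add: free_mod_simps(2-4) cc a_ac\<close>, simp add: free_mod_simps)
qed (use assms smult add in "simp_all add: free_mod_simps(2-4) cc l_distr r_distr m_assoc")
qed

lemma free_gen_carrier:
assumes "cring k" and "x \<in> B"
shows "free_gen k x .: free_mod k B"
proof -
interpret cring k by fact
have "finite {y. free_gen k x y ~= 0\<^sub>k}" by (rule finite_subset[of _ "{x}"]) (auto simp: free_gen_def)
then show ?thesis using assms(2) by (auto simp: free_mod_simps free_gen_def)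
qed

lemma free_mod_induct:
assumes k: "cring k" and S: "submodule S k (free_mod k B)" and gen: "!!x. x \<in> B ==> free_gen k x \<in> S"
 and c: "c .: free_mod k B"
shows "c \<in> S"
proof -
interpret cring k by fact
interpret F: module k "free_mod k B" by (rule free_mod_module[OF k])
have fin: "finite {x. c x ~= 0\<^sub>k}" using c by (simp add: free_mod_simps)
then show ?thesis using c
proof (induction "{x. c x ~= 0\<^sub>k}" arbitrary: c rule: finite_psubset_induct)
 case (psubset c)
 show ?case
 proof (cases "{x. c x ~= 0\<^sub>k} = {}")
 case True
 then have "c = 0\<^sub>(free_mod k B)" by (auto simp: free_mod_simps)
 then show ?thesis using submodule_zero[OF F.module_axioms S] by simp
 next
 case False
 then obtain y where y: "c y ~= 0\<^sub>k" by auto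
 then have yB: "y \<in> B" using psubset.prems by (auto simp: free_mod_simps)
 let ?d = "%x. if x = y then 0\<^sub>k else c x"
 have "finite {x. ?d x ~= 0\<^sub>k}" by (rule finite_subset[OF _ \<open>finite {x. c x ~= 0\<^sub>k}\<close>]) auto
 then have d: "?d .: free_mod k B" using psubset.prems by (auto simp: free_mod_simps)
 moreover have "{x. ?d x ~= 0\<^sub>k} \<subset> {x. c x ~= 0\<^sub>k}" using y by auto
 ultimately have "?d \<in> S" using psubset.hyps by simp
 moreover have "c y \<odot>\<^sub>(free_mod k B) free_gen k y \<in> S"
  using F.submoduleE(4)[OF S] gen[OF yB] free_mod_coeff[OF k psubset.prems] by simp
 moreover have "c = ?d +\<^sub>(free_mod k B) c y \<odot>\<^sub>(free_mod k B) free_gen k y"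
  using free_mod_coeff[OF k psubset.prems] by (auto simp: free_mod_simps free_gen_def)
 ultimately show ?thesis using F.submoduleE(5)[OF S] by metis
 qed
qed
qed

lemma lin_ext_superset:
assumes V: "module k V" and f: "f \<in> B \<rightarrow> carrier V" and c: "c .: free_mod k B"
 and A: "finite A" "{x. c x ~= 0\<^sub>k} \<subseteq> A" "A \<subseteq> B"
shows "lin_ext k V f c = (\<Oplus>\<^bsub>V\<^esub>x\<in>A. c x \<odot>\<^sub>V f x)"
proof -
interpret V: module k V by fact
show ?thesis unfolding lin_ext_def
proof (rule V.add.finprod_mono_neutral_cong_left)
 show "!!i. i \<in> A - {x. c x ~= 0\<^sub>k} ==> c i \<odot>\<^sub>V f i = 0\<^sub>V" using f A(3) by (auto simp: Pi_def)
 show "(%x. c x \<odot>\<^sub>V f x) \<in> A \<rightarrow> carrier V" using f A(3) free_mod_coeff[OF V.R.cring_axioms c] by (auto simp: Pi_def)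
qed (use A in auto)
qed

lemma lin_ext_lin_hom:
assumes V: "module k V" and f: "f \<in> B \<rightarrow> carrier V"
shows "lin_ext k V f : lin_hom k (free_mod k B) V"
proof (rule lin_homI)
interpret V: module k V by fact
note cc = free_mod_coeff[OF V.R.cring_axioms]
interpret F: module k "free_mod k B" by (rule free_mod_module[OF V.R.cring_axioms])
note fc = f[THEN funcset_mem]
fix c assume c: "c .: free_mod k B"
have supp: "{x. c x ~= 0\<^sub>k} \<subseteq> B" "finite {x. c x ~= 0\<^sub>k}" if "c .: free_mod k B" for c
 using that by (auto simp: free_mod_simps)
have *: "(%x. c x \<odot>\<^sub>V f x) \<in> A \<rightarrow> carrier V" if "A \<subseteq> B" "c .: free_mod k B" for A c
 using cc[OF that(2)] fc that(1) by auto
show "lin_ext k V f c .: V" unfolding lin_ext_def using *[OF supp(1)] c by (simp add: V.finsum_closed)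
fix d assume d: "d .: free_mod k B"
define A where "A = {x. c x ~= 0\<^sub>k} \<union> {x. d x ~= 0\<^sub>k}"
have A: "finite A" "A \<subseteq> B" using supp c d by (auto simp: A_def)
have sub: "{x. c x ~= 0\<^sub>k} \<subseteq> A" "{x. d x ~= 0\<^sub>k} \<subseteq> A" "{x. (c +\<^sub>(free_mod k B) d) x ~= 0\<^sub>k} \<subseteq> A"
 by (auto simp: A_def free_mod_simps)
have "(\<Oplus>\<^bsub>V\<^esub>x\<in>A. (c +\<^sub>(free_mod k B) d) x \<odot>\<^sub>V f x) = (\<Oplus>\<^bsub>V\<^esub>x\<in>A. c x \<odot>\<^sub>V f x +\<^sub>V d x \<odot>\<^sub>V f x)"
 using A cc[OF c] cc[OF d] fc by (intro V.finsum_cong') (auto simp: free_mod_simps V.smult_l_distr subset_iff)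
then show "lin_ext k V f (c +\<^sub>(free_mod k B) d) = lin_ext k V f c +\<^sub>V lin_ext k V f d"
 using V.finsum_addf[OF *[OF A(2) c] *[OF A(2) d]] c d sub A by (simp add: lin_ext_superset[OF V f _ A(1) _ A(2)])
next
interpret V: module k V by fact
note cc = free_mod_coeff[OF V.R.cring_axioms]
interpret F: module k "free_mod k B" by (rule free_mod_module[OF V.R.cring_axioms])
note fc = f[THEN funcset_mem]
fix a c assume a: "a .: k" and c: "c .: free_mod k B"
define A where "A = {x. c x ~= 0\<^sub>k}"
have A: "finite A" "A \<subseteq> B" using c by (auto simp: A_def free_mod_simps)
have sub: "{x. c x ~= 0\<^sub>k} \<subseteq> A" "{x. (a \<odot>\<^sub>(free_mod k B) c) x ~= 0\<^sub>k} \<subseteq> A"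
 using a by (auto simp: A_def free_mod_simps)
have *: "(%x. c x \<odot>\<^sub>V f x) \<in> A \<rightarrow> carrier V" using cc[OF c] fc A(2) by auto
have "(\<Oplus>\<^bsub>V\<^esub>x\<in>A. (a \<odot>\<^sub>(free_mod k B) c) x \<odot>\<^sub>V f x) = (\<Oplus>\<^bsub>V\<^esub>x\<in>A. a \<odot>\<^sub>V (c x \<odot>\<^sub>V f x))"
 using A a cc[OF c] fc by (intro V.finsum_cong') (auto simp: free_mod_simps V.smult_assoc1 subset_iff)
then show "lin_ext k V f (a \<odot>\<^sub>(free_mod k B) c) = a \<odot>\<^sub>V lin_ext k V f c" using V.finsum_smult_ldistr[OF A(1) a *] a c sub A
 by (simp add: lin_ext_superset[OF V f _ A(1) _ A(2)])
qed

lemma lin_ext_gen: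
assumes V: "module k V" and f: "f \<in> B \<rightarrow> carrier V" and x: "x \<in> B"
shows "lin_ext k V f (free_gen k x) = f x"
proof -
interpret V: module k V by fact
have "f x .: V" using f x by auto
then have "(\<Oplus>\<^bsub>V\<^esub>y\<in>{x}. free_gen k x y \<odot>\<^sub>V f y) = f x" by (simp add: free_gen_def)
moreover have "lin_ext k V f (free_gen k x) = (\<Oplus>\<^bsub>V\<^esub>y\<in>{x}. free_gen k x y \<odot>\<^sub>V f y)"
 using x by (intro lin_ext_superset[OF V f free_gen_carrier[OF V.R.cring_axioms x]]) (auto simp: free_gen_def)
ultimately show ?thesis by simp
qed

lemma pres_mod_module:
assumes k: "cring k" and R: "Rel <: free_mod k B"
shows "module k (pres_mod k B Rel)" unfolding pres_mod_def by (intro quot_module free_mod_module mod_span_sub k R)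

lemma pres_gen_carrier:
assumes k: "cring k" and "x \<in> B"
shows "pres_gen k B Rel x .: pres_mod k B Rel" using free_gen_carrier[OF assms] by (auto simp: pres_gen_def pres_mod_def quot_carrier)

lemma pres_lift:
assumes k: "cring k" and R: "Rel <: free_mod k B" and V: "module k V"
 and f: "f \<in> B \<rightarrow> carrier V" and kill: "!!r. r \<in> Rel ==> lin_ext k V f r = 0\<^sub>V"
shows "pres_lift k V f : lin_hom k (pres_mod k B Rel) V"
 and "x \<in> B ==> pres_lift k V f (pres_gen k B Rel x) = f x"
proof -
note F = free_mod_module[OF k]
note N = mod_span_sub[OF F R]
note l = lin_ext_lin_hom[OF V f]
have "mod_span k (free_mod k B) Rel \<subseteq> {c \<in> carrier (free_mod k B). lin_ext k V f c = 0\<^sub>V}"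
 using R kill by (intro mod_span_least submodule_kernel[OF l F V]) auto
then have kill': "lin_ext k V f n = 0\<^sub>V" if "n \<in> mod_span k (free_mod k B) Rel" for n using that by auto
show "pres_lift k V f : lin_hom k (pres_mod k B Rel) V" using quot_lift(1)[OF F N V l kill'] by (simp add: pres_lift_def[abs_def] pres_mod_def)
show "x \<in> B ==> pres_lift k V f (pres_gen k B Rel x) = f x" using quot_lift(2)[OF F N V l kill' free_gen_carrier[OF k]] lin_ext_gen[OF V f]
 by (simp add: pres_lift_def pres_gen_def)
qed

lemma pres_mod_induct:
assumes k: "cring k" and R: "Rel <: free_mod k B"
 and S: "submodule S k (pres_mod k B Rel)" and gen: "!!x. x \<in> B ==> pres_gen k B Rel x \<in> S"
 and c: "c .: pres_mod k B Rel"
shows "c \<in> S"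
proof -
note F = free_mod_module[OF k]
note N = mod_span_sub[OF F R]
define q where "q = (%v. mod_span k (free_mod k B) Rel +>\<^sub>(free_mod k B) v)"
have q: "q : lin_hom k (free_mod k B) (pres_mod k B Rel)" unfolding pres_mod_def q_def by (rule quot_proj[OF F N])
have qgen: "q (free_gen k x) = pres_gen k B Rel x" for x by (simp add: q_def pres_gen_def)
interpret F: module k "free_mod k B" by (rule F)
note P = pres_mod_module[OF k R]
interpret P: module k "pres_mod k B Rel" by (rule P)
have "submodule {v \<in> carrier (free_mod k B). q v \<in> S} k (free_mod k B)"
proof (rule F.submoduleI)
 show "0\<^sub>(free_mod k B) \<in> {v \<in> carrier (free_mod k B). q v \<in> S}" using submodule_zero[OF P S] by (simp add: lin_zero[OF q F P])
qed (use P.submoduleE(3-5)[OF S] in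
 \<open>auto simp: lin_add[OF q] lin_smult[OF q] lin_minus[OF q F P]\<close>)
then have "v \<in> {v \<in> carrier (free_mod k B). q v \<in> S}" if "v .: free_mod k B" for v
 by (rule free_mod_induct[OF k _ _ that]) (simp_all add: free_gen_carrier[OF k] qgen gen)
then have "q v \<in> S" if "v .: free_mod k B" for v using that by blast
moreover have "carrier (pres_mod k B Rel) = q ` carrier (free_mod k B)" unfolding pres_mod_def quot_carrier q_def ..
ultimately show ?thesis using c by auto
qed

lemma pres_mod_ext:
assumes k: "cring k" and R: "Rel <: free_mod k B" and V: "module k V"
 and f: "f : lin_hom k (pres_mod k B Rel) V" and g: "g : lin_hom k (pres_mod k B Rel) V"
 and eq: "!!x. x \<in> B ==> f (pres_gen k B Rel x) = g (pres_gen k B Rel x)"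
 and c: "c .: pres_mod k B Rel"
shows "f c = g c"
proof -
have "c \<in> {v \<in> carrier (pres_mod k B Rel). f v = g v}" using eq pres_gen_carrier[OF k]
 by (intro pres_mod_induct[OF k R submodule_equalizer[OF f g pres_mod_module[OF k R] V] _ c]) auto
then show ?thesis by simp
qed

lemma pres_gen_lin_ext:
assumes k: "cring k" and R: "Rel <: free_mod k B" and c: "c .: free_mod k B"
shows "lin_ext k (pres_mod k B Rel) (pres_gen k B Rel) c = mod_span k (free_mod k B) Rel +>\<^sub>(free_mod k B) c"
proof -
note F = free_mod_module[OF k]
note N = mod_span_sub[OF F R]
note P = pres_mod_module[OF k R]
define q where "q = (%v. mod_span k (free_mod k B) Rel +>\<^sub>(free_mod k B) v)"
have q: "q : lin_hom k (free_mod k B) (pres_mod k B Rel)" unfolding pres_mod_def q_def by (rule quot_proj[OF F N])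
have qgen: "pres_gen k B Rel x = q (free_gen k x)" for x by (simp add: q_def pres_gen_def)
have g: "pres_gen k B Rel \<in> B \<rightarrow> carrier (pres_mod k B Rel)" using pres_gen_carrier[OF k] by auto
have "c \<in> {v \<in> carrier (free_mod k B). lin_ext k (pres_mod k B Rel) (pres_gen k B Rel) v = q v}"
proof (rule free_mod_induct[OF k submodule_equalizer[OF lin_ext_lin_hom[OF P g] q F P] _ c])
 fix x assume x: "x \<in> B"
 then show "free_gen k x \<in> {v \<in> carrier (free_mod k B). lin_ext k (pres_mod k B Rel) (pres_gen k B Rel) v = q v}"
 using free_gen_carrier[OF k x] lin_ext_gen[OF P g x] by (simp add: qgen)
qed
then show ?thesis by (simp add: q_def)
qed

lemma pres_rel:
assumes k: "cring k" and R: "Rel <: free_mod k B" and r: "r \<in> Rel"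
shows "lin_ext k (pres_mod k B Rel) (pres_gen k B Rel) r = 0\<^sub>(pres_mod k B Rel)"
proof -
note F = free_mod_module[OF k]
note N = mod_span_sub[OF F R]
have "mod_span k (free_mod k B) Rel +>\<^sub>(free_mod k B) r = 0\<^sub>(quot_mod (free_mod k B) (mod_span k (free_mod k B) Rel))"
 using r R mod_span_superset[of Rel k "free_mod k B"] by (subst quot_eq_zero[OF F N]) auto
then show ?thesis using r R by (subst pres_gen_lin_ext[OF k R]) (auto simp: pres_mod_def)
qed

lemma lin_ext_relations:
assumes V: "module k V" and f: "f \<in> B \<rightarrow> carrier V" and x: "x \<in> B" and y: "y \<in> B"
shows "z \<in> B ==> lin_ext k V f (free_gen k x -\<^sub>(free_mod k B) (free_gen k y +\<^sub>(free_mod k B) free_gen k z))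
 = f x -\<^sub>V (f y +\<^sub>V f z)"
 and "a .: k ==> lin_ext k V f (free_gen k x -\<^sub>(free_mod k B) a \<odot>\<^sub>(free_mod k B) free_gen k y)
 = f x -\<^sub>V a \<odot>\<^sub>V f y"
 and "lin_ext k V f (free_gen k x -\<^sub>(free_mod k B) free_gen k y) = f x -\<^sub>V f y"
proof -
note k = module_cring[OF V]
note F = free_mod_module[OF k, of B]
interpret F: module k "free_mod k B" by (rule F)
note l = lin_ext_lin_hom[OF V f] and g = free_gen_carrier[OF k, of _ B]
note * = lin_diff[OF l F V] lin_add[OF l] lin_smult[OF l] lin_ext_gen[OF V f]
show "lin_ext k V f (free_gen k x -\<^sub>(free_mod k B) free_gen k y) = f x -\<^sub>V f y" using g[OF x] g[OF y] x y by (simp add: *)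
show "z \<in> B ==> lin_ext k V f (free_gen k x -\<^sub>(free_mod k B) (free_gen k y +\<^sub>(free_mod k B) free_gen k z))
 = f x -\<^sub>V (f y +\<^sub>V f z)" using g[OF x] g[OF y] g[of z] x y by (simp add: *)
show "a .: k ==> lin_ext k V f (free_gen k x -\<^sub>(free_mod k B) a \<odot>\<^sub>(free_mod k B) free_gen k y)
 = f x -\<^sub>V a \<odot>\<^sub>V f y" using g[OF x] g[OF y] x y by (simp add: *)
qed

lemma free_relations_carrier:
assumes k: "cring k" and x: "x \<in> B" and y: "y \<in> B"
shows "z \<in> B ==> free_gen k x -\<^sub>(free_mod k B) (free_gen k y +\<^sub>(free_mod k B) free_gen k z) .: free_mod k B"
 and "a .: k ==> free_gen k x -\<^sub>(free_mod k B) a \<odot>\<^sub>(free_mod k B) free_gen k y .: free_mod k B"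
 and "free_gen k x -\<^sub>(free_mod k B) free_gen k y .: free_mod k B"
proof -
interpret F: module k "free_mod k B" by (rule free_mod_module[OF k])
note g = free_gen_carrier[OF k, of _ B]
show "z \<in> B ==> free_gen k x -\<^sub>(free_mod k B) (free_gen k y +\<^sub>(free_mod k B) free_gen k z) .: free_mod k B"
 and "a .: k ==> free_gen k x -\<^sub>(free_mod k B) a \<odot>\<^sub>(free_mod k B) free_gen k y .: free_mod k B"
 and "free_gen k x -\<^sub>(free_mod k B) free_gen k y .: free_mod k B" using g[OF x] g[OF y] g[of z] by simp_all
qed

section \<open>Tensor powers and multilinear maps\<close>

definition multilin ::
 "('k, 'e) ring_scheme => ('k, 'v, 'f) module_scheme => nat => ('k, 'w, 'g) module_scheme => ('v list => 'w) => bool" where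
"multilin k V n W f \<longleftrightarrow> (\<forall>vs\<in>tpow_basis V n. f vs .: W) &
 (\<forall>xs ys. length xs + Suc (length ys) = n --> set xs <: V --> set ys <: V --> (%v. f (xs @ v # ys)) : lin_hom k V W)"

lemma multilinI:
assumes "!!vs. length vs = n ==> set vs <: V ==> f vs .: W"
 and "!!xs ys. length xs + Suc (length ys) = n ==> set xs <: V ==> set ys <: V ==> (%v. f (xs @ v # ys)) : lin_hom k V W"
shows "multilin k V n W f" using assms by (auto simp: multilin_def tpow_basis_def)

lemma multilin_in: "multilin k V n W f ==> vs \<in> tpow_basis V n ==> f vs .: W" by (auto simp: multilin_def)

lemma multilin_slot:
"multilin k V n W f ==> length xs + Suc (length ys) = n ==> set xs <: V ==> set ys <: V ==> (%v. f (xs @ v # ys)) : lin_hom k V W"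
by (auto simp: multilin_def)

lemma multilin_comp:
assumes f: "multilin k V n W f" and g: "g : lin_hom k W U"
shows "multilin k V n U (%vs. g (f vs))" by (rule multilinI) (use lin_in[OF g] multilin_in[OF f] lin_comp[OF multilin_slot[OF f] g] in
 \<open>auto simp: tpow_basis_def\<close>)

lemma tpow_rel_carrier:
assumes "module k V"
shows "tpow_rel k V n <: free_mod k (tpow_basis V n)"
proof -
interpret V: module k V by fact
show ?thesis unfolding tpow_rel_def Let_def by (auto intro!: free_relations_carrier[OF V.R.cring_axioms] simp: tpow_basis_def)
qed

lemma tpow_module: "module k V ==> module k (tpow k V n)" unfolding tpow_def by (intro pres_mod_module tpow_rel_carrier module_cring)

lemma tpow_lift:
assumes V: "module k V" and W: "module k W" and f: "multilin k V n W f"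
shows "pres_lift k W f : lin_hom k (tpow k V n) W"
 and "length vs = n ==> set vs <: V ==> pres_lift k W f (tpow_pure k V vs) = f vs"
proof -
interpret V: module k V by fact
interpret W: module k W by fact
have f': "f \<in> tpow_basis V n \<rightarrow> carrier W" using multilin_in[OF f] by auto
note * = lin_ext_relations[OF W f']
have kill: "lin_ext k W f r = 0\<^sub>W" if r: "r \<in> tpow_rel k V n" for r
proof -
 from r consider (add) xs ys u v where "xs @ u # ys \<in> tpow_basis V n" "v .: V"
  "r = free_gen k (xs @ (u +\<^sub>V v) # ys) -\<^sub>(free_mod k (tpow_basis V n))
   (free_gen k (xs @ u # ys) +\<^sub>(free_mod k (tpow_basis V n)) free_gen k (xs @ v # ys))"
 | (smult) xs ys a v where "xs @ v # ys \<in> tpow_basis V n" "a .: k"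
  "r = free_gen k (xs @ (a \<odot>\<^sub>V v) # ys) -\<^sub>(free_mod k (tpow_basis V n))
   a \<odot>\<^sub>(free_mod k (tpow_basis V n)) free_gen k (xs @ v # ys)" by (auto simp: tpow_rel_def Let_def)
 then show ?thesis
 proof cases
 case add
 then have b: "xs @ v # ys \<in> tpow_basis V n" "xs @ (u +\<^sub>V v) # ys \<in> tpow_basis V n" "u .: V" by (auto simp: tpow_basis_def)
 have "f (xs @ (u +\<^sub>V v) # ys) = f (xs @ u # ys) +\<^sub>W f (xs @ v # ys)"
  using add b by (intro lin_add[OF multilin_slot[OF f]]) (auto simp: tpow_basis_def)
 then show ?thesis using add b f' by (simp add: * W.diff_eq_zero_iff Pi_def)
 next
 case smult
 then have b: "xs @ (a \<odot>\<^sub>V v) # ys \<in> tpow_basis V n" "v .: V" by (auto simp: tpow_basis_def)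
 have "f (xs @ (a \<odot>\<^sub>V v) # ys) = a \<odot>\<^sub>W f (xs @ v # ys)"
  using smult b by (intro lin_smult[OF multilin_slot[OF f]]) (auto simp: tpow_basis_def)
 then show ?thesis using smult b f' by (simp add: * W.diff_eq_zero_iff Pi_def)
 qed
qed
note l = pres_lift[OF V.R.cring_axioms tpow_rel_carrier[OF V] W f' kill]
show "pres_lift k W f : lin_hom k (tpow k V n) W" using l(1) by (simp add: tpow_def)
show "length vs = n ==> set vs <: V ==> pres_lift k W f (tpow_pure k V vs) = f vs" using l(2)[of vs] by (simp add: tpow_pure_def tpow_basis_def)
qed

lemma tpow_pure_in:
assumes V: "module k V" and "length vs = n" "set vs <: V"
shows "tpow_pure k V vs .: tpow k V n" using assms pres_gen_carrier[OF module_cring[OF V], of vs "tpow_basis V n" "tpow_rel k V n"]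
by (simp add: tpow_pure_def tpow_def tpow_basis_def)

lemma tpow_pure_multilin:
assumes V: "module k V"
shows "multilin k V n (tpow k V n) (tpow_pure k V)"
proof (rule multilinI)
interpret V: module k V by fact
let ?T = "tpow k V n"
interpret T: module k ?T by (rule tpow_module[OF V])
note cl = tpow_pure_in[OF V]
show "length vs = n ==> set vs <: V ==> tpow_pure k V vs .: ?T" for vs by (rule cl)
note rel = pres_rel[OF V.R.cring_axioms tpow_rel_carrier[OF V], of _ n, folded tpow_def]
let ?g = "pres_gen k (tpow_basis V n) (tpow_rel k V n)"
have g: "?g \<in> tpow_basis V n \<rightarrow> carrier ?T" using pres_gen_carrier[OF V.R.cring_axioms] by (auto simp: tpow_def)
note * = lin_ext_relations[OF T.module_axioms g]
fix xs ys assume xy: "length xs + Suc (length ys) = n" "set xs <: V" "set ys <: V"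
then have b: "v .: V ==> xs @ v # ys \<in> tpow_basis V n" for v by (auto simp: tpow_basis_def)
have pg: "tpow_pure k V (xs @ v # ys) = ?g (xs @ v # ys)" for v using xy by (simp add: tpow_pure_def)
have gc: "v .: V ==> ?g (xs @ v # ys) .: ?T" for v using g b by auto
show "(%v. tpow_pure k V (xs @ v # ys)) : lin_hom k V ?T" unfolding pg
proof (rule lin_homI)
 fix u v assume uv: "u .: V" "v .: V"
 show "?g (xs @ u # ys) .: ?T" using gc uv by simp
 have "free_gen k (xs @ (u +\<^sub>V v) # ys) -\<^sub>(free_mod k (tpow_basis V n))
 (free_gen k (xs @ u # ys) +\<^sub>(free_mod k (tpow_basis V n)) free_gen k (xs @ v # ys)) \<in> tpow_rel k V n"
 unfolding tpow_rel_def Let_def using uv b by (intro UnI1 CollectI exI[of _ xs] exI[of _ ys] exI[of _ u] exI[of _ v]) simp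
 from rel[OF this] show "?g (xs @ (u +\<^sub>V v) # ys) = ?g (xs @ u # ys) +\<^sub>?T ?g (xs @ v # ys)"
 using uv b gc by (simp add: * T.diff_eq_zero_iff)
next
 fix a v assume av: "a .: k" "v .: V"
 have "free_gen k (xs @ (a \<odot>\<^sub>V v) # ys) -\<^sub>(free_mod k (tpow_basis V n))
 a \<odot>\<^sub>(free_mod k (tpow_basis V n)) free_gen k (xs @ v # ys) \<in> tpow_rel k V n" unfolding tpow_rel_def Let_def using av b
 by (intro UnI2 CollectI exI[of _ xs] exI[of _ ys] exI[of _ a] exI[of _ v]) simp
 from rel[OF this] show "?g (xs @ (a \<odot>\<^sub>V v) # ys) = a \<odot>\<^sub>?T ?g (xs @ v # ys)"
 using av b gc by (simp add: * T.diff_eq_zero_iff)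
qed
qed

lemma tpow_ext:
assumes V: "module k V" and W: "module k W"
 and f: "f : lin_hom k (tpow k V n) W" and g: "g : lin_hom k (tpow k V n) W"
 and eq: "!!vs. length vs = n ==> set vs <: V ==> f (tpow_pure k V vs) = g (tpow_pure k V vs)"
 and t: "t .: tpow k V n"
shows "f t = g t"
proof (rule pres_mod_ext[OF module_cring[OF V] tpow_rel_carrier[OF V] W f[unfolded tpow_def] g[unfolded tpow_def] _ t[unfolded tpow_def]])
fix vs assume "vs \<in> tpow_basis V n"
then have vs: "length vs = n" "set vs <: V" by (auto simp: tpow_basis_def)
from eq[OF vs] show "f (pres_gen k (tpow_basis V n) (tpow_rel k V n) vs) = g (pres_gen k (tpow_basis V n) (tpow_rel k V n) vs)"
 unfolding tpow_pure_def vs(1) .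
qed

lemma tpow_induct:
assumes V: "module k V" and S: "submodule S k (tpow k V n)"
 and gen: "!!vs. length vs = n ==> set vs <: V ==> tpow_pure k V vs \<in> S"
 and t: "t .: tpow k V n"
shows "t \<in> S"
proof (rule pres_mod_induct[OF module_cring[OF V] tpow_rel_carrier[OF V] S[unfolded tpow_def] _ t[unfolded tpow_def]])
fix vs assume "vs \<in> tpow_basis V n"
then have vs: "length vs = n" "set vs <: V" by (auto simp: tpow_basis_def)
from gen[OF vs] show "pres_gen k (tpow_basis V n) (tpow_rel k V n) vs \<in> S" unfolding tpow_pure_def vs(1) .
qed

lemma lin_lift_parameter:
assumes V: "module k V" and U: "module k U" and W: "module k W"
 and f: "!!u. u .: U ==> multilin k V n W (f u)"
 and slot: "!!vs. length vs = n ==> set vs <: V ==> (%u. f u vs) : lin_hom k U W"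
 and t: "t .: tpow k V n"
shows "(%u. pres_lift k W (f u) t) : lin_hom k U W"
proof (rule lin_homI)
interpret W: module k W by fact
interpret U: module k U by fact
note l = tpow_lift[OF V W f]
fix u v assume u: "u .: U" and v: "v .: U"
show "pres_lift k W (f u) t .: W" using lin_in[OF l(1) t] u by blast
have uv: "u +\<^sub>U v .: U" using u v by simp
show "pres_lift k W (f (u +\<^sub>U v)) t = pres_lift k W (f u) t +\<^sub>W pres_lift k W (f v) t"
 by (rule tpow_ext[OF V W l(1)[OF uv] lin_sum[OF l(1)[OF u] l(1)[OF v] W] _ t]) (simp add: l(2) u v uv lin_add[OF slot u v])
next
interpret W: module k W by fact
interpret U: module k U by fact
note l = tpow_lift[OF V W f]
fix a u assume a: "a .: k" and u: "u .: U"
then have au: "a \<odot>\<^sub>U u .: U" by simp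
show "pres_lift k W (f (a \<odot>\<^sub>U u)) t = a \<odot>\<^sub>W pres_lift k W (f u) t"
 by (rule tpow_ext[OF V W l(1)[OF au] lin_scale[OF l(1)[OF u] W a] _ t]) (simp add: l(2) u au lin_smult[OF slot a u])
qed

lemma multilin_lift_parameter:
assumes V: "module k V" and U: "module k U" and W: "module k W"
 and f: "!!us. length us = m ==> set us <: U ==> multilin k V n W (f us)"
 and f': "!!vs. length vs = n ==> set vs <: V ==> multilin k U m W (%us. f us vs)"
 and t: "t .: tpow k V n"
shows "multilin k U m W (%us. pres_lift k W (f us) t)"
proof (rule multilinI)
show "length us = m ==> set us <: U ==> pres_lift k W (f us) t .: W" for us using lin_in[OF tpow_lift(1)[OF V W f]] t by blast
fix xs ys assume xy: "length xs + Suc (length ys) = m" "set xs <: U" "set ys <: U"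
show "(%u. pres_lift k W (f (xs @ u # ys)) t) : lin_hom k U W" by (rule lin_lift_parameter[OF V U W f multilin_slot[OF f' xy] t]) (use xy in auto)
qed

section \<open>Bilinear and balanced maps\<close>

definition bilin ::
 "('k, 'e) ring_scheme => ('k, 'u, 'f) module_scheme => ('k, 'v, 'g) module_scheme => ('k, 'w, 'h) module_scheme
 => ('u => 'v => 'w) => bool" where
"bilin k U V W F \<longleftrightarrow> (\<forall>u\<in>carrier U. (%v. F u v) : lin_hom k V W) & (\<forall>v\<in>carrier V. (%u. F u v) : lin_hom k U W)"

lemma bilinI:
assumes "!!u. u .: U ==> (%v. F u v) : lin_hom k V W"
 and "!!v. v .: V ==> (%u. F u v) : lin_hom k U W"
shows "bilin k U V W F" using assms by (simp add: bilin_def)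

lemma bilin1: "bilin k U V W F ==> u .: U ==> (%v. F u v) : lin_hom k V W" by (simp add: bilin_def)

lemma bilin2: "bilin k U V W F ==> v .: V ==> (%u. F u v) : lin_hom k U W" by (simp add: bilin_def)

lemma bilin_in: "bilin k U V W F ==> u .: U ==> v .: V ==> F u v .: W" using lin_in[OF bilin1] .

lemma bilin_comp1: "bilin k U V W F ==> f : lin_hom k T V ==> u .: U ==> (%t. F u (f t)) : lin_hom k T W" by (rule lin_comp[OF _ bilin1])

lemma bilin_comp2: "bilin k U V W F ==> f : lin_hom k T U ==> v .: V ==> (%t. F (f t) v) : lin_hom k T W" by (rule lin_comp[OF _ bilin2])

lemma bilin_post: "bilin k U V W F ==> f : lin_hom k W T ==> bilin k U V T (%u v. f (F u v))"
using lin_comp[of "%u. F u v" for v, OF _ _] by (auto simp: bilin_def intro: lin_comp)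

lemma multilin_2:
assumes "bilin k V V W F"
shows "multilin k V 2 W (%vs. F (vs ! 0) (vs ! 1))"
proof (rule multilinI)
show "length vs = 2 ==> set vs <: V ==> F (vs ! 0) (vs ! 1) .: W" for vs by (rule bilin_in[OF assms]) (auto intro: nth_mem simp: subset_iff)
fix xs ys assume *: "length xs + Suc (length ys) = 2" "set xs <: V" "set ys <: V"
then consider y where "xs = []" "ys = [y]" | x where "xs = [x]" "ys = []" by (cases xs; cases ys) (auto simp: length_Suc_conv)
then show "(%v. F ((xs @ v # ys) ! 0) ((xs @ v # ys) ! 1)) : lin_hom k V W" by cases (use * bilin1[OF assms] bilin2[OF assms] in auto)
qed

lemma bilin_rel_carrier:
assumes V: "module k V" and W: "module k W"
shows "bilin_rel k V W <: (free_mod k (carrier V \<times> carrier W))"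
proof -
interpret V: module k V by fact
interpret W: module k W by fact
show ?thesis unfolding bilin_rel_def Let_def by (auto intro!: free_relations_carrier[OF V.R.cring_axioms])
qed

lemma bilin_rel_kill:
assumes V: "module k V" and W: "module k W" and T: "module k T" and f: "bilin k V W T (%v w. f (v, w))"
 and r: "r \<in> bilin_rel k V W"
shows "lin_ext k T f r = 0\<^sub>T"
proof -
interpret V: module k V by fact
interpret W: module k W by fact
interpret T: module k T by fact
have f': "f \<in> carrier V \<times> carrier W \<rightarrow> carrier T" using bilin_in[OF f] by auto
note * = lin_ext_relations[OF T f']
note l = lin_add[OF bilin1[OF f]] lin_add[OF bilin2[OF f]]
 lin_smult[OF bilin1[OF f]] lin_smult[OF bilin2[OF f]]
show ?thesis using r unfolding bilin_rel_def Let_def by (auto simp: * l bilin_in[OF f] T.diff_eq_zero_iff)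
qed

lemma bilin_pres_gen:
assumes V: "module k V" and W: "module k W" and R: "Rel <: (free_mod k (carrier V \<times> carrier W))"
 and sub: "bilin_rel k V W \<subseteq> Rel"
shows "bilin k V W (pres_mod k (carrier V \<times> carrier W) Rel) (%v w. pres_gen k (carrier V \<times> carrier W) Rel (v, w))"
proof -
interpret V: module k V by fact
interpret W: module k W by fact
let ?T = "pres_mod k (carrier V \<times> carrier W) Rel"
let ?g = "pres_gen k (carrier V \<times> carrier W) Rel"
let ?F = "free_mod k (carrier V \<times> carrier W)"
interpret T: module k ?T by (rule pres_mod_module[OF V.R.cring_axioms R])
have g: "?g \<in> carrier V \<times> carrier W \<rightarrow> carrier ?T" by (rule funcsetI, rule pres_gen_carrier[OF V.R.cring_axioms])
have gc: "v .: V ==> w .: W ==> ?g (v, w) .: ?T" for v w using g by auto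
note * = lin_ext_relations[OF T.module_axioms g]
have rel: "lin_ext k ?T ?g r = 0\<^sub>?T" if "r \<in> bilin_rel k V W" for r using pres_rel[OF V.R.cring_axioms R] sub that by auto
show ?thesis
proof (rule bilinI)
 fix u assume u: "u .: V"
 show "(%w. ?g (u, w)) : lin_hom k W ?T"
 proof (rule lin_homI)
 fix w z assume wz: "w .: W" "z .: W"
 have "free_gen k (u, w +\<^sub>W z) -\<^sub>?F (free_gen k (u, w) +\<^sub>?F free_gen k (u, z)) \<in> bilin_rel k V W"
  unfolding bilin_rel_def Let_def using u wz by - (rule UnI1, rule UnI1, rule UnI2, intro CollectI exI[of _ u] exI[of _ w] exI[of _ z], simp)
 from rel[OF this] show "?g (u, w +\<^sub>W z) = ?g (u, w) +\<^sub>?T ?g (u, z)" using u wz gc by (simp add: * T.diff_eq_zero_iff)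
 next
 fix a w assume aw: "a .: k" "w .: W"
 have "free_gen k (u, a \<odot>\<^sub>W w) -\<^sub>?F a \<odot>\<^sub>?F free_gen k (u, w) \<in> bilin_rel k V W"
  unfolding bilin_rel_def Let_def using u aw by - (rule UnI2, intro CollectI exI[of _ a] exI[of _ u] exI[of _ w], simp)
 from rel[OF this] show "?g (u, a \<odot>\<^sub>W w) = a \<odot>\<^sub>?T ?g (u, w)" using u aw gc by (simp add: * T.diff_eq_zero_iff)
 qed (use u gc in auto)
next
 fix w assume w: "w .: W"
 show "(%v. ?g (v, w)) : lin_hom k V ?T"
 proof (rule lin_homI)
 fix u v assume uv: "u .: V" "v .: V"
 have "free_gen k (u +\<^sub>V v, w) -\<^sub>?F (free_gen k (u, w) +\<^sub>?F free_gen k (v, w)) \<in> bilin_rel k V W"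
  unfolding bilin_rel_def Let_def using uv w by - (rule UnI1, rule UnI1, rule UnI1, intro CollectI exI[of _ u] exI[of _ v] exI[of _ w], simp)
 from rel[OF this] show "?g (u +\<^sub>V v, w) = ?g (u, w) +\<^sub>?T ?g (v, w)" using uv w gc by (simp add: * T.diff_eq_zero_iff)
 next
 fix a v assume av: "a .: k" "v .: V"
 have "free_gen k (a \<odot>\<^sub>V v, w) -\<^sub>?F a \<odot>\<^sub>?F free_gen k (v, w) \<in> bilin_rel k V W"
  unfolding bilin_rel_def Let_def using w av by - (rule UnI1, rule UnI2, intro CollectI exI[of _ a] exI[of _ v] exI[of _ w], simp)
 from rel[OF this] show "?g (a \<odot>\<^sub>V v, w) = a \<odot>\<^sub>?T ?g (v, w)" using w av gc by (simp add: * T.diff_eq_zero_iff)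
 qed (use w gc in auto)
qed
qed

lemma tensor_lift_pure:
assumes V: "module k V" and W: "module k W" and T: "module k T" and f: "bilin k V W T (%v w. f (v, w))"
 and "v .: V" "w .: W"
shows "pres_lift k T f (tensor_pure k V W v w) = f (v, w)"
proof -
have "f \<in> carrier V \<times> carrier W \<rightarrow> carrier T" using bilin_in[OF f] by auto
from pres_lift(2)[OF module_cring[OF V] bilin_rel_carrier[OF V W] T this bilin_rel_kill[OF V W T f], of "(v, w)"]
show ?thesis using assms(5,6) by (simp add: tensor_pure_def)
qed

lemma balanced_rel_carrier:
assumes V: "right_module k R V" and W: "left_module k R W"
shows "bilin_rel k V W \<union> balanced_rel k R V W <: (free_mod k (carrier V \<times> carrier W))"
proof -
interpret V: right_module k R V by fact
interpret W: left_module k R W by fact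
show ?thesis using bilin_rel_carrier[OF V.ACTED.module_axioms W.ACTED.module_axioms] by (auto simp: balanced_rel_def V.ract_closed W.lact_closed
  intro!: free_relations_carrier[OF module_cring[OF V.ACTED.module_axioms]])
qed

lemma rmod_module: "right_module k R V ==> module k V" by (simp add: right_module_def)

lemma left_module_module: "left_module k R V ==> module k V" by (simp add: left_module_def)

lemma tensor_over_module: "right_module k R V ==> left_module k R W ==> module k (tensor_over k R V W)" unfolding tensor_over_def
by (intro pres_mod_module balanced_rel_carrier module_cring[OF rmod_module])

lemma tensor_over_lift:
assumes V: "right_module k R V" and W: "left_module k R W" and T: "module k T"
 and f: "bilin k V W T (%v w. f (v, w))"
 and bal: "!!v r w. v .: V ==> r .: R ==> w .: W ==> f (ract V v r, w) = f (v, lact W r w)"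
shows "pres_lift k T f : lin_hom k (tensor_over k R V W) T"
 and "v .: V ==> w .: W ==> pres_lift k T f (tensor_over_pure k R V W v w) = f (v, w)"
proof -
interpret V: right_module k R V by fact
interpret W: left_module k R W by fact
interpret T: module k T by fact
have f': "f \<in> carrier V \<times> carrier W \<rightarrow> carrier T" using bilin_in[OF f] by auto
have kill: "lin_ext k T f r = 0\<^sub>T" if "r \<in> bilin_rel k V W \<union> balanced_rel k R V W" for r using that
proof
 assume "r \<in> balanced_rel k R V W"
 then show ?thesis by (auto simp: balanced_rel_def lin_ext_relations[OF T f'] V.ract_closed W.lact_closed bal
  bilin_in[OF f] T.diff_eq_zero_iff)
qed (rule bilin_rel_kill[OF V.ACTED.module_axioms W.ACTED.module_axioms T f])
note l = pres_lift[OF module_cring[OF T] balanced_rel_carrier[OF V W] T f' kill]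
show "pres_lift k T f : lin_hom k (tensor_over k R V W) T" using l(1) by (simp add: tensor_over_def)
show "v .: V ==> w .: W ==> pres_lift k T f (tensor_over_pure k R V W v w) = f (v, w)" using l(2)[of "(v, w)"] by (simp add: tensor_over_pure_def)
qed

lemma tensor_over_pure_bilin:
assumes V: "right_module k R V" and W: "left_module k R W"
shows "bilin k V W (tensor_over k R V W) (%v w. tensor_over_pure k R V W v w)"
proof -
interpret V: right_module k R V by fact
interpret W: left_module k R W by fact
show ?thesis unfolding tensor_over_def tensor_over_pure_def
 by (rule bilin_pres_gen[OF V.ACTED.module_axioms W.ACTED.module_axioms balanced_rel_carrier[OF V W]]) simp
qed

lemma tensor_over_pure_balanced:
assumes V: "right_module k R V" and W: "left_module k R W"
 and "v .: V" "r .: R" "w .: W"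
shows "tensor_over_pure k R V W (ract V v r) w = tensor_over_pure k R V W v (lact W r w)"
proof -
interpret V: right_module k R V by fact
interpret W: left_module k R W by fact
let ?Rel = "bilin_rel k V W \<union> balanced_rel k R V W"
let ?T = "pres_mod k (carrier V \<times> carrier W) ?Rel"
let ?g = "pres_gen k (carrier V \<times> carrier W) ?Rel"
have c: "cring k" using module_cring[OF V.ACTED.module_axioms] .
interpret T: module k ?T by (rule pres_mod_module[OF c balanced_rel_carrier[OF V W]])
have g: "?g \<in> carrier V \<times> carrier W \<rightarrow> carrier ?T" by (rule funcsetI, rule pres_gen_carrier[OF c])
have "free_gen k (ract V v r, w) -\<^sub>(free_mod k (carrier V \<times> carrier W)) free_gen k (v, lact W r w) \<in> ?Rel"
 unfolding balanced_rel_def using assms(3-5) by blast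
from pres_rel[OF c balanced_rel_carrier[OF V W] this]
show ?thesis using assms(3-5) g by (simp add: lin_ext_relations[OF T.module_axioms g] V.ract_closed W.lact_closed T.diff_eq_zero_iff
  tensor_over_pure_def Pi_def)
qed

lemma tensor_over_ext:
assumes V: "right_module k R V" and W: "left_module k R W" and T: "module k T"
 and f: "f : lin_hom k (tensor_over k R V W) T" and g: "g : lin_hom k (tensor_over k R V W) T"
 and eq: "!!v w. v .: V ==> w .: W ==>
 f (tensor_over_pure k R V W v w) = g (tensor_over_pure k R V W v w)"
 and t: "t .: tensor_over k R V W"
shows "f t = g t"
proof (rule pres_mod_ext[OF module_cring[OF T] balanced_rel_carrier[OF V W] T f[unfolded tensor_over_def] g[unfolded tensor_over_def] _ t[unfolded tensor_over_def]])
fix p assume "p \<in> carrier V \<times> carrier W"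
then obtain v w where p: "p = (v, w)" "v .: V" "w .: W" by auto
from eq[OF p(2,3)] show "f (pres_gen k (carrier V \<times> carrier W) (bilin_rel k V W \<union> balanced_rel k R V W) p)
 = g (pres_gen k (carrier V \<times> carrier W) (bilin_rel k V W \<union> balanced_rel k R V W) p)" unfolding tensor_over_pure_def p(1) .
qed

section \<open>Bases and finite-dimensional spaces\<close>

lemma base_mod_simps [simp]:
"carrier (base_mod k) = carrier k" "0\<^sub>(base_mod k) = 0\<^sub>k" "1\<^sub>(base_mod k) = 1\<^sub>k"
"a +\<^sub>(base_mod k) b = a +\<^sub>k b" "a \<odot>\<^sub>(base_mod k) b = a **\<^sub>k b" "a **\<^sub>(base_mod k) b = a **\<^sub>k b"
by (simp_all add: base_mod_def)

lemma base_mod_module: "cring k ==> module k (base_mod k)"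
proof -
assume "cring k"
then interpret cring k .
show ?thesis
proof (rule moduleI)
 show "abelian_group (base_mod k)"
 proof (rule abelian_groupI)
 show "\<exists>y\<in>carrier (base_mod k). y +\<^sub>(base_mod k) x = 0\<^sub>(base_mod k)" if "x .: base_mod k" for x
  using that by (intro bexI[of _ "-\<^sub>k x"]) (simp_all add: l_neg)
 qed (simp_all add: a_ac)
qed (simp_all add: l_distr r_distr m_assoc cring_axioms)
qed

lemma free_mod_update:
assumes k: "cring k" and d: "d .: free_mod k (insert w B)" and w: "w \<notin> B"
shows "d(w := 0\<^sub>k) .: free_mod k B"
 and "d = d w \<odot>\<^sub>(free_mod k (insert w B)) free_gen k w +\<^sub>(free_mod k (insert w B)) d(w := 0\<^sub>k)"
proof -
interpret cring k by fact
have "finite {x. (d(w := 0\<^sub>k)) x ~= 0\<^sub>k}" by (rule finite_subset[of _ "{x. d x ~= 0\<^sub>k}"]) (use d in "auto simp: free_mod_simps")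
then show "d(w := 0\<^sub>k) .: free_mod k B" using d w by (auto simp: free_mod_simps)
show "d = d w \<odot>\<^sub>(free_mod k (insert w B)) free_gen k w +\<^sub>(free_mod k (insert w B)) d(w := 0\<^sub>k)"
 using free_mod_coeff[OF k d] by (auto simp: free_mod_simps free_gen_def)
qed

text \<open>A set of vectors that is maximal among those independent modulo \<open>U\<close> represents a basis of \<open>W / U\<close>.
For \<open>U = 0\<close> this is a basis of \<open>W\<close>; in general the part in \<open>U\<close> gives a projection onto \<open>U\<close>.\<close>

lemma exists_basis_modulo:
assumes k: "field k" and W: "module k W" and U: "submodule U k W"
shows "\<exists>B. B <: W & (\<forall>w\<in>carrier W. \<exists>!c. c .: free_mod k B & w -\<^sub>W lin_ext k W (%x. x) c \<in> U)"
proof -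
interpret k: field k by fact
interpret W: module k W by fact
note cr = k.cring_axioms
define indep where "indep = {B. B <: W & (\<forall>c\<in>carrier (free_mod k B). lin_ext k W (%x. x) c \<in> U --> c = (%x. 0\<^sub>k))}"
have "\<exists>B\<in>indep. \<forall>Y\<in>indep. B \<subseteq> Y --> Y = B"
proof (rule subset_Zorn)
 fix C assume chain: "subset.chain indep C"
 then have Ci: "C \<subseteq> indep" by (simp add: subset_chain_def)
 have "c = (%x. 0\<^sub>k)" if c: "c .: (free_mod k (\<Union>C))" and cU: "lin_ext k W (%x. x) c \<in> U" for c
 proof (cases "{x. c x ~= 0\<^sub>k} = {}")
 case False
 have "finite {x. c x ~= 0\<^sub>k}" "{x. c x ~= 0\<^sub>k} \<subseteq> \<Union>C" using c by (auto simp: free_mod_simps)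
 moreover from this(2) False have "C ~= {}" by auto
 ultimately obtain B where B: "B \<in> C" "{x. c x ~= 0\<^sub>k} \<subseteq> B"
  using finite_subset_Union_chain[of "{x. c x ~= 0\<^sub>k}" C indep] chain by metis
 then have "c .: free_mod k B" using c free_mod_coeff[OF cr c] by (auto simp: free_mod_simps)
 then show ?thesis using B(1) Ci cU by (auto simp: indep_def)
 qed auto
 then have "\<Union>C \<in> indep" using Ci by (auto simp: indep_def)
 then show "\<exists>U\<in>indep. \<forall>Y\<in>C. Y \<subseteq> U" by blast
qed
then obtain B where B: "B \<in> indep" and max: "!!Y. Y \<in> indep ==> B \<subseteq> Y ==> Y = B" by blast
have BW: "B <: W" using B by (simp add: indep_def)
let ?e = "lin_ext k W (%x. x)"
have e: "?e : lin_hom k (free_mod k Y) W" if "Y <: W" for Y using that by (intro lin_ext_lin_hom[OF W]) auto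
have eg: "?e (free_gen k x) = x" if "x .: W" for x using that lin_ext_gen[OF W, of "%x. x" "carrier W" x] by auto
have ex: "\<exists>c\<in>carrier (free_mod k B). w -\<^sub>W ?e c \<in> U" if w: "w .: W" for w
proof (rule ccontr)
 assume no: "\<not> ?thesis"
 interpret FB: module k "free_mod k B" by (rule free_mod_module[OF cr])
 have wB: "w \<notin> B"
 proof
 assume "w \<in> B"
 then have "free_gen k w .: free_mod k B" by (rule free_gen_carrier[OF cr])
 moreover have "w -\<^sub>W ?e (free_gen k w) \<in> U" using w submodule_zero[OF W U] by (simp add: eg W.r_neg a_minus_def)
 ultimately show False using no by blast
 qed
 have iW: "insert w B <: W" using w BW by simp
 have "d = (%x. 0\<^sub>k)" if d: "d .: free_mod k (insert w B)" and dU: "?e d \<in> U" for d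
 proof -
 interpret F: module k "free_mod k (insert w B)" by (rule free_mod_module[OF cr])
 note upd = free_mod_update[OF cr d wB]
 let ?d = "d(w := 0\<^sub>k)"
 have d': "?d .: free_mod k (insert w B)" using upd(1) by (auto simp: free_mod_simps)
 have dw: "d w .: k" using free_mod_coeff[OF cr d] .
 have ed: "?e ?d .: W" using lin_in[OF e[OF iW] d'] .
 have gw: "free_gen k w .: free_mod k (insert w B)" by (rule free_gen_carrier[OF cr]) simp
 have "?e d = ?e (d w \<odot>\<^sub>(free_mod k (insert w B)) free_gen k w +\<^sub>(free_mod k (insert w B)) ?d)"  using upd(2) by simp
 also have "... = d w \<odot>\<^sub>W w +\<^sub>W ?e ?d" using d' dw gw by (simp add: lin_add[OF e[OF iW]] lin_smult[OF e[OF iW]] eg w)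
 finally have sum: "?e d = d w \<odot>\<^sub>W w +\<^sub>W ?e ?d" .
 show ?thesis
 proof (cases "d w = 0\<^sub>k")
  case True
  then have "d = ?d" by auto
  then show ?thesis using B upd(1) dU by (auto simp: indep_def)
 next
  case False
  then have i: "inv\<^bsub>k\<^esub> (d w) .: k" "inv\<^bsub>k\<^esub> (d w) **\<^sub>k d w = 1\<^sub>k" using dw k.field_Units by auto
  let ?c = "(-\<^sub>k (inv\<^bsub>k\<^esub> (d w))) \<odot>\<^sub>(free_mod k B) ?d"
  have "inv\<^bsub>k\<^esub> (d w) \<odot>\<^sub>W ?e d = w +\<^sub>W inv\<^bsub>k\<^esub> (d w) \<odot>\<^sub>W ?e ?d"
  using i dw w ed by (simp add: sum W.smult_r_distr W.smult_assoc1[symmetric])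
  also have "... = w -\<^sub>W ?e ?c" using i upd(1) ed w by (simp add: lin_smult[OF e[OF BW]] W.smult_l_minus W.minus_minus a_minus_def)
  finally have "w -\<^sub>W ?e ?c \<in> U" using W.submoduleE(4)[OF U i(1) dU] by simp
  moreover have "?c .: free_mod k B" using i upd(1) by simp
  ultimately show ?thesis using no by blast
 qed
 qed
 then have "insert w B \<in> indep" using iW by (auto simp: indep_def)
 then show False using max wB by blast
qed
have "c = c'" if c: "c .: free_mod k B" "w -\<^sub>W ?e c \<in> U" and c': "c' .: free_mod k B" "w -\<^sub>W ?e c' \<in> U"
 and w: "w .: W" for c c' w
proof -
 interpret FB: module k "free_mod k B" by (rule free_mod_module[OF cr])
 have ec: "?e c .: W" "?e c' .: W" using lin_in[OF e[OF BW]] c c' by auto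
 have "?e (c -\<^sub>(free_mod k B) c') = ?e c -\<^sub>W ?e c'" using c c' by (simp add: lin_diff[OF e[OF BW] FB.module_axioms W])
 also have "... = (w -\<^sub>W ?e c') -\<^sub>W (w -\<^sub>W ?e c)"
 proof -
 have "(w -\<^sub>W ?e c') -\<^sub>W (w -\<^sub>W ?e c) = (w +\<^sub>W -\<^sub>W w) +\<^sub>W (?e c +\<^sub>W -\<^sub>W ?e c')"
  using w ec by (simp add: a_minus_def W.minus_add W.minus_minus W.a_ac)
 then show ?thesis using w ec by (simp add: W.r_neg a_minus_def)
 qed
 finally have "?e (c -\<^sub>(free_mod k B) c') \<in> U" using submodule_diff[OF W U c'(2) c(2)] by simp
 then have "c -\<^sub>(free_mod k B) c' = 0\<^sub>(free_mod k B)" using B c c' FB.minus_closed[of c c'] by (simp add: indep_def free_mod_simps(2))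
 then show ?thesis using c c' by (simp add: FB.diff_eq_zero_iff)
qed
then show ?thesis using BW ex by (intro exI[of _ B]) blast
qed

lemma exists_coordinates:
assumes k: "field k" and W: "module k W" and U: "submodule U k W"
shows "\<exists>B p c. B <: W & p : lin_hom k W W & p ` carrier W \<subseteq> U & (\<forall>u\<in>U. p u = u) &
 (\<forall>b. c b : lin_hom k W (base_mod k)) & (\<forall>w\<in>carrier W. finite {b. c b w ~= 0\<^sub>k} & {b. c b w ~= 0\<^sub>k} \<subseteq> B &
 w = p w +\<^sub>W (\<Oplus>\<^bsub>W\<^esub>b\<in>{b. c b w ~= 0\<^sub>k}. c b w \<odot>\<^sub>W b))"
proof -
interpret k: field k by fact
interpret W: module k W by fact
note cr = k.cring_axioms
from exists_basis_modulo[OF assms] obtain B where B: "B <: W"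
 and "\<forall>w\<in>carrier W. \<exists>!c. c .: free_mod k B & w -\<^sub>W lin_ext k W (%x. x) c \<in> U" by (elim exE conjE)
note ex1 = this(2)[rule_format]
let ?e = "lin_ext k W (%x. x)"
have e: "?e : lin_hom k (free_mod k B) W" using B by (intro lin_ext_lin_hom[OF W]) auto
interpret F: module k "free_mod k B" by (rule free_mod_module[OF cr])
define q where "q w = (THE c. c .: free_mod k B & w -\<^sub>W ?e c \<in> U)" for w
have q: "q w .: free_mod k B" "w -\<^sub>W ?e (q w) \<in> U" if "w .: W" for w using theI'[OF ex1[OF that]] by (simp_all add: q_def)
have qI: "q w = c" if "w .: W" "c .: free_mod k B" "w -\<^sub>W ?e c \<in> U" for w c
 unfolding q_def by (rule the1_equality[OF ex1[OF that(1)]]) (intro conjI that(2,3))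
have qlin: "q : lin_hom k W (free_mod k B)"
proof (rule lin_homI)
 fix u v assume uv: "u .: W" "v .: W"
 have "(u +\<^sub>W v) -\<^sub>W ?e (q u +\<^sub>(free_mod k B) q v) = (u -\<^sub>W ?e (q u)) +\<^sub>W (v -\<^sub>W ?e (q v))"
 using uv q lin_in[OF e] by (simp add: lin_add[OF e] a_minus_def W.minus_add W.a_ac)
 then show "q (u +\<^sub>W v) = q u +\<^sub>(free_mod k B) q v"
 using uv q(1) W.submoduleE(5)[OF U q(2)[OF uv(1)] q(2)[OF uv(2)]] by (intro qI) simp_all
next
 fix a v assume av: "a .: k" "v .: W"
 have "(a \<odot>\<^sub>W v) -\<^sub>W ?e (a \<odot>\<^sub>(free_mod k B) q v) = a \<odot>\<^sub>W (v -\<^sub>W ?e (q v))"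
 using av q lin_in[OF e] by (simp add: lin_smult[OF e] a_minus_def W.smult_r_distr W.smult_r_minus)
 then show "q (a \<odot>\<^sub>W v) = a \<odot>\<^sub>(free_mod k B) q v"
 using av q(1) W.submoduleE(4)[OF U av(1) q(2)[OF av(2)]] by (intro qI) simp_all
qed (use q in simp)
define p where "p w = w -\<^sub>W ?e (q w)" for w
have p: "p : lin_hom k W W" unfolding p_def[abs_def] by (intro lin_minus_map lin_id W lin_comp[OF qlin e])
have pu: "p u = u" if "u \<in> U" for u
proof -
 have u: "u .: W" using that W.submoduleE(1)[OF U] by auto
 have "q u = 0\<^sub>(free_mod k B)" using u that by (intro qI) (simp_all add: lin_zero[OF e F.module_axioms W])
 then show ?thesis using u by (simp add: p_def lin_zero[OF e F.module_axioms W])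
qed
define c where "c b w = q w b" for b w
have clin: "c b : lin_hom k W (base_mod k)" for b
 by (rule lin_homI) (simp_all add: c_def lin_add[OF qlin] lin_smult[OF qlin] free_mod_simps(3,4) free_mod_coeff[OF cr q(1)])
have "finite {b. c b w ~= 0\<^sub>k} & {b. c b w ~= 0\<^sub>k} \<subseteq> B &
 w = p w +\<^sub>W (\<Oplus>\<^bsub>W\<^esub>b\<in>{b. c b w ~= 0\<^sub>k}. c b w \<odot>\<^sub>W b)" if w: "w .: W" for w
proof -
 have "w = p w +\<^sub>W ?e (q w)" using w lin_in[OF e q(1)[OF w]] by (simp add: p_def a_minus_def W.a_assoc W.l_neg)
 moreover have "finite {b. c b w ~= 0\<^sub>k}" "{b. c b w ~= 0\<^sub>k} \<subseteq> B" using q(1)[OF w] by (auto simp: c_def free_mod_simps(1))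
 ultimately show ?thesis by (simp add: c_def lin_ext_def)
qed
moreover have "p ` carrier W \<subseteq> U" using q(2) by (auto simp: p_def)
ultimately show ?thesis using B p pu clin by (intro exI[of _ B] exI[of _ p] exI[of _ c]) blast
qed

lemma exists_projection:
assumes "field k" "module k W" "submodule U k W"
obtains p where "p : lin_hom k W W" "!!w. w .: W ==> p w \<in> U" "!!u. u \<in> U ==> p u = u"
proof -
from exists_coordinates[OF assms] obtain B p c where
 "p : lin_hom k W W" "p ` carrier W \<subseteq> U" "\<forall>u\<in>U. p u = u" by (elim exE conjE)
then show ?thesis by (intro that[of p]) auto
qed

lemma exists_basis:
assumes "field k" "module k W"
obtains c where "!!b. c b : lin_hom k W (base_mod k)"
 and "!!w. w .: W ==> finite {b. c b w ~= 0\<^sub>k}"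
 and "!!w. w .: W ==> {b. c b w ~= 0\<^sub>k} <: W"
 and "!!w. w .: W ==> w = (\<Oplus>\<^bsub>W\<^esub>b\<in>{b. c b w ~= 0\<^sub>k}. c b w \<odot>\<^sub>W b)"
proof -
interpret W: module k W by fact
have U: "submodule {0\<^sub>W} k W" by (rule W.submoduleI) auto
from exists_coordinates[OF assms U] obtain B p c where
 B: "B <: W" "p ` carrier W \<subseteq> {0\<^sub>W}" and c': "\<forall>b. c b : lin_hom k W (base_mod k)"
 and w': "\<forall>w\<in>carrier W. finite {b. c b w ~= 0\<^sub>k} & {b. c b w ~= 0\<^sub>k} \<subseteq> B &
 w = p w +\<^sub>W (\<Oplus>\<^bsub>W\<^esub>b\<in>{b. c b w ~= 0\<^sub>k}. c b w \<odot>\<^sub>W b)" by (elim exE conjE)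
note w = w'[rule_format] and c = c'[rule_format]
have eq: "w = (\<Oplus>\<^bsub>W\<^esub>b\<in>{b. c b w ~= 0\<^sub>k}. c b w \<odot>\<^sub>W b)" if "w .: W" for w
proof -
 have "(%b. c b w \<odot>\<^sub>W b) \<in> {b. c b w ~= 0\<^sub>k} \<rightarrow> carrier W" using w[OF that] B(1) lin_in[OF c that] by auto
 then have "(\<Oplus>\<^bsub>W\<^esub>b\<in>{b. c b w ~= 0\<^sub>k}. c b w \<odot>\<^sub>W b) .: W" by (rule W.finsum_closed)
 moreover have "p w = 0\<^sub>W" using B(2) that by auto
 moreover have "w = p w +\<^sub>W (\<Oplus>\<^bsub>W\<^esub>b\<in>{b. c b w ~= 0\<^sub>k}. c b w \<odot>\<^sub>W b)" using w[OF that] by blast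
 ultimately show ?thesis by (metis W.l_zero)
qed
have "finite {b. c b w ~= 0\<^sub>k}" "{b. c b w ~= 0\<^sub>k} <: W" if "w .: W" for w using w[OF that] B(1) by auto
from that[OF c this eq] show ?thesis .
qed

lemma eq_if_functionals_eq:
assumes k: "field k" and W: "module k W" and u: "u .: W" and v: "v .: W"
 and eq: "!!f. f : lin_hom k W (base_mod k) ==> f u = f v"
shows "u = v"
proof -
obtain c where c: "!!b. c b : lin_hom k W (base_mod k)"
 and "!!w. w .: W ==> finite {b. c b w ~= 0\<^sub>k}"
 "!!w. w .: W ==> {b. c b w ~= 0\<^sub>k} <: W"
 and s: "!!w. w .: W ==> w = (\<Oplus>\<^bsub>W\<^esub>b\<in>{b. c b w ~= 0\<^sub>k}. c b w \<odot>\<^sub>W b)"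
 by (rule exists_basis[OF k W]) blast
have "c b u = c b v" for b by (rule eq[OF c])
then have "(\<Oplus>\<^bsub>W\<^esub>b\<in>{b. c b u ~= 0\<^sub>k}. c b u \<odot>\<^sub>W b) = (\<Oplus>\<^bsub>W\<^esub>b\<in>{b. c b v ~= 0\<^sub>k}. c b v \<odot>\<^sub>W b)"
 by presburger
then show ?thesis using s[OF u] s[OF v] by presburger
qed

lemma mod_span_insert:
assumes V: "module k V" and A: "A <: V" and v: "v .: V"
 and u: "u \<in> mod_span k V (insert v A)"
shows "\<exists>a\<in>carrier k. \<exists>s\<in>mod_span k V A. u = s +\<^sub>V a \<odot>\<^sub>V v"
proof -
interpret V: module k V by fact
note S = mod_span_sub[OF V A]
note sub = submodule_sub[OF V S]
let ?X = "{s +\<^sub>V a \<odot>\<^sub>V v | a s. a .: k & s \<in> mod_span k V A}"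
have "submodule ?X k V"
proof (rule V.submoduleI)
 show "?X <: V" using sub v by auto
 show "0\<^sub>V \<in> ?X" using submodule_zero[OF V S] v by (auto intro!: exI[of _ "0\<^sub>k"] exI[of _ "0\<^sub>V"])
next
 fix x assume "x \<in> ?X"
 then obtain a s where x: "x = s +\<^sub>V a \<odot>\<^sub>V v" "a .: k" "s \<in> mod_span k V A" by auto
 then have "-\<^sub>V x = (-\<^sub>V s) +\<^sub>V (-\<^sub>k a) \<odot>\<^sub>V v" using sub v by (simp add: V.minus_add V.smult_l_minus)
 then show "-\<^sub>V x \<in> ?X" using x V.submoduleE(3)[OF S] by blast
 fix y assume "y \<in> ?X"
 then obtain b t where y: "y = t +\<^sub>V b \<odot>\<^sub>V v" "b .: k" "t \<in> mod_span k V A" by auto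
 then have "x +\<^sub>V y = (s +\<^sub>V t) +\<^sub>V (a +\<^sub>k b) \<odot>\<^sub>V v" using x sub v by (simp add: V.smult_l_distr V.a_ac)
 then show "x +\<^sub>V y \<in> ?X" using x y V.submoduleE(5)[OF S] by blast
next
 fix b x assume b: "b .: k" and "x \<in> ?X"
 then obtain a s where x: "x = s +\<^sub>V a \<odot>\<^sub>V v" "a .: k" "s \<in> mod_span k V A" by auto
 then have "b \<odot>\<^sub>V x = (b \<odot>\<^sub>V s) +\<^sub>V (b **\<^sub>k a) \<odot>\<^sub>V v"
 using sub v b by (simp add: V.smult_r_distr V.smult_assoc1)
 then show "b \<odot>\<^sub>V x \<in> ?X" using x b V.submoduleE(4)[OF S] by blast
qed
moreover have "insert v A \<subseteq> ?X"
proof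
 fix x assume "x \<in> insert v A"
 then consider "x = v" | "x \<in> A" by auto
 then show "x \<in> ?X"
 proof cases
 case 1
 then have "x = 0\<^sub>V +\<^sub>V 1\<^sub>k \<odot>\<^sub>V v" using v by simp
 then show ?thesis using submodule_zero[OF V S] by blast
 next
 case 2
 then have "x = x +\<^sub>V 0\<^sub>k \<odot>\<^sub>V v" "x \<in> mod_span k V A" using v A mod_span_superset[of A k V] by auto
 then show ?thesis by blast
 qed
qed
ultimately have "u \<in> ?X" using u mod_span_least by blast
then show ?thesis by blast
qed

text \<open>The pivots of a subspace with respect to a flag; their number is its dimension. This is all of the
theory of dimension that is used.\<close>

definition pivots ::
 "('k, 'e) ring_scheme => ('k, 'v, 'f) module_scheme => (nat => 'v) => nat => 'v set => nat set" where
"pivots k V v n D = {i. i < n & (\<exists>d\<in>D. d \<in> mod_span k V (v ` {..<Suc i}) & d \<notin> mod_span k V (v ` {..<i}))}"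

lemma pivots_eq_imp_eq:
assumes k: "field k" and V: "module k V" and v: "!!i. v i .: V"
 and D: "submodule D k V" and E: "submodule E k V" and sub: "D \<subseteq> E" "E \<subseteq> mod_span k V (v ` {..<n})"
 and piv: "pivots k V v n D = pivots k V v n E"
shows "D = E"
proof -
interpret k: field k by fact
interpret V: module k V by fact
define L where "L i = mod_span k V (v ` {..<i})" for i
have S: "submodule (L i) k V" for i unfolding L_def using v by (intro mod_span_sub[OF V]) auto
have step: "\<exists>a\<in>carrier k. \<exists>s\<in>L i. u = s +\<^sub>V a \<odot>\<^sub>V v i" if "u \<in> L (Suc i)" for u i
 using mod_span_insert[OF V _ v, of "v ` {..<i}" u i] that v by (auto simp: L_def lessThan_Suc)
have "E \<inter> L m \<subseteq> D" if "m \<le> n" for m using that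
proof (induction m)
 case 0
 have "submodule {0\<^sub>V} k V" by (rule V.submoduleI) auto
 from mod_span_least[OF this, of "{}"] have "L 0 \<subseteq> {0\<^sub>V}" by (simp add: L_def)
 then show ?case using submodule_zero[OF V D] by auto
next
 case (Suc m)
 show ?case
 proof
 fix e assume e: "e \<in> E \<inter> L (Suc m)"
 show "e \<in> D"
 proof (cases "e \<in> L m")
  case True then show ?thesis using Suc e by auto
 next
  case False
  then have "m \<in> pivots k V v n E" using e Suc.prems by (auto simp: pivots_def L_def)
  then obtain d where d: "d \<in> D" "d \<in> L (Suc m)" "d \<notin> L m" unfolding piv[symmetric] by (auto simp: pivots_def L_def)
  obtain a s where a: "a .: k" "s \<in> L m" "e = s +\<^sub>V a \<odot>\<^sub>V v m" using step e by blast
  obtain b t where b: "b .: k" "t \<in> L m" "d = t +\<^sub>V b \<odot>\<^sub>V v m" using step d by blast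
  have st: "s .: V" "t .: V" "d .: V" "e .: V" using a b d e submodule_sub[OF V S] submodule_sub[OF V D] by auto
  have "b ~= 0\<^sub>k" using d(3) b st v by auto
  then have i: "inv\<^bsub>k\<^esub> b .: k" "inv\<^bsub>k\<^esub> b **\<^sub>k b = 1\<^sub>k" using b(1) k.field_Units by auto
  define r where "r = a **\<^sub>k inv\<^bsub>k\<^esub> b"
  have r: "r .: k" "r **\<^sub>k b = a" using i a b by (simp_all add: r_def k.m_assoc)
  have "e -\<^sub>V r \<odot>\<^sub>V d = (s -\<^sub>V r \<odot>\<^sub>V t) +\<^sub>V (a \<odot>\<^sub>V v m -\<^sub>V (r **\<^sub>k b) \<odot>\<^sub>V v m)"
  using r(1) a b st v by (simp add: V.smult_r_distr a_minus_def V.minus_add V.smult_assoc1 V.a_ac)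
  also have "... = s -\<^sub>V r \<odot>\<^sub>V t" using r a b st v by (simp add: a_minus_def V.r_neg)
  finally have *: "e -\<^sub>V r \<odot>\<^sub>V d = s -\<^sub>V r \<odot>\<^sub>V t" .
  have rd: "r \<odot>\<^sub>V d \<in> D" using V.submoduleE(4)[OF D r(1) d(1)] .
  have "s -\<^sub>V r \<odot>\<^sub>V t \<in> L m" using a b r by (intro submodule_diff[OF V S] V.submoduleE(4)[OF S])
  moreover have "e -\<^sub>V r \<odot>\<^sub>V d \<in> E" using e rd sub(1) by (intro submodule_diff[OF V E]) auto
  ultimately have "e -\<^sub>V r \<odot>\<^sub>V d \<in> D" using * Suc by auto
  then have "(e -\<^sub>V r \<odot>\<^sub>V d) +\<^sub>V r \<odot>\<^sub>V d \<in> D" using V.submoduleE(5)[OF D] rd by blast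
  moreover have "(e -\<^sub>V r \<odot>\<^sub>V d) +\<^sub>V r \<odot>\<^sub>V d = e" using st r by (simp add: a_minus_def V.a_assoc V.l_neg)
  ultimately show ?thesis by simp
 qed
 qed
qed
from this[of n] show ?thesis using sub by (auto simp: L_def)
qed

lemma pivots_strict_mono:
assumes "field k" "module k V" "!!i. v i .: V" "submodule D k V" "submodule E k V"
 and "D \<subset> E" "E \<subseteq> mod_span k V (v ` {..<n})"
shows "card (pivots k V v n D) < card (pivots k V v n E)"
proof (rule psubset_card_mono)
show "finite (pivots k V v n E)" by (simp add: pivots_def)
have "pivots k V v n D \<subseteq> pivots k V v n E" using assms(6) by (auto simp: pivots_def)
then show "pivots k V v n D \<subset> pivots k V v n E" using pivots_eq_imp_eq[OF assms(1-5) _ assms(7)] assms(6) by blast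
qed

lemma exists_minimal_sub:
fixes v :: "nat => 'v" and n :: nat
assumes "field k" "module k V" "!!i. v i .: V"
 and F: "!!D. P D ==> submodule D k V & D \<subseteq> mod_span k V (v ` {..<n})" and ex: "P D0"
shows "\<exists>D. P D & (\<forall>E. P E --> E \<subseteq> D --> E = D)"
proof -
obtain D where D: "P D" "!!E. P E ==> card (pivots k V v n D) \<le> card (pivots k V v n E)"
 using ex_has_least_nat[of P D0 "%D. card (pivots k V v n D)"] ex by blast
have "E = D" if "P E" "E \<subseteq> D" for E
proof (rule ccontr)
 assume "E ~= D"
 then have "E \<subset> D" using that by auto
 from pivots_strict_mono[where v = v and n = n, OF assms(1-3) _ _ this] F[OF D(1)] F[OF that(1)] D(2)[OF that(1)]
 show False by simp
qed
then show ?thesis using D by blast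
qed

lemma no_ascending_chain:
fixes v :: "nat => 'v" and n :: nat
assumes "field k" "module k V" "!!i. v i .: V"
 and F: "!!m. submodule (D m) k V" "!!m. D m \<subseteq> mod_span k V (v ` {..<n})" and chain: "!!m. D m \<subset> D (Suc m)"
shows False
proof -
have "m \<le> card (pivots k V v n (D m))" for m :: nat
proof (induction m)
 case (Suc m)
 then show ?case using pivots_strict_mono[OF assms(1-3) F(1) F(1) chain[of m] F(2)] by simp
qed simp
moreover have "card (pivots k V v n (D (Suc n))) \<le> n" using card_mono[of "{..<n}" "pivots k V v n (D (Suc n))"] by (auto simp: pivots_def)
ultimately show False by (metis Suc_n_not_le_n order_trans)
qed

section \<open>Homology\<close>

lemma submodule_restrict:
assumes V: "module k V" and Z: "submodule Z k V" and B: "submodule B k V" and sub: "B \<subseteq> Z"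
shows "module k (V\<lparr>carrier := Z\<rparr>)" and "submodule B k (V\<lparr>carrier := Z\<rparr>)"
proof -
interpret V: module k V by fact
show Zm: "module k (V\<lparr>carrier := Z\<rparr>)" by (rule submodule.submodule_is_module[OF Z V])
interpret Z: module k "V\<lparr>carrier := Z\<rparr>" by (rule Zm)
have "module k (V\<lparr>carrier := B\<rparr>)" by (rule submodule.submodule_is_module[OF B V])
then show "submodule B k (V\<lparr>carrier := Z\<rparr>)" using sub by (intro Z.module_incl_imp_submodule) auto
qed

lemma restrict_diff:
assumes V: "module k V" and Z: "submodule Z k V" and u: "u \<in> Z" and v: "v \<in> Z"
shows "u -\<^sub>(V\<lparr>carrier := Z\<rparr>) v = u -\<^sub>V v"
proof -
interpret V: module k V by fact
interpret Z: module k "V\<lparr>carrier := Z\<rparr>" by (rule submodule.submodule_is_module[OF Z V])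
have "-\<^sub>V v \<in> Z" using V.submoduleE(3)[OF Z v] .
then have "-\<^sub>(V\<lparr>carrier := Z\<rparr>) v = -\<^sub>V v"
 using v submodule_sub[OF V Z v] Z.minus_equality[of "-\<^sub>V v" v] by (simp add: V.l_neg)
then show ?thesis by (simp add: a_minus_def)
qed

lemma subquotient_iso:
assumes V: "module k V" and Z: "submodule Z k V" and B: "submodule B k V" and BZ: "B \<subseteq> Z"
 and V': "module k V'" and Z': "submodule Z' k V'" and B': "submodule B' k V'" and BZ': "B' \<subseteq> Z'"
 and F: "F : lin_hom k V V'" "!!z. z \<in> Z ==> F z \<in> Z'" "!!z. z \<in> B ==> F z \<in> B'"
 and G: "G : lin_hom k V' V" "!!z. z \<in> Z' ==> G z \<in> Z" "!!z. z \<in> B' ==> G z \<in> B"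
 and GF: "!!z. z \<in> Z ==> G (F z) -\<^sub>V z \<in> B" and FG: "!!z. z \<in> Z' ==> F (G z) -\<^sub>V' z \<in> B'"
shows "lin_iso k (quot_mod (V\<lparr>carrier := Z\<rparr>) B) (quot_mod (V'\<lparr>carrier := Z'\<rparr>) B')"
proof -
let ?Z = "V\<lparr>carrier := Z\<rparr>" and ?Z' = "V'\<lparr>carrier := Z'\<rparr>"
note r = submodule_restrict[OF V Z B BZ] and r' = submodule_restrict[OF V' Z' B' BZ']
have lift: "(%C. the_elem ((%z. B2 +>\<^sub>V2 f z) ` C)) : lin_hom k (quot_mod V1 B1) (quot_mod V2 B2) &
 (\<forall>u\<in>carrier V1. the_elem ((%z. B2 +>\<^sub>V2 f z) ` (B1 +>\<^sub>V1 u)) = B2 +>\<^sub>V2 f u)"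
 if "module k V1" "submodule B1 k V1" "module k V2" "submodule B2 k V2" "f : lin_hom k V1 V2" "!!b. b \<in> B1 ==> f b \<in> B2"
 for V1 :: "('a, 'x, 'y) module_scheme" and V2 :: "('a, 'z, 'w) module_scheme" and B1 B2 f
proof -
 have g: "(%z. B2 +>\<^sub>V2 f z) : lin_hom k V1 (quot_mod V2 B2)" using lin_comp[OF that(5) quot_proj[OF that(3,4)]] .
 have "B2 +>\<^sub>V2 f b = 0\<^sub>(quot_mod V2 B2)" if "b \<in> B1" for b
 using \<open>!!b. b \<in> B1 ==> f b \<in> B2\<close>[OF that] submodule_sub[OF \<open>module k V2\<close> \<open>submodule B2 k V2\<close>]
 by (simp add: quot_eq_zero[OF \<open>module k V2\<close> \<open>submodule B2 k V2\<close>])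
 then show ?thesis using quot_lift[OF that(1,2) quot_module[OF that(3,4)] g] by blast
qed
have F': "F : lin_hom k ?Z ?Z'" using F submodule_sub[OF V Z] by (auto simp: lin_hom_def)
have G': "G : lin_hom k ?Z' ?Z" using G submodule_sub[OF V' Z'] by (auto simp: lin_hom_def)
define \<Phi> where "\<Phi> C = the_elem ((%z. B' +>\<^sub>?Z' F z) ` C)" for C
define \<Psi> where "\<Psi> C = the_elem ((%z. B +>\<^sub>?Z G z) ` C)" for C
have \<Phi>: "\<Phi> \<in> lin_hom k (quot_mod ?Z B) (quot_mod ?Z' B')" "!!z. z \<in> Z ==> \<Phi> (B +>\<^sub>?Z z) = B' +>\<^sub>?Z' F z"
 using lift[OF r r' F' F(3)] by (simp_all add: \<Phi>_def[abs_def])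
have \<Psi>: "\<Psi> \<in> lin_hom k (quot_mod ?Z' B') (quot_mod ?Z B)" "!!z. z \<in> Z' ==> \<Psi> (B' +>\<^sub>?Z' z) = B +>\<^sub>?Z G z"
 using lift[OF r' r G' G(3)] by (simp_all add: \<Psi>_def[abs_def])
have 1: "\<Psi> (\<Phi> C) = C" if C: "C .: quot_mod ?Z B" for C
proof -
 obtain z where z: "C = B +>\<^sub>?Z z" "z \<in> Z" using C by (auto simp: quot_carrier)
 then have "B +>\<^sub>?Z G (F z) = B +>\<^sub>?Z z" using GF F G by (subst coset_eq[OF r]) (simp_all add: restrict_diff[OF V Z])
 then show ?thesis using z F(2) by (simp add: \<Phi>(2) \<Psi>(2))
qed
have 2: "\<Phi> (\<Psi> C) = C" if C: "C .: quot_mod ?Z' B'" for C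
proof -
 obtain z where z: "C = B' +>\<^sub>?Z' z" "z \<in> Z'" using C by (auto simp: quot_carrier)
 then have "B' +>\<^sub>?Z' F (G z) = B' +>\<^sub>?Z' z" using FG F G by (subst coset_eq[OF r']) (simp_all add: restrict_diff[OF V' Z'])
 then show ?thesis using z G(2) by (simp add: \<Phi>(2) \<Psi>(2))
qed
have "bij_betw \<Phi> (carrier (quot_mod ?Z B)) (carrier (quot_mod ?Z' B'))"
 using 1 2 lin_in[OF \<Phi>(1)] lin_in[OF \<Psi>(1)] by (intro bij_betw_byWitness[where f' = \<Psi>]) auto
then show ?thesis using \<Phi>(1) by (auto simp: lin_iso_def)
qed

lemma cycles_sub:
assumes "!!n. module k (C n)" "!!n. d (Suc n) : lin_hom k (C (Suc n)) (C n)"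
shows "submodule (cycles C d n) k (C n)"
proof (cases n)
case 0
then show ?thesis using module.carrier_is_submodule[OF assms(1)] by (simp add: cycles_def)
next
case (Suc m)
then show ?thesis using submodule_kernel[OF assms(2)[of m] assms(1) assms(1)] by (simp add: cycles_def)
qed

lemma cycles_map:
assumes f: "!!n. f n : lin_hom k (C n) (C' n)"
 and df: "!!n z. z .: C (Suc n) ==> f n (d (Suc n) z) = d' (Suc n) (f (Suc n) z)"
 and C: "!!n. module k (C n)" and C': "!!n. module k (C' n)" and z: "z \<in> cycles C d n"
shows "f n z \<in> cycles C' d' n"
proof (cases n)
case 0
then show ?thesis using z lin_in[OF f[of n]] by (simp add: cycles_def)
next
case (Suc m)
then show ?thesis using z df[of z m] lin_in[OF f[of n]] lin_zero[OF f[of m] C C'] by (simp add: cycles_def)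
qed

lemma boundaries_subset:
assumes d: "!!n. d (Suc n) : lin_hom k (C (Suc n)) (C n)"
 and dd: "!!n z. z .: C (Suc (Suc n)) ==> d (Suc n) (d (Suc (Suc n)) z) = 0\<^sub>(C n)"
shows "d (Suc n) ` carrier (C (Suc n)) \<subseteq> cycles C d n" using dd lin_in[OF d] by (cases n) (auto simp: cycles_def)

lemma boundaries_sub:
assumes "!!n. d (Suc n) : lin_hom k (C (Suc n)) (C n)" "!!n. module k (C n)"
shows "submodule (d (Suc n) ` carrier (C (Suc n))) k (C n)"
using submodule_image[OF assms(1) assms(2) assms(2) module.carrier_is_submodule[OF assms(2)]] .

lemma homology_iso:
assumes C: "!!n. module k (C n)" and d: "!!n. d (Suc n) : lin_hom k (C (Suc n)) (C n)"
 and dd: "!!n z. z .: C (Suc (Suc n)) ==> d (Suc n) (d (Suc (Suc n)) z) = 0\<^sub>(C n)"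
 and C': "!!n. module k (C' n)" and d': "!!n. d' (Suc n) : lin_hom k (C' (Suc n)) (C' n)"
 and dd': "!!n z. z .: C' (Suc (Suc n)) ==> d' (Suc n) (d' (Suc (Suc n)) z) = 0\<^sub>(C' n)"
 and F: "!!n. F n : lin_hom k (C n) (C' n)" and G: "!!n. G n : lin_hom k (C' n) (C n)"
 and dF: "!!n z. z .: C (Suc n) ==> F n (d (Suc n) z) = d' (Suc n) (F (Suc n) z)"
 and dG: "!!n z. z .: C' (Suc n) ==> G n (d' (Suc n) z) = d (Suc n) (G (Suc n) z)"
 and GF: "!!n z. z \<in> cycles C d n ==> G n (F n z) -\<^sub>(C n) z \<in> d (Suc n) ` carrier (C (Suc n))"
 and FG: "!!n z. z \<in> cycles C' d' n ==> F n (G n z) -\<^sub>(C' n) z \<in> d' (Suc n) ` carrier (C' (Suc n))"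
shows "lin_iso k (homology C d n) (homology C' d' n)"
proof -
show ?thesis unfolding homology_def
proof (rule subquotient_iso[OF C cycles_sub[where C = C and d = d, OF C d] boundaries_sub[where C = C and d = d, OF d C] boundaries_subset[where C = C and d = d, OF d dd]
  C' cycles_sub[where C = C' and d = d', OF C' d'] boundaries_sub[where C = C' and d = d', OF d' C'] boundaries_subset[where C = C' and d = d', OF d' dd'] F _ _ G])
 show "!!z. z \<in> cycles C d n ==> F n z \<in> cycles C' d' n" by (rule cycles_map[where C = C and d = d and f = F, OF F dF C C'])
 show "!!z. z \<in> cycles C' d' n ==> G n z \<in> cycles C d n" by (rule cycles_map[where C = C' and d = d' and f = G, OF G dG C' C])
 show "!!z. z \<in> d (Suc n) ` carrier (C (Suc n)) ==> F n z \<in> d' (Suc n) ` carrier (C' (Suc n))" using dF lin_in[OF F] by auto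
 show "!!z. z \<in> d' (Suc n) ` carrier (C' (Suc n)) ==> G n z \<in> d (Suc n) ` carrier (C (Suc n))" using dG lin_in[OF G] by auto
qed (assumption | erule GF FG)+
qed

section \<open>Projective resolutions and their comparison\<close>

lemma rhomI:
"f : lin_hom k V W ==> (!!v r. v .: V ==> r .: R ==> f (ract V v r) = ract W (f v) r) ==>
 f : right_hom k R V W" by (simp add: right_hom_def)

lemma rhom_lin: "f : right_hom k R V W ==> f : lin_hom k V W" by (simp add: right_hom_def)

lemma rhom_ract:
"f : right_hom k R V W ==> v .: V ==> r .: R ==> f (ract V v r) = ract W (f v) r" by (simp add: right_hom_def)

lemma rhom_in: "f : right_hom k R V W ==> v .: V ==> f v .: W" using lin_in[OF rhom_lin] .

lemma rhom_id: "(%v. v) : right_hom k R V V" by (rule rhomI) simp_all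

lemma rhom_comp:
"f : right_hom k R U V ==> g : right_hom k R V W ==> (%u. g (f u)) : right_hom k R U W" by (rule rhomI[OF lin_comp[OF rhom_lin rhom_lin]])
 (simp_all add: rhom_ract rhom_in)

lemma ract_lin1: "right_module k R V ==> r .: R ==> (%v. ract V v r) : lin_hom k V V"
by (rule lin_homI) (auto simp: right_module.ract_closed right_module.ract_l_distr right_module.ract_smult_l)

lemma ract_lin2: "right_module k R V ==> v .: V ==> (%r. ract V v r) : lin_hom k R V"
by (rule lin_homI) (auto simp: right_module.ract_closed right_module.ract_r_distr right_module.ract_smult_r)

lemma assoc_algebra_module: "assoc_algebra k R ==> module k R" by (simp add: assoc_algebra_def)

lemma rmod_algebra: "right_module k R V ==> module k R" by (simp add: right_module_def assoc_algebra_def)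

lemma rmod_ring: "right_module k R V ==> ring R" by (simp add: right_module_def assoc_algebra_def)

lemma rhom_diff:
assumes f: "f : right_hom k R V W" and g: "g : right_hom k R V W" and W: "right_module k R W"
shows "(%v. f v -\<^sub>W g v) : right_hom k R V W"
proof (rule rhomI)
note Wm = rmod_module[OF W]
show "(%v. f v -\<^sub>W g v) : lin_hom k V W" by (intro lin_minus_map rhom_lin[OF f] rhom_lin[OF g] Wm)
fix v r assume "v .: V" "r .: R"
then show "f (ract V v r) -\<^sub>W g (ract V v r) = ract W (f v -\<^sub>W g v) r" using rhom_in[OF f] rhom_in[OF g]
 by (simp add: rhom_ract[OF f] rhom_ract[OF g] lin_diff[OF ract_lin1[OF W] Wm Wm])
qed

text \<open>Projective modules are handled through dual bases: elements \<open>e\<^sub>i\<close> and functionals \<open>\<phi>\<^sub>i\<close> with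
\<open>p = \<Sum> e\<^sub>i \<phi>\<^sub>i(p)\<close>. In contrast to the lifting property this speaks about one module only.\<close>

definition dual_basis ::
 "('k, 'e) ring_scheme => ('k, 'r, 'f) module_scheme => ('k, 'r, 'p, 'g) right_mod_scheme
 => 'i set => ('i => 'p) => ('i => 'p => 'r) => bool" where
"dual_basis k R P I e \<phi> \<longleftrightarrow> (\<forall>i\<in>I. e i .: P) &
 (\<forall>i\<in>I. \<phi> i : lin_hom k P R & (\<forall>p\<in>carrier P. \<forall>r\<in>carrier R. \<phi> i (ract P p r) = \<phi> i p **\<^sub>R r)) &
 (\<forall>p\<in>carrier P. \<exists>J. finite J & J \<subseteq> I & (\<forall>i\<in>I - J. \<phi> i p = 0\<^sub>R) &
  p = (\<Oplus>\<^bsub>P\<^esub>i\<in>J. ract P (e i) (\<phi> i p)))"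

lemma ract_finsum_cong:
assumes B: "right_module k R B" and J: "finite J" "J' \<subseteq> J"
 and b: "!!i. i \<in> J ==> b i .: B" and c: "!!i. i \<in> J ==> c i .: R"
 and z: "!!i. i \<in> J - J' ==> c i = 0\<^sub>R"
shows "(\<Oplus>\<^bsub>B\<^esub>i\<in>J'. ract B (b i) (c i)) = (\<Oplus>\<^bsub>B\<^esub>i\<in>J. ract B (b i) (c i))"
proof -
interpret B: module k B by (rule rmod_module[OF B])
show ?thesis
proof (rule B.add.finprod_mono_neutral_cong_left)
 show "!!i. i \<in> J - J' ==> ract B (b i) (c i) = 0\<^sub>B" using z b lin_zero[OF ract_lin2[OF B] rmod_algebra[OF B] rmod_module[OF B]] by simp
 show "(%i. ract B (b i) (c i)) \<in> J \<rightarrow> carrier B" using b c right_module.ract_closed[OF B] by auto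
qed (use J in auto)
qed

text \<open>To lift \<open>f\<close> along \<open>g\<close>, choose preimages \<open>b\<^sub>i\<close> of the \<open>f(e\<^sub>i)\<close> and send \<open>p\<close> to \<open>\<Sum> b\<^sub>i \<phi>\<^sub>i(p)\<close>.\<close>

lemma dual_basis_lifting:
assumes P: "right_module k R P" and B: "right_module k R B" and N: "right_module k R N"
 and db: "dual_basis k R P I e \<phi>"
 and g: "g : right_hom k R B N" and f: "f : right_hom k R P N"
 and im: "!!p. p .: P ==> f p \<in> g ` carrier B"
shows "\<exists>l\<in>right_hom k R P B. \<forall>p\<in>carrier P. g (l p) = f p"
proof -
note Pm = rmod_module[OF P] and Bm = rmod_module[OF B] and Nm = rmod_module[OF N]
 and Rm = rmod_algebra[OF P]
interpret P: module k P by (rule Pm)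
interpret B: module k B by (rule Bm)
interpret N: module k N by (rule Nm)
interpret R: ring R by (rule rmod_ring[OF P])
have eP: "!!i. i \<in> I ==> e i .: P" and \<phi>: "!!i. i \<in> I ==> \<phi> i : lin_hom k P R"
 and \<phi>r: "!!i p r. i \<in> I ==> p .: P ==> r .: R ==> \<phi> i (ract P p r) = \<phi> i p **\<^sub>R r"
 and supp: "!!p. p .: P ==> \<exists>J. finite J & J \<subseteq> I & (\<forall>i\<in>I - J. \<phi> i p = 0\<^sub>R) &
  p = (\<Oplus>\<^bsub>P\<^esub>i\<in>J. ract P (e i) (\<phi> i p))" using db unfolding dual_basis_def by auto
have "\<forall>i\<in>I. \<exists>b. b .: B & g b = f (e i)" using im[OF eP] by (fastforce simp: image_iff)
then obtain b where bB: "!!i. i \<in> I ==> b i .: B" and gb: "!!i. i \<in> I ==> g (b i) = f (e i)" by (auto simp: bchoice_iff)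
define S where "S p = {i \<in> I. \<phi> i p ~= 0\<^sub>R}" for p
have finS: "finite (S p)" if p: "p .: P" for p
proof -
 from supp[OF p] obtain J where "finite J" "\<forall>i\<in>I - J. \<phi> i p = 0\<^sub>R" by auto
 then show ?thesis by (intro finite_subset[of "S p" J]) (auto simp: S_def)
qed
define l where "l p = (\<Oplus>\<^bsub>B\<^esub>i\<in>S p. ract B (b i) (\<phi> i p))" for p
have \<phi>c: "!!i p. i \<in> I ==> p .: P ==> \<phi> i p .: R" using lin_in[OF \<phi>] .
have lJ: "l p = (\<Oplus>\<^bsub>B\<^esub>i\<in>J. ract B (b i) (\<phi> i p))"
 if "p .: P" "finite J" "S p \<subseteq> J" "J \<subseteq> I" for p J unfolding l_def
 by (rule ract_finsum_cong[OF B that(2,3)]) (use that bB \<phi>c in "auto simp: S_def")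
have bc: "(%i. ract B (b i) (\<phi> i p)) \<in> J \<rightarrow> carrier B" if "p .: P" "J \<subseteq> I" for p J
 using that bB \<phi>c right_module.ract_closed[OF B] by auto
have "l : right_hom k R P B"
proof (rule rhomI, rule lin_homI)
 fix p q assume p: "p .: P" and q: "q .: P"
 show "l p .: B" unfolding l_def using bc[OF p, of "S p"] by (simp add: S_def)
 define J where "J = S p \<union> S q"
 have J: "finite J" "S p \<subseteq> J" "S q \<subseteq> J" "J \<subseteq> I" "S (p +\<^sub>P q) \<subseteq> J"
 using finS p q by (auto simp: J_def S_def lin_add[OF \<phi>])
 have "l (p +\<^sub>P q) = (\<Oplus>\<^bsub>B\<^esub>i\<in>J. ract B (b i) (\<phi> i (p +\<^sub>P q)))" using p q J by (intro lJ) auto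
 also have "... = (\<Oplus>\<^bsub>B\<^esub>i\<in>J. ract B (b i) (\<phi> i p) +\<^sub>B ract B (b i) (\<phi> i q))"
 using p q J(4) bc[OF p J(4)] bc[OF q J(4)] bB \<phi>c
 by (intro B.finsum_cong') (auto simp: lin_add[OF \<phi>] right_module.ract_r_distr[OF B] subset_iff)
 also have "... = l p +\<^sub>B l q" using J p q by (simp add: B.finsum_addf[OF bc[OF p J(4)] bc[OF q J(4)]] lJ)
 finally show "l (p +\<^sub>P q) = l p +\<^sub>B l q" .
next
 fix a p assume a: "a .: k" and p: "p .: P"
 have J: "S (a \<odot>\<^sub>P p) \<subseteq> S p" "finite (S p)" "S p \<subseteq> I"
 using finS p a module.smult_r_null[OF Rm a] by (auto simp: S_def lin_smult[OF \<phi>])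
 have "l (a \<odot>\<^sub>P p) = (\<Oplus>\<^bsub>B\<^esub>i\<in>S p. ract B (b i) (\<phi> i (a \<odot>\<^sub>P p)))"
 using p a J by (intro lJ) auto
 also have "... = (\<Oplus>\<^bsub>B\<^esub>i\<in>S p. a \<odot>\<^sub>B ract B (b i) (\<phi> i p))" using p a J(3) bc[OF p J(3)] bB \<phi>c
 by (intro B.finsum_cong') (auto simp: lin_smult[OF \<phi>] right_module.ract_smult_r[OF B] subset_iff)
 also have "... = a \<odot>\<^sub>B l p" unfolding l_def using B.finsum_smult_ldistr[OF J(2) a bc[OF p J(3)]] by simp
 finally show "l (a \<odot>\<^sub>P p) = a \<odot>\<^sub>B l p" .
next
 fix p r assume r: "r .: R" and p: "p .: P"
 have pr: "ract P p r .: P" using right_module.ract_closed[OF P p r] .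
 have J: "S (ract P p r) \<subseteq> S p" "finite (S p)" "S p \<subseteq> I" using finS p r by (auto simp: S_def \<phi>r)
 have "l (ract P p r) = (\<Oplus>\<^bsub>B\<^esub>i\<in>S p. ract B (b i) (\<phi> i (ract P p r)))" using pr J by (intro lJ) auto
 also have "... = (\<Oplus>\<^bsub>B\<^esub>i\<in>S p. ract B (ract B (b i) (\<phi> i p)) r)"
 using p r J(3) bB \<phi>c right_module.ract_closed[OF B] by (intro B.finsum_cong') (auto simp: \<phi>r right_module.ract_assoc[OF B] subset_iff)
 also have "... = ract B (l p) r" unfolding l_def using lin_finsum[OF ract_lin1[OF B r] Bm Bm J(2) bc[OF p J(3)]] by simp
 finally show "l (ract P p r) = ract B (l p) r" .
qed
moreover have "g (l p) = f p" if p: "p .: P" for p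
proof -
 from supp[OF p] obtain J where J: "finite J" "J \<subseteq> I" "\<forall>i\<in>I - J. \<phi> i p = 0\<^sub>R"
 "p = (\<Oplus>\<^bsub>P\<^esub>i\<in>J. ract P (e i) (\<phi> i p))" by auto
 have ec: "(%i. ract P (e i) (\<phi> i p)) \<in> J \<rightarrow> carrier P" using J(2) eP \<phi>c p right_module.ract_closed[OF P] by auto
 have "l p = (\<Oplus>\<^bsub>B\<^esub>i\<in>J. ract B (b i) (\<phi> i p))" by (rule lJ[OF p J(1) _ J(2)]) (use J(3) in "auto simp: S_def")
 then have "g (l p) = g (\<Oplus>\<^bsub>B\<^esub>i\<in>J. ract B (b i) (\<phi> i p))" by simp
 also have "... = (\<Oplus>\<^bsub>N\<^esub>i\<in>J. g (ract B (b i) (\<phi> i p)))" using lin_finsum[OF rhom_lin[OF g] Bm Nm J(1) bc[OF p J(2)]] .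
 also have "... = (\<Oplus>\<^bsub>N\<^esub>i\<in>J. f (ract P (e i) (\<phi> i p)))"
 using J(2) eP \<phi>c p bB rhom_in[OF f] right_module.ract_closed[OF P] right_module.ract_closed[OF N]
 by (intro N.finsum_cong') (auto simp: rhom_ract[OF g] rhom_ract[OF f] gb subset_iff)
 also have "... = f p" using lin_finsum[OF rhom_lin[OF f] Pm Nm J(1) ec] J(4) by simp
 finally show ?thesis .
qed
ultimately show ?thesis by blast
qed

definition free_right ::
 "('k, 'r, 'f) module_scheme => 'x set => ('k, 'r, 'x => 'r) right_mod" where
"free_right R B = \<lparr>
 carrier = {c. finite {x. c x ~= 0\<^sub>R} & (\<forall>x\<in>B. c x .: R) & (\<forall>x. x \<notin> B --> c x = 0\<^sub>R)},
 monoid.mult = undefined, one = undefined,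
 ring.zero = (%x. 0\<^sub>R), ring.add = (%c d x. c x +\<^sub>R d x), smult = (%a c x. a \<odot>\<^sub>R c x),
 ract = (%c r x. c x **\<^sub>R r)\<rparr>"

lemma free_right_simps:
"carrier (free_right R B) = {c. finite {x. c x ~= 0\<^sub>R} & (\<forall>x\<in>B. c x .: R) & (\<forall>x. x \<notin> B --> c x = 0\<^sub>R)}"
"0\<^sub>(free_right R B) = (%x. 0\<^sub>R)"
"c +\<^sub>(free_right R B) d = (%x. c x +\<^sub>R d x)"
"a \<odot>\<^sub>(free_right R B) c = (%x. a \<odot>\<^sub>R c x)"
"ract (free_right R B) c r = (%x. c x **\<^sub>R r)" by (simp_all add: free_right_def)

lemma free_right_coeff:
assumes "ring R" and "c .: free_right R B"
shows "c x .: R"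
proof -
interpret ring R by fact
show ?thesis using assms(2) by (cases "x \<in> B") (auto simp: free_right_simps)
qed

lemma free_rmod:
fixes R :: "('k, 'r, 'f) module_scheme" and B :: "'x set"
assumes "assoc_algebra k R"
shows "right_module k R (free_right R B)"
proof -
interpret assoc_algebra k R by fact
have cc: "c x .: R" if "c .: free_right R B" for c :: "'x => 'r" and x using free_right_coeff[OF ALG.ring_axioms that] .
have cl: "(%x. f (c x) (d x)) .: free_right R B"
 if "c .: free_right R B" "d .: free_right R B" 
 "!!r s. r .: R ==> s .: R ==> f r s .: R" "f 0\<^sub>R 0\<^sub>R = 0\<^sub>R"
 for c d :: "'x => 'r" and f
proof -
 have "finite {x. f (c x) (d x) ~= 0\<^sub>R}" by (rule finite_subset[of _ "{x. c x ~= 0\<^sub>R} \<union> {x. d x ~= 0\<^sub>R}"])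
  (use that in "auto simp: free_right_simps")
 then show ?thesis using that by (auto simp: free_right_simps)
qed
have add: "(%x. c x +\<^sub>R d x) .: free_right R B"
 if "c .: free_right R B" "d .: free_right R B" for c d :: "'x => 'r" using cl[OF that, of "%r s. r +\<^sub>R s"] by simp
have smult: "(%x. a \<odot>\<^sub>R c x) .: free_right R B"
 if "c .: free_right R B" "a .: k" for a and c :: "'x => 'r" using cl[OF that(1) that(1), of "%r s. a \<odot>\<^sub>R r"] that by simp
have ract: "(%x. c x **\<^sub>R r) .: free_right R B"
 if "c .: free_right R B" "r .: R" for r and c :: "'x => 'r" using cl[OF that(1) that(1), of "%s t. s **\<^sub>R r"] that by simp
have m: "module k (free_right R B)"
proof (rule moduleI)
 show "abelian_group (free_right R B)"
 proof (rule abelian_groupI)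
 fix c assume c: "c .: free_right R B"
 show "\<exists>d\<in>carrier (free_right R B). d +\<^sub>(free_right R B) c = 0\<^sub>(free_right R B)"
 proof
  show "(%x. -\<^sub>R c x) .: free_right R B" using cl[OF c c, of "%r s. -\<^sub>R r"] by simp
  show "(%x. -\<^sub>R c x) +\<^sub>(free_right R B) c = 0\<^sub>(free_right R B)" using cc[OF c] by (auto simp: free_right_simps VEC.M.l_neg)
 qed
 qed (use add in \<open>simp_all add: free_right_simps(2-4) cc VEC.M.a_ac\<close>, simp add: free_right_simps)
qed (use smult add in "simp_all add: free_right_simps(2-4) cc VEC.smult_l_distr VEC.smult_r_distr VEC.smult_assoc1 module_cring[OF assoc_algebra_module[OF assms]]")
show ?thesis by (intro right_module.intro right_module_axioms.intro assms m)
 (simp_all add: free_right_simps(2-5) cc add smult ract ALG.l_distr ALG.r_distr ALG.m_assoc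
  smult_mult_left smult_mult_right)
qed

lemma projective_dual_basis:
fixes P :: "('k, 'r, 'p) right_mod"
assumes pr: "projective k R P"
shows "\<exists>\<phi>. dual_basis k R P (carrier P) (%p. p) \<phi>"
proof -
have P: "right_module k R P" using pr by (simp add: projective_def)
note Pm = rmod_module[OF P] and Rm = rmod_algebra[OF P]
have A: "assoc_algebra k R" using P by (simp add: right_module_def)
interpret P: module k P by (rule Pm)
interpret R: ring R by (rule rmod_ring[OF P])
let ?F = "free_right R (carrier P)"
have F: "right_module k R ?F" by (rule free_rmod[OF A])
note cc = free_right_coeff[OF R.ring_axioms]
define S :: "('p => 'r) => 'p set" where "S c = {p. c p ~= 0\<^sub>R}" for c
have S: "finite (S c)" "S c <: P" if "c .: ?F" for c using that by (auto simp: S_def free_right_simps)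
define g where "g c = (\<Oplus>\<^bsub>P\<^esub>p\<in>S c. ract P p (c p))" for c
have gJ: "g c = (\<Oplus>\<^bsub>P\<^esub>p\<in>J. ract P p (c p))"
 if "c .: ?F" "finite J" "S c \<subseteq> J" "J <: P" for c J
 unfolding g_def by (rule ract_finsum_cong[OF P that(2,3)]) (use that cc in "auto simp: S_def")
have rc: "(%p. ract P p (c p)) \<in> J \<rightarrow> carrier P" if "c .: ?F" "J <: P" for c J
 using that(2) cc[OF that(1)] right_module.ract_closed[OF P] by auto
have g: "g : right_hom k R ?F P"
proof (rule rhomI, rule lin_homI)
 fix c d assume c: "c .: ?F" and d: "d .: ?F"
 show "g c .: P" unfolding g_def using rc[OF c S(2)[OF c]] by simp
 define J where "J = S c \<union> S d"
 have J: "finite J" "S c \<subseteq> J" "S d \<subseteq> J" "J <: P" "S (c +\<^sub>?F d) \<subseteq> J"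
 using S[OF c] S[OF d] by (auto simp: J_def) (auto simp: S_def free_right_simps(3))
 have cd: "c +\<^sub>?F d .: ?F" using abelian_groupE(1)[OF module.axioms(2)[OF rmod_module[OF F]] c d] .
 have "g (c +\<^sub>?F d) = (\<Oplus>\<^bsub>P\<^esub>p\<in>J. ract P p ((c +\<^sub>?F d) p))" by (rule gJ[OF cd J(1,5,4)])
 also have "... = (\<Oplus>\<^bsub>P\<^esub>p\<in>J. ract P p (c p) +\<^sub>P ract P p (d p))"
 using J(4) rc[OF c J(4)] rc[OF d J(4)] cc[OF c] cc[OF d]
 by (intro P.finsum_cong') (auto simp: free_right_simps(3) right_module.ract_r_distr[OF P] subset_iff)
 also have "... = g c +\<^sub>P g d" using J by (simp add: P.finsum_addf[OF rc[OF c J(4)] rc[OF d J(4)]] gJ[OF c J(1,2,4)] gJ[OF d J(1,3,4)])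
 finally show "g (c +\<^sub>?F d) = g c +\<^sub>P g d" .
next
 fix a c assume a: "a .: k" and c: "c .: ?F"
 have ac: "a \<odot>\<^sub>?F c .: ?F" using module.smult_closed[OF rmod_module[OF F] a c] .
 have J: "S (a \<odot>\<^sub>?F c) \<subseteq> S c" using module.smult_r_null[OF Rm a] by (auto simp: S_def free_right_simps(4))
 have "g (a \<odot>\<^sub>?F c) = (\<Oplus>\<^bsub>P\<^esub>p\<in>S c. ract P p ((a \<odot>\<^sub>?F c) p))"
 by (rule gJ[OF ac S(1)[OF c] J S(2)[OF c]])
 also have "... = (\<Oplus>\<^bsub>P\<^esub>p\<in>S c. a \<odot>\<^sub>P ract P p (c p))" using S(2)[OF c] a rc[OF c S(2)[OF c]] cc[OF c]
 by (intro P.finsum_cong') (auto simp: free_right_simps(4) right_module.ract_smult_r[OF P] subset_iff)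
 also have "... = a \<odot>\<^sub>P g c" unfolding g_def using P.finsum_smult_ldistr[OF S(1)[OF c] a rc[OF c S(2)[OF c]]] by simp
 finally show "g (a \<odot>\<^sub>?F c) = a \<odot>\<^sub>P g c" .
next
 fix c r assume c: "c .: ?F" and r: "r .: R"
 have cr: "ract ?F c r .: ?F" using right_module.ract_closed[OF F c r] .
 have J: "S (ract ?F c r) \<subseteq> S c" using r by (auto simp: S_def free_right_simps(5))
 have "g (ract ?F c r) = (\<Oplus>\<^bsub>P\<^esub>p\<in>S c. ract P p (ract ?F c r p))" by (rule gJ[OF cr S(1)[OF c] J S(2)[OF c]])
 also have "... = (\<Oplus>\<^bsub>P\<^esub>p\<in>S c. ract P (ract P p (c p)) r)" using S(2)[OF c] r cc[OF c] right_module.ract_closed[OF P]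
 by (intro P.finsum_cong') (auto simp: free_right_simps(5) right_module.ract_assoc[OF P] subset_iff)
 also have "... = ract P (g c) r" unfolding g_def using lin_finsum[OF ract_lin1[OF P r] Pm Pm S(1)[OF c] rc[OF c S(2)[OF c]]] by simp
 finally show "g (ract ?F c r) = ract P (g c) r" .
qed
have "g ` carrier ?F = carrier P"
proof
 show "g ` carrier ?F <: P" using rhom_in[OF g] by auto
 show "carrier P \<subseteq> g ` carrier ?F"
 proof
 fix p assume p: "p .: P"
 define c where "c = (%q. if q = p then 1\<^sub>R else 0\<^sub>R)"
 have "finite {x. c x ~= 0\<^sub>R}" by (rule finite_subset[of _ "{p}"]) (auto simp: c_def)
 then have c: "c .: ?F" using p by (auto simp: free_right_simps c_def)
 have "g c = (\<Oplus>\<^bsub>P\<^esub>q\<in>{p}. ract P q (c q))" using p by (intro gJ[OF c]) (auto simp: S_def c_def)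
 also have "... = p" using p right_module.ract_one[OF P p] by (simp add: c_def)
 finally show "p \<in> g ` carrier ?F" using c by force
 qed
qed
with pr F P g rhom_id[of k R P] obtain l where
 l: "l : right_hom k R P ?F" and gl: "\<forall>p\<in>carrier P. g (l p) = p" unfolding projective_def by blast
have "dual_basis k R P (carrier P) (%p. p) (%q p. l p q)" unfolding dual_basis_def
proof (intro conjI ballI)
 fix q
 show "(%p. l p q) : lin_hom k P R" using cc[OF rhom_in[OF l]]
 by (intro lin_homI) (auto simp: lin_add[OF rhom_lin[OF l]] lin_smult[OF rhom_lin[OF l]] free_right_simps(3,4))
 fix p r assume "p .: P" "r .: R"
 then show "l (ract P p r) q = l p q **\<^sub>R r" by (simp add: rhom_ract[OF l] free_right_simps(5))
next
 fix p assume p: "p .: P"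
 then have lp: "l p .: ?F" using rhom_in[OF l] by simp
 show "\<exists>J. finite J & J <: P & (\<forall>i\<in>carrier P - J. l p i = 0\<^sub>R) & p = (\<Oplus>\<^bsub>P\<^esub>i\<in>J. ract P i (l p i))"
 using S[OF lp] gl p by (intro exI[of _ "S (l p)"]) (auto simp: S_def g_def)
qed simp
then show ?thesis by blast
qed

definition exact_resolution ::
 "('k, 'e) ring_scheme => ('k, 'r, 'f) module_scheme => ('k, 'r, 'a, 'g) right_mod_scheme
 => (nat => ('k, 'r, 'p) right_mod) => (nat => 'p => 'p) => ('p => 'a) => bool" where
"exact_resolution k R A P d aug \<longleftrightarrow> right_module k R A & (\<forall>n. right_module k R (P n)) &
 (\<forall>n. d (Suc n) : right_hom k R (P (Suc n)) (P n)) &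
 aug : right_hom k R (P 0) A & aug ` carrier (P 0) = carrier A &
 {p \<in> carrier (P 0). aug p = 0\<^sub>A} = d 1 ` carrier (P 1) &
 (\<forall>n. {p \<in> carrier (P (Suc n)). d (Suc n) p = 0\<^sub>(P n)} = d (Suc (Suc n)) ` carrier (P (Suc (Suc n))))"

lemma exact_resolutionD:
assumes "exact_resolution k R A P d aug"
shows "right_module k R A" "right_module k R (P n)" "d (Suc n) : right_hom k R (P (Suc n)) (P n)"
 "aug : right_hom k R (P 0) A" "aug ` carrier (P 0) = carrier A"
 "{p \<in> carrier (P 0). aug p = 0\<^sub>A} = d (Suc 0) ` carrier (P (Suc 0))"
 "{p \<in> carrier (P (Suc n)). d (Suc n) p = 0\<^sub>(P n)} = d (Suc (Suc n)) ` carrier (P (Suc (Suc n)))"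
 "p .: P (Suc 0) ==> aug (d (Suc 0) p) = 0\<^sub>A"
 "p .: P (Suc (Suc n)) ==> d (Suc n) (d (Suc (Suc n)) p) = 0\<^sub>(P n)"
proof -
show "right_module k R A" "right_module k R (P n)" "d (Suc n) : right_hom k R (P (Suc n)) (P n)"
 "aug : right_hom k R (P 0) A" "aug ` carrier (P 0) = carrier A"
 and a: "{p \<in> carrier (P 0). aug p = 0\<^sub>A} = d (Suc 0) ` carrier (P (Suc 0))"
 and b: "{p \<in> carrier (P (Suc n)). d (Suc n) p = 0\<^sub>(P n)} = d (Suc (Suc n)) ` carrier (P (Suc (Suc n)))"
 using assms by (simp_all add: exact_resolution_def)
show "p .: P (Suc 0) ==> aug (d (Suc 0) p) = 0\<^sub>A" using a by blast
show "p .: P (Suc (Suc n)) ==> d (Suc n) (d (Suc (Suc n)) p) = 0\<^sub>(P n)" using b by blast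
qed

lemma chain_map_exists:
assumes P: "exact_resolution k R A P d aug" and Q: "exact_resolution k R A Q e aug'"
 and db: "!!n. dual_basis k R (P n) (I n) (x n) (\<phi> n)"
shows "\<exists>F. (\<forall>n. F n : right_hom k R (P n) (Q n)) & (\<forall>p\<in>carrier (P 0). aug' (F 0 p) = aug p) &
 (\<forall>n. \<forall>p\<in>carrier (P (Suc n)). F n (d (Suc n) p) = e (Suc n) (F (Suc n) p))"
proof -
note PD = exact_resolutionD[OF P] and QD = exact_resolutionD[OF Q]
note Pd = rhom_in[OF PD(3)]
let ?good = "%n f. f : right_hom k R (P n) (Q n) & (n = 0 --> (\<forall>p\<in>carrier (P 0). aug' (f p) = aug p)) &
 (\<forall>p\<in>carrier (P (Suc n)). f (d (Suc n) p) \<in> e (Suc n) ` carrier (Q (Suc n)))"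
have "\<exists>F. \<forall>n. ?good n (F n) & (\<forall>p\<in>carrier (P (Suc n)). F n (d (Suc n) p) = e (Suc n) (F (Suc n) p))"
proof (rule dependent_nat_choice)
 have "\<exists>f\<in>right_hom k R (P 0) (Q 0). \<forall>p\<in>carrier (P 0). aug' (f p) = aug p" using rhom_in[OF PD(4)] QD(5)
 by (intro dual_basis_lifting[OF PD(2) QD(2) PD(1) db QD(4) PD(4)]) auto
 then obtain f where f: "f : right_hom k R (P 0) (Q 0)" and fa: "\<forall>p\<in>carrier (P 0). aug' (f p) = aug p" by blast
 have "f (d (Suc 0) p) \<in> e (Suc 0) ` carrier (Q (Suc 0))" if p: "p .: P (Suc 0)" for p
 using fa Pd[OF p] rhom_in[OF f Pd[OF p]] PD(8)[OF p] QD(6) by auto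
 then show "\<exists>f. ?good 0 f" using f fa by blast
next
 fix f n assume good: "?good n f"
 then have f: "f : right_hom k R (P n) (Q n)" by blast
 have fd: "(%p. f (d (Suc n) p)) : right_hom k R (P (Suc n)) (Q n)" by (rule rhom_comp[OF PD(3) f])
 have "\<exists>f'\<in>right_hom k R (P (Suc n)) (Q (Suc n)). \<forall>p\<in>carrier (P (Suc n)). e (Suc n) (f' p) = f (d (Suc n) p)"
 using good by (intro dual_basis_lifting[OF PD(2) QD(2) QD(2) db QD(3) fd]) auto
 then obtain f' where f': "f' : right_hom k R (P (Suc n)) (Q (Suc n))"
 and ef: "\<forall>p\<in>carrier (P (Suc n)). e (Suc n) (f' p) = f (d (Suc n) p)" by blast
 have "f' (d (Suc (Suc n)) p) \<in> e (Suc (Suc n)) ` carrier (Q (Suc (Suc n)))"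
 if p: "p .: P (Suc (Suc n))" for p
 proof -
 have "e (Suc n) (f' (d (Suc (Suc n)) p)) = 0\<^sub>(Q n)"
  using ef Pd[OF p] PD(9)[OF p] lin_zero[OF rhom_lin[OF f] rmod_module[OF PD(2)] rmod_module[OF QD(2)]] by simp
 then show ?thesis using rhom_in[OF f' Pd[OF p]] QD(7)[of n] by auto
 qed
 then show "\<exists>f'. ?good (Suc n) f' & (\<forall>p\<in>carrier (P (Suc n)). f (d (Suc n) p) = e (Suc n) (f' p))"
 using f' ef by (intro exI[of _ f']) auto
qed
then show ?thesis by blast
qed

lemma null_homotopy_exists:
assumes P: "exact_resolution k R A P d aug" and Q: "exact_resolution k R A' Q e aug'"
 and db: "!!n. dual_basis k R (P n) (I n) (x n) (\<phi> n)"
 and F: "!!n. F n : right_hom k R (P n) (Q n)" and Fa: "!!p. p .: P 0 ==> aug' (F 0 p) = 0\<^sub>A'"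
 and dF: "!!n p. p .: P (Suc n) ==> F n (d (Suc n) p) = e (Suc n) (F (Suc n) p)"
shows "\<exists>s. (\<forall>n. s n : right_hom k R (P n) (Q (Suc n))) & (\<forall>p\<in>carrier (P 0). e (Suc 0) (s 0 p) = F 0 p) &
 (\<forall>n. \<forall>p\<in>carrier (P (Suc n)). e (Suc (Suc n)) (s (Suc n) p) = F (Suc n) p -\<^sub>(Q (Suc n)) s n (d (Suc n) p))"
proof -
note PD = exact_resolutionD[OF P] and QD = exact_resolutionD[OF Q]
note Pd = rhom_in[OF PD(3)] and Fc = rhom_in[OF F]
note Pm = rmod_module[OF PD(2)] and Qm = rmod_module[OF QD(2)]
have ab: "abelian_group (Q n)" for n using module.axioms(2)[OF Qm] .
let ?good = "%n s. s : right_hom k R (P n) (Q (Suc n)) & (n = 0 --> (\<forall>p\<in>carrier (P 0). e (Suc 0) (s p) = F 0 p)) &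
 (\<forall>p\<in>carrier (P (Suc n)). e (Suc n) (s (d (Suc n) p)) = F n (d (Suc n) p))"
have "\<exists>s. \<forall>n. ?good n (s n) &
 (\<forall>p\<in>carrier (P (Suc n)). e (Suc (Suc n)) (s (Suc n) p) = F (Suc n) p -\<^sub>(Q (Suc n)) s n (d (Suc n) p))"
proof (rule dependent_nat_choice)
 have "\<exists>s\<in>right_hom k R (P 0) (Q (Suc 0)). \<forall>p\<in>carrier (P 0). e (Suc 0) (s p) = F 0 p"
 using Fa Fc QD(6) by (intro dual_basis_lifting[OF PD(2) QD(2) QD(2) db QD(3) F]) auto
 then show "\<exists>s. ?good 0 s" using Pd by fastforce
next
 fix s n assume good: "?good n s"
 then have s: "s : right_hom k R (P n) (Q (Suc n))" by blast
 have f: "(%p. F (Suc n) p -\<^sub>(Q (Suc n)) s (d (Suc n) p)) : right_hom k R (P (Suc n)) (Q (Suc n))"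
 by (intro rhom_diff F rhom_comp[OF PD(3) s] QD(2))
 have "e (Suc n) (F (Suc n) p -\<^sub>(Q (Suc n)) s (d (Suc n) p)) = 0\<^sub>(Q n)" if p: "p .: P (Suc n)" for p
 using good p Fc[OF p] rhom_in[OF s Pd[OF p]] Fc[OF Pd[OF p]]
 by (simp add: lin_diff[OF rhom_lin[OF QD(3)] Qm Qm] dF[OF p, symmetric] abelian_group.diff_eq_zero_iff[OF ab])
 then have "\<exists>s'\<in>right_hom k R (P (Suc n)) (Q (Suc (Suc n))).
  \<forall>p\<in>carrier (P (Suc n)). e (Suc (Suc n)) (s' p) = F (Suc n) p -\<^sub>(Q (Suc n)) s (d (Suc n) p)" using rhom_in[OF f] QD(7)[of n]
 by (intro dual_basis_lifting[OF PD(2) QD(2) QD(2) db QD(3) f]) blast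
 then obtain s' where s': "s' : right_hom k R (P (Suc n)) (Q (Suc (Suc n)))"
 and es: "\<forall>p\<in>carrier (P (Suc n)). e (Suc (Suc n)) (s' p) = F (Suc n) p -\<^sub>(Q (Suc n)) s (d (Suc n) p)" by blast
 have "e (Suc (Suc n)) (s' (d (Suc (Suc n)) p)) = F (Suc n) (d (Suc (Suc n)) p)" if p: "p .: P (Suc (Suc n))" for p
 using es Pd[OF p] PD(9)[OF p] lin_zero[OF rhom_lin[OF s] Pm Qm] Fc[OF Pd[OF p]] by (simp add: abelian_group.diff_zero[OF ab])
 then show "\<exists>s'. ?good (Suc n) s' & (\<forall>p\<in>carrier (P (Suc n)).
  e (Suc (Suc n)) (s' p) = F (Suc n) p -\<^sub>(Q (Suc n)) s (d (Suc n) p))" using s' es by (intro exI[of _ s']) auto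
qed
then show ?thesis by blast
qed

definition tensor_map ::
 "('k, 'e) ring_scheme => ('k, 'r, 'f) module_scheme => ('k, 'r, 'w, 'h) right_mod_scheme
 => ('k, 'r, 'b, 'i) left_mod_scheme => ('v => 'w) => ('v \<times> 'b => 'k) set => ('w \<times> 'b => 'k) set" where
"tensor_map k R W B f = pres_lift k (tensor_over k R W B) (%(p, b). tensor_over_pure k R W B (f p) b)"

lemma tensor_map:
assumes V: "right_module k R V" and W: "right_module k R W" and B: "left_module k R B"
 and f: "f : right_hom k R V W"
shows "tensor_map k R W B f : lin_hom k (tensor_over k R V B) (tensor_over k R W B)"
 and "v .: V ==> b .: B ==>
 tensor_map k R W B f (tensor_over_pure k R V B v b) = tensor_over_pure k R W B (f v) b"
proof -
let ?f = "%(p, b). tensor_over_pure k R W B (f p) b"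
note bl = tensor_over_pure_bilin[OF W B]
have 1: "bilin k V B (tensor_over k R W B) (%p b. ?f (p, b))"
proof (rule bilinI)
 show "(%b. ?f (u, b)) : lin_hom k B (tensor_over k R W B)" if "u .: V" for u using bilin1[OF bl rhom_in[OF f that]] by simp
 show "(%u. ?f (u, b)) : lin_hom k V (tensor_over k R W B)" if "b .: B" for b using bilin_comp2[OF bl rhom_lin[OF f] that] by simp
qed
have 2: "?f (ract V v r, b) = ?f (v, lact B r b)" if "v .: V" "r .: R" "b .: B" for v r b
 using that rhom_in[OF f] by (simp add: rhom_ract[OF f] tensor_over_pure_balanced[OF W B])
note l = tensor_over_lift[OF V B tensor_over_module[OF W B] 1 2]
show "tensor_map k R W B f : lin_hom k (tensor_over k R V B) (tensor_over k R W B)" unfolding tensor_map_def by (rule l(1))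
show "v .: V ==> b .: B ==>
 tensor_map k R W B f (tensor_over_pure k R V B v b) = tensor_over_pure k R W B (f v) b" unfolding tensor_map_def using l(2)[of v b] by simp
qed

lemma tensor_map_comp:
assumes U: "right_module k R U" and V: "right_module k R V" and W: "right_module k R W" and B: "left_module k R B"
 and f: "f : right_hom k R U V" and g: "g : right_hom k R V W" and h: "h : right_hom k R U W"
 and eq: "!!u. u .: U ==> g (f u) = h u"
 and t: "t .: tensor_over k R U B"
shows "tensor_map k R W B g (tensor_map k R V B f t) = tensor_map k R W B h t"
by (rule tensor_over_ext[OF U B tensor_over_module[OF W B] lin_comp[OF tensor_map(1)[OF U V B f] tensor_map(1)[OF V W B g]]
 tensor_map(1)[OF U W B h] _ t]) (simp add: tensor_map(2)[OF U V B f] tensor_map(2)[OF V W B g] tensor_map(2)[OF U W B h] rhom_in[OF f] eq)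

lemma rhom_zero_map: 
assumes W: "right_module k R W"
shows "(%v. 0\<^sub>W) : right_hom k R V W" using lin_zero[OF ract_lin1[OF W] rmod_module[OF W] rmod_module[OF W]]
by (intro rhomI lin_zero_map rmod_module[OF W]) simp

lemma tensor_map_zero:
assumes V: "right_module k R V" and W: "right_module k R W" and B: "left_module k R B"
 and t: "t .: tensor_over k R V B"
shows "tensor_map k R W B (%v. 0\<^sub>W) t = 0\<^sub>(tensor_over k R W B)"
proof (rule tensor_over_ext[OF V B tensor_over_module[OF W B] tensor_map(1)[OF V W B rhom_zero_map[OF W]]
 lin_zero_map[OF tensor_over_module[OF W B]] _ t])
fix v b assume "v .: V" "b .: B"
then show "tensor_map k R W B (%v. 0\<^sub>W) (tensor_over_pure k R V B v b) = 0\<^sub>(tensor_over k R W B)"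
 using lin_zero[OF bilin2[OF tensor_over_pure_bilin[OF W B]] rmod_module[OF W] tensor_over_module[OF W B]]
 by (simp add: tensor_map(2)[OF V W B rhom_zero_map[OF W]])
qed

text \<open>Two projective resolutions are homotopy equivalent, and the tensor product preserves homotopies.\<close>

lemma tensor_homotopy:
assumes P: "exact_resolution k R A P d aug" and B: "left_module k R B"
 and db: "!!n. dual_basis k R (P n) (I n) (x n) (\<phi> n)"
 and F: "!!n. F n : right_hom k R (P n) (P n)" and Fa: "!!p. p .: P 0 ==> aug (F 0 p) = aug p"
 and dF: "!!n p. p .: P (Suc n) ==> F n (d (Suc n) p) = d (Suc n) (F (Suc n) p)"
 and z: "z \<in> cycles (%n. tensor_over k R (P n) B) (%n. tensor_map k R (P (n - 1)) B (d n)) n"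
shows "tensor_map k R (P n) B (F n) z -\<^sub>(tensor_over k R (P n) B) z
 \<in> tensor_map k R (P n) B (d (Suc n)) ` carrier (tensor_over k R (P (Suc n)) B)"
proof -
note PD = exact_resolutionD[OF P]
note Pm = rmod_module[OF PD(2)]
have ab: "abelian_group (P n)" for n using module.axioms(2)[OF Pm] .
note tm = tensor_map[OF PD(2) PD(2) B]
let ?T = "%n. tensor_over k R (P n) B"
have T: "module k (?T n)" for n by (rule tensor_over_module[OF PD(2) B])
have Tab: "abelian_group (?T n)" for n using module.axioms(2)[OF T] .
note bl = tensor_over_pure_bilin[OF PD(2) B]
define E where "E n p = F n p -\<^sub>(P n) p" for n p
have E: "E n : right_hom k R (P n) (P n)" for n unfolding E_def by (intro rhom_diff F rhom_id PD(2))
note Pd = rhom_in[OF PD(3)]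
have "\<exists>s. (\<forall>n. s n : right_hom k R (P n) (P (Suc n))) & (\<forall>p\<in>carrier (P 0). d (Suc 0) (s 0 p) = E 0 p) &
 (\<forall>n. \<forall>p\<in>carrier (P (Suc n)). d (Suc (Suc n)) (s (Suc n) p) = E (Suc n) p -\<^sub>(P (Suc n)) s n (d (Suc n) p))"
proof (rule null_homotopy_exists[OF P P db E])
 fix p assume p: "p .: P 0"
 show "aug (E 0 p) = 0\<^sub>A" using p Fa[OF p] rhom_in[OF F p] rhom_in[OF PD(4) p]
 by (simp add: E_def lin_diff[OF rhom_lin[OF PD(4)] Pm rmod_module[OF PD(1)]]
  abelian_group.diff_eq_zero_iff[OF module.axioms(2)[OF rmod_module[OF PD(1)]]])
next
 fix n p assume p: "p .: P (Suc n)"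
 then show "E n (d (Suc n) p) = d (Suc n) (E (Suc n) p)" using rhom_in[OF F] by (simp add: E_def dF lin_diff[OF rhom_lin[OF PD(3)] Pm Pm])
qed
then obtain s where s: "!!n. s n : right_hom k R (P n) (P (Suc n))"
 and s0: "!!p. p .: P 0 ==> d (Suc 0) (s 0 p) = E 0 p"
 and sS: "!!n p. p .: P (Suc n) ==> d (Suc (Suc n)) (s (Suc n) p) = E (Suc n) p -\<^sub>(P (Suc n)) s n (d (Suc n) p)" by blast
have zc: "z .: ?T n" using z by (simp add: cycles_def)
have diff: "tensor_map k R (P n) B (F n) z -\<^sub>(?T n) z = tensor_map k R (P n) B (E n) z"
proof (rule tensor_over_ext[OF PD(2) B T lin_minus_map[OF tm(1)[OF F] lin_id T] tm(1)[OF E] _ zc])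
 fix v w assume vw: "v .: P n" "w .: B"
 then show "tensor_map k R (P n) B (F n) (tensor_over_pure k R (P n) B v w) -\<^sub>(?T n) tensor_over_pure k R (P n) B v w =
 tensor_map k R (P n) B (E n) (tensor_over_pure k R (P n) B v w)"
 using rhom_in[OF F] by (simp add: tm(2)[OF F] tm(2)[OF E] E_def lin_diff[OF bilin2[OF bl] Pm T])
qed
have "tensor_map k R (P n) B (E n) z = tensor_map k R (P n) B (d (Suc n)) (tensor_map k R (P (Suc n)) B (s n) z)"
proof (cases n)
 case 0
 show ?thesis unfolding 0 by (rule tensor_map_comp[OF PD(2) PD(2) PD(2) B s PD(3) E, symmetric]) (use s0 zc 0 in auto)
next
 case (Suc m)
 have "tensor_map k R (P n) B (d (Suc n)) (tensor_map k R (P (Suc n)) B (s n) z) =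
 tensor_map k R (P n) B (E n) z -\<^sub>(?T n) tensor_map k R (P n) B (s m) (tensor_map k R (P m) B (d n) z)" unfolding Suc
 proof (rule tensor_over_ext[OF PD(2) B T lin_comp[OF tm(1)[OF s] tm(1)[OF PD(3)]]
  lin_minus_map[OF tm(1)[OF E] lin_comp[OF tm(1)[OF PD(3)] tm(1)[OF s]] T] _ zc[unfolded Suc]])
 fix v w assume v: "v .: P (Suc m)" and w: "w .: B"
 show "tensor_map k R (P (Suc m)) B (d (Suc (Suc m))) (tensor_map k R (P (Suc (Suc m))) B (s (Suc m)) (tensor_over_pure k R (P (Suc m)) B v w)) =
  tensor_map k R (P (Suc m)) B (E (Suc m)) (tensor_over_pure k R (P (Suc m)) B v w) -\<^sub>(?T (Suc m))
  tensor_map k R (P (Suc m)) B (s m) (tensor_map k R (P m) B (d (Suc m)) (tensor_over_pure k R (P (Suc m)) B v w))"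
  using rhom_in[OF s] rhom_in[OF E] Pd v w by (simp add: tm(2)[OF s] tm(2)[OF E] tm(2)[OF PD(3)] sS lin_diff[OF bilin2[OF bl] Pm T])
 qed
 moreover have "tensor_map k R (P m) B (d n) z = 0\<^sub>(?T m)" using z by (simp add: cycles_def Suc)
 ultimately show ?thesis using lin_zero[OF tm(1)[OF s] T T] lin_in[OF tm(1)[OF E] zc] Suc by (simp add: abelian_group.diff_zero[OF Tab])
qed
then show ?thesis using diff lin_in[OF tm(1)[OF s] zc] by auto
qed

theorem comparison:
assumes P: "exact_resolution k R A P d aug" and Q: "exact_resolution k R A Q e aug'"
 and B: "left_module k R B"
 and dbP: "!!n. dual_basis k R (P n) (I n) (x n) (\<phi> n)" and dbQ: "!!n. dual_basis k R (Q n) (J n) (y n) (\<psi> n)"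
shows "lin_iso k (homology (%n. tensor_over k R (P n) B) (%n. tensor_map k R (P (n - 1)) B (d n)) n)
 (homology (%n. tensor_over k R (Q n) B) (%n. tensor_map k R (Q (n - 1)) B (e n)) n)"
proof -
note PD = exact_resolutionD[OF P] and QD = exact_resolutionD[OF Q]
obtain F where F: "!!n. F n : right_hom k R (P n) (Q n)" and Fa: "!!p. p .: P 0 ==> aug' (F 0 p) = aug p"
 and dF: "!!n p. p .: P (Suc n) ==> F n (d (Suc n) p) = e (Suc n) (F (Suc n) p)" using chain_map_exists[OF P Q dbP] by blast
obtain G where G: "!!n. G n : right_hom k R (Q n) (P n)" and Ga: "!!p. p .: Q 0 ==> aug (G 0 p) = aug' p"
 and dG: "!!n p. p .: Q (Suc n) ==> G n (e (Suc n) p) = d (Suc n) (G (Suc n) p)" using chain_map_exists[OF Q P dbQ] by blast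
note Fc = rhom_in[OF F] and Gc = rhom_in[OF G]
note GF = rhom_comp[OF F G] and FG = rhom_comp[OF G F]
note zero = tensor_map_comp[OF _ _ _ B _ _ rhom_zero_map]
note TP = tensor_over_module[OF PD(2) B] and TQ = tensor_over_module[OF QD(2) B]
show ?thesis
proof (rule homology_iso[where F = "%n. tensor_map k R (Q n) B (F n)" and G = "%n. tensor_map k R (P n) B (G n)"])
 fix n
 show "module k (tensor_over k R (P n) B)" "module k (tensor_over k R (Q n) B)"
 by (rule tensor_over_module[OF PD(2) B], rule tensor_over_module[OF QD(2) B])
 show "tensor_map k R (P (Suc n - 1)) B (d (Suc n)) : lin_hom k (tensor_over k R (P (Suc n)) B) (tensor_over k R (P n) B)"
 using tensor_map(1)[OF PD(2) PD(2) B PD(3)] by simp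
 show "tensor_map k R (Q (Suc n - 1)) B (e (Suc n)) : lin_hom k (tensor_over k R (Q (Suc n)) B) (tensor_over k R (Q n) B)"
 using tensor_map(1)[OF QD(2) QD(2) B QD(3)] by simp
 show "tensor_map k R (Q n) B (F n) : lin_hom k (tensor_over k R (P n) B) (tensor_over k R (Q n) B)" by (rule tensor_map(1)[OF PD(2) QD(2) B F])
 show "tensor_map k R (P n) B (G n) : lin_hom k (tensor_over k R (Q n) B) (tensor_over k R (P n) B)" by (rule tensor_map(1)[OF QD(2) PD(2) B G])
 show "tensor_map k R (P (Suc n - 1)) B (d (Suc n)) (tensor_map k R (P (Suc (Suc n) - 1)) B (d (Suc (Suc n))) z) = 0\<^sub>(tensor_over k R (P n) B)"
 if "z .: tensor_over k R (P (Suc (Suc n))) B" for z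
 using that zero[OF PD(2) PD(2) PD(2) PD(3) PD(3) PD(2) PD(9)] tensor_map_zero[OF PD(2) PD(2) B] by simp
 show "tensor_map k R (Q (Suc n - 1)) B (e (Suc n)) (tensor_map k R (Q (Suc (Suc n) - 1)) B (e (Suc (Suc n))) z) = 0\<^sub>(tensor_over k R (Q n) B)"
 if "z .: tensor_over k R (Q (Suc (Suc n))) B" for z
 using that zero[OF QD(2) QD(2) QD(2) QD(3) QD(3) QD(2) QD(9)] tensor_map_zero[OF QD(2) QD(2) B] by simp
 show "tensor_map k R (Q n) B (F n) (tensor_map k R (P (Suc n - 1)) B (d (Suc n)) z) =
 tensor_map k R (Q (Suc n - 1)) B (e (Suc n)) (tensor_map k R (Q (Suc n)) B (F (Suc n)) z)"
 if z: "z .: tensor_over k R (P (Suc n)) B" for z using tensor_map_comp[OF PD(2) PD(2) QD(2) B PD(3) F rhom_comp[OF F QD(3)] dF z]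
  tensor_map_comp[OF PD(2) QD(2) QD(2) B F QD(3) rhom_comp[OF F QD(3)] refl z] by simp
 show "tensor_map k R (P n) B (G n) (tensor_map k R (Q (Suc n - 1)) B (e (Suc n)) z) =
 tensor_map k R (P (Suc n - 1)) B (d (Suc n)) (tensor_map k R (P (Suc n)) B (G (Suc n)) z)"
 if z: "z .: tensor_over k R (Q (Suc n)) B" for z using tensor_map_comp[OF QD(2) QD(2) PD(2) B QD(3) G rhom_comp[OF G PD(3)] dG z]
  tensor_map_comp[OF QD(2) PD(2) PD(2) B G PD(3) rhom_comp[OF G PD(3)] refl z] by simp
next
 fix n z assume z: "z \<in> cycles (%n. tensor_over k R (P n) B) (%n. tensor_map k R (P (n - 1)) B (d n)) n"
 have "tensor_map k R (P n) B (%p. G n (F n p)) z -\<^sub>(tensor_over k R (P n) B) z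
 \<in> tensor_map k R (P n) B (d (Suc n)) ` carrier (tensor_over k R (P (Suc n)) B)" using rhom_in[OF PD(3)] Fc
 by (intro tensor_homotopy[OF P B dbP GF _ _ z]) (simp_all add: Fa Ga dF dG)
 then show "tensor_map k R (P n) B (G n) (tensor_map k R (Q n) B (F n) z) -\<^sub>(tensor_over k R (P n) B) z
 \<in> tensor_map k R (P (Suc n - 1)) B (d (Suc n)) ` carrier (tensor_over k R (P (Suc n)) B)"
 using z tensor_map_comp[OF PD(2) QD(2) PD(2) B F G GF refl] by (simp add: cycles_def)
next
 fix n z assume z: "z \<in> cycles (%n. tensor_over k R (Q n) B) (%n. tensor_map k R (Q (n - 1)) B (e n)) n"
 have "tensor_map k R (Q n) B (%p. F n (G n p)) z -\<^sub>(tensor_over k R (Q n) B) z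
 \<in> tensor_map k R (Q n) B (e (Suc n)) ` carrier (tensor_over k R (Q (Suc n)) B)" using rhom_in[OF QD(3)] Gc
 by (intro tensor_homotopy[OF Q B dbQ FG _ _ z]) (simp_all add: Fa Ga dF dG)
 then show "tensor_map k R (Q n) B (F n) (tensor_map k R (P n) B (G n) z) -\<^sub>(tensor_over k R (Q n) B) z
 \<in> tensor_map k R (Q (Suc n - 1)) B (e (Suc n)) ` carrier (tensor_over k R (Q (Suc n)) B)"
 using z tensor_map_comp[OF QD(2) PD(2) QD(2) B G F FG refl] by (simp add: cycles_def)
qed
qed

section \<open>Appending and prepending tensor factors\<close>

definition tsnoc ::
 "('k, 'e) ring_scheme => ('k, 'v, 'f) module_scheme => nat => ('v list => 'k) set => 'v => ('v list => 'k) set" where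
"tsnoc k V n t g = pres_lift k (tpow k V (Suc n)) (%vs. tpow_pure k V (vs @ [g])) t"

definition tcons ::
 "('k, 'e) ring_scheme => ('k, 'v, 'f) module_scheme => nat => 'v => ('v list => 'k) set => ('v list => 'k) set" where
"tcons k V n g t = pres_lift k (tpow k V (Suc n)) (%vs. tpow_pure k V (g # vs)) t"

lemma multilin_append1:
assumes f: "multilin k V m W f" and ws: "set ws <: V" and m: "m = n + length ws"
shows "multilin k V n W (%vs. f (vs @ ws))"
proof (rule multilinI)
show "length vs = n ==> set vs <: V ==> f (vs @ ws) .: W" for vs using ws m by (intro multilin_in[OF f]) (auto simp: tpow_basis_def)
fix xs ys assume "length xs + Suc (length ys) = n" "set xs <: V" "set ys <: V"
then show "(%v. f ((xs @ v # ys) @ ws)) : lin_hom k V W" using multilin_slot[OF f, of xs "ys @ ws"] ws m by simp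
qed

lemma multilin_append2:
assumes f: "multilin k V m W f" and ws: "set ws <: V" and m: "m = length ws + n"
shows "multilin k V n W (%vs. f (ws @ vs))"
proof (rule multilinI)
show "length vs = n ==> set vs <: V ==> f (ws @ vs) .: W" for vs using ws m by (intro multilin_in[OF f]) (auto simp: tpow_basis_def)
fix xs ys assume "length xs + Suc (length ys) = n" "set xs <: V" "set ys <: V"
then show "(%v. f (ws @ (xs @ v # ys))) : lin_hom k V W" using multilin_slot[OF f, of "ws @ xs" ys] ws m by simp
qed

lemma multilin_snoc:
assumes f: "multilin k V (Suc n) W f" and g: "g .: V"
shows "multilin k V n W (%vs. f (vs @ [g]))" and "multilin k V n W (%vs. f (g # vs))"
using multilin_append1[OF f, of "[g]" n] multilin_append2[OF f, of "[g]" n] g by simp_all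

lemma multilin_at:
assumes i: "i < n"
 and mid: "!!ps qs. length ps = i ==> set ps <: V ==> length qs = n - Suc i ==> set qs <: V ==> (%v. G ps v qs) : lin_hom k V W"
 and left: "!!v qs. v .: V ==> length qs = n - Suc i ==> set qs <: V ==>
 multilin k V i W (%ps. G ps v qs)"
 and right: "!!ps v. length ps = i ==> set ps <: V ==> v .: V ==>
 multilin k V (n - Suc i) W (%qs. G ps v qs)"
shows "multilin k V n W (%vs. G (take i vs) (vs ! i) (drop (Suc i) vs))"
proof (rule multilinI)
fix vs assume vs: "length vs = n" "set vs <: V"
then have "vs ! i .: V" using i by (auto simp: subset_iff)
moreover have "set (take i vs) <: V" "set (drop (Suc i) vs) <: V" using vs set_take_subset[of i vs] set_drop_subset[of "Suc i" vs] by blast+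
ultimately show "G (take i vs) (vs ! i) (drop (Suc i) vs) .: W" using vs i by (intro lin_in[OF mid]) auto
next
fix xs ys assume xy: "length xs + Suc (length ys) = n" "set xs <: V" "set ys <: V"
consider "i < length xs" | "i = length xs" | "length xs < i" by linarith
then show "(%v. G (take i (xs @ v # ys)) ((xs @ v # ys) ! i) (drop (Suc i) (xs @ v # ys))) : lin_hom k V W"
proof cases
 case 1
 have "set (take i xs) <: V" "set (drop (Suc i) xs) <: V" using xy set_take_subset[of i xs] set_drop_subset[of "Suc i" xs] by blast+
 moreover have "xs ! i .: V" using 1 xy by (auto simp: subset_iff)
 ultimately show ?thesis using multilin_slot[OF right[of "take i xs" "xs ! i"], of "drop (Suc i) xs" ys] 1 xy by (simp add: nth_append)
next
 case 2
 then show ?thesis using mid[of xs ys] xy by simp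
next
 case 3
 define j where "j = i - Suc (length xs)"
 have j: "i = Suc (length xs + j)" "j < length ys" using 3 i xy by (simp_all add: j_def)
 have "set (take j ys) <: V" "set (drop (Suc j) ys) <: V" using xy set_take_subset[of j ys] set_drop_subset[of "Suc j" ys] by blast+
 moreover have "ys ! j .: V" using j xy by (auto simp: subset_iff)
 ultimately show ?thesis using multilin_slot[OF left[of "ys ! j" "drop (Suc j) ys"], of xs "take j ys"] j xy by (simp add: nth_append)
qed
qed

lemma tsnoc_pure:
assumes V: "module k V" and "length vs = n" "set vs <: V" "g .: V"
shows "tsnoc k V n (tpow_pure k V vs) g = tpow_pure k V (vs @ [g])" unfolding tsnoc_def
by (rule tpow_lift(2)[OF V tpow_module[OF V] multilin_snoc(1)[OF tpow_pure_multilin[OF V]]]) (use assms in auto)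

lemma tcons_pure:
assumes V: "module k V" and "length vs = n" "set vs <: V" "g .: V"
shows "tcons k V n g (tpow_pure k V vs) = tpow_pure k V (g # vs)" unfolding tcons_def
by (rule tpow_lift(2)[OF V tpow_module[OF V] multilin_snoc(2)[OF tpow_pure_multilin[OF V]]]) (use assms in auto)

lemma tsnoc_bilin:
assumes V: "module k V"
shows "bilin k (tpow k V n) V (tpow k V (Suc n)) (%t g. tsnoc k V n t g)"
proof (rule bilinI)
note T = tpow_module[OF V] and p = tpow_pure_multilin[OF V]
show "(%t. tsnoc k V n t g) : lin_hom k (tpow k V n) (tpow k V (Suc n))" if "g .: V" for g
 unfolding tsnoc_def using tpow_lift(1)[OF V T multilin_snoc(1)[OF p that]] .
show "(%g. tsnoc k V n t g) : lin_hom k V (tpow k V (Suc n))" if "t .: tpow k V n" for t unfolding tsnoc_def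
proof (rule lin_lift_parameter[OF V V T multilin_snoc(1)[OF p] _ that])
 fix vs assume "length vs = n" "set vs <: V"
 then show "(%g. tpow_pure k V (vs @ [g])) : lin_hom k V (tpow k V (Suc n))" by (intro multilin_slot[OF p]) auto
qed
qed

lemma tcons_bilin:
assumes V: "module k V"
shows "bilin k V (tpow k V n) (tpow k V (Suc n)) (%g t. tcons k V n g t)"
proof (rule bilinI)
note T = tpow_module[OF V] and p = tpow_pure_multilin[OF V]
show "(%t. tcons k V n g t) : lin_hom k (tpow k V n) (tpow k V (Suc n))" if "g .: V" for g
 unfolding tcons_def using tpow_lift(1)[OF V T multilin_snoc(2)[OF p that]] .
show "(%g. tcons k V n g t) : lin_hom k V (tpow k V (Suc n))" if "t .: tpow k V n" for t unfolding tcons_def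
proof (rule lin_lift_parameter[OF V V T multilin_snoc(2)[OF p] _ that])
 fix vs assume "length vs = n" "set vs <: V"
 then show "(%g. tpow_pure k V (g # vs)) : lin_hom k V (tpow k V (Suc n))" using multilin_slot[OF p, of "[]" vs] by auto
qed
qed

lemma tpow_Suc_ext:
assumes V: "module k V" and W: "module k W"
 and f: "f : lin_hom k (tpow k V (Suc n)) W" and g: "g : lin_hom k (tpow k V (Suc n)) W"
 and eq: "!!s v. s .: tpow k V n ==> v .: V ==> f (tsnoc k V n s v) = g (tsnoc k V n s v)"
 and t: "t .: tpow k V (Suc n)"
shows "f t = g t"
proof (rule tpow_ext[OF V W f g _ t])
fix vs assume vs: "length vs = Suc n" "set vs <: V"
then have "vs ~= []" by auto
then obtain ws v where ws: "vs = ws @ [v]" by (metis append_butlast_last_id)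
then have "length ws = n" "set ws <: V" "v .: V" using vs by auto
then show "f (tpow_pure k V vs) = g (tpow_pure k V vs)" using eq[OF tpow_pure_in[OF V], of ws v] by (simp add: ws tsnoc_pure[OF V])
qed

lemma tcons_tsnoc:
assumes V: "module k V" and g: "g .: V" and h: "h .: V" and t: "t .: tpow k V n"
shows "tcons k V (Suc n) g (tsnoc k V n t h) = tsnoc k V (Suc n) (tcons k V n g t) h"
proof (rule tpow_ext[OF V tpow_module[OF V] lin_comp[OF bilin2[OF tsnoc_bilin[OF V] h] bilin1[OF tcons_bilin[OF V] g]]
 lin_comp[OF bilin1[OF tcons_bilin[OF V] g] bilin2[OF tsnoc_bilin[OF V] h]] _ t])
qed (use g h in "simp add: tsnoc_pure[OF V] tcons_pure[OF V]")

text \<open>Currying for the last tensor factor: bilinear maps on \<open>V\<^sup>\<otimes>\<^sup>n \<times> V\<close> are the linear maps on \<open>V\<^sup>\<otimes>\<^sup>(\<^sup>n\<^sup>+\<^sup>1\<^sup>)\<close>.\<close>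

definition tlast_lift ::
 "('k, 'e) ring_scheme => ('k, 'v, 'f) module_scheme => ('k, 'w, 'g) module_scheme
 => (('v list => 'k) set => 'v => 'w) => ('v list => 'k) set => 'w" where
"tlast_lift k V W F = pres_lift k W (%vs. F (tpow_pure k V (butlast vs)) (last vs))"

lemma tlast_multilin:
assumes V: "module k V" and F: "bilin k (tpow k V n) V W F"
shows "multilin k V (Suc n) W (%vs. F (tpow_pure k V (butlast vs)) (last vs))"
proof (rule multilinI)
fix vs assume vs: "length vs = Suc n" "set vs <: V"
then have "vs ~= []" by auto
then obtain ws v where "vs = ws @ [v]" by (metis append_butlast_last_id)
then show "F (tpow_pure k V (butlast vs)) (last vs) .: W" using vs by (auto intro!: bilin_in[OF F] tpow_pure_in[OF V])
next
fix xs ys assume xy: "length xs + Suc (length ys) = Suc n" "set xs <: V" "set ys <: V"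
show "(%v. F (tpow_pure k V (butlast (xs @ v # ys))) (last (xs @ v # ys))) : lin_hom k V W"
proof (cases ys rule: rev_cases)
 case Nil
 then show ?thesis using xy bilin1[OF F tpow_pure_in[OF V, of xs n]] by (simp add: butlast_append)
next
 case (snoc zs z)
 then show ?thesis using xy bilin_comp2[OF F multilin_slot[OF tpow_pure_multilin[OF V], of xs zs n], of z] by (simp add: butlast_append)
qed
qed

lemma tlast_lift:
assumes V: "module k V" and W: "module k W" and F: "bilin k (tpow k V n) V W F"
shows "tlast_lift k V W F : lin_hom k (tpow k V (Suc n)) W"
 and "t .: tpow k V n ==> g .: V ==> tlast_lift k V W F (tsnoc k V n t g) = F t g"
proof -
note l = tpow_lift[OF V W tlast_multilin[OF V F]]
show 1: "tlast_lift k V W F : lin_hom k (tpow k V (Suc n)) W" unfolding tlast_lift_def by (rule l(1))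
assume t: "t .: tpow k V n" and g: "g .: V"
show "tlast_lift k V W F (tsnoc k V n t g) = F t g"
proof (rule tpow_ext[OF V W lin_comp[OF bilin2[OF tsnoc_bilin[OF V] g] 1] bilin2[OF F g] _ t])
 fix vs assume vs: "length vs = n" "set vs <: V"
 have "tlast_lift k V W F (tpow_pure k V (vs @ [g])) = F (tpow_pure k V (butlast (vs @ [g]))) (last (vs @ [g]))"
 unfolding tlast_lift_def by (rule l(2)) (use vs g in auto)
 then show "tlast_lift k V W F (tsnoc k V n (tpow_pure k V vs) g) = F (tpow_pure k V vs) g" using vs g by (simp add: tsnoc_pure[OF V])
qed
qed

section \<open>Sweedler calculus\<close>

text \<open>The sum \<open>\<Sum> F(h\<^sub>(\<^sub>1\<^sub>), h\<^sub>(\<^sub>2\<^sub>))\<close> for a bilinear map \<open>F\<close> with values in \<open>W\<close>. The axioms of a Hopf algebra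
become rewrite rules for such sums.\<close>

definition sw ::
 "('k, 'e) ring_scheme => ('k, 'c, 'f) coalg_scheme => ('k, 'w, 'g) module_scheme => 'c => ('c => 'c => 'w) => 'w" where
"sw k C W h F = pres_lift k W (%hs. F (hs ! 0) (hs ! 1)) (comult C h)"

lemma lin_smult_vec:
assumes "module k W" "w .: W" "f : lin_hom k U (base_mod k)"
shows "(%u. f u \<odot>\<^sub>W w) : lin_hom k U W"
proof -
interpret W: module k W by fact
have "f u .: k" if "u .: U" for u using lin_in[OF assms(3) that] by simp
then show ?thesis using assms(2) by (intro lin_homI) (simp_all add: lin_add[OF assms(3)] lin_smult[OF assms(3)] W.smult_l_distr W.smult_assoc1)
qed

context coalgebra
begin

lemma Cm: "module k C" by (rule CO.module_axioms)

lemma kmod: "module k (base_mod k)" by (rule base_mod_module) (rule module_cring[OF Cm])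

lemma Tm: "module k (tpow k C n)" by (rule tpow_module[OF Cm])

lemma comult_in: "h .: C ==> comult C h .: tpow k C 2" using lin_in[OF comult_linear] .

lemma counit_in: "h .: C ==> counit C h .: k" using lin_in[OF counit_linear] by simp

lemma pure_in: "length vs = n ==> set vs <: C ==> tpow_pure k C vs .: tpow k C n" by (rule tpow_pure_in[OF Cm])

lemma lift2:
assumes W: "module k W" and F: "bilin k C C W F"
shows "pres_lift k W (%hs. F (hs ! 0) (hs ! 1)) : lin_hom k (tpow k C 2) W"
 and "a .: C ==> b .: C ==> pres_lift k W (%hs. F (hs ! 0) (hs ! 1)) (tpow_pure k C [a, b]) = F a b"
using tpow_lift[OF Cm W multilin_2[OF F]] by auto

lemma tpow2_ext:
assumes W: "module k W" and f: "f : lin_hom k (tpow k C 2) W" and g: "g : lin_hom k (tpow k C 2) W"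
 and eq: "!!a b. a .: C ==> b .: C ==> f (tpow_pure k C [a, b]) = g (tpow_pure k C [a, b])"
 and t: "t .: tpow k C 2"
shows "f t = g t"
proof (rule tpow_ext[OF Cm W f g _ t])
fix vs assume "length vs = 2" "set vs <: C"
then show "f (tpow_pure k C vs) = g (tpow_pure k C vs)" using eq by (auto simp: numeral_2_eq_2 length_Suc_conv)
qed

lemma sw_lin:
assumes "module k W" "bilin k C C W F" "f : lin_hom k U C"
shows "(%u. sw k C W (f u) F) : lin_hom k U W" unfolding sw_def by (rule lin_comp[OF lin_comp[OF assms(3) comult_linear] lift2(1)[OF assms(1,2)]])

lemma sw_in: "module k W ==> bilin k C C W F ==> h .: C ==> sw k C W h F .: W" using lin_in[OF sw_lin[OF _ _ lin_id]] .

lemma sw_param: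
assumes U: "module k U" and W: "module k W" and F: "!!u. u .: U ==> bilin k C C W (%a b. F u a b)"
 and l: "!!a b. a .: C ==> b .: C ==> (%u. F u a b) : lin_hom k U W" and h: "h .: C"
shows "(%u. sw k C W h (%a b. F u a b)) : lin_hom k U W" unfolding sw_def
proof (rule lin_lift_parameter[OF Cm U W multilin_2[OF F] _ comult_in[OF h]])
fix vs assume "length vs = 2" "set vs <: C"
then show "(%u. F u (vs ! 0) (vs ! 1)) : lin_hom k U W" by (intro l) (auto simp: subset_iff)
qed

lemma sw_cong:
assumes W: "module k W" and F: "bilin k C C W F" and h: "h .: C"
 and eq: "!!a b. a .: C ==> b .: C ==> F a b = G a b"
shows "sw k C W h F = sw k C W h G"
proof -
have G: "bilin k C C W G"
proof (rule bilinI)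
 show "(%b. G a b) : lin_hom k C W" if "a .: C" for a using bilin1[OF F that] that eq by (subst lin_cong[where g = "%b. F a b", OF _ Cm]) auto
 show "(%a. G a b) : lin_hom k C W" if "b .: C" for b using bilin2[OF F that] that eq by (subst lin_cong[where g = "%a. F a b", OF _ Cm]) auto
qed
show ?thesis unfolding sw_def by (rule tpow2_ext[OF W lift2(1)[OF W F] lift2(1)[OF W G] _ comult_in[OF h]])
 (simp del: One_nat_def add: lift2(2)[OF W F] lift2(2)[OF W G] eq)
qed

lemma sw_post:
assumes W: "module k W" and F: "bilin k C C W F" and h: "h .: C"
 and U: "module k U" and f: "f : lin_hom k W U"
shows "f (sw k C W h F) = sw k C U h (%a b. f (F a b))" unfolding sw_def
by (rule tpow2_ext[OF U lin_comp[OF lift2(1)[OF W F] f] lift2(1)[OF U bilin_post[OF F f]] _ comult_in[OF h]])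
 (simp del: One_nat_def add: lift2(2)[OF W F] lift2(2)[OF U bilin_post[OF F f]])

lemma counit_at_multilin:
assumes "i \<le> n"
shows "multilin k C (Suc n) (tpow k C n) (%cs. counit C (cs ! i) \<odot>\<^sub>(tpow k C n) tpow_pure k C (take i cs @ drop (Suc i) cs))"
proof (rule multilin_at)
note p = tpow_pure_multilin[OF Cm, of n]
show "i < Suc n" using assms by simp
fix v assume v: "v .: C"
have sc: "(%t. counit C v \<odot>\<^sub>(tpow k C n) t) : lin_hom k (tpow k C n) (tpow k C n)" by (intro lin_scale lin_id Tm counit_in v)
{
 fix qs assume "length qs = Suc n - Suc i" "set qs <: C"
 then show "multilin k C i (tpow k C n) (%ps. counit C v \<odot>\<^sub>(tpow k C n) tpow_pure k C (ps @ qs))"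
 using assms by (intro multilin_comp[OF multilin_append1[OF p] sc]) auto
next
 fix ps assume "length ps = i" "set ps <: C"
 then show "multilin k C (Suc n - Suc i) (tpow k C n) (%qs. counit C v \<odot>\<^sub>(tpow k C n) tpow_pure k C (ps @ qs))"
 using assms by (intro multilin_comp[OF multilin_append2[OF p] sc]) auto
}
next
fix ps qs assume "length ps = i" "set ps <: C" "length qs = Suc n - Suc i" "set qs <: C"
then show "(%v. counit C v \<odot>\<^sub>(tpow k C n) tpow_pure k C (ps @ qs)) : lin_hom k C (tpow k C n)"
 using assms by (intro lin_smult_vec Tm pure_in counit_linear) auto
qed

lemma counit_at:
assumes "i \<le> n"
shows "counit_at k C n i : lin_hom k (tpow k C (Suc n)) (tpow k C n)"
 and "length cs = Suc n ==> set cs <: C ==> counit_at k C n i (tpow_pure k C cs) =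
 counit C (cs ! i) \<odot>\<^sub>(tpow k C n) tpow_pure k C (take i cs @ drop (Suc i) cs)"
unfolding counit_at_def using tpow_lift[OF Cm Tm counit_at_multilin[OF assms]] by auto

lemma comult_at_inner:
assumes ps: "set ps <: C" and qs: "set qs <: C" and n: "Suc n = length ps + 2 + length qs"
shows "bilin k C C (tpow k C (Suc n)) (%a b. tpow_pure k C (ps @ [a, b] @ qs))"
 and "h .: C ==> pres_lift k (tpow k C (Suc n)) (%ds. tpow_pure k C (ps @ ds @ qs)) (comult C h)
 = sw k C (tpow k C (Suc n)) h (%a b. tpow_pure k C (ps @ [a, b] @ qs))"
proof -
note p = tpow_pure_multilin[OF Cm, of "Suc n"]
have m: "multilin k C 2 (tpow k C (Suc n)) (%ds. tpow_pure k C (ps @ ds @ qs))"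
 using multilin_append1[OF multilin_append2[OF p ps], of "2 + length qs" qs 2] qs n by simp
show b: "bilin k C C (tpow k C (Suc n)) (%a b. tpow_pure k C (ps @ [a, b] @ qs))"
proof (rule bilinI)
 fix u assume "u .: C"
 then show "(%v. tpow_pure k C (ps @ [u, v] @ qs)) : lin_hom k C (tpow k C (Suc n))" using multilin_slot[OF m, of "[u]" "[]"] by simp
 show "(%v. tpow_pure k C (ps @ [v, u] @ qs)) : lin_hom k C (tpow k C (Suc n))"
 using multilin_slot[OF m, of "[]" "[u]"] \<open>u .: C\<close> by simp
qed
assume h: "h .: C"
show "pres_lift k (tpow k C (Suc n)) (%ds. tpow_pure k C (ps @ ds @ qs)) (comult C h)
 = sw k C (tpow k C (Suc n)) h (%a b. tpow_pure k C (ps @ [a, b] @ qs))" unfolding sw_def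
 by (rule tpow2_ext[OF Tm tpow_lift(1)[OF Cm Tm m] lift2(1)[OF Tm b] _ comult_in[OF h]])
 (use tpow_lift(2)[OF Cm Tm m] lift2(2)[OF Tm b] in "simp del: One_nat_def")
qed

lemma comult_at:
assumes i: "i < n"
shows "comult_at k C n i : lin_hom k (tpow k C n) (tpow k C (Suc n))"
 and "length cs = n ==> set cs <: C ==> comult_at k C n i (tpow_pure k C cs) =
 sw k C (tpow k C (Suc n)) (cs ! i) (%a b. tpow_pure k C (take i cs @ [a, b] @ drop (Suc i) cs))"
proof -
let ?G = "%ps v qs. pres_lift k (tpow k C (Suc n)) (%ds. tpow_pure k C (ps @ ds @ qs)) (comult C v)"
note p = tpow_pure_multilin[OF Cm, of "Suc n"]
have m: "multilin k C n (tpow k C (Suc n)) (%cs. ?G (take i cs) (cs ! i) (drop (Suc i) cs))"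
proof (rule multilin_at[OF i])
 fix ps qs assume *: "length ps = i" "set ps <: C" "length qs = n - Suc i" "set qs <: C"
 have "multilin k C 2 (tpow k C (Suc n)) (%ds. tpow_pure k C (ps @ ds @ qs))"
 using multilin_append1[OF multilin_append2[OF p *(2)], of "2 + length qs" qs 2] * i by simp
 then show "(%v. ?G ps v qs) : lin_hom k C (tpow k C (Suc n))" by (intro lin_comp[OF comult_linear] tpow_lift(1)[OF Cm Tm])
next
 fix v qs assume *: "v .: C" "length qs = n - Suc i" "set qs <: C"
 show "multilin k C i (tpow k C (Suc n)) (%ps. ?G ps v qs)"
 proof (rule multilin_lift_parameter[OF Cm Cm Tm _ _ comult_in[OF *(1)]])
 fix us assume u: "length us = i" "set us <: C"
 show "multilin k C 2 (tpow k C (Suc n)) (%ds. tpow_pure k C (us @ ds @ qs))"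
  using multilin_append1[OF multilin_append2[OF p u(2)], of "2 + length qs" qs 2] * i u by simp
 next
 fix vs assume v: "length vs = 2" "set vs <: C"
 show "multilin k C i (tpow k C (Suc n)) (%us. tpow_pure k C (us @ vs @ qs))" using * i v by (intro multilin_append1[OF p]) auto
 qed
next
 fix v ps assume *: "v .: C" "length ps = i" "set ps <: C"
 show "multilin k C (n - Suc i) (tpow k C (Suc n)) (%qs. ?G ps v qs)"
 proof (rule multilin_lift_parameter[OF Cm Cm Tm _ _ comult_in[OF *(1)]])
 fix us assume u: "length us = n - Suc i" "set us <: C"
 show "multilin k C 2 (tpow k C (Suc n)) (%ds. tpow_pure k C (ps @ ds @ us))"
  using multilin_append1[OF multilin_append2[OF p *(3)], of "2 + length us" us 2] * i u by simp
 next
 fix vs assume v: "length vs = 2" "set vs <: C"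
 show "multilin k C (n - Suc i) (tpow k C (Suc n)) (%us. tpow_pure k C (ps @ vs @ us))"
  using multilin_append2[OF p, of "ps @ vs" "n - Suc i"] * i v by simp
 qed
qed
note l = tpow_lift[OF Cm Tm m]
show "comult_at k C n i : lin_hom k (tpow k C n) (tpow k C (Suc n))" unfolding comult_at_def by (rule l(1))
assume cs: "length cs = n" "set cs <: C"
then have "set (take i cs) <: C" "set (drop (Suc i) cs) <: C" "cs ! i .: C"
 using set_take_subset[of i cs] set_drop_subset[of "Suc i" cs] i by (blast, blast, auto simp: subset_iff)
then show "comult_at k C n i (tpow_pure k C cs) =
 sw k C (tpow k C (Suc n)) (cs ! i) (%a b. tpow_pure k C (take i cs @ [a, b] @ drop (Suc i) cs))"
 unfolding comult_at_def l(2)[OF cs] using cs i by (intro comult_at_inner(2)) auto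
qed

lemma comult_as_sw:
assumes h: "h .: C"
shows "comult C h = sw k C (tpow k C 2) h (%a b. tpow_pure k C [a, b])"
 and "bilin k C C (tpow k C 2) (%a b. tpow_pure k C [a, b])"
proof -
show b: "bilin k C C (tpow k C 2) (%a b. tpow_pure k C [a, b])" using comult_at_inner(1)[of "[]" "[]" 1] by (simp add: numeral_2_eq_2)
show "comult C h = sw k C (tpow k C 2) h (%a b. tpow_pure k C [a, b])" unfolding sw_def
 by (rule tpow2_ext[OF Tm lin_id lift2(1)[OF Tm b] _ comult_in[OF h]]) (simp del: One_nat_def add: lift2(2)[OF Tm b])
qed

lemma lin_comult:
assumes W: "module k W" and f: "f : lin_hom k (tpow k C 2) W" and h: "h .: C"
shows "f (comult C h) = sw k C W h (%a b. f (tpow_pure k C [a, b]))" using sw_post[OF Tm comult_as_sw(2)[OF h] h W f] comult_as_sw(1)[OF h] by simp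

lemma lin_on_vector: "f : lin_hom k C W ==> multilin k C 1 W (%vs. f (vs ! 0))" by (rule multilinI) (auto intro!: lin_in[of f k C W] simp: subset_iff)

lemma sw_counit1:
assumes W: "module k W" and g: "g : lin_hom k C W" and h: "h .: C"
shows "sw k C W h (%a b. counit C a \<odot>\<^sub>W g b) = g h"
proof -
note l = tpow_lift[OF Cm W lin_on_vector[OF g]]
let ?L = "pres_lift k W (%vs. g (vs ! 0))"
have f: "(%t. ?L (counit_at k C 1 0 t)) : lin_hom k (tpow k C 2) W" using lin_comp[OF _ l(1)] counit_at(1)[of 0 1] by (simp add: numeral_2_eq_2)
have "g h = ?L (counit_at k C 1 0 (comult C h))" using counit_left[OF h] l(2)[of "[h]"] h by simp
also have "... = sw k C W h (%a b. ?L (counit_at k C 1 0 (tpow_pure k C [a, b])))" by (rule lin_comult[OF W f h])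
also have "... = sw k C W h (%a b. counit C a \<odot>\<^sub>W g b)"
proof (rule sw_cong[OF W bilin_post[OF comult_as_sw(2)[OF h] f] h])
 fix a b assume "a .: C" "b .: C"
 then show "?L (counit_at k C 1 0 (tpow_pure k C [a, b])) = counit C a \<odot>\<^sub>W g b"
 using counit_at(2)[of 0 1 "[a, b]"] l(2)[of "[b]"] pure_in[of "[b]" 1] counit_in by (simp del: One_nat_def add: lin_smult[OF l(1)])
qed
finally show ?thesis by simp
qed

lemma sw_counit2:
assumes W: "module k W" and g: "g : lin_hom k C W" and h: "h .: C"
shows "sw k C W h (%a b. counit C b \<odot>\<^sub>W g a) = g h"
proof -
note l = tpow_lift[OF Cm W lin_on_vector[OF g]]
let ?L = "pres_lift k W (%vs. g (vs ! 0))"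
have f: "(%t. ?L (counit_at k C 1 1 t)) : lin_hom k (tpow k C 2) W" using lin_comp[OF _ l(1)] counit_at(1)[of 1 1] by (simp add: numeral_2_eq_2)
have "g h = ?L (counit_at k C 1 1 (comult C h))" using counit_right[OF h] l(2)[of "[h]"] h by simp
also have "... = sw k C W h (%a b. ?L (counit_at k C 1 1 (tpow_pure k C [a, b])))" by (rule lin_comult[OF W f h])
also have "... = sw k C W h (%a b. counit C b \<odot>\<^sub>W g a)"
proof (rule sw_cong[OF W bilin_post[OF comult_as_sw(2)[OF h] f] h])
 fix a b assume "a .: C" "b .: C"
 moreover from this have "counit_at k C 1 1 (tpow_pure k C [a, b]) = counit C b \<odot>\<^sub>(tpow k C 1) tpow_pure k C [a]"
 using counit_at(2)[of 1 1 "[a, b]"] by simp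
 ultimately show "?L (counit_at k C 1 1 (tpow_pure k C [a, b])) = counit C b \<odot>\<^sub>W g a"
 using l(2)[of "[a]"] pure_in[of "[a]" 1] counit_in by (simp del: One_nat_def add: lin_smult[OF l(1)])
qed
finally show ?thesis by simp
qed

lemma sw_coassoc:
assumes W: "module k W"
 and T1: "!!b c. b .: C ==> c .: C ==> (%a. T a b c) : lin_hom k C W"
 and T2: "!!a c. a .: C ==> c .: C ==> (%b. T a b c) : lin_hom k C W"
 and T3: "!!a b. a .: C ==> b .: C ==> (%c. T a b c) : lin_hom k C W"
 and h: "h .: C"
shows "sw k C W h (%a b. sw k C W a (%c d. T c d b)) = sw k C W h (%a b. sw k C W b (%c d. T a c d))"
proof -
have m: "multilin k C 3 W (%vs. T (vs ! 0) (vs ! 1) (vs ! 2))"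
proof (rule multilinI)
 fix vs assume "length vs = 3" "set vs <: C"
 then show "T (vs ! 0) (vs ! 1) (vs ! 2) .: W" by (intro lin_in[OF T1]) (auto simp: subset_iff)
next
 fix xs ys assume *: "length xs + Suc (length ys) = 3" "set xs <: C" "set ys <: C"
 then consider y z where "xs = []" "ys = [y, z]" | x y where "xs = [x]" "ys = [y]" | x y where "xs = [x, y]" "ys = []"
 by (cases xs; cases ys; cases "tl xs"; cases "tl ys") (auto simp: length_Suc_conv)
 then show "(%v. T ((xs @ v # ys) ! 0) ((xs @ v # ys) ! 1) ((xs @ v # ys) ! 2)) : lin_hom k C W"
 by cases (use * T1 T2 T3 in "auto simp: numeral_2_eq_2")
qed
note l = tpow_lift[OF Cm W m]
let ?L = "pres_lift k W (%vs. T (vs ! 0) (vs ! 1) (vs ! 2))"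
have l2: "?L (tpow_pure k C [a, b, c]) = T a b c" if "a .: C" "b .: C" "c .: C" for a b c using l(2)[of "[a, b, c]"] that by simp
have f: "(%t. ?L (comult_at k C 2 i t)) : lin_hom k (tpow k C 2) W" if "i < 2" for i
 using lin_comp[OF comult_at(1)[OF that]] l(1) by (simp add: numeral_3_eq_3 numeral_2_eq_2)
have F: "bilin k C C (tpow k C 3) (%a b. tpow_pure k C (ps @ [a, b] @ qs))"
 if "set ps <: C" "set qs <: C" "length ps + length qs = 1" for ps qs
 using comult_at_inner(1)[OF that(1,2), of 2] that(3) by (simp add: numeral_3_eq_3 numeral_2_eq_2)
have eq: "?L (comult_at k C 2 0 (tpow_pure k C [a, b])) = sw k C W a (%c d. T c d b)"
 "?L (comult_at k C 2 1 (tpow_pure k C [a, b])) = sw k C W b (%c d. T a c d)"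
 if ab: "a .: C" "b .: C" for a b
proof -
 have "?L (comult_at k C 2 0 (tpow_pure k C [a, b])) = ?L (sw k C (tpow k C 3) a (%c d. tpow_pure k C ([] @ [c, d] @ [b])))"
 using comult_at(2)[of 0 2 "[a, b]"] ab by (simp add: numeral_3_eq_3 numeral_2_eq_2)
 also have "... = sw k C W a (%c d. ?L (tpow_pure k C ([] @ [c, d] @ [b])))" using ab by (intro sw_post[OF Tm F _ W l(1)]) auto
 also have "... = sw k C W a (%c d. T c d b)" using ab by (intro sw_cong[OF W bilin_post[OF F l(1)]]) (auto simp del: One_nat_def simp: l2)
 finally show "?L (comult_at k C 2 0 (tpow_pure k C [a, b])) = sw k C W a (%c d. T c d b)" .
 have "?L (comult_at k C 2 1 (tpow_pure k C [a, b])) = ?L (sw k C (tpow k C 3) b (%c d. tpow_pure k C ([a] @ [c, d] @ [])))"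
 using comult_at(2)[of 1 2 "[a, b]"] ab by (simp add: numeral_3_eq_3 numeral_2_eq_2)
 also have "... = sw k C W b (%c d. ?L (tpow_pure k C ([a] @ [c, d] @ [])))" using ab by (intro sw_post[OF Tm F _ W l(1)]) auto
 also have "... = sw k C W b (%c d. T a c d)" using ab by (intro sw_cong[OF W bilin_post[OF F l(1)]]) (auto simp del: One_nat_def simp: l2)
 finally show "?L (comult_at k C 2 1 (tpow_pure k C [a, b])) = sw k C W b (%c d. T a c d)" .
qed
have "sw k C W h (%a b. sw k C W a (%c d. T c d b)) = ?L (comult_at k C 2 0 (comult C h))"
 using lin_comult[OF W f h, of 0] sw_cong[OF W bilin_post[OF comult_as_sw(2)[OF h] f] h, of 0] eq(1) by simp
also have "... = sw k C W h (%a b. sw k C W b (%c d. T a c d))"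
 using lin_comult[OF W f h, of 1] sw_cong[OF W bilin_post[OF comult_as_sw(2)[OF h] f] h, of 1] eq(2) by (simp add: coassoc[OF h])
finally show ?thesis .
qed

lemma sw_group_like:
assumes W: "module k W" and F: "bilin k C C W F" and g: "group_like k C g"
shows "sw k C W g F = F g g" using g lift2(2)[OF W F, of g g] by (simp add: sw_def group_like_def)

lemma sw_cocommutative:
assumes W: "module k W" and F: "bilin k C C W F" and h: "h .: C" and cc: "cocommutative k C"
shows "sw k C W h (%a b. F b a) = sw k C W h F"
proof -
let ?r = "pres_lift k (tpow k C 2) (%cs. tpow_pure k C (rev cs))"
have F': "bilin k C C W (%a b. F b a)" using F by (simp add: bilin_def)
have m: "multilin k C 2 (tpow k C 2) (%cs. tpow_pure k C (rev cs))"
proof (rule multilinI)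
 fix xs ys assume "length xs + Suc (length ys) = 2" "set xs <: C" "set ys <: C"
 then show "(%v. tpow_pure k C (rev (xs @ v # ys))) : lin_hom k C (tpow k C 2)"
 using multilin_slot[OF tpow_pure_multilin[OF Cm], of "rev ys" "rev xs" 2] by simp
qed (auto intro!: pure_in)
note r = tpow_lift[OF Cm Tm m]
have "pres_lift k W (%hs. F (hs ! 0) (hs ! 1)) (?r t) = pres_lift k W (%hs. F (hs ! 1) (hs ! 0)) t"
 if t: "t .: tpow k C 2" for t by (rule tpow2_ext[OF W lin_comp[OF r(1) lift2(1)[OF W F]] lift2(1)[OF W F'] _ t])
 (simp del: One_nat_def add: r(2) lift2(2)[OF W F] lift2(2)[OF W F'])
from this[OF comult_in[OF h]] show ?thesis using cc h by (simp add: sw_def cocommutative_def)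
qed

end

section \<open>The diagonal action of a Hopf algebra on its tensor powers\<close>

lemma multilin_cong:
assumes f: "multilin k V n W f" and eq: "!!vs. length vs = n ==> set vs <: V ==> f vs = g vs"
 and V: "module k V"
shows "multilin k V n W g"
proof (rule multilinI)
fix vs assume vs: "length vs = n" "set vs <: V"
then show "g vs .: W" using multilin_in[OF f, of vs] eq[OF vs] by (simp add: tpow_basis_def)
next
fix xs ys assume *: "length xs + Suc (length ys) = n" "set xs <: V" "set ys <: V"
have "f (xs @ v # ys) = g (xs @ v # ys)" if "v .: V" for v using * that by (intro eq) auto
from iffD1[OF lin_cong[OF this V] multilin_slot[OF f *]]
show "(%v. g (xs @ v # ys)) : lin_hom k V W" .
qed

context assoc_algebra
begin

lemma Am: "module k A" by (rule VEC.module_axioms)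

lemma mult_bilin: "bilin k A A A (%a b. a **\<^sub>A b)"
by (intro bilinI lin_homI) (simp_all add: ALG.l_distr ALG.r_distr smult_mult_left smult_mult_right)

lemma map2_mult_multilin:
assumes cs: "length cs = n" "set cs <: A"
shows "multilin k A n (tpow k A n) (%bs. tpow_pure k A (map2 (monoid.mult A) cs bs))"
 and "multilin k A n (tpow k A n) (%bs. tpow_pure k A (map2 (monoid.mult A) bs cs))"
proof -
have cl: "set (map2 (monoid.mult A) as bs) <: A"
 if "set as <: A" "set bs <: A" for as bs using that by (auto dest: set_zip_leftD set_zip_rightD)
have split: "cs = take i cs @ cs ! i # drop (Suc i) cs" if "i < n" for i using id_take_nth_drop[of i cs] that cs by simp
have sub: "set (take i cs) <: A" "set (drop i cs) <: A" for i using cs set_take_subset[of i cs] set_drop_subset[of i cs] by blast+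
have mem: "cs ! i .: A" if "i < n" for i using cs that by (auto simp: subset_iff)
note p = tpow_pure_multilin[OF Am, of n]
show "multilin k A n (tpow k A n) (%bs. tpow_pure k A (map2 (monoid.mult A) cs bs))"
proof (rule multilinI)
 fix xs ys assume *: "length xs + Suc (length ys) = n" "set xs <: A" "set ys <: A"
 let ?i = "length xs"
 have "map2 (monoid.mult A) cs (xs @ v # ys) = map2 (monoid.mult A) (take ?i cs) xs @ (cs ! ?i **\<^sub>A v) # map2 (monoid.mult A) (drop (Suc ?i) cs) ys" for v
 by (subst split[of ?i]) (use * cs in "auto simp: zip_append")
 then show "(%v. tpow_pure k A (map2 (monoid.mult A) cs (xs @ v # ys))) : lin_hom k A (tpow k A n)"
 using lin_comp[OF bilin1[OF mult_bilin mem[of ?i]] multilin_slot[OF p, of "map2 (monoid.mult A) (take ?i cs) xs" "map2 (monoid.mult A) (drop (Suc ?i) cs) ys"]]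
  cl sub * cs by (simp add: min_def)
qed (rule tpow_pure_in[OF Am _ cl]; use cs in simp)
show "multilin k A n (tpow k A n) (%bs. tpow_pure k A (map2 (monoid.mult A) bs cs))"
proof (rule multilinI)
 fix xs ys assume *: "length xs + Suc (length ys) = n" "set xs <: A" "set ys <: A"
 let ?i = "length xs"
 have "map2 (monoid.mult A) (xs @ v # ys) cs = map2 (monoid.mult A) xs (take ?i cs) @ (v **\<^sub>A cs ! ?i) # map2 (monoid.mult A) ys (drop (Suc ?i) cs)" for v
 by (subst split[of ?i]) (use * cs in "auto simp: zip_append")
 then show "(%v. tpow_pure k A (map2 (monoid.mult A) (xs @ v # ys) cs)) : lin_hom k A (tpow k A n)"
 using lin_comp[OF bilin2[OF mult_bilin mem[of ?i]] multilin_slot[OF p, of "map2 (monoid.mult A) xs (take ?i cs)" "map2 (monoid.mult A) ys (drop (Suc ?i) cs)"]]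
  cl sub * cs by (simp add: min_def)
qed (rule tpow_pure_in[OF Am _ cl]; use cs in simp)
qed

lemma tpow_mult_bilin: "bilin k (tpow k A n) (tpow k A n) (tpow k A n) (%s t. tpow_mult k A n s t)"
and tpow_mult_pure: "length as = n ==> set as <: A ==> length bs = n ==> set bs <: A ==>
 tpow_mult k A n (tpow_pure k A as) (tpow_pure k A bs) = tpow_pure k A (map2 (monoid.mult A) as bs)"
proof -
note T = tpow_module[OF Am]
note l = tpow_lift[OF Am T map2_mult_multilin(1)]
let ?I = "%as t. pres_lift k (tpow k A n) (%bs. tpow_pure k A (map2 (monoid.mult A) as bs)) t"
have m: "multilin k A n (tpow k A n) (%as. ?I as t)" if t: "t .: tpow k A n" for t
 by (rule multilin_lift_parameter[OF Am Am T map2_mult_multilin t])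
note l' = tpow_lift[OF Am T m]
show "bilin k (tpow k A n) (tpow k A n) (tpow k A n) (%s t. tpow_mult k A n s t)"
 unfolding tpow_mult_def by (intro bilinI l'(1) lin_lift_parameter[OF Am T T m] l(1))
assume as: "length as = n" "set as <: A" and bs: "length bs = n" "set bs <: A"
have "tpow_mult k A n (tpow_pure k A as) (tpow_pure k A bs) = ?I as (tpow_pure k A bs)"
 unfolding tpow_mult_def by (rule tpow_lift(2)[OF Am T m[OF tpow_pure_in[OF Am bs]] as])
also have "... = tpow_pure k A (map2 (monoid.mult A) as bs)" by (rule tpow_lift(2)[OF Am T map2_mult_multilin(1)[OF as] bs])
finally show "tpow_mult k A n (tpow_pure k A as) (tpow_pure k A bs) = tpow_pure k A (map2 (monoid.mult A) as bs)" .
qed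

lemma tpow_mult_snoc:
assumes s: "s .: tpow k A n" and t: "t .: tpow k A n" and g: "g .: A" and h: "h .: A"
shows "tpow_mult k A (Suc n) (tsnoc k A n s g) (tsnoc k A n t h) = tsnoc k A n (tpow_mult k A n s t) (g **\<^sub>A h)"
proof -
note T = tpow_module[OF Am] and sb = tsnoc_bilin[OF Am]
have gh: "g **\<^sub>A h .: A" using g h by simp
note c1 = lin_comp[OF bilin2[OF sb g] bilin2[OF tpow_mult_bilin bilin_in[OF sb _ h]]]
note c2 = lin_comp[OF bilin2[OF sb h] bilin1[OF tpow_mult_bilin bilin_in[OF sb _ g]]]
note d1 = lin_comp[OF bilin2[OF tpow_mult_bilin] bilin2[OF sb gh]]
note d2 = lin_comp[OF bilin1[OF tpow_mult_bilin] bilin2[OF sb gh]]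
show ?thesis
proof (rule tpow_ext[OF Am T c1[OF t] d1[OF t] _ s])
 fix as assume as: "length as = n" "set as <: A"
 note asc = tpow_pure_in[OF Am as]
 show "tpow_mult k A (Suc n) (tsnoc k A n (tpow_pure k A as) g) (tsnoc k A n t h) =
  tsnoc k A n (tpow_mult k A n (tpow_pure k A as) t) (g **\<^sub>A h)"
 proof (rule tpow_ext[OF Am T c2[OF asc] d2[OF asc] _ t])
 fix bs assume bs: "length bs = n" "set bs <: A"
 have "set (map2 (monoid.mult A) as bs) <: A" using as bs by (auto dest: set_zip_leftD set_zip_rightD)
 then show "tpow_mult k A (Suc n) (tsnoc k A n (tpow_pure k A as) g) (tsnoc k A n (tpow_pure k A bs) h) =
  tsnoc k A n (tpow_mult k A n (tpow_pure k A as) (tpow_pure k A bs)) (g **\<^sub>A h)"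
  using as bs g h gh by (simp add: tsnoc_pure[OF Am] tpow_mult_pure)
 qed
qed
qed

end

text \<open>The diagonal action, defined by recursion over the last tensor factor. It makes sense in degree \<open>0\<close>
as well, where it is the trivial action.\<close>

primrec tact ::
 "('k, 'e) ring_scheme => ('k, 'h, 'f) coalg_scheme => nat => ('h list => 'k) set => 'h => ('h list => 'k) set" where
"tact k H 0 t h = counit H h \<odot>\<^sub>(tpow k H 0) t"
| "tact k H (Suc n) t h = tlast_lift k H (tpow k H (Suc n))
 (%s g. sw k H (tpow k H (Suc n)) h (%a b. tsnoc k H n (tact k H n s a) (g **\<^sub>H b))) t"

context hopf_algebra
begin
abbreviation (input) "pur \<equiv> tpow_pure k H"
abbreviation (input) "tp \<equiv> tpow k H"
abbreviation (input) "snc \<equiv> tsnoc k H"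
abbreviation (input) "cns \<equiv> tcons k H"
abbreviation (input) "act \<equiv> tact k H"
abbreviation (input) "eps \<equiv> counit_at k H"
abbreviation (input) "Hom \<equiv> lin_hom k"

lemma mult_in: "a .: H ==> b .: H ==> a **\<^sub>H b .: H" by (rule ALG.m_closed)

lemma one_closed': "1\<^sub>H .: H" by (rule ALG.one_closed)

lemma mult_assoc: "a .: H ==> b .: H ==> c .: H ==> (a **\<^sub>H b) **\<^sub>H c = a **\<^sub>H (b **\<^sub>H c)" by (rule ALG.m_assoc)

lemma antipode_in: "a .: H ==> antipode H a .: H" using lin_in[OF antipode_linear] .

lemma tsnoc_in: "t .: tp n ==> g .: H ==> snc n t g .: tp (Suc n)" by (rule bilin_in[OF tsnoc_bilin[OF Cm]])

lemma tcons_in: "t .: tp n ==> g .: H ==> cns n g t .: tp (Suc n)" by (rule bilin_in[OF tcons_bilin[OF Cm]])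

lemma L_mult1: "f : Hom U H ==> c .: H ==> (%u. f u **\<^sub>H c) : Hom U H" by (rule bilin_comp2[OF mult_bilin])

lemma L_mult2: "f : Hom U H ==> c .: H ==> (%u. c **\<^sub>H f u) : Hom U H" by (rule bilin_comp1[OF mult_bilin])

lemma L_snoc1: "f : Hom U (tp n) ==> c .: H ==> (%u. snc n (f u) c) : Hom U (tp (Suc n))" by (rule bilin_comp2[OF tsnoc_bilin[OF Cm]])

lemma L_snoc2: "f : Hom U H ==> t .: tp n ==> (%u. snc n t (f u)) : Hom U (tp (Suc n))" by (rule bilin_comp1[OF tsnoc_bilin[OF Cm]])

lemma L_cons1: "f : Hom U H ==> t .: tp n ==> (%u. cns n (f u) t) : Hom U (tp (Suc n))" by (rule bilin_comp2[OF tcons_bilin[OF Cm]])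

lemma L_cons2: "f : Hom U (tp n) ==> c .: H ==> (%u. cns n c (f u)) : Hom U (tp (Suc n))" by (rule bilin_comp1[OF tcons_bilin[OF Cm]])

lemma L_antipode: "f : Hom U H ==> (%u. antipode H (f u)) : Hom U H" by (rule lin_comp[OF _ antipode_linear])

lemma L_counit: "f : Hom U H ==> module k W ==> w .: W ==> (%u. counit H (f u) \<odot>\<^sub>W w) : Hom U W"
by (rule lin_smult_vec[OF _ _ lin_comp[OF _ counit_linear]])

lemma L_scale: "f : Hom U W ==> module k W ==> a .: k ==> (%u. a \<odot>\<^sub>W f u) : Hom U W" by (rule lin_scale)

lemmas lin_intros = lin_id L_mult1 L_mult2 L_snoc1 L_snoc2 L_cons1 L_cons2 L_antipode L_counit L_scale Tm Cm
lemmas closed_intros = mult_in one_closed' antipode_in tsnoc_in tcons_in counit_in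

lemma tact_bilin: "bilin k (tp n) H (tp n) (%t h. act n t h)"
proof (induction n)
case 0
show ?case by (auto intro!: bilinI lin_intros closed_intros)
next
case (Suc n)
let ?T = "tp (Suc n)"
let ?F = "%h s g. sw k H ?T h (%a b. snc n (act n s a) (g **\<^sub>H b))"
have b: "bilin k H H ?T (%a b. snc n (act n s a) (g **\<^sub>H b))"
 if "s .: tp n" "g .: H" for s g using that by (auto intro!: bilinI lin_intros closed_intros bilin_in[OF Suc] bilin_comp1[OF Suc])
have F: "bilin k (tp n) H ?T (?F h)" if h: "h .: H" for h
 by (intro bilinI sw_param b Tm Cm h lin_intros closed_intros bilin_comp2[OF Suc] bilin_in[OF Suc])
show ?case
proof (rule bilinI)
 show "(%t. act (Suc n) t h) : Hom ?T ?T" if "h .: H" for h using tlast_lift(1)[OF Cm Tm F[OF that]] by simp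
 show "(%h. act (Suc n) t h) : Hom H ?T" if t: "t .: ?T" for t unfolding tact.simps tlast_lift_def
 proof (rule lin_lift_parameter[OF Cm Cm Tm tlast_multilin[OF Cm F] _ t])
 fix vs assume vs: "length vs = Suc n" "set vs <: H"
 then have "vs ~= []" by auto
 then obtain ws v where ws: "vs = ws @ [v]" by (metis append_butlast_last_id)
 then have ws': "length ws = n" "set ws <: H" "v .: H" using vs by auto
 show "(%h. ?F h (pur (butlast vs)) (last vs)) : Hom H ?T" using sw_lin[OF Tm b[OF pure_in[OF ws'(1,2)] ws'(3)] lin_id] by (simp add: ws)
 qed
qed
qed

lemma tact_in: "t .: tp n ==> h .: H ==> act n t h .: tp n" by (rule bilin_in[OF tact_bilin])

lemma L_act1: "f : Hom U (tp n) ==> c .: H ==> (%u. act n (f u) c) : Hom U (tp n)" by (rule bilin_comp2[OF tact_bilin])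

lemma L_act2: "f : Hom U H ==> t .: tp n ==> (%u. act n t (f u)) : Hom U (tp n)" by (rule bilin_comp1[OF tact_bilin])

lemmas lin_intros' = lin_intros L_act1 L_act2
lemmas closed_intros' = closed_intros tact_in

lemma tact_snoc:
assumes t: "t .: tp n" and g: "g .: H" and h: "h .: H"
shows "act (Suc n) (snc n t g) h
 = sw k H (tp (Suc n)) h (%a b. snc n (act n t a) (g **\<^sub>H b))"
proof -
have "bilin k (tp n) H (tp (Suc n)) (%s g. sw k H (tp (Suc n)) h (%a b. snc n (act n s a) (g **\<^sub>H b)))"
 by (intro bilinI sw_param h lin_intros' closed_intros')
from tlast_lift(2)[OF Cm Tm this t g] show ?thesis by simp
qed

lemma sw_mult:
assumes W: "module k W" and F: "bilin k H H W F" and g: "g .: H" and h: "h .: H"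
shows "sw k H W (g **\<^sub>H h) F = sw k H W g (%a b. sw k H W h (%c d. F (a **\<^sub>H c) (b **\<^sub>H d)))"
proof -
let ?L = "pres_lift k W (%hs. F (hs ! 0) (hs ! 1))"
note L = lift2[OF W F]
have cl: "pur [a, b] .: tp 2" if "a .: H" "b .: H" for a b using that by (intro pure_in) auto
have f1: "(%s. ?L (tpow_mult k H 2 s (comult H h))) : Hom (tp 2) W" by (rule lin_comp[OF bilin2[OF tpow_mult_bilin comult_in[OF h]] L(1)])
have f2: "(%t. ?L (tpow_mult k H 2 (pur [a, b]) t)) : Hom (tp 2) W" if "a .: H" "b .: H" for a b
 by (rule lin_comp[OF bilin1[OF tpow_mult_bilin cl[OF that]] L(1)])
have "sw k H W (g **\<^sub>H h) F = ?L (tpow_mult k H 2 (comult H g) (comult H h))" using comult_mult[OF g h] by (simp add: sw_def)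
also have "... = sw k H W g (%a b. ?L (tpow_mult k H 2 (pur [a, b]) (comult H h)))" by (rule lin_comult[OF W f1 g])
also have "... = sw k H W g (%a b. sw k H W h (%c d. F (a **\<^sub>H c) (b **\<^sub>H d)))"
proof (rule sw_cong[OF W bilin_post[OF comult_as_sw(2)[OF g] f1] g])
 fix a b assume ab: "a .: H" "b .: H"
 have "?L (tpow_mult k H 2 (pur [a, b]) (comult H h)) = sw k H W h (%c d. ?L (tpow_mult k H 2 (pur [a, b]) (pur [c, d])))"
 by (rule lin_comult[OF W f2[OF ab] h])
 also have "... = sw k H W h (%c d. F (a **\<^sub>H c) (b **\<^sub>H d))"
 proof (rule sw_cong[OF W bilin_post[OF comult_as_sw(2)[OF g] f2[OF ab]] h])
 fix c d assume cd: "c .: H" "d .: H"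
 have "tpow_mult k H 2 (pur [a, b]) (pur [c, d]) = pur [a **\<^sub>H c, b **\<^sub>H d]"
  using ab cd tpow_mult_pure[of "[a, b]" 2 "[c, d]"] by simp
 then show "?L (tpow_mult k H 2 (pur [a, b]) (pur [c, d])) = F (a **\<^sub>H c) (b **\<^sub>H d)"
  using ab cd by (simp del: One_nat_def add: L(2) mult_in)
 qed
 finally show "?L (tpow_mult k H 2 (pur [a, b]) (comult H h)) = sw k H W h (%c d. F (a **\<^sub>H c) (b **\<^sub>H d))" .
qed
finally show ?thesis .
qed

lemma group_like_one: "group_like k H 1\<^sub>H" by (simp add: group_like_def comult_one counit_one)

lemma sw_antipode_left: "h .: H ==> sw k H H h (%a b. antipode H a **\<^sub>H b) = counit H h \<odot>\<^sub>H 1\<^sub>H"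
using antipode_left[of h] by (simp add: sw_def)

lemma sw_antipode_right: "h .: H ==> sw k H H h (%a b. a **\<^sub>H antipode H b) = counit H h \<odot>\<^sub>H 1\<^sub>H"
using antipode_right[of h] by (simp add: sw_def)

lemma tact_one:
assumes "t .: tp n"
shows "act n t 1\<^sub>H = t" using assms
proof (induction n arbitrary: t)
case 0
then show ?case using module.smult_one[OF Tm] by (simp add: counit_one)
next
case (Suc n)
have b: "bilin k H H (tp (Suc n)) (%a b. snc n (act n s a) (g **\<^sub>H b))"
 if "s .: tp n" "g .: H" for s g using that by (intro bilinI lin_intros' closed_intros')
show ?case
proof (rule tpow_Suc_ext[OF Cm Tm _ lin_id _ Suc.prems])
 show "(%t. act (Suc n) t 1\<^sub>H) : Hom (tp (Suc n)) (tp (Suc n))" by (intro lin_intros' closed_intros')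
 show "act (Suc n) (snc n s v) 1\<^sub>H = snc n s v"
 if "s .: tp n" "v .: H" for s v using that by (simp del: tact.simps add: tact_snoc one_closed' sw_group_like[OF Tm b group_like_one] Suc.IH)
qed
qed

lemma tact_mult:
assumes "t .: tp n" "g .: H" "h .: H"
shows "act n t (g **\<^sub>H h) = act n (act n t g) h" using assms
proof (induction n arbitrary: t g h)
case 0
then show ?case using comm_monoid.m_comm[OF cring.axioms(2)[OF module_cring[OF Cm]], of "counit H g" "counit H h"]
 by (simp add: counit_mult module.smult_assoc1[OF Tm, symmetric] counit_in)
next
case (Suc n)
let ?T = "tp (Suc n)"
note g = Suc.prems(2) and h = Suc.prems(3)
show ?case
proof (rule tpow_Suc_ext[OF Cm Tm _ _ _ Suc.prems(1)])
 show "(%t. act (Suc n) t (g **\<^sub>H h)) : Hom ?T ?T" by (intro lin_intros' closed_intros' g h)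
 show "(%t. act (Suc n) (act (Suc n) t g) h) : Hom ?T ?T" by (intro lin_intros' closed_intros' g h)
 fix s c assume s: "s .: tp n" and c: "c .: H"
 have b: "bilin k H H ?T (%a b. snc n (act n s a) (c **\<^sub>H b))" using s c by (intro bilinI lin_intros' closed_intros')
 have b2: "bilin k H H ?T (%a b. act (Suc n) (snc n (act n s a) (c **\<^sub>H b)) h)" using s c h by (intro bilinI lin_intros' closed_intros')
 have "act (Suc n) (snc n s c) (g **\<^sub>H h) =
 sw k H ?T g (%p q. sw k H ?T h (%a b. snc n (act n s (p **\<^sub>H a)) (c **\<^sub>H (q **\<^sub>H b))))"
 using s c g h by (simp del: tact.simps add: tact_snoc mult_in sw_mult[OF Tm b])
 also have "... = sw k H ?T g (%p q. act (Suc n) (snc n (act n s p) (c **\<^sub>H q)) h)"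
 proof (rule sw_cong[OF Tm b2 g, symmetric])
 fix p q assume p: "p .: H" and q: "q .: H"
 have "act (Suc n) (snc n (act n s p) (c **\<^sub>H q)) h =
  sw k H ?T h (%a b. snc n (act n (act n s p) a) ((c **\<^sub>H q) **\<^sub>H b))" using s c h p q by (intro tact_snoc closed_intros')
 also have "... = sw k H ?T h (%a b. snc n (act n s (p **\<^sub>H a)) (c **\<^sub>H (q **\<^sub>H b)))"
 proof (rule sw_cong[OF Tm _ h])
  show "bilin k H H ?T (%a b. snc n (act n (act n s p) a) ((c **\<^sub>H q) **\<^sub>H b))"
  using s c p q by (intro bilinI lin_intros' closed_intros')
 qed (use s c p q in "simp add: Suc.IH mult_assoc")
 finally show "act (Suc n) (snc n (act n s p) (c **\<^sub>H q)) h =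
  sw k H ?T h (%a b. snc n (act n s (p **\<^sub>H a)) (c **\<^sub>H (q **\<^sub>H b)))" .
 qed
 also have "... = act (Suc n) (sw k H ?T g (%p q. snc n (act n s p) (c **\<^sub>H q))) h"
 using h by (intro sw_post[OF Tm b g Tm, symmetric] lin_intros')
 also have "... = act (Suc n) (act (Suc n) (snc n s c) g) h" using s c g by (simp del: tact.simps add: tact_snoc)
 finally show "act (Suc n) (snc n s c) (g **\<^sub>H h) = act (Suc n) (act (Suc n) (snc n s c) g) h" .
qed
qed

lemma tact_group_like:
assumes x: "group_like k H x" and "length vs = n" "set vs <: H"
shows "act n (pur vs) x = pur (map (%v. v **\<^sub>H x) vs)" using assms(2,3)
proof (induction vs arbitrary: n rule: rev_induct)
case Nil
then show ?case using module.smult_one[OF Tm pure_in[of "[]" 0]] x by (simp add: group_like_def)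
next
case (snoc v vs)
have xc: "x .: H" using x by (simp add: group_like_def)
from snoc.prems have n: "n = Suc (length vs)" and vs: "set vs <: H" "v .: H" by auto
have b: "bilin k H H (tp n) (%a b. snc (length vs) (act (length vs) (pur vs) a) (v **\<^sub>H b))"
 unfolding n using vs by (intro bilinI lin_intros' closed_intros' pure_in refl)
have "act n (pur (vs @ [v])) x = act n (snc (length vs) (pur vs) v) x" using vs by (simp add: tsnoc_pure[OF Cm])
also have "... = snc (length vs) (act (length vs) (pur vs) x) (v **\<^sub>H x)"
 using vs xc sw_group_like[OF Tm b x] pure_in[OF refl vs(1)] by (simp del: tact.simps add: tact_snoc n)
also have "... = pur (map (%v. v **\<^sub>H x) (vs @ [v]))"
proof -
 have "set (map (%v. v **\<^sub>H x) vs) <: H" "v **\<^sub>H x .: H" using vs xc mult_in by auto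
 then show ?thesis using vs by (simp del: set_map add: snoc.IH tsnoc_pure[OF Cm])
qed
finally show ?case .
qed

lemma tact_Suc_0:
assumes g: "g .: H" and h: "h .: H" and s: "s .: tp 0"
shows "act (Suc 0) (snc 0 s g) h = snc 0 s (g **\<^sub>H h)"
proof -
have "act (Suc 0) (snc 0 s g) h = sw k H (tp (Suc 0)) h (%a b. snc 0 (counit H a \<odot>\<^sub>(tp 0) s) (g **\<^sub>H b))"
 using tact_snoc[OF s g h] by simp
also have "... = sw k H (tp (Suc 0)) h (%a b. counit H a \<odot>\<^sub>(tp (Suc 0)) snc 0 s (g **\<^sub>H b))"
proof (rule sw_cong[OF Tm _ h])
 show "bilin k H H (tp (Suc 0)) (%a b. snc 0 (counit H a \<odot>\<^sub>(tp 0) s) (g **\<^sub>H b))"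
 using s g by (intro bilinI lin_intros' closed_intros' module.smult_closed[OF Tm])
qed (use s g in "simp add: lin_smult[OF bilin2[OF tsnoc_bilin[OF Cm]]] counit_in mult_in")
also have "... = snc 0 s (g **\<^sub>H h)" using s g by (intro sw_counit1[OF Tm _ h] lin_intros')
finally show ?thesis .
qed

text \<open>The diagonal action can also be computed from the first tensor factor; this uses coassociativity.\<close>

lemma tact_cons:
assumes "t .: tp n" "g .: H" "h .: H"
shows "act (Suc n) (cns n g t) h = sw k H (tp (Suc n)) h (%a b. cns n (g **\<^sub>H a) (act n t b))" using assms
proof (induction n arbitrary: t h)
case 0
let ?T = "tp (Suc 0)"
have l1: "(%t. sw k H ?T h (%a b. cns 0 (g **\<^sub>H a) (act 0 t b))) : Hom (tp 0) ?T" by (intro sw_param bilinI lin_intros' closed_intros' 0(2,3))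
have l2: "(%t. act (Suc 0) (cns 0 g t) h) : Hom (tp 0) ?T" by (intro L_act1 L_cons2 lin_id 0(2,3))
show ?case
proof (rule tpow_ext[OF Cm Tm l2 l1 _ 0(1)])
 fix vs assume "length vs = 0" "set vs <: H"
 then have vs: "vs = []" by simp
 let ?e = "pur []"
 have e: "?e .: tp 0" by (intro pure_in) auto
 have c: "cns 0 v ?e = snc 0 ?e v" if "v .: H" for v using that by (simp add: tcons_pure[OF Cm] tsnoc_pure[OF Cm])
 have "sw k H ?T h (%a b. cns 0 (g **\<^sub>H a) (act 0 ?e b)) =
  sw k H ?T h (%a b. counit H b \<odot>\<^sub>?T cns 0 (g **\<^sub>H a) ?e)"
 proof (rule sw_cong[OF Tm _ 0(3)])
 show "bilin k H H ?T (%a b. cns 0 (g **\<^sub>H a) (act 0 ?e b))" by (intro bilinI lin_intros' closed_intros' 0(2) e)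
 qed (use 0(2) e in "simp add: lin_smult[OF bilin1[OF tcons_bilin[OF Cm]]] counit_in mult_in")
 also have "... = cns 0 (g **\<^sub>H h) ?e" by (intro sw_counit2[OF Tm _ 0(3)] lin_intros' closed_intros' 0(2) e)
 finally show "act (Suc 0) (cns 0 g (pur vs)) h =
  sw k H ?T h (%a b. cns 0 (g **\<^sub>H a) (act 0 (pur vs) b))" using 0 e by (simp del: tact.simps add: vs c tact_Suc_0 mult_in)
qed
next
case (Suc n)
let ?T = "tp (Suc (Suc n))"
note g = Suc.prems(2) and h = Suc.prems(3)
show ?case
proof (rule tpow_Suc_ext[OF Cm Tm _ _ _ Suc.prems(1)])
 show "(%t. act (Suc (Suc n)) (cns (Suc n) g t) h) : Hom (tp (Suc n)) ?T" by (intro L_act1 L_cons2 lin_id g h)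
 show "(%t. sw k H ?T h (%a b. cns (Suc n) (g **\<^sub>H a) (act (Suc n) t b))) : Hom (tp (Suc n)) ?T"
 by (intro sw_param bilinI lin_intros' closed_intros' g h)
 fix s c assume s: "s .: tp n" and c: "c .: H"
 have "act (Suc (Suc n)) (cns (Suc n) g (snc n s c)) h
  = act (Suc (Suc n)) (snc (Suc n) (cns n g s) c) h" using s c g by (simp del: tact.simps add: tcons_tsnoc[OF Cm])
 also have "... = sw k H ?T h (%a b. snc (Suc n) (act (Suc n) (cns n g s) a) (c **\<^sub>H b))" using s c g h by (intro tact_snoc closed_intros')
 also have "... = sw k H ?T h (%a b. sw k H ?T a (%p q. snc (Suc n) (cns n (g **\<^sub>H p) (act n s q)) (c **\<^sub>H b)))"
 proof (rule sw_cong[OF Tm _ h])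
 show "bilin k H H ?T (%a b. snc (Suc n) (act (Suc n) (cns n g s) a) (c **\<^sub>H b))" using s c g by (intro bilinI lin_intros' closed_intros')
 fix a b assume a: "a .: H" and b: "b .: H"
 have bb: "bilin k H H (tp (Suc n)) (%p q. cns n (g **\<^sub>H p) (act n s q))" using s g by (intro bilinI lin_intros' closed_intros')
 show "snc (Suc n) (act (Suc n) (cns n g s) a) (c **\<^sub>H b) =
  sw k H ?T a (%p q. snc (Suc n) (cns n (g **\<^sub>H p) (act n s q)) (c **\<^sub>H b))"
  unfolding Suc.IH[OF s g a] using c b by (intro sw_post[OF Tm bb a Tm] lin_intros' closed_intros')
 qed
 also have "... = sw k H ?T h (%a b. sw k H ?T b (%p q. snc (Suc n) (cns n (g **\<^sub>H a) (act n s p)) (c **\<^sub>H q)))"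
 using s c g by (intro sw_coassoc[OF Tm _ _ _ h] lin_intros' closed_intros')
 also have "... = sw k H ?T h (%a b. cns (Suc n) (g **\<^sub>H a) (act (Suc n) (snc n s c) b))"
 proof (rule sw_cong[OF Tm _ h, symmetric])
 show "bilin k H H ?T (%a b. cns (Suc n) (g **\<^sub>H a) (act (Suc n) (snc n s c) b))" using s c g by (intro bilinI lin_intros' closed_intros')
 fix a b assume a: "a .: H" and b: "b .: H"
 have bb: "bilin k H H (tp (Suc n)) (%p q. snc n (act n s p) (c **\<^sub>H q))" using s c by (intro bilinI lin_intros' closed_intros')
 have "cns (Suc n) (g **\<^sub>H a) (act (Suc n) (snc n s c) b) =
  sw k H ?T b (%p q. cns (Suc n) (g **\<^sub>H a) (snc n (act n s p) (c **\<^sub>H q)))"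
  unfolding tact_snoc[OF s c b] using g a by (intro sw_post[OF Tm bb b Tm] lin_intros' closed_intros')
 also have "... = sw k H ?T b (%p q. snc (Suc n) (cns n (g **\<^sub>H a) (act n s p)) (c **\<^sub>H q))"
 proof (rule sw_cong[OF Tm _ b])
  show "bilin k H H ?T (%p q. cns (Suc n) (g **\<^sub>H a) (snc n (act n s p) (c **\<^sub>H q)))"
  using s c g a by (intro bilinI lin_intros' closed_intros')
 qed (use s c g a in "simp add: tcons_tsnoc[OF Cm] closed_intros'")
 finally show "cns (Suc n) (g **\<^sub>H a) (act (Suc n) (snc n s c) b) =
  sw k H ?T b (%p q. snc (Suc n) (cns n (g **\<^sub>H a) (act n s p)) (c **\<^sub>H q))" .
 qed
 finally show "act (Suc (Suc n)) (cns (Suc n) g (snc n s c)) h =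
 sw k H ?T h (%a b. cns (Suc n) (g **\<^sub>H a) (act (Suc n) (snc n s c) b))" .
qed
qed

lemma comult_iter_in: "h .: H ==> comult_iter k H n h .: tp (Suc n)"
and comult_iter_lin: "(%h. comult_iter k H n h) : Hom H (tp (Suc n))"
proof -
show l: "(%h. comult_iter k H n h) : Hom H (tp (Suc n))"
proof (induction n)
 case 0
 show ?case using multilin_slot[OF tpow_pure_multilin[OF Cm], of "[]" "[]" "Suc 0"] by simp
next
 case (Suc n)
 show ?case using lin_comp[OF Suc comult_at(1)[of 0 "Suc n"]] by simp
qed
show "h .: H ==> comult_iter k H n h .: tp (Suc n)" by (rule lin_in[OF l])
qed

lemma comult_at_0_snoc:
assumes t: "t .: tp (Suc n)" and b: "b .: H"
shows "comult_at k H (Suc (Suc n)) 0 (snc (Suc n) t b) = snc (Suc (Suc n)) (comult_at k H (Suc n) 0 t) b"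
proof (rule tpow_ext[OF Cm Tm _ _ _ t])
note ca = comult_at(1)[of 0 "Suc n"] comult_at(1)[of 0 "Suc (Suc n)"]
show "(%t. comult_at k H (Suc (Suc n)) 0 (snc (Suc n) t b)) : Hom (tp (Suc n)) (tp (Suc (Suc (Suc n))))"
 using lin_comp[OF L_snoc1[OF lin_id b] ca(2)] by simp
show "(%t. snc (Suc (Suc n)) (comult_at k H (Suc n) 0 t) b) : Hom (tp (Suc n)) (tp (Suc (Suc (Suc n))))" using L_snoc1[OF ca(1) b] by simp
fix vs assume vs: "length vs = Suc n" "set vs <: H"
then obtain c cs where c: "vs = c # cs" "length cs = n" "c .: H" "set cs <: H" by (cases vs) auto
have bl: "bilin k H H (tp (Suc (Suc n))) (%p q. pur ([] @ [p, q] @ cs))" using c by (intro comult_at_inner(1)) auto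
have "snc (Suc (Suc n)) (comult_at k H (Suc n) 0 (pur vs)) b =
 snc (Suc (Suc n)) (sw k H (tp (Suc (Suc n))) c (%p q. pur ([] @ [p, q] @ cs))) b" using comult_at(2)[of 0 "Suc n" vs] vs c by simp
also have "... = sw k H (tp (Suc (Suc (Suc n)))) c (%p q. snc (Suc (Suc n)) (pur ([] @ [p, q] @ cs)) b)"
 by (intro sw_post[OF Tm bl c(3) Tm] L_snoc1 lin_id b)
also have "... = sw k H (tp (Suc (Suc (Suc n)))) c (%p q. pur ([p, q] @ cs @ [b]))"
 using c b by (intro sw_cong[OF Tm bilin_post[OF bl L_snoc1[OF lin_id b]] c(3)]) (simp add: tsnoc_pure[OF Cm])
also have "... = comult_at k H (Suc (Suc n)) 0 (pur (vs @ [b]))" using comult_at(2)[of 0 "Suc (Suc n)" "vs @ [b]"] vs c b by simp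
finally show "comult_at k H (Suc (Suc n)) 0 (snc (Suc n) (pur vs) b) =
 snc (Suc (Suc n)) (comult_at k H (Suc n) 0 (pur vs)) b" using vs b by (simp add: tsnoc_pure[OF Cm])
qed

lemma comult_iter_snoc:
assumes h: "h .: H"
shows "comult_iter k H (Suc n) h = sw k H (tp (Suc (Suc n))) h (%a b. snc (Suc n) (comult_iter k H n a) b)"
proof -
have bl: "bilin k H H (tp (Suc (Suc n))) (%a b. snc (Suc n) (comult_iter k H n a) b)" for n
 by (intro bilinI lin_intros comult_iter_lin comult_iter_in)
show ?thesis
proof (induction n)
 case 0
 have b2: "bilin k H H (tp (Suc (Suc 0))) (%a b. pur [a, b])" using comult_as_sw(2)[OF h] by (simp add: numeral_2_eq_2)
 have "comult_iter k H (Suc 0) h = sw k H (tp (Suc (Suc 0))) h (%a b. pur [a, b])" using comult_at(2)[of 0 "Suc 0" "[h]"] h by simp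
 also have "... = sw k H (tp (Suc (Suc 0))) h (%a b. snc (Suc 0) (comult_iter k H 0 a) b)"
 by (intro sw_cong[OF Tm b2 h]) (simp add: tsnoc_pure[OF Cm])
 finally show ?case .
next
 case (Suc n)
 have "comult_iter k H (Suc (Suc n)) h = comult_at k H (Suc (Suc n)) 0 (sw k H (tp (Suc (Suc n))) h (%a b. snc (Suc n) (comult_iter k H n a) b))"
 using Suc by simp
 also have "... = sw k H (tp (Suc (Suc (Suc n)))) h (%a b. comult_at k H (Suc (Suc n)) 0 (snc (Suc n) (comult_iter k H n a) b))"
 by (intro sw_post[OF Tm bl h Tm] comult_at(1)) simp
 also have "... = sw k H (tp (Suc (Suc (Suc n)))) h (%a b. snc (Suc (Suc n)) (comult_iter k H (Suc n) a) b)"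
 by (intro sw_cong[OF Tm bilin_post[OF bl comult_at(1)] h]) (simp_all add: comult_at_0_snoc comult_iter_in)
 finally show ?case .
qed
qed

lemma tact_tpow_mult:
assumes "t .: tp (Suc n)" "h .: H"
shows "tpow_mult k H (Suc n) t (comult_iter k H n h) = act (Suc n) t h" using assms
proof (induction n arbitrary: t h)
case 0
note h = 0(2)
let ?e = "pur []"
have e: "?e .: tp 0" by (intro pure_in) auto
have he: "comult_iter k H 0 h = snc 0 ?e h" using h by (simp add: tsnoc_pure[OF Cm])
have id: "tpow_mult k H 0 s ?e = s" if "s .: tp 0" for s
 by (rule tpow_ext[OF Cm Tm bilin2[OF tpow_mult_bilin e] lin_id _ that]) (simp add: tpow_mult_pure)
show ?case
proof (rule tpow_Suc_ext[OF Cm Tm bilin2[OF tpow_mult_bilin comult_iter_in[OF h]] bilin2[OF tact_bilin h] _ 0(1)])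
 show "tpow_mult k H (Suc 0) (snc 0 s v) (comult_iter k H 0 h) = act (Suc 0) (snc 0 s v) h"
 if "s .: tp 0" "v .: H" for s v unfolding he using that e h by (simp del: tact.simps add: tpow_mult_snoc id tact_Suc_0)
qed
next
case (Suc n)
note h = Suc(3)
let ?T = "tp (Suc (Suc n))"
have bl: "bilin k H H ?T (%a b. snc (Suc n) (comult_iter k H n a) b)" by (intro bilinI lin_intros comult_iter_lin comult_iter_in)
show ?case
proof (rule tpow_Suc_ext[OF Cm Tm bilin2[OF tpow_mult_bilin comult_iter_in[OF h]] bilin2[OF tact_bilin h] _ Suc(2)])
 fix s v assume s: "s .: tp (Suc n)" and v: "v .: H"
 note m = bilin1[OF tpow_mult_bilin tsnoc_in[OF s v]]
 have "tpow_mult k H (Suc (Suc n)) (snc (Suc n) s v) (comult_iter k H (Suc n) h) =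
 sw k H ?T h (%a b. tpow_mult k H (Suc (Suc n)) (snc (Suc n) s v) (snc (Suc n) (comult_iter k H n a) b))"
 unfolding comult_iter_snoc[OF h] by (rule sw_post[OF Tm bl h Tm m])
 also have "... = sw k H ?T h (%a b. snc (Suc n) (act (Suc n) s a) (v **\<^sub>H b))"
 by (intro sw_cong[OF Tm bilin_post[OF bl m] h]) (simp del: tact.simps add: tpow_mult_snoc s v comult_iter_in Suc.IH)
 also have "... = act (Suc (Suc n)) (snc (Suc n) s v) h" by (rule tact_snoc[OF s v h, symmetric])
 finally show "tpow_mult k H (Suc (Suc n)) (snc (Suc n) s v) (comult_iter k H (Suc n) h) =
  act (Suc (Suc n)) (snc (Suc n) s v) h" .
qed
qed

lemma diag_mod_simps [simp]:
"carrier (diag_mod k H n) = carrier (tp n)" "0\<^sub>(diag_mod k H n) = 0\<^sub>(tp n)"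
"s +\<^sub>(diag_mod k H n) t = s +\<^sub>(tp n) t" "a \<odot>\<^sub>(diag_mod k H n) t = a \<odot>\<^sub>(tp n) t"
by (simp_all add: diag_mod_def module.defs)

lemma diag_mod_ract [simp]:
"t .: tp (Suc n) ==> h .: H ==> ract (diag_mod k H (Suc n)) t h = act (Suc n) t h"
using tact_tpow_mult by (simp add: diag_mod_def module.defs right_mod.defs)

lemma diag_mod_module: "module k (diag_mod k H n)" by (rule module_surj_image[where V = "tp n" and q = "%v. v"]) (auto simp: Tm intro!: lin_homI)

lemma diag_rmod: "right_module k H (diag_mod k H (Suc n))"
proof -
note bl = tact_bilin[of "Suc n"]
show ?thesis by (intro right_module.intro right_module_axioms.intro assoc_algebra_axioms diag_mod_module)
 (simp_all del: tact.simps add: tact_in tact_one tact_mult mult_in one_closed'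
  module.smult_closed[OF Tm] module.smult_closed[OF Cm] abelian_groupE(1)[OF module.axioms(2)[OF Tm]]
  abelian_groupE(1)[OF module.axioms(2)[OF Cm]]
  lin_add[OF bilin1[OF bl]] lin_add[OF bilin2[OF bl]]
  lin_smult[OF bilin1[OF bl]] lin_smult[OF bilin2[OF bl]])
qed

end

section \<open>Group-like elements of infinite order act freely\<close>

lemma smult_eq_zero:
assumes k: "field k" and V: "module k V" and "a .: k" "v .: V" "a \<odot>\<^sub>V v = 0\<^sub>V" "v ~= 0\<^sub>V"
shows "a = 0\<^sub>k"
proof (rule ccontr)
interpret k: field k by fact
interpret V: module k V by fact
assume "a ~= 0\<^sub>k"
then have "inv\<^bsub>k\<^esub> a .: k" "inv\<^bsub>k\<^esub> a **\<^sub>k a = 1\<^sub>k" using assms(3) k.field_Units by auto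
then have "v = inv\<^bsub>k\<^esub> a \<odot>\<^sub>V (a \<odot>\<^sub>V v)" using assms(3,4) by (simp add: V.smult_assoc1[symmetric])
then show False using \<open>inv\<^bsub>k\<^esub> a .: k\<close> assms(5,6) by simp
qed

lemma submodule_preimage:
assumes f: "f : lin_hom k V W" and V: "module k V" and W: "module k W" and S: "submodule S k W"
shows "submodule {v \<in> carrier V. f v \<in> S} k V"
proof -
interpret V: module k V by fact
show ?thesis
proof (rule V.submoduleI)
 show "0\<^sub>V \<in> {v \<in> carrier V. f v \<in> S}" using submodule_zero[OF W S] by (simp add: lin_zero[OF f V W])
 show "-\<^sub>V a \<in> {v \<in> carrier V. f v \<in> S}" if "a \<in> {v \<in> carrier V. f v \<in> S}" for a
 using that module.submoduleE(3)[OF W S] by (simp add: lin_minus[OF f V W])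
 show "a +\<^sub>V b \<in> {v \<in> carrier V. f v \<in> S}" if "a \<in> {v \<in> carrier V. f v \<in> S}" "b \<in> {v \<in> carrier V. f v \<in> S}" for a b
 using that module.submoduleE(5)[OF W S] by (simp add: lin_add[OF f])
 show "a \<odot>\<^sub>V b \<in> {v \<in> carrier V. f v \<in> S}" if "a .: k" "b \<in> {v \<in> carrier V. f v \<in> S}" for a b
 using that module.submoduleE(4)[OF W S] by (simp add: lin_smult[OF f])
qed auto
qed

lemma submodule_singleton_zero: "module k V ==> submodule {0\<^sub>V} k V"
proof -
assume "module k V"
then interpret V: module k V .
show ?thesis by (rule V.submoduleI) auto
qed

lemma tpow_Suc_induct:
assumes V: "module k V" and S: "submodule S k (tpow k V (Suc n))"
 and gen: "!!s v. s .: tpow k V n ==> v .: V ==> tsnoc k V n s v \<in> S"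
 and t: "t .: tpow k V (Suc n)"
shows "t \<in> S"
proof (rule tpow_induct[OF V S _ t])
fix vs assume vs: "length vs = Suc n" "set vs <: V"
then have "vs ~= []" by auto
then obtain ws v where ws: "vs = ws @ [v]" by (metis append_butlast_last_id)
then have "length ws = n" "set ws <: V" "v .: V" using vs by auto
then show "tpow_pure k V vs \<in> S" using gen[OF tpow_pure_in[OF V], of ws v] by (simp add: ws tsnoc_pure[OF V])
qed

text \<open>Coordinates of \<open>V\<^sup>\<otimes>\<^sup>n \<otimes> V\<close> with respect to a basis of \<open>V\<^sup>\<otimes>\<^sup>n\<close>.\<close>

lemma tpow_Suc_coordinates:
assumes k: "field k" and V: "module k V"
shows "\<exists>C. (\<forall>e. C e : lin_hom k (tpow k V (Suc n)) V) &
 (\<forall>e. \<exists>c\<in>lin_hom k (tpow k V n) (base_mod k). \<forall>s\<in>carrier (tpow k V n). \<forall>v\<in>carrier V. C e (tsnoc k V n s v) = c s \<odot>\<^sub>V v) &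
 (\<forall>w\<in>carrier (tpow k V (Suc n)). \<exists>E. finite E & E <: tpow k V n & (\<forall>e. e \<notin> E --> C e w = 0\<^sub>V) &
 w = (\<Oplus>\<^bsub>tpow k V (Suc n)\<^esub>e\<in>E. tsnoc k V n e (C e w)))"
proof -
interpret V: module k V by fact
let ?S = "tpow k V n" and ?T = "tpow k V (Suc n)"
note Tm = tpow_module[OF V]
interpret S: module k ?S by (rule Tm)
interpret T: module k ?T by (rule Tm)
note sb = tsnoc_bilin[OF V]
obtain c where c: "!!b. c b : lin_hom k ?S (base_mod k)"
 and fin: "!!w. w .: ?S ==> finite {b. c b w ~= 0\<^sub>k}"
 and sub: "!!w. w .: ?S ==> {b. c b w ~= 0\<^sub>k} <: ?S"
 and exp: "!!w. w .: ?S ==> w = (\<Oplus>\<^bsub>?S\<^esub>b\<in>{b. c b w ~= 0\<^sub>k}. c b w \<odot>\<^sub>?S b)"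
 by (rule exists_basis[OF k Tm]) blast
have ck: "c e s .: k" if "s .: ?S" for e s using lin_in[OF c that] by simp
have cb: "bilin k ?S V V (%s v. c e s \<odot>\<^sub>V v)" for e by (intro bilinI lin_scale lin_smult_vec lin_id V c ck)
define C where "C e = tlast_lift k V V (%s v. c e s \<odot>\<^sub>V v)" for e
have C: "C e : lin_hom k ?T V"
 and Cs: "s .: ?S ==> v .: V ==> C e (tsnoc k V n s v) = c e s \<odot>\<^sub>V v" for e s v unfolding C_def using tlast_lift[OF V V cb] by blast+
define R where "R E w = (\<Oplus>\<^bsub>?T\<^esub>e\<in>E. tsnoc k V n e (C e w))" for E w
have R: "R E : lin_hom k ?T ?T" if "finite E" "E <: ?S" for E
 unfolding R_def[abs_def] using that by (intro lin_finsum_map Tm bilin_comp1[OF sb C]) auto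
define good where "good E w \<longleftrightarrow> finite E & E <: ?S & (\<forall>e. e \<notin> E --> C e w = 0\<^sub>V) &
 (\<forall>G. finite G --> E \<subseteq> G --> G <: ?S --> R G w = w)" for E w
have sm: "submodule {w \<in> carrier ?T. \<exists>E. good E w} k ?T"
proof (rule T.submoduleI)
 have "good {} 0\<^sub>?T" using lin_zero[OF R Tm Tm] lin_zero[OF C Tm V] by (simp add: good_def)
 then show "0\<^sub>?T \<in> {w \<in> carrier ?T. \<exists>E. good E w}" by auto
 show "-\<^sub>?T u \<in> {w \<in> carrier ?T. \<exists>E. good E w}" if u: "u \<in> {w \<in> carrier ?T. \<exists>E. good E w}" for u
 proof -
 from u obtain E where E: "u .: ?T" "good E u" by blast
 then have "good E (-\<^sub>?T u)" using lin_minus[OF R Tm Tm] lin_minus[OF C Tm V] by (simp add: good_def)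
 then show ?thesis using E(1) by auto
 qed
 show "a \<odot>\<^sub>?T u \<in> {w \<in> carrier ?T. \<exists>E. good E w}" if a: "a .: k" and u: "u \<in> {w \<in> carrier ?T. \<exists>E. good E w}" for a u
 proof -
 from u obtain E where E: "u .: ?T" "good E u" by blast
 then have "good E (a \<odot>\<^sub>?T u)" using a lin_smult[OF R] lin_smult[OF C] by (simp add: good_def)
 then show ?thesis using E(1) a by auto
 qed
 show "u +\<^sub>?T v \<in> {w \<in> carrier ?T. \<exists>E. good E w}"
 if u: "u \<in> {w \<in> carrier ?T. \<exists>E. good E w}" and v: "v \<in> {w \<in> carrier ?T. \<exists>E. good E w}" for u v
 proof -
 from u obtain E where E: "u .: ?T" "good E u" by blast
 from v obtain F where F: "v .: ?T" "good F v" by blast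
 have "good (E \<union> F) (u +\<^sub>?T v)" using E F lin_add[OF R] lin_add[OF C] by (simp add: good_def)
 then show ?thesis using E(1) F(1) by auto
 qed
qed auto
have gen: "tsnoc k V n s v \<in> {w \<in> carrier ?T. \<exists>E. good E w}" if s: "s .: ?S" and v: "v .: V" for s v
proof -
 let ?E = "{b. c b s ~= 0\<^sub>k}"
 have "R G (tsnoc k V n s v) = tsnoc k V n s v" if G: "finite G" "?E \<subseteq> G" "G <: ?S" for G
 proof -
 have "c e s \<odot>\<^sub>?S e .: ?S" if "e \<in> G" for e using that G(3) ck[OF s] by auto
 then have cl: "(%e. c e s \<odot>\<^sub>?S e) \<in> G \<rightarrow> carrier ?S" by auto
 have "R G (tsnoc k V n s v) = (\<Oplus>\<^bsub>?T\<^esub>e\<in>G. tsnoc k V n (c e s \<odot>\<^sub>?S e) v)" unfolding R_def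
 proof (rule T.finsum_cong')
  fix e assume "e \<in> G"
  then have "e .: ?S" using G by auto
  then show "tsnoc k V n e (C e (tsnoc k V n s v)) = tsnoc k V n (c e s \<odot>\<^sub>?S e) v"
  using s v ck by (simp add: Cs lin_smult[OF bilin1[OF sb]] lin_smult[OF bilin2[OF sb]])
 next
  show "(%e. tsnoc k V n (c e s \<odot>\<^sub>?S e) v) \<in> G \<rightarrow> carrier ?T" using cl v bilin_in[OF sb] by auto
 qed simp
 also have "... = tsnoc k V n (\<Oplus>\<^bsub>?S\<^esub>e\<in>G. c e s \<odot>\<^sub>?S e) v"
  using lin_finsum[OF bilin2[OF sb v] Tm Tm G(1) cl] by simp
 also have "(\<Oplus>\<^bsub>?S\<^esub>e\<in>G. c e s \<odot>\<^sub>?S e) = (\<Oplus>\<^bsub>?S\<^esub>e\<in>?E. c e s \<odot>\<^sub>?S e)"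
  by (rule S.add.finprod_mono_neutral_cong_right[OF G(1,2)]) (use G(3) cl in auto)
 also have "... = s" using exp[OF s] by simp
 finally show ?thesis .
 qed
 moreover have "C e (tsnoc k V n s v) = 0\<^sub>V" if "e \<notin> ?E" for e using that s v by (simp add: Cs)
 ultimately have "good ?E (tsnoc k V n s v)" using fin[OF s] sub[OF s] by (simp add: good_def)
 then show ?thesis using bilin_in[OF sb s v] by auto
qed
have "\<exists>E. finite E & E <: ?S & (\<forall>e. e \<notin> E --> C e w = 0\<^sub>V) & w = (\<Oplus>\<^bsub>?T\<^esub>e\<in>E. tsnoc k V n e (C e w))"
 if w: "w .: ?T" for w
proof -
 have "w \<in> {w \<in> carrier ?T. \<exists>E. good E w}" by (rule tpow_Suc_induct[OF V sm gen w])
 then obtain E where "good E w" by blast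
 then show ?thesis by (intro exI[of _ E]) (simp add: good_def R_def)
qed
moreover have "\<forall>e. \<exists>c\<in>lin_hom k ?S (base_mod k). \<forall>s\<in>carrier ?S. \<forall>v\<in>carrier V. C e (tsnoc k V n s v) = c s \<odot>\<^sub>V v"
 using c Cs by blast
ultimately show ?thesis using C by (intro exI[of _ C]) blast
qed

context coalgebra
begin

lemma kf: "field k" by (rule field_axioms)

text \<open>\<open>cut f h\<close> is \<open>(f \<otimes> id) \<Delta>(h)\<close>.\<close>

definition cut :: "('c => 'k) => 'c => 'c" where
"cut f h = sw k C C h (%a b. f a \<odot>\<^sub>C b)"

lemma cut_bilin: "f : lin_hom k C (base_mod k) ==> bilin k C C C (%a b. f a \<odot>\<^sub>C b)" using lin_in[of f k C "base_mod k"]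
by (intro bilinI lin_smult_vec lin_scale lin_id Cm) simp_all

lemma cut_lin: "f : lin_hom k C (base_mod k) ==> cut f : lin_hom k C C" unfolding cut_def by (intro sw_lin Cm cut_bilin lin_id)

lemma cut_group_like: "f : lin_hom k C (base_mod k) ==> group_like k C g ==> cut f g = f g \<odot>\<^sub>C g"
unfolding cut_def by (rule sw_group_like[OF Cm cut_bilin])

lemma sw_add:
assumes W: "module k W" and F: "bilin k C C W F" and G: "bilin k C C W G" and h: "h .: C"
shows "sw k C W h (%a b. F a b +\<^sub>W G a b) = sw k C W h F +\<^sub>W sw k C W h G"
proof -
have FG: "bilin k C C W (%a b. F a b +\<^sub>W G a b)" by (intro bilinI lin_sum W bilin1[OF F] bilin1[OF G] bilin2[OF F] bilin2[OF G])
show ?thesis unfolding sw_def by (rule tpow2_ext[OF W lift2(1)[OF W FG] lin_sum[OF lift2(1)[OF W F] lift2(1)[OF W G] W] _ comult_in[OF h]])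
 (simp del: One_nat_def add: lift2(2)[OF W F] lift2(2)[OF W G] lift2(2)[OF W FG])
qed

text \<open>A basis of the left factors gives coordinates for \<open>\<Delta>(h)\<close> of the form \<open>(f \<otimes> id) \<Delta>(h)\<close>.\<close>

lemma comult_expansion:
assumes h: "h .: C"
shows "\<exists>c E. (\<forall>e. c e : lin_hom k C (base_mod k)) & finite E & E <: tpow k C (Suc 0) &
 comult C h = (\<Oplus>\<^bsub>tpow k C 2\<^esub>e\<in>E. tsnoc k C (Suc 0) e (cut (c e) h))"
proof -
let ?S = "tpow k C (Suc 0)"
have two: "tpow k C (Suc (Suc 0)) = tpow k C 2" by (simp add: numeral_2_eq_2)
from tpow_Suc_coordinates[OF kf Cm, of "Suc 0"] obtain L where L: "\<forall>e. L e : lin_hom k (tpow k C 2) C"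
 and d: "\<forall>e. \<exists>d\<in>lin_hom k ?S (base_mod k). \<forall>s\<in>carrier ?S. \<forall>v\<in>carrier C. L e (tsnoc k C (Suc 0) s v) = d s \<odot>\<^sub>C v"
 and ex: "\<forall>w\<in>carrier (tpow k C 2). \<exists>E. finite E & E <: ?S & (\<forall>e. e \<notin> E --> L e w = 0\<^sub>C) &
 w = (\<Oplus>\<^bsub>tpow k C 2\<^esub>e\<in>E. tsnoc k C (Suc 0) e (L e w))" unfolding two by (elim exE conjE)
from d have "\<forall>e. \<exists>d. d : lin_hom k ?S (base_mod k) & (\<forall>s\<in>carrier ?S. \<forall>v\<in>carrier C. L e (tsnoc k C (Suc 0) s v) = d s \<odot>\<^sub>C v)"
 by blast
from choice[OF this] obtain d where d: "!!e. d e : lin_hom k ?S (base_mod k)"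
 and Ld: "!!e s v. s .: ?S ==> v .: C ==> L e (tsnoc k C (Suc 0) s v) = d e s \<odot>\<^sub>C v" by blast
define c where "c e a = d e (tpow_pure k C [a])" for e a
have "(%a. tpow_pure k C ([] @ a # [])) : lin_hom k C ?S" by (rule multilin_slot[OF tpow_pure_multilin[OF Cm]]) auto
then have c: "c e : lin_hom k C (base_mod k)" for e unfolding c_def[abs_def] using lin_comp[OF _ d] by simp
have Lh: "L e (comult C h) = cut (c e) h" for e unfolding cut_def lin_comult[OF Cm L[rule_format] h]
proof (rule sw_cong[OF Cm cut_bilin[OF c] h, symmetric])
 fix a b assume a: "a .: C" and b: "b .: C"
 show "c e a \<odot>\<^sub>C b = L e (tpow_pure k C [a, b])"
 using Ld[OF pure_in b, of "[a]" e] tsnoc_pure[OF Cm, of "[a]" "Suc 0" b] a b by (simp add: c_def)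
qed
from ex comult_in[OF h] obtain E where "finite E" "E <: ?S"
 and "comult C h = (\<Oplus>\<^bsub>tpow k C 2\<^esub>e\<in>E. tsnoc k C (Suc 0) e (L e (comult C h)))" by (elim ballE exE conjE) auto
then show ?thesis using c unfolding Lh by blast
qed

lemma lift2_snoc:
assumes W: "module k W" and F: "bilin k C C W F" and S: "submodule S k W" and w: "w .: C"
 and FS: "!!a. a .: C ==> F a w \<in> S" and e: "e .: tpow k C (Suc 0)"
shows "pres_lift k W (%hs. F (hs ! 0) (hs ! 1)) (tsnoc k C (Suc 0) e w) \<in> S"
proof -
let ?L = "pres_lift k W (%hs. F (hs ! 0) (hs ! 1))"
note L = lift2[OF W F]
have l: "(%e. ?L (tsnoc k C (Suc 0) e w)) : lin_hom k (tpow k C (Suc 0)) W"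
 using lin_comp[OF bilin2[OF tsnoc_bilin[OF Cm, of "Suc 0"] w]] L(1) by (simp add: numeral_2_eq_2)
have "e \<in> {e \<in> carrier (tpow k C (Suc 0)). ?L (tsnoc k C (Suc 0) e w) \<in> S}"
proof (rule tpow_induct[OF Cm submodule_preimage[OF l Tm W S] _ e])
 fix vs assume "length vs = Suc 0" "set vs <: C"
 then obtain a where a: "vs = [a]" "a .: C" by (auto simp: length_Suc_conv)
 then show "tpow_pure k C vs \<in> {e \<in> carrier (tpow k C (Suc 0)). ?L (tsnoc k C (Suc 0) e w) \<in> S}"
 using FS[OF a(2)] L(2)[OF a(2) w] w by (simp del: One_nat_def add: tsnoc_pure[OF Cm] pure_in)
qed
then show ?thesis by simp
qed

text \<open>Group-like elements are common eigenvectors of the commuting operators \<open>cut f\<close>, with different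
eigenvalues. So distinct ones are linearly independent.\<close>

lemma group_like_independent:
assumes g: "!!i. group_like k C (\<gamma> i)" and inj: "inj \<gamma>"
shows "j \<le> m ==> \<gamma> (m::nat) \<notin> mod_span k C (\<gamma> ` {..<j})"
proof (induction j)
case 0
have "mod_span k C {} \<subseteq> {0\<^sub>C}" by (rule mod_span_least[OF submodule_singleton_zero[OF Cm]]) simp
moreover have "\<gamma> m ~= 0\<^sub>C"
proof
 assume "\<gamma> m = 0\<^sub>C"
 then have "counit C (\<gamma> m) = 0\<^sub>k" using lin_zero[OF counit_linear Cm kmod] by simp
 then show False using g[of m] one_not_zero by (simp add: group_like_def)
qed
ultimately show ?case by auto
next
case (Suc j)
have gc: "\<gamma> i .: C" for i using g[of i] by (simp add: group_like_def)
let ?L = "mod_span k C (\<gamma> ` {..<j})"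
have L: "submodule ?L k C" using gc by (intro mod_span_sub[OF Cm]) auto
show ?case
proof
 assume "\<gamma> m \<in> mod_span k C (\<gamma> ` {..<Suc j})"
 then have "\<gamma> m \<in> mod_span k C (insert (\<gamma> j) (\<gamma> ` {..<j}))" by (simp add: lessThan_Suc)
 then obtain a s where a: "a .: k" and s: "s \<in> ?L" and eq: "\<gamma> m = s +\<^sub>C a \<odot>\<^sub>C \<gamma> j"
 using mod_span_insert[OF Cm _ gc, of "\<gamma> ` {..<j}"] gc by blast
 have sc: "s .: C" using submodule_sub[OF Cm L s] .
 have "\<gamma> m ~= \<gamma> j" using inj Suc.prems by (auto dest: injD)
 then obtain f where f: "f : lin_hom k C (base_mod k)" and ne: "f (\<gamma> m) ~= f (\<gamma> j)"
 using eq_if_functionals_eq[OF kf Cm gc gc] by blast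
 have fc: "f (\<gamma> i) .: k" for i using lin_in[OF f gc] by simp
 have cs: "cut f s \<in> ?L"
 proof -
 have "cut f (\<gamma> i) \<in> ?L" if "i < j" for i
  using CO.submoduleE(4)[OF L fc] subsetD[OF mod_span_superset[of "\<gamma> ` {..<j}" k C], of "\<gamma> i"] that
  by (simp add: cut_group_like[OF f g])
 then have "?L \<subseteq> {u \<in> carrier C. cut f u \<in> ?L}"
  using gc by (intro mod_span_least submodule_preimage[OF cut_lin[OF f] Cm Cm L]) auto
 then show ?thesis using s by auto
 qed
 have csc: "cut f s .: C" using submodule_sub[OF Cm L cs] .
 have "f (\<gamma> m) \<odot>\<^sub>C \<gamma> m = cut f s +\<^sub>C a \<odot>\<^sub>C (f (\<gamma> j) \<odot>\<^sub>C \<gamma> j)"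
 using cut_group_like[OF f g, of m] sc a gc
 by (subst (asm) eq) (simp add: lin_add[OF cut_lin[OF f]] lin_smult[OF cut_lin[OF f]] cut_group_like[OF f g])
 also have "a \<odot>\<^sub>C (f (\<gamma> j) \<odot>\<^sub>C \<gamma> j) = f (\<gamma> j) \<odot>\<^sub>C (a \<odot>\<^sub>C \<gamma> j)"
 using a fc gc by (metis CO.smult_assoc1 m_comm)
 also have "a \<odot>\<^sub>C \<gamma> j = \<gamma> m -\<^sub>C s"
 using sc a gc by (subst eq) (simp add: a_minus_def CO.a_comm[of s] CO.a_assoc CO.r_neg)
 finally have "f (\<gamma> m) \<odot>\<^sub>C \<gamma> m = cut f s +\<^sub>C f (\<gamma> j) \<odot>\<^sub>C (\<gamma> m -\<^sub>C s)" .
 then have "(f (\<gamma> m) -\<^sub>k f (\<gamma> j)) \<odot>\<^sub>C \<gamma> m =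
  (cut f s +\<^sub>C f (\<gamma> j) \<odot>\<^sub>C (\<gamma> m -\<^sub>C s)) -\<^sub>C f (\<gamma> j) \<odot>\<^sub>C \<gamma> m"
 using fc gc by (simp add: a_minus_def CO.smult_l_distr CO.smult_l_minus)
 also have "... = cut f s -\<^sub>C f (\<gamma> j) \<odot>\<^sub>C s"
 proof -
 have "(cut f s +\<^sub>C f (\<gamma> j) \<odot>\<^sub>C (\<gamma> m -\<^sub>C s)) -\<^sub>C f (\<gamma> j) \<odot>\<^sub>C \<gamma> m =
  (cut f s -\<^sub>C f (\<gamma> j) \<odot>\<^sub>C s) +\<^sub>C (f (\<gamma> j) \<odot>\<^sub>C \<gamma> m -\<^sub>C f (\<gamma> j) \<odot>\<^sub>C \<gamma> m)"
  using fc gc sc csc by (simp add: a_minus_def CO.smult_r_distr CO.smult_r_minus CO.a_ac)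
 then show ?thesis using fc gc sc csc by (simp add: a_minus_def CO.r_neg)
 qed
 also have "... \<in> ?L" using cs CO.submoduleE(4)[OF L fc s] by (rule submodule_diff[OF Cm L])
 finally have in_L: "(f (\<gamma> m) -\<^sub>k f (\<gamma> j)) \<odot>\<^sub>C \<gamma> m \<in> ?L" .
 define d where "d = f (\<gamma> m) -\<^sub>k f (\<gamma> j)"
 have d: "d .: k" "d ~= 0\<^sub>k" using fc ne by (simp_all add: d_def diff_eq_zero_iff)
 have i: "inv\<^bsub>k\<^esub> d .: k" "inv\<^bsub>k\<^esub> d **\<^sub>k d = 1\<^sub>k" using d field_Units by auto
 then have "\<gamma> m = inv\<^bsub>k\<^esub> d \<odot>\<^sub>C (d \<odot>\<^sub>C \<gamma> m)" using d gc by (simp add: CO.smult_assoc1[symmetric])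
 then have "\<gamma> m \<in> ?L" using CO.submoduleE(4)[OF L i(1) in_L] by (simp add: d_def)
 then show False using Suc by simp
qed
qed

definition coeff_space :: "'c => 'c set" where
"coeff_space h = {cut f h | f. f : lin_hom k C (base_mod k)}"

lemma coeff_space_sub:
assumes h: "h .: C"
shows "submodule (coeff_space h) k C"
proof -
have sm: "a \<odot>\<^sub>C v \<in> coeff_space h" if a: "a .: k" and v: "v \<in> coeff_space h" for a v
proof -
 obtain f where f: "f : lin_hom k C (base_mod k)" "v = cut f h" using v by (auto simp: coeff_space_def)
 have g: "(%c. a **\<^sub>k f c) : lin_hom k C (base_mod k)" using lin_scale[OF f(1) kmod a] by simp
 have "a \<odot>\<^sub>C v = sw k C C h (%p q. a \<odot>\<^sub>C (f p \<odot>\<^sub>C q))"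
 unfolding f(2) cut_def by (intro sw_post[OF Cm cut_bilin[OF f(1)] h Cm] lin_scale lin_id Cm a)
 also have "... = cut (%c. a **\<^sub>k f c) h" unfolding cut_def using a lin_in[OF f(1)]
 by (intro sw_cong[OF Cm _ h, symmetric] cut_bilin[OF g]) (simp add: CO.smult_assoc1)
 finally show ?thesis using g by (auto simp: coeff_space_def)
qed
show ?thesis
proof (rule CO.submoduleI)
 show sub: "coeff_space h <: C" using lin_in[OF cut_lin h] by (auto simp: coeff_space_def)
 have "cut (counit C) h \<in> coeff_space h" using counit_linear by (auto simp: coeff_space_def)
 from sm[OF zero_closed this] show "0\<^sub>C \<in> coeff_space h" using lin_in[OF cut_lin[OF counit_linear] h] by simp
 show "-\<^sub>C v \<in> coeff_space h" if "v \<in> coeff_space h" for v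
 using sm[OF _ that, of "-\<^sub>k 1\<^sub>k"] that sub by (auto simp: CO.smult_l_minus)
 fix u v assume "u \<in> coeff_space h" "v \<in> coeff_space h"
 then obtain f g where f: "f : lin_hom k C (base_mod k)" "u = cut f h" and g: "g : lin_hom k C (base_mod k)" "v = cut g h"
 by (auto simp: coeff_space_def)
 have fg: "(%c. f c +\<^sub>k g c) : lin_hom k C (base_mod k)" using lin_sum[OF f(1) g(1) kmod] by simp
 have "cut (%c. f c +\<^sub>k g c) h = sw k C C h (%p q. f p \<odot>\<^sub>C q +\<^sub>C g p \<odot>\<^sub>C q)"
 unfolding cut_def using lin_in[OF f(1)] lin_in[OF g(1)] by (intro sw_cong[OF Cm _ h] cut_bilin[OF fg]) (simp add: CO.smult_l_distr)
 also have "... = u +\<^sub>C v" unfolding f(2) g(2) cut_def by (rule sw_add[OF Cm cut_bilin[OF f(1)] cut_bilin[OF g(1)] h])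
 finally show "u +\<^sub>C v \<in> coeff_space h" using fg by (auto simp: coeff_space_def intro!: exI[of _ "%c. f c +\<^sub>k g c"])
qed (rule sm)
qed

lemma coeff_space_self: "h .: C ==> h \<in> coeff_space h"
using sw_counit1[OF Cm lin_id] counit_linear by (auto simp: coeff_space_def cut_def intro!: exI[of _ "counit C"])

lemma mod_span_mono: "A \<subseteq> B ==> mod_span k V A \<subseteq> mod_span k V B" by (auto simp: mod_span_def)

lemma coeff_space_finite:
assumes h: "h .: C"
shows "\<exists>(v :: nat => 'c) n. (\<forall>i. v i .: C) & coeff_space h \<subseteq> mod_span k C (v ` {..<n})"
proof -
note two = numeral_2_eq_2
from comult_expansion[OF h] obtain c E where c: "\<forall>e. c e : lin_hom k C (base_mod k)"
 and E: "finite E" "E <: tpow k C (Suc 0)"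
 and ex: "comult C h = (\<Oplus>\<^bsub>tpow k C 2\<^esub>e\<in>E. tsnoc k C (Suc 0) e (cut (c e) h))" by (elim exE conjE)
let ?A = "(%e. cut (c e) h) ` E"
have wc: "cut (c e) h .: C" for e by (rule lin_in[OF cut_lin[OF c[rule_format]] h])
have A: "submodule (mod_span k C ?A) k C" using wc by (intro mod_span_sub[OF Cm]) auto
have tc: "tsnoc k C (Suc 0) e (cut (c e) h) .: tpow k C 2" if "e \<in> E" for e
 using bilin_in[OF tsnoc_bilin[OF Cm, of "Suc 0"] subsetD[OF E(2) that] wc] by (simp add: two)
have "cut f h \<in> mod_span k C ?A" if f: "f : lin_hom k C (base_mod k)" for f
proof -
 let ?L = "pres_lift k C (%hs. f (hs ! 0) \<odot>\<^sub>C hs ! 1)"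
 have "cut f h = ?L (\<Oplus>\<^bsub>tpow k C 2\<^esub>e\<in>E. tsnoc k C (Suc 0) e (cut (c e) h))" by (subst ex[symmetric]) (simp only: cut_def sw_def)
 also have "... = (\<Oplus>\<^bsub>C\<^esub>e\<in>E. ?L (tsnoc k C (Suc 0) e (cut (c e) h)))"
 by (rule lin_finsum[OF lift2(1)[OF Cm cut_bilin[OF f]] Tm Cm E(1)]) (use tc in auto)
 also have "... \<in> mod_span k C ?A"
 proof (rule submodule_finsum[OF Cm A E(1)])
 fix e assume e: "e \<in> E"
 have fk: "f a .: k" if "a .: C" for a using lin_in[OF f that] by simp
 have "cut (c e) h \<in> ?A" using e by (rule imageI)
 from subsetD[OF mod_span_superset this] have wA: "cut (c e) h \<in> mod_span k C ?A" .
 show "?L (tsnoc k C (Suc 0) e (cut (c e) h)) \<in> mod_span k C ?A"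
  by (rule lift2_snoc[OF Cm cut_bilin[OF f] A wc CO.submoduleE(4)[OF A fk wA] subsetD[OF E(2) e]])
 qed
 finally show ?thesis .
qed
then have sp: "coeff_space h \<subseteq> mod_span k C ?A" by (auto simp: coeff_space_def)
obtain A where A: "A = ?A" "finite A" "A <: C" using finite_imageI[OF E(1)] wc by blast
moreover obtain u n where "A = u ` {i. i < (n::nat)}" using finite_imp_nat_seg_image_inj_on[OF A(2)] by blast
then have "A = (%i. if i < n then u i else 0\<^sub>C) ` {..<n}" by auto
ultimately show ?thesis using sp[folded A(1)] A(3) \<open>A = u ` {i. i < n}\<close>
 by (intro exI[of _ "%i. if i < n then u i else 0\<^sub>C"] exI[of _ n]) auto
qed

text \<open>Coassociativity gives \<open>\<Delta>(V) \<subseteq> C \<otimes> V\<close> for the coefficient space \<open>V\<close>, and cocommutativity turns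
this into \<open>\<Delta>(V) \<subseteq> V \<otimes> V\<close>.\<close>

lemma coeff_space_subcoalgebra:
assumes cc: "cocommutative k C" and h: "h .: C"
shows "subcoalgebra k C (coeff_space h)"
proof -
interpret T: module k "tpow k C 2" by (rule Tm)
let ?V = "coeff_space h" and ?T = "tpow k C 2"
note V = coeff_space_sub[OF h]
have cutV: "cut c v \<in> ?V" if c: "c : lin_hom k C (base_mod k)" and v: "v \<in> ?V" for c v
proof -
 obtain f where f: "f : lin_hom k C (base_mod k)" "v = cut f h" using v by (auto simp: coeff_space_def)
 have fk: "f a .: k" "c a .: k" if "a .: C" for a using lin_in[OF f(1) that] lin_in[OF c that] by auto
 have b: "bilin k C C (base_mod k) (%p q. f p **\<^sub>k c q)"
 proof (rule bilinI)
 show "(%q. f p **\<^sub>k c q) : lin_hom k C (base_mod k)" if "p .: C" for p using lin_scale[OF c kmod, of "f p"] fk[OF that] by simp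
 show "(%p. f p **\<^sub>k c q) : lin_hom k C (base_mod k)" if "q .: C" for q using lin_smult_vec[OF kmod _ f(1), of "c q"] fk[OF that] by simp
 qed
 define f' where "f' a = sw k C (base_mod k) a (%p q. f p **\<^sub>k c q)" for a
 have f': "f' : lin_hom k C (base_mod k)" unfolding f'_def[abs_def] by (intro sw_lin kmod b lin_id)
 have "cut c v = sw k C C h (%a b. cut c (f a \<odot>\<^sub>C b))"
 unfolding f(2) cut_def[of f] by (intro sw_post[OF Cm cut_bilin[OF f(1)] h Cm] cut_lin c)
 also have "... = sw k C C h (%a b. sw k C C b (%p q. f a \<odot>\<^sub>C (c p \<odot>\<^sub>C q)))"
 proof (rule sw_cong[OF Cm bilin_post[OF cut_bilin[OF f(1)] cut_lin[OF c]] h])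
 fix a b assume a: "a .: C" and b: "b .: C"
 have "cut c (f a \<odot>\<^sub>C b) = f a \<odot>\<^sub>C cut c b" using a b fk by (simp add: lin_smult[OF cut_lin[OF c]])
 also have "... = sw k C C b (%p q. f a \<odot>\<^sub>C (c p \<odot>\<^sub>C q))"
  unfolding cut_def using a fk by (intro sw_post[OF Cm cut_bilin[OF c] b Cm] lin_scale lin_id Cm)
 finally show "cut c (f a \<odot>\<^sub>C b) = sw k C C b (%p q. f a \<odot>\<^sub>C (c p \<odot>\<^sub>C q))" .
 qed
 also have "... = sw k C C h (%a b. sw k C C a (%p q. f p \<odot>\<^sub>C (c q \<odot>\<^sub>C b)))"
 by (intro sw_coassoc[OF Cm _ _ _ h, symmetric] lin_scale lin_smult_vec lin_id Cm f c fk CO.smult_closed)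
 also have "... = cut f' h" unfolding cut_def
 proof (rule sw_cong[OF Cm cut_bilin[OF f'] h, symmetric])
 fix a d assume a: "a .: C" and d: "d .: C"
 have "f' a \<odot>\<^sub>C d = sw k C C a (%p q. (f p **\<^sub>k c q) \<odot>\<^sub>C d)"
  unfolding f'_def by (intro sw_post[OF kmod b a Cm] lin_smult_vec Cm d lin_id)
 also have "... = sw k C C a (%p q. f p \<odot>\<^sub>C (c q \<odot>\<^sub>C d))"
  using fk d by (intro sw_cong[OF Cm _ a] bilin_post[OF b lin_smult_vec] Cm d lin_id) (simp add: CO.smult_assoc1)
 finally show "f' a \<odot>\<^sub>C d = sw k C C a (%p q. f p \<odot>\<^sub>C (c q \<odot>\<^sub>C d))" .
 qed
 finally show ?thesis using f' by (auto simp: coeff_space_def)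
qed
obtain p where p: "p : lin_hom k C C" and pV: "!!c. c .: C ==> p c \<in> ?V" and pid: "!!v. v \<in> ?V ==> p v = v"
 using exists_projection[OF kf Cm V] by blast
note pb = comult_as_sw(2)[OF CO.M.zero_closed]
note pc = lin_in[OF p]
let ?N = "mod_span k ?T {tpow_pure k C [c, d] | c d. c \<in> ?V & d \<in> ?V}"
have Vc: "?V <: C" using submodule_sub[OF Cm V] by auto
have N: "submodule ?N k ?T" using Vc by (intro mod_span_sub[OF Tm]) (auto intro!: pure_in)
have "comult C v \<in> ?N" if v: "v \<in> ?V" for v
proof -
 have vc: "v .: C" using v Vc by auto
 have b1: "bilin k C C ?T (%a b. tpow_pure k C [a, p b])" by (intro bilinI bilin_comp1[OF pb] bilin2[OF pb] p pc)
 have b2: "bilin k C C ?T (%a b. tpow_pure k C [b, p a])" using b1 by (simp add: bilin_def)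
 have b3: "bilin k C C ?T (%a b. tpow_pure k C [p a, p b])" by (intro bilinI bilin_comp1[OF pb] bilin_comp2[OF pb] p pc)
 have *: "comult C v = sw k C ?T v (%a b. tpow_pure k C [a, p b])"
 proof -
 note L = lift2[OF Tm b1]
 let ?L = "pres_lift k ?T (%hs. tpow_pure k C [hs ! 0, p (hs ! 1)])"
 from comult_expansion[OF vc] obtain c E where c: "\<forall>e. c e : lin_hom k C (base_mod k)"
  and E: "finite E" "E <: tpow k C (Suc 0)"
  and ex: "comult C v = (\<Oplus>\<^bsub>?T\<^esub>e\<in>E. tsnoc k C (Suc 0) e (cut (c e) v))" by (elim exE conjE)
 have Lid: "?L (tsnoc k C (Suc 0) e w) = tsnoc k C (Suc 0) e w" if w: "w \<in> ?V" and e: "e .: tpow k C (Suc 0)" for e w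
 proof (rule tpow_ext[OF Cm Tm[of 2] _ _ _ e])
  have wc: "w .: C" using w Vc by auto
  note sb = bilin2[OF tsnoc_bilin[OF Cm, of "Suc 0"] wc]
  show "(%e. ?L (tsnoc k C (Suc 0) e w)) : lin_hom k (tpow k C (Suc 0)) ?T" using lin_comp[OF sb] L(1) by (simp add: numeral_2_eq_2)
  show "(%e. tsnoc k C (Suc 0) e w) : lin_hom k (tpow k C (Suc 0)) ?T" using sb by (simp add: numeral_2_eq_2)
  fix vs assume "length vs = Suc 0" "set vs <: C"
  then obtain a where a: "vs = [a]" "a .: C" by (auto simp: length_Suc_conv)
  then show "?L (tsnoc k C (Suc 0) (tpow_pure k C vs) w) = tsnoc k C (Suc 0) (tpow_pure k C vs) w"
  using L(2)[OF a(2) wc] pid[OF w] wc by (simp del: One_nat_def add: tsnoc_pure[OF Cm])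
 qed
 have wV: "cut (c e) v \<in> ?V" for e by (rule cutV[OF c[rule_format] v])
 have tc: "tsnoc k C (Suc 0) e (cut (c e) v) .: ?T" if "e \<in> E" for e
  using bilin_in[OF tsnoc_bilin[OF Cm, of "Suc 0"] subsetD[OF E(2) that] subsetD[OF Vc wV]] by (simp add: numeral_2_eq_2)
 have "?L (comult C v) = (\<Oplus>\<^bsub>?T\<^esub>e\<in>E. ?L (tsnoc k C (Suc 0) e (cut (c e) v)))"
  by (subst ex, rule lin_finsum[OF L(1) Tm Tm E(1)]) (use tc in auto)
 also have "... = (\<Oplus>\<^bsub>?T\<^esub>e\<in>E. tsnoc k C (Suc 0) e (cut (c e) v))" using Lid[OF wV] E(2) tc by (intro T.finsum_cong') auto
 finally show ?thesis unfolding ex[symmetric] sw_def by simp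
 qed
 have project: "sw k C ?T v F = sw k C ?T v (%a b. F a (p b))" if F: "bilin k C C ?T F" for F
 proof -
 note L = lift2[OF Tm F]
 have F': "bilin k C C ?T (%a b. F a (p b))" by (intro bilinI bilin_comp1[OF F p] bilin2[OF F] pc)
 have "sw k C ?T v F = pres_lift k ?T (%hs. F (hs ! 0) (hs ! 1)) (sw k C ?T v (%a b. tpow_pure k C [a, p b]))"
  by (simp only: sw_def[of k C ?T v F] *)
 also have "... = sw k C ?T v (%a b. pres_lift k ?T (%hs. F (hs ! 0) (hs ! 1)) (tpow_pure k C [a, p b]))" by (rule sw_post[OF Tm b1 vc Tm L(1)])
 also have "... = sw k C ?T v (%a b. F a (p b))" by (rule sw_cong[OF Tm F' vc, symmetric]) (simp only: L(2) pc)
 finally show ?thesis .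
 qed
 have "comult C v = sw k C ?T v (%a b. tpow_pure k C [b, p a])" using * sw_cocommutative[OF Tm b1 vc cc] by simp
 also have "... = sw k C ?T v (%a b. tpow_pure k C [p b, p a])" by (rule project[OF b2])
 also have "... = sw k C ?T v (%a b. tpow_pure k C [p a, p b])" by (rule sw_cocommutative[OF Tm b3 vc cc])
 also have "... \<in> ?N"
 proof -
 note L = lift2[OF Tm b3]
 let ?L = "pres_lift k ?T (%hs. tpow_pure k C [p (hs ! 0), p (hs ! 1)])"
 have sub: "submodule {t \<in> carrier ?T. ?L t \<in> ?N} k ?T" by (rule submodule_preimage[OF L(1) Tm Tm N])
 have "comult C v \<in> {t \<in> carrier ?T. ?L t \<in> ?N}"
 proof (rule tpow_induct[OF Cm sub _ comult_in[OF vc]])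
  fix vs assume "length vs = 2" "set vs <: C"
  then obtain a b where vs: "vs = [a, b]" "a .: C" "b .: C" by (auto simp: numeral_2_eq_2 length_Suc_conv)
  have "tpow_pure k C [p a, p b] \<in> ?N" using pV vs by (intro subsetD[OF mod_span_superset]) blast
  then show "tpow_pure k C vs \<in> {t \<in> carrier ?T. ?L t \<in> ?N}"
  using vs L(2)[OF vs(2,3)] by (auto simp del: One_nat_def intro!: pure_in)
 qed
 then show ?thesis by (simp add: sw_def)
 qed
 finally show ?thesis .
qed
then show ?thesis using V by (auto simp: subcoalgebra_def)
qed

lemma one_dimensional_group_like:
assumes D: "subcoalgebra k C D" and dim: "one_dimensional k C D"
shows "\<exists>g\<in>D. group_like k C g"
proof -
interpret T: module k "tpow k C 2" by (rule Tm)
let ?T = "tpow k C 2"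
obtain v where v: "v .: C" "v ~= 0\<^sub>C" and Dv: "D = {a \<odot>\<^sub>C v | a. a .: k}" using dim by (auto simp: one_dimensional_def)
note pb = comult_as_sw(2)[OF CO.M.zero_closed]
have vv: "tpow_pure k C [v, v] .: ?T" using v by (intro pure_in) auto
have lin: "(%r. r \<odot>\<^sub>?T tpow_pure k C [v, v]) : lin_hom k (base_mod k) ?T" by (intro lin_smult_vec Tm vv lin_id)
have "mod_span k ?T {tpow_pure k C [c, d] | c d. c \<in> D & d \<in> D} \<subseteq> (%r. r \<odot>\<^sub>?T tpow_pure k C [v, v]) ` carrier k"
proof (rule mod_span_least)
 show "submodule ((%r. r \<odot>\<^sub>?T tpow_pure k C [v, v]) ` carrier k) k ?T"
 using submodule_image[OF lin kmod Tm module.carrier_is_submodule[OF kmod]] by simp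
 show "{tpow_pure k C [c, d] | c d. c \<in> D & d \<in> D} \<subseteq> (%r. r \<odot>\<^sub>?T tpow_pure k C [v, v]) ` carrier k"
 proof
 fix z assume "z \<in> {tpow_pure k C [c, d] | c d. c \<in> D & d \<in> D}"
 then obtain a b where ab: "a .: k" "b .: k" "z = tpow_pure k C [a \<odot>\<^sub>C v, b \<odot>\<^sub>C v]" by (auto simp: Dv)
 then have "z = (a **\<^sub>k b) \<odot>\<^sub>?T tpow_pure k C [v, v]"
  using v vv by (simp add: lin_smult[OF bilin1[OF pb]] lin_smult[OF bilin2[OF pb]] T.smult_assoc1 m_comm[of a b])
 then show "z \<in> (%r. r \<odot>\<^sub>?T tpow_pure k C [v, v]) ` carrier k" using ab by auto
 qed
qed
moreover have "v \<in> D" using v by (auto simp: Dv intro!: exI[of _ "1\<^sub>k"])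
ultimately obtain r where r: "r .: k" "comult C v = r \<odot>\<^sub>?T tpow_pure k C [v, v]"
 using D by (auto simp: subcoalgebra_def image_subset_iff)
note L = lift2[OF Cm cut_bilin[OF counit_linear]]
have ev: "counit C v .: k" using counit_in[OF v(1)] .
have "v = pres_lift k C (%hs. counit C (hs ! 0) \<odot>\<^sub>C hs ! 1) (r \<odot>\<^sub>?T tpow_pure k C [v, v])"
 using sw_counit1[OF Cm lin_id v(1)] by (simp add: sw_def r(2))
also have "... = (r **\<^sub>k counit C v) \<odot>\<^sub>C v"
 using r vv v ev by (simp del: One_nat_def add: lin_smult[OF L(1)] L(2) CO.smult_assoc1)
finally have "(r **\<^sub>k counit C v -\<^sub>k 1\<^sub>k) \<odot>\<^sub>C v = 0\<^sub>C"
 using r ev v by (simp add: a_minus_def CO.smult_l_distr CO.smult_l_minus CO.r_neg)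
moreover have rv: "r **\<^sub>k counit C v .: k" using r(1) ev by simp
ultimately have "r **\<^sub>k counit C v -\<^sub>k 1\<^sub>k = 0\<^sub>k" by (intro smult_eq_zero[OF kf Cm _ v(1) _ v(2)]) simp_all
then have one: "r **\<^sub>k counit C v = 1\<^sub>k" using rv by (simp add: diff_eq_zero_iff)
have "group_like k C (r \<odot>\<^sub>C v)" using r v vv one by (simp add: group_like_def lin_smult[OF comult_linear] lin_smult[OF counit_linear]
  lin_smult[OF bilin1[OF pb]] lin_smult[OF bilin2[OF pb]])
then show ?thesis using r Dv by blast
qed

end

context hopf_algebra
begin

lemma group_like_mult:
assumes "group_like k H g" "group_like k H h"
shows "group_like k H (g **\<^sub>H h)" using assms tpow_mult_pure[of "[g, g]" 2 "[h, h]"] module_cring[OF Cm]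
by (simp add: group_like_def mult_in comult_mult counit_mult monoid.l_one[OF comm_monoid.axioms(1)[OF cring.axioms(2)]] cring.cring_simprules(6))

lemma group_like_antipode:
assumes "group_like k H g"
shows "antipode H g **\<^sub>H g = 1\<^sub>H" "g **\<^sub>H antipode H g = 1\<^sub>H"
proof -
have g: "g .: H" "counit H g = 1\<^sub>k" using assms by (simp_all add: group_like_def)
have "bilin k H H H (%a b. antipode H a **\<^sub>H b)" "bilin k H H H (%a b. a **\<^sub>H antipode H b)"
 by (intro bilinI lin_intros closed_intros; assumption)+
from sw_group_like[OF Cm this(1) assms] sw_group_like[OF Cm this(2) assms]
show "antipode H g **\<^sub>H g = 1\<^sub>H" "g **\<^sub>H antipode H g = 1\<^sub>H"
 using sw_antipode_left[OF g(1)] sw_antipode_right[OF g(1)] g module.smult_one[OF Cm one_closed'] by simp_all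
qed

lemma group_like_pow: "group_like k H x ==> group_like k H (x [^]\<^bsub>H\<^esub> (i::nat))"
by (induction i) (simp_all add: group_like_one group_like_mult)

text \<open>If \<open>h x = h ~= 0\<close>, then right multiplication by \<open>x\<close> preserves the coefficient space \<open>V\<close> of \<open>h\<close>. As \<open>V\<close>
is a finite-dimensional subcoalgebra and \<open>H\<close> is pointed, \<open>V\<close> contains a group-like \<open>g\<close>, hence all
the \<open>g x\<^sup>i\<close>; these are independent if \<open>x\<close> has infinite order.\<close>

theorem no_fixed_vectors:
assumes cc: "cocommutative k H" and pt: "pointed k H" and x: "group_like k H x"
 and inf: "!!i::nat. i > 0 ==> x [^]\<^bsub>H\<^esub> i ~= 1\<^sub>H"
 and h: "h .: H" and fixed: "h **\<^sub>H x = h"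
shows "h = 0\<^sub>H"
proof (rule ccontr)
assume nz: "h ~= 0\<^sub>H"
let ?V = "coeff_space h"
note V = coeff_space_sub[OF h]
have xc: "x .: H" using x by (simp add: group_like_def)
have yc: "antipode H x .: H" using xc by (rule antipode_in)
have Vx: "v **\<^sub>H x \<in> ?V" if v: "v \<in> ?V" for v
proof -
 obtain f where f: "f : Hom H (base_mod k)" "v = cut f h" using v by (auto simp: coeff_space_def)
 have fk: "f a .: k" if "a .: H" for a using lin_in[OF f(1) that] by simp
 define f' where "f' a = f (a **\<^sub>H antipode H x)" for a
 have f': "f' : Hom H (base_mod k)" unfolding f'_def[abs_def] by (rule lin_comp[OF _ f(1)]) (intro lin_intros yc)
 note b' = cut_bilin[OF f']
 have b: "bilin k H H H (%a b. f a \<odot>\<^sub>H (b **\<^sub>H x))"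
 using fk xc by (intro bilinI lin_scale lin_smult_vec f(1) lin_intros closed_intros)
 have b2: "bilin k H H H (%p q. f' (a **\<^sub>H p) \<odot>\<^sub>H (b **\<^sub>H q))" if "a .: H" "b .: H" for a b
 using that lin_in[OF f'] mult_in by (intro bilinI lin_scale lin_smult_vec lin_comp[OF _ f'] lin_intros closed_intros) simp_all
 have xy: "f' (a **\<^sub>H x) = f a" if "a .: H" for a using that xc yc group_like_antipode(2)[OF x] ALG.r_one by (simp add: f'_def mult_assoc)
 have "cut f' h = cut f' (h **\<^sub>H x)" by (simp add: fixed)
 also have "... = sw k H H h (%a b. sw k H H x (%p q. f' (a **\<^sub>H p) \<odot>\<^sub>H (b **\<^sub>H q)))"
 unfolding cut_def by (rule sw_mult[OF Cm b' h xc])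
 also have "... = sw k H H h (%a b. f a \<odot>\<^sub>H (b **\<^sub>H x))"
 by (rule sw_cong[OF Cm b h, symmetric]) (simp add: sw_group_like[OF Cm b2 x] xy)
 also have "... = sw k H H h (%a b. (f a \<odot>\<^sub>H b) **\<^sub>H x)" using fk xc by (intro sw_cong[OF Cm b h]) (simp add: smult_mult_left)
 also have "... = v **\<^sub>H x" unfolding f(2) cut_def by (intro sw_post[OF Cm cut_bilin[OF f(1)] h Cm, symmetric] lin_intros xc)
 finally show ?thesis using f' by (auto simp: coeff_space_def intro!: exI[of _ f'])
qed
obtain v :: "nat => _" and n where vc: "!!i. v i .: H" and span: "?V \<subseteq> mod_span k H (v ` {..<n})" using coeff_space_finite[OF h] by blast
let ?P = "%D. subcoalgebra k H D & D ~= {0\<^sub>H} & D \<subseteq> ?V"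
have "\<exists>D. ?P D & (\<forall>E. ?P E --> E \<subseteq> D --> E = D)"
proof (rule exists_minimal_sub[OF kf Cm vc])
 show "submodule D k H & D \<subseteq> mod_span k H (v ` {..<n})" if "?P D" for D using that span by (auto simp: subcoalgebra_def)
 show "?P ?V" using coeff_space_subcoalgebra[OF cc h] coeff_space_self[OF h] nz by blast
qed
then obtain D where D: "?P D" "\<forall>E. ?P E --> E \<subseteq> D --> E = D" by blast
then have "simple_subcoalgebra k H D" unfolding simple_subcoalgebra_def by blast
then have "one_dimensional k H D" using pt by (simp add: pointed_def)
then obtain g where g: "g \<in> ?V" "group_like k H g" using one_dimensional_group_like D(1) by blast
have gc: "g .: H" using g(2) by (simp add: group_like_def)
define \<gamma> where "\<gamma> i = g **\<^sub>H x [^]\<^bsub>H\<^esub> (i::nat)" for i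
have powc: "x [^]\<^bsub>H\<^esub> (i::nat) .: H" for i using group_like_pow[OF x, of i] by (simp add: group_like_def)
have \<gamma>: "group_like k H (\<gamma> i)" for i unfolding \<gamma>_def by (intro group_like_mult g group_like_pow x)
have \<gamma>V: "\<gamma> i \<in> ?V" for i
proof (induction i)
 case 0 then show ?case using g gc ALG.r_one by (simp add: \<gamma>_def)
next
 case (Suc i)
 have "\<gamma> (Suc i) = \<gamma> i **\<^sub>H x" using gc powc[of i] xc by (simp add: \<gamma>_def mult_assoc)
 then show ?case using Vx[OF Suc] by simp
qed
have cancel: "i = j" if "i \<le> j" "\<gamma> i = \<gamma> j" for i j
proof (rule ccontr)
 assume "i ~= j"
 have lc: "a = b" if "g **\<^sub>H a = g **\<^sub>H b" "a .: H" "b .: H" for a b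
 using that gc group_like_antipode(1)[OF g(2)] antipode_in[OF gc] ALG.l_one by (metis mult_assoc)
 from that(2) have eq: "x [^]\<^bsub>H\<^esub> i = x [^]\<^bsub>H\<^esub> j" unfolding \<gamma>_def by (rule lc[OF _ powc powc])
 let ?s = "antipode H (x [^]\<^bsub>H\<^esub> i)"
 have s: "?s .: H" "x [^]\<^bsub>H\<^esub> i **\<^sub>H ?s = 1\<^sub>H"
 using group_like_antipode(2)[OF group_like_pow[OF x]] antipode_in[OF powc] by auto
 have "x [^]\<^bsub>H\<^esub> j = x [^]\<^bsub>H\<^esub> (j - i) **\<^sub>H x [^]\<^bsub>H\<^esub> i" using xc that(1) by (simp add: ALG.nat_pow_mult)
 then have "x [^]\<^bsub>H\<^esub> (j - i) = 1\<^sub>H" using s powc[of i] powc[of "j - i"] eq ALG.r_one by (metis mult_assoc)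
 then show False using inf[of "j - i"] that(1) \<open>i ~= j\<close> by simp
qed
then have inj: "inj \<gamma>" by (intro injI) (metis nat_le_linear)
let ?D = "%m. mod_span k H (\<gamma> ` {..<m})"
have \<gamma>c: "\<gamma> i .: H" for i using \<gamma>[of i] by (simp add: group_like_def)
show False
proof (rule no_ascending_chain[OF kf Cm vc])
 show "submodule (?D m) k H" for m using \<gamma>c by (intro mod_span_sub[OF Cm]) auto
 show "?D m \<subseteq> mod_span k H (v ` {..<n})" for m
 proof -
 have "?D m \<subseteq> ?V" using \<gamma>V by (intro mod_span_least[OF V]) auto
 then show ?thesis using span by blast
 qed
 show "?D m \<subset> ?D (Suc m)" for m
 proof -
 have "?D m \<subseteq> ?D (Suc m)" by (intro mod_span_mono) auto
 moreover have "\<gamma> m \<in> ?D (Suc m)" by (intro subsetD[OF mod_span_superset]) auto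
 moreover have "\<gamma> m \<notin> ?D m" using group_like_independent[OF \<gamma> inj, of m m] by simp
 ultimately show ?thesis by blast
 qed
qed
qed

end

section \<open>Freeness of the diagonal action\<close>

lemma tcons_ext:
assumes V: "module k V" and W: "module k W"
 and f: "f : lin_hom k (tpow k V (Suc n)) W" and g: "g : lin_hom k (tpow k V (Suc n)) W"
 and eq: "!!s v. s .: tpow k V n ==> v .: V ==> f (tcons k V n v s) = g (tcons k V n v s)"
 and t: "t .: tpow k V (Suc n)"
shows "f t = g t"
proof (rule tpow_ext[OF V W f g _ t])
fix vs assume vs: "length vs = Suc n" "set vs <: V"
then obtain v ws where ws: "vs = v # ws" by (cases vs) auto
then have "length ws = n" "set ws <: V" "v .: V" using vs by auto
then show "f (tpow_pure k V vs) = g (tpow_pure k V vs)" using eq[OF tpow_pure_in[OF V], of ws v] by (simp add: ws tcons_pure[OF V])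
qed

lemma dual_basisD:
assumes "dual_basis k R P I e \<phi>" and "i \<in> I"
shows "e i .: P" and "\<phi> i : lin_hom k P R"
 and "p .: P ==> r .: R ==> \<phi> i (ract P p r) = \<phi> i p **\<^sub>R r" using assms by (auto simp: dual_basis_def)

lemma dual_basis_expansion:
assumes "dual_basis k R P I e \<phi>" and "p .: P"
shows "\<exists>J. finite J & J \<subseteq> I & (\<forall>i\<in>I - J. \<phi> i p = 0\<^sub>R) & p = (\<Oplus>\<^bsub>P\<^esub>i\<in>J. ract P (e i) (\<phi> i p))"
using assms by (simp add: dual_basis_def)

context hopf_algebra
begin

text \<open>The maps \<open>v \<otimes> h \<mapsto> v h\<^sub>(\<^sub>1\<^sub>) \<otimes> h\<^sub>(\<^sub>2\<^sub>)\<close> and \<open>v \<otimes> h \<mapsto> v S(h\<^sub>(\<^sub>1\<^sub>)) \<otimes> h\<^sub>(\<^sub>2\<^sub>)\<close>. They are inverse to each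
other and translate between the diagonal action and the action on the last factor only.\<close>

definition untwist :: "nat => ('h list => 'k) set => ('h list => 'k) set" where
"untwist n = tlast_lift k H (tp (Suc n)) (%t h. sw k H (tp (Suc n)) h (%a b. snc n (act n t (antipode H a)) b))"

definition twist :: "nat => ('h list => 'k) set => ('h list => 'k) set" where
"twist n = tlast_lift k H (tp (Suc n)) (%t h. sw k H (tp (Suc n)) h (%a b. snc n (act n t a) b))"

definition last_act :: "nat => ('h list => 'k) set => 'h => ('h list => 'k) set" where
"last_act n y g = tlast_lift k H (tp (Suc n)) (%t h. snc n t (h **\<^sub>H g)) y"

lemma twist_inner: "t .: tp n ==> bilin k H H (tp (Suc n)) (%a b. snc n (act n t a) b)" by (intro bilinI lin_intros' closed_intros')

lemma untwist_inner: "t .: tp n ==> bilin k H H (tp (Suc n)) (%a b. snc n (act n t (antipode H a)) b)" by (intro bilinI lin_intros' closed_intros')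

lemma twist: "twist n : Hom (tp (Suc n)) (tp (Suc n))"
 "t .: tp n ==> h .: H ==>
 twist n (snc n t h) = sw k H (tp (Suc n)) h (%a b. snc n (act n t a) b)"
proof -
have b: "bilin k (tp n) H (tp (Suc n)) (%t h. sw k H (tp (Suc n)) h (%a b. snc n (act n t a) b))"
proof (rule bilinI)
 show "(%h. sw k H (tp (Suc n)) h (%a b. snc n (act n t a) b)) : Hom H (tp (Suc n))"
 if "t .: tp n" for t using that by (intro sw_lin twist_inner lin_intros)
 show "(%t. sw k H (tp (Suc n)) h (%a b. snc n (act n t a) b)) : Hom (tp n) (tp (Suc n))"
 if "h .: H" for h using that by (intro sw_param twist_inner lin_intros' closed_intros')
qed
show "twist n : Hom (tp (Suc n)) (tp (Suc n))"
 "t .: tp n ==> h .: H ==>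
 twist n (snc n t h) = sw k H (tp (Suc n)) h (%a b. snc n (act n t a) b)"
 unfolding twist_def by (rule tlast_lift(1)[OF Cm Tm b], rule tlast_lift(2)[OF Cm Tm b])
qed

lemma untwist: "untwist n : Hom (tp (Suc n)) (tp (Suc n))"
 "t .: tp n ==> h .: H ==>
 untwist n (snc n t h) = sw k H (tp (Suc n)) h (%a b. snc n (act n t (antipode H a)) b)"
proof -
have b: "bilin k (tp n) H (tp (Suc n)) (%t h. sw k H (tp (Suc n)) h (%a b. snc n (act n t (antipode H a)) b))"
proof (rule bilinI)
 show "(%h. sw k H (tp (Suc n)) h (%a b. snc n (act n t (antipode H a)) b)) : Hom H (tp (Suc n))"
 if "t .: tp n" for t using that by (intro sw_lin untwist_inner lin_intros)
 show "(%t. sw k H (tp (Suc n)) h (%a b. snc n (act n t (antipode H a)) b)) : Hom (tp n) (tp (Suc n))"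
 if "h .: H" for h using that by (intro sw_param untwist_inner lin_intros' closed_intros')
qed
show "untwist n : Hom (tp (Suc n)) (tp (Suc n))"
 "t .: tp n ==> h .: H ==>
 untwist n (snc n t h) = sw k H (tp (Suc n)) h (%a b. snc n (act n t (antipode H a)) b)"
 unfolding untwist_def by (rule tlast_lift(1)[OF Cm Tm b], rule tlast_lift(2)[OF Cm Tm b])
qed

lemma last_act: "g .: H ==> (%y. last_act n y g) : Hom (tp (Suc n)) (tp (Suc n))"
 "t .: tp n ==> h .: H ==> g .: H ==> last_act n (snc n t h) g = snc n t (h **\<^sub>H g)"
proof -
have b: "bilin k (tp n) H (tp (Suc n)) (%t h. snc n t (h **\<^sub>H g))" if "g .: H" for g using that by (intro bilinI lin_intros' closed_intros')
show "g .: H ==> (%y. last_act n y g) : Hom (tp (Suc n)) (tp (Suc n))" unfolding last_act_def by (rule tlast_lift(1)[OF Cm Tm b])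
show "t .: tp n ==> h .: H ==> g .: H ==> last_act n (snc n t h) g = snc n t (h **\<^sub>H g)"
 unfolding last_act_def by (rule tlast_lift(2)[OF Cm Tm b])
qed

text \<open>The computation behind both inverse laws: if \<open>\<Sum> f(h\<^sub>(\<^sub>1\<^sub>)) g(h\<^sub>(\<^sub>2\<^sub>)) = \<epsilon>(h)\<close>, then acting with it leaves
\<open>t \<otimes> h\<close> unchanged.\<close>

lemma sw_convolution_inverse:
assumes t: "t .: tp n" and h: "h .: H"
 and f: "f : Hom H H" and g: "g : Hom H H"
 and inv: "!!a. a .: H ==> sw k H H a (%c d. f c **\<^sub>H g d) = counit H a \<odot>\<^sub>H 1\<^sub>H"
shows "sw k H (tp (Suc n)) h (%a b. sw k H (tp (Suc n)) b (%c d. snc n (act n (act n t (f a)) (g c)) d))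
 = snc n t h"
proof -
let ?T = "tp (Suc n)"
note fc = lin_in[OF f] and gc = lin_in[OF g]
note fl = lin_comp[OF _ f] and gl = lin_comp[OF _ g]
have fg: "bilin k H H H (%c d. f c **\<^sub>H g d)" by (intro bilinI L_mult1 L_mult2 f g fc gc)
have "sw k H ?T h (%a b. sw k H ?T b (%c d. snc n (act n (act n t (f a)) (g c)) d)) =
 sw k H ?T h (%a b. sw k H ?T a (%c d. snc n (act n (act n t (f c)) (g d)) b))"
 by (rule sw_coassoc[OF Tm _ _ _ h, symmetric]) (intro lin_intros' closed_intros' f g fc gc t; assumption)+
also have "... = sw k H ?T h (%a b. counit H a \<odot>\<^sub>?T snc n t b)"
proof (rule sw_cong[OF Tm _ h, symmetric])
 show "bilin k H H ?T (%a b. counit H a \<odot>\<^sub>?T snc n t b)" by (intro bilinI lin_intros' closed_intros' t)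
 fix a b assume a: "a .: H" and b: "b .: H"
 have "counit H a \<odot>\<^sub>?T snc n t b = snc n (act n t (counit H a \<odot>\<^sub>H 1\<^sub>H)) b" using a b t
 by (simp del: tact.simps add: lin_smult[OF bilin1[OF tact_bilin]] lin_smult[OF bilin2[OF tsnoc_bilin[OF Cm]]]
  counit_in one_closed' tact_one)
 also have "... = sw k H ?T a (%c d. snc n (act n t (f c **\<^sub>H g d)) b)"
 unfolding inv[OF a, symmetric] by (intro sw_post[OF Cm fg a Tm] lin_intros' t b)
 also have "... = sw k H ?T a (%c d. snc n (act n (act n t (f c)) (g d)) b)"
 using t b fc gc by (intro sw_cong[OF Tm bilin_post[OF fg] a] lin_intros') (simp_all del: tact.simps add: tact_mult)
 finally show "counit H a \<odot>\<^sub>?T snc n t b = sw k H ?T a (%c d. snc n (act n (act n t (f c)) (g d)) b)" .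
qed
also have "... = snc n t h" by (intro sw_counit1[OF Tm _ h] lin_intros' t)
finally show ?thesis .
qed

lemma twist_untwist:
assumes y: "y .: tp (Suc n)"
shows "twist n (untwist n y) = y"
proof (rule tpow_Suc_ext[OF Cm Tm lin_comp[OF untwist(1) twist(1)] lin_id _ y])
let ?T = "tp (Suc n)"
fix t h assume t: "t .: tp n" and h: "h .: H"
have "twist n (untwist n (snc n t h)) = sw k H ?T h (%a b. twist n (snc n (act n t (antipode H a)) b))"
 unfolding untwist(2)[OF t h] by (rule sw_post[OF Tm untwist_inner[OF t] h Tm twist(1)])
also have "... = sw k H ?T h (%a b. sw k H ?T b (%c d. snc n (act n (act n t (antipode H a)) c) d))"
 using t by (intro sw_cong[OF Tm bilin_post[OF untwist_inner[OF t] twist(1)] h] twist(2) closed_intros')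
also have "... = snc n t h" by (rule sw_convolution_inverse[OF t h antipode_linear lin_id]) (rule sw_antipode_left)
finally show "twist n (untwist n (snc n t h)) = snc n t h" .
qed

lemma untwist_twist:
assumes y: "y .: tp (Suc n)"
shows "untwist n (twist n y) = y"
proof (rule tpow_Suc_ext[OF Cm Tm lin_comp[OF twist(1) untwist(1)] lin_id _ y])
let ?T = "tp (Suc n)"
fix t h assume t: "t .: tp n" and h: "h .: H"
have "untwist n (twist n (snc n t h)) = sw k H ?T h (%a b. untwist n (snc n (act n t a) b))"
 unfolding twist(2)[OF t h] by (rule sw_post[OF Tm twist_inner[OF t] h Tm untwist(1)])
also have "... = sw k H ?T h (%a b. sw k H ?T b (%c d. snc n (act n (act n t a) (antipode H c)) d))"
 using t by (intro sw_cong[OF Tm bilin_post[OF twist_inner[OF t] untwist(1)] h] untwist(2) closed_intros')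
also have "... = snc n t h" by (rule sw_convolution_inverse[OF t h lin_id antipode_linear]) (rule sw_antipode_right)
finally show "untwist n (twist n (snc n t h)) = snc n t h" .
qed

lemma twist_last_act:
assumes y: "y .: tp (Suc n)" and g: "g .: H"
shows "twist n (last_act n y g) = act (Suc n) (twist n y) g"
proof (rule tpow_Suc_ext[OF Cm Tm lin_comp[OF last_act(1)[OF g] twist(1)] _ _ y])
let ?T = "tp (Suc n)"
show "(%y. act (Suc n) (twist n y) g) : Hom ?T ?T" by (intro L_act1 twist(1) g)
fix t h assume t: "t .: tp n" and h: "h .: H"
have "twist n (last_act n (snc n t h) g) = sw k H ?T h (%a b. sw k H ?T g (%c d. snc n (act n t (a **\<^sub>H c)) (b **\<^sub>H d)))"
 using t h g by (simp add: last_act(2) twist(2) mult_in sw_mult[OF Tm twist_inner[OF t]])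
also have "... = sw k H ?T h (%a b. act (Suc n) (snc n (act n t a) b) g)"
proof (rule sw_cong[OF Tm bilin_post[OF twist_inner[OF t] L_act1[OF lin_id g]] h, symmetric])
 fix a b assume a: "a .: H" and b: "b .: H"
 have "act (Suc n) (snc n (act n t a) b) g = sw k H ?T g (%c d. snc n (act n (act n t a) c) (b **\<^sub>H d))" by (intro tact_snoc tact_in t a b g)
 also have "... = sw k H ?T g (%c d. snc n (act n t (a **\<^sub>H c)) (b **\<^sub>H d))"
 proof (rule sw_cong[OF Tm _ g])
 show "bilin k H H ?T (%c d. snc n (act n (act n t a) c) (b **\<^sub>H d))" by (intro bilinI lin_intros' closed_intros' t a b)
 qed (simp add: tact_mult t a)
 finally show "act (Suc n) (snc n (act n t a) b) g = sw k H ?T g (%c d. snc n (act n t (a **\<^sub>H c)) (b **\<^sub>H d))" .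
qed
also have "... = act (Suc n) (twist n (snc n t h)) g"
 unfolding twist(2)[OF t h] by (rule sw_post[OF Tm twist_inner[OF t] h Tm L_act1[OF lin_id g], symmetric])
finally show "twist n (last_act n (snc n t h) g) = act (Suc n) (twist n (snc n t h)) g" .
qed

lemma untwist_act:
assumes y: "y .: tp (Suc n)" and g: "g .: H"
shows "untwist n (act (Suc n) y g) = last_act n (untwist n y) g"
proof -
note u = lin_in[OF untwist(1) y]
have "untwist n (act (Suc n) y g) = untwist n (act (Suc n) (twist n (untwist n y)) g)" by (simp only: twist_untwist[OF y])
also have "... = untwist n (twist n (last_act n (untwist n y) g))" by (simp only: twist_last_act[OF u g])
also have "... = last_act n (untwist n y) g" by (rule untwist_twist[OF lin_in[OF last_act(1)[OF g] u]])
finally show ?thesis .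
qed

text \<open>Under the isomorphism \<open>untwist\<close>, a basis \<open>e\<close> of \<open>H\<^sup>\<otimes>\<^sup>n\<close> yields the \<open>H\<close>-basis \<open>e \<otimes> 1\<close> of \<open>H\<^sup>\<otimes>\<^sup>(\<^sup>n\<^sup>+\<^sup>1\<^sup>)\<close>.\<close>

theorem diag_dual_basis:
"\<exists>\<phi>. dual_basis k H (diag_mod k H (Suc n)) (carrier (tp n)) (%e. snc n e 1\<^sub>H) \<phi>"
proof -
let ?S = "tp n" and ?T = "tp (Suc n)" and ?D = "diag_mod k H (Suc n)"
from tpow_Suc_coordinates[OF kf Cm, of n] obtain C where C0: "\<forall>e. C e : Hom ?T H"
 and Cs0: "\<forall>e. \<exists>c\<in>Hom ?S (base_mod k). \<forall>s\<in>carrier ?S. \<forall>v\<in>carrier H. C e (snc n s v) = c s \<odot>\<^sub>H v"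
 and Cf0: "\<forall>w\<in>carrier ?T. \<exists>E. finite E & E <: ?S & (\<forall>e. e \<notin> E --> C e w = 0\<^sub>H) & w = (\<Oplus>\<^bsub>?T\<^esub>e\<in>E. snc n e (C e w))"
 by (elim exE conjE)
note C = C0[rule_format] and Cf = Cf0[rule_format]
interpret T: module k ?T by (rule Tm)
have Cl: "C e (last_act n y g) = C e y **\<^sub>H g" if y: "y .: ?T" and g: "g .: H" for e y g
proof (rule tpow_Suc_ext[OF Cm Cm lin_comp[OF last_act(1)[OF g] C] L_mult1[OF C g] _ y])
 fix t h assume t: "t .: ?S" and h: "h .: H"
 from Cs0 obtain c where c: "c : Hom ?S (base_mod k)"
 and Cc: "!!s v. s .: ?S ==> v .: H ==> C e (snc n s v) = c s \<odot>\<^sub>H v" by blast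
 have "c t .: k" using lin_in[OF c t] by simp
 then show "C e (last_act n (snc n t h) g) = C e (snc n t h) **\<^sub>H g" using t h g by (simp add: last_act(2) Cc mult_in smult_mult_left)
qed
define \<phi> where "\<phi> e y = C e (untwist n y)" for e y
note uc = lin_in[OF untwist(1)]
have \<phi>: "\<phi> e : Hom ?T H" for e unfolding \<phi>_def[abs_def] by (rule lin_comp[OF untwist(1) C])
have act1: "act (Suc n) (snc n e 1\<^sub>H) h = twist n (snc n e h)" if e: "e .: ?S" and h: "h .: H" for e h
proof -
 have "act (Suc n) (snc n e 1\<^sub>H) h = sw k H ?T h (%a b. snc n (act n e a) (1\<^sub>H **\<^sub>H b))" by (rule tact_snoc[OF e one_closed' h])
 also have "... = sw k H ?T h (%a b. snc n (act n e a) b)" by (rule sw_cong[OF Tm twist_inner[OF e] h, symmetric]) (simp add: ALG.l_one)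
 also have "... = twist n (snc n e h)" by (rule twist(2)[OF e h, symmetric])
 finally show ?thesis .
qed
have exp: "\<exists>J. finite J & J <: ?S & (\<forall>i\<in>carrier ?S - J. \<phi> i y = 0\<^sub>H) &
 y = (\<Oplus>\<^bsub>?D\<^esub>i\<in>J. ract ?D (snc n i 1\<^sub>H) (\<phi> i y))" if y: "y .: ?T" for y
proof -
 from Cf[OF uc[OF y]] obtain E where E: "finite E" "E <: ?S" "\<forall>e. e \<notin> E --> C e (untwist n y) = 0\<^sub>H"
 and ex: "untwist n y = (\<Oplus>\<^bsub>?T\<^esub>e\<in>E. snc n e (C e (untwist n y)))" by (elim exE conjE)
 have cl: "(%e. snc n e (C e (untwist n y))) \<in> E \<rightarrow> carrier ?T" using E(2) lin_in[OF C uc[OF y]] tsnoc_in by auto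
 have "y = twist n (\<Oplus>\<^bsub>?T\<^esub>e\<in>E. snc n e (C e (untwist n y)))"
 unfolding ex[symmetric] by (rule twist_untwist[OF y, symmetric])
 also have "... = (\<Oplus>\<^bsub>?T\<^esub>e\<in>E. twist n (snc n e (C e (untwist n y))))" by (rule lin_finsum[OF twist(1) Tm Tm E(1) cl])
 also have "... = (\<Oplus>\<^bsub>?T\<^esub>e\<in>E. ract ?D (snc n e 1\<^sub>H) (\<phi> e y))"
 proof (rule T.finsum_cong'[OF refl])
 fix e assume "e \<in> E"
 then have e: "e .: ?S" using E(2) by auto
 show "twist n (snc n e (C e (untwist n y))) = ract ?D (snc n e 1\<^sub>H) (\<phi> e y)"
  using act1[OF e lin_in[OF C uc[OF y]]] diag_mod_ract[OF tsnoc_in[OF e one_closed'] lin_in[OF \<phi> y]] by (simp add: \<phi>_def)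
 next
 show "(%e. ract ?D (snc n e 1\<^sub>H) (\<phi> e y)) \<in> E \<rightarrow> carrier ?T"
 proof
  fix e assume "e \<in> E"
  then have e: "e .: ?S" using E(2) by auto
  show "ract ?D (snc n e 1\<^sub>H) (\<phi> e y) .: ?T"
  using right_module.ract_closed[OF diag_rmod[of n], of "snc n e 1\<^sub>H" "\<phi> e y"] tsnoc_in[OF e one_closed'] lin_in[OF \<phi> y]
  by simp
 qed
 qed
 also have "... = (\<Oplus>\<^bsub>?D\<^esub>e\<in>E. ract ?D (snc n e 1\<^sub>H) (\<phi> e y))"
 by (simp add: finsum_def finprod_def diag_mod_def module.defs)
 finally show ?thesis using E by (intro exI[of _ E]) (auto simp: \<phi>_def)
qed
have "dual_basis k H ?D (carrier ?S) (%e. snc n e 1\<^sub>H) \<phi>" unfolding dual_basis_def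
proof (intro conjI ballI)
 fix i assume i: "i .: ?S"
 show "snc n i 1\<^sub>H .: ?D" using tsnoc_in[OF i one_closed'] by simp
 show "\<phi> i : Hom ?D H" using \<phi>[of i] by (simp add: lin_hom_def)
 fix y g assume "y .: ?D" and g: "g .: H"
 then have y: "y .: ?T" by simp
 show "\<phi> i (ract ?D y g) = \<phi> i y **\<^sub>H g" unfolding diag_mod_ract[OF y g] \<phi>_def untwist_act[OF y g] by (rule Cl[OF uc[OF y] g])
next
 fix y assume "y .: ?D"
 then show "\<exists>J. finite J & J <: ?S & (\<forall>i\<in>carrier ?S - J. \<phi> i y = 0\<^sub>H) &
 y = (\<Oplus>\<^bsub>?D\<^esub>i\<in>J. ract ?D (snc n i 1\<^sub>H) (\<phi> i y))" using exp by simp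
qed
then show ?thesis by blast
qed

text \<open>A right multiplication on \<open>H\<close> without fixed vectors also acts on the tensor powers without fixed
vectors: look at the coordinates.\<close>

lemma diag_no_fixed_vectors:
assumes free: "!!h. h .: H ==> h **\<^sub>H x = h ==> h = 0\<^sub>H" and x: "x .: H"
 and y: "y .: tp (Suc n)" and fixed: "act (Suc n) y x = y"
shows "y = 0\<^sub>(tp (Suc n))"
proof -
let ?D = "diag_mod k H (Suc n)"
obtain \<phi> where db: "dual_basis k H ?D (carrier (tp n)) (%e. snc n e 1\<^sub>H) \<phi>" using diag_dual_basis by blast
have yD: "y .: ?D" using y by simp
interpret D: module k ?D by (rule diag_mod_module)
from dual_basis_expansion[OF db yD] obtain J where J: "finite J" "J <: tp n"
 and ex: "y = (\<Oplus>\<^bsub>?D\<^esub>i\<in>J. ract ?D (snc n i 1\<^sub>H) (\<phi> i y))" by (elim exE conjE)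
have \<phi>0: "\<phi> i y = 0\<^sub>H" if "i \<in> J" for i
proof -
 have i: "i .: tp n" using that J by auto
 note lin = dual_basisD(2)[OF db i] and eq = dual_basisD(3)[OF db i yD x]
 have "\<phi> i y **\<^sub>H x = \<phi> i y" unfolding eq[symmetric] diag_mod_ract[OF y x] fixed ..
 then show ?thesis by (rule free[OF lin_in[OF lin yD]])
qed
have "(\<Oplus>\<^bsub>?D\<^esub>i\<in>J. ract ?D (snc n i 1\<^sub>H) (\<phi> i y)) = (\<Oplus>\<^bsub>?D\<^esub>i\<in>J. 0\<^sub>?D)"
proof (rule D.finsum_cong'[OF refl])
 fix i assume i: "i \<in> J"
 then have "snc n i 1\<^sub>H .: ?D" using J tsnoc_in[OF _ one_closed'] by auto
 then show "ract ?D (snc n i 1\<^sub>H) (\<phi> i y) = 0\<^sub>?D"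
 unfolding \<phi>0[OF i] by (rule lin_zero[OF ract_lin2[OF diag_rmod] Cm diag_mod_module])
qed (rule funcsetI, rule D.zero_closed)
from trans[OF ex this] have "y = 0\<^sub>?D" unfolding D.finsum_zero .
then show ?thesis by simp
qed

end

section \<open>The total complex of a cyclic object\<close>

lemma alt_sign_lin:
assumes "module k V" "f : lin_hom k U V"
shows "(%u. alt_sign V i (f u)) : lin_hom k U V" using assms lin_neg by (cases "even i") (auto simp: alt_sign_def)

lemma alt_sign_in: "module k V ==> v .: V ==> alt_sign V i v .: V" using lin_in[OF alt_sign_lin[OF _ lin_id]] .

lemma lin_alt_sign:
assumes "module k V" "module k W" "f : lin_hom k V W" "v .: V"
shows "f (alt_sign V i v) = alt_sign W i (f v)" using lin_minus[OF assms(3,1,2,4)] by (simp add: alt_sign_def)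

text \<open>The data from which the total complex is built. The paracyclic object below has them as well.\<close>

definition cyclic_data :: "('k, 'e) ring_scheme => ('k, 'z) cyclic_object => bool" where
"cyclic_data k Z \<longleftrightarrow> (\<forall>n. module k (chains Z n)) &
 (\<forall>n i. i \<le> Suc n --> face Z (Suc n) i : lin_hom k (chains Z (Suc n)) (chains Z n)) &
 (\<forall>n. cyc Z n : lin_hom k (chains Z n) (chains Z n))"

lemma cyclic_dataD:
assumes "cyclic_data k Z"
shows "module k (chains Z n)" "i \<le> Suc n ==> face Z (Suc n) i : lin_hom k (chains Z (Suc n)) (chains Z n)"
 "cyc Z n : lin_hom k (chains Z n) (chains Z n)" using assms by (auto simp: cyclic_data_def)

lemma cyclic_operators_lin:
assumes Z: "cyclic_data k Z"
shows "cyc_b Z (Suc n) : lin_hom k (chains Z (Suc n)) (chains Z n)"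
 "cyc_b' Z (Suc n) : lin_hom k (chains Z (Suc n)) (chains Z n)"
 "cyc_t Z n : lin_hom k (chains Z n) (chains Z n)"
 "(%z. (cyc_t Z n ^^ i) z) : lin_hom k (chains Z n) (chains Z n)"
 "cyc_norm Z n : lin_hom k (chains Z n) (chains Z n)"
proof -
note D = cyclic_dataD[OF Z]
show "cyc_b Z (Suc n) : lin_hom k (chains Z (Suc n)) (chains Z n)"
 unfolding cyc_b_def[abs_def] diff_Suc_1 by (intro lin_finsum_map alt_sign_lin D) auto
show "cyc_b' Z (Suc n) : lin_hom k (chains Z (Suc n)) (chains Z n)"
 unfolding cyc_b'_def[abs_def] diff_Suc_1 by (intro lin_finsum_map alt_sign_lin D) auto
show t: "cyc_t Z n : lin_hom k (chains Z n) (chains Z n)" unfolding cyc_t_def[abs_def] by (intro alt_sign_lin D)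
show p: "(%z. (cyc_t Z n ^^ i) z) : lin_hom k (chains Z n) (chains Z n)" for i
proof (induction i)
 case (Suc i)
 show ?case using lin_comp[OF Suc t] by simp
qed simp
show "cyc_norm Z n : lin_hom k (chains Z n) (chains Z n)" unfolding cyc_norm_def[abs_def] by (intro lin_finsum_map p D) auto
qed

definition cyclic_morphism ::
 "('k, 'e) ring_scheme => ('k, 'y) cyclic_object => ('k, 'z) cyclic_object => (nat => 'y => 'z) => bool" where
"cyclic_morphism k U Z f \<longleftrightarrow> (\<forall>n. f n : lin_hom k (chains U n) (chains Z n)) &
 (\<forall>n. \<forall>i\<le>Suc n. \<forall>u\<in>carrier (chains U (Suc n)). f n (face U (Suc n) i u) = face Z (Suc n) i (f (Suc n) u)) &
 (\<forall>n. \<forall>u\<in>carrier (chains U n). f n (cyc U n u) = cyc Z n (f n u))"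

lemma cyclic_morphism_operators:
assumes U: "cyclic_data k U" and Z: "cyclic_data k Z" and f: "cyclic_morphism k U Z f"
shows "u .: chains U (Suc n) ==> f n (cyc_b U (Suc n) u) = cyc_b Z (Suc n) (f (Suc n) u)"
 and "u .: chains U (Suc n) ==> f n (cyc_b' U (Suc n) u) = cyc_b' Z (Suc n) (f (Suc n) u)"
 and "v .: chains U n ==> f n (cyc_t U n v) = cyc_t Z n (f n v)"
 and "v .: chains U n ==> f n (cyc_norm U n v) = cyc_norm Z n (f n v)"
proof -
note UD = cyclic_dataD[OF U] and ZD = cyclic_dataD[OF Z] and UL = cyclic_operators_lin[OF U]
 and ZL = cyclic_operators_lin[OF Z]
have fl: "f n : lin_hom k (chains U n) (chains Z n)" for n using f by (simp add: cyclic_morphism_def)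
have ff: "f n (face U (Suc n) i u) = face Z (Suc n) i (f (Suc n) u)" if "i \<le> Suc n" "u .: chains U (Suc n)" for n i u
 using f that by (simp add: cyclic_morphism_def)
have fc: "f n (cyc U n u) = cyc Z n (f n u)" if "u .: chains U n" for n u using f that by (simp add: cyclic_morphism_def)
have sum: "f n (\<Oplus>\<^bsub>chains U n\<^esub>i\<in>A. alt_sign (chains U n) i (face U (Suc n) i u)) =
 (\<Oplus>\<^bsub>chains Z n\<^esub>i\<in>A. alt_sign (chains Z n) i (face Z (Suc n) i (f (Suc n) u)))"
 if u: "u .: chains U (Suc n)" and A: "A \<subseteq> {..Suc n}" for u A n
proof -
 interpret Zn: module k "chains Z n" by (rule ZD(1))
 have fin: "finite A" using A finite_subset by blast
 have c: "face U (Suc n) i u .: chains U n" if "i \<in> A" for i using that A lin_in[OF UD(2) u] by auto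
 have "f n (\<Oplus>\<^bsub>chains U n\<^esub>i\<in>A. alt_sign (chains U n) i (face U (Suc n) i u)) =
 (\<Oplus>\<^bsub>chains Z n\<^esub>i\<in>A. f n (alt_sign (chains U n) i (face U (Suc n) i u)))"
 using c by (intro lin_finsum[OF fl UD(1) ZD(1) fin]) (auto intro: alt_sign_in[OF UD(1)])
 also have "... = (\<Oplus>\<^bsub>chains Z n\<^esub>i\<in>A. alt_sign (chains Z n) i (face Z (Suc n) i (f (Suc n) u)))"
 proof (rule Zn.finsum_cong'[OF refl])
 show "(%i. alt_sign (chains Z n) i (face Z (Suc n) i (f (Suc n) u))) \<in> A \<rightarrow> carrier (chains Z n)"
  using A by (auto intro!: alt_sign_in[OF ZD(1)] lin_in[OF ZD(2)] lin_in[OF fl u])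
 fix i assume i: "i \<in> A"
 then show "f n (alt_sign (chains U n) i (face U (Suc n) i u)) = alt_sign (chains Z n) i (face Z (Suc n) i (f (Suc n) u))"
  using A lin_alt_sign[OF UD(1) ZD(1) fl c[OF i]] ff[of i n u] u by auto
 qed
 finally show ?thesis .
qed
show "u .: chains U (Suc n) ==> f n (cyc_b U (Suc n) u) = cyc_b Z (Suc n) (f (Suc n) u)" using sum[of u n "{..Suc n}"] by (simp add: cyc_b_def)
show "u .: chains U (Suc n) ==> f n (cyc_b' U (Suc n) u) = cyc_b' Z (Suc n) (f (Suc n) u)"
 using sum[of u n "{..<Suc n}"] by (simp add: cyc_b'_def lessThan_subset_iff order_less_imp_le subset_iff)
show t: "v .: chains U n ==> f n (cyc_t U n v) = cyc_t Z n (f n v)" for v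
 using lin_in[OF UD(3)] by (simp add: cyc_t_def lin_alt_sign[OF UD(1) ZD(1) fl] fc)
assume v: "v .: chains U n"
interpret Zn: module k "chains Z n" by (rule ZD(1))
have p: "f n ((cyc_t U n ^^ i) v) = (cyc_t Z n ^^ i) (f n v)" for i by (induction i) (use t lin_in[OF UL(4) v] in auto)
have "f n (cyc_norm U n v) = (\<Oplus>\<^bsub>chains Z n\<^esub>i\<in>{..n}. f n ((cyc_t U n ^^ i) v))" unfolding cyc_norm_def
 by (intro lin_finsum[OF fl UD(1) ZD(1)]) (auto intro: lin_in[OF UL(4) v])
also have "... = cyc_norm Z n (f n v)" unfolding cyc_norm_def p ..
finally show "f n (cyc_norm U n v) = cyc_norm Z n (f n v)" .
qed

lemma tsygan_tot_simps:
"carrier (tsygan_tot Z n) = (\<Pi>\<^sub>E q\<in>{..n}. carrier (chains Z q))"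
"0\<^sub>(tsygan_tot Z n) = (\<lambda>q\<in>{..n}. 0\<^sub>(chains Z q))"
"f +\<^sub>(tsygan_tot Z n) g = (\<lambda>q\<in>{..n}. f q +\<^sub>(chains Z q) g q)"
"a \<odot>\<^sub>(tsygan_tot Z n) f = (\<lambda>q\<in>{..n}. a \<odot>\<^sub>(chains Z q) f q)" by (simp_all add: tsygan_tot_def)

lemma tot_memI: "(!!q. q \<le> n ==> f q .: chains Z q) ==> (\<lambda>q\<in>{..n}. f q) .: tsygan_tot Z n" by (auto simp: tsygan_tot_simps)

lemma tot_mem: "f .: tsygan_tot Z n ==> q \<le> n ==> f q .: chains Z q" by (auto simp: tsygan_tot_simps)

lemma tot_ext:
"f .: tsygan_tot Z n ==> g .: tsygan_tot Z n ==> (!!q. q \<le> n ==> f q = g q) ==> f = g" by (auto simp: tsygan_tot_simps intro: PiE_ext)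

lemma tot_module:
assumes k: "cring k" and Z: "!!n. module k (chains Z n)"
shows "module k (tsygan_tot Z n)"
proof -
note sm = module.smult_closed[OF Z]
have ab: "abelian_group (chains Z q)" for q using module.axioms(2)[OF Z] .
note ac = abelian_groupE(1)[OF ab]
have add: "f +\<^sub>(tsygan_tot Z n) g .: tsygan_tot Z n"
 if "f .: tsygan_tot Z n" "g .: tsygan_tot Z n" for f g unfolding tsygan_tot_simps(3) using that by (intro tot_memI ac tot_mem) auto
have smult: "a \<odot>\<^sub>(tsygan_tot Z n) f .: tsygan_tot Z n"
 if "a .: k" "f .: tsygan_tot Z n" for a f unfolding tsygan_tot_simps(4) using that by (intro tot_memI sm tot_mem) auto
have zero: "0\<^sub>(tsygan_tot Z n) .: tsygan_tot Z n" unfolding tsygan_tot_simps(2) by (intro tot_memI abelian_groupE(2)[OF ab])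
show ?thesis
proof (rule moduleI[OF k])
 show "abelian_group (tsygan_tot Z n)"
 proof (rule abelian_groupI)
 fix f g h assume f: "f .: tsygan_tot Z n" and g: "g .: tsygan_tot Z n" and h: "h .: tsygan_tot Z n"
 show "(f +\<^sub>(tsygan_tot Z n) g) +\<^sub>(tsygan_tot Z n) h = f +\<^sub>(tsygan_tot Z n) (g +\<^sub>(tsygan_tot Z n) h)"
  using f g h by (intro tot_ext[of _ Z n] add) (auto simp: tsygan_tot_simps(3) abelian_groupE(3)[OF ab] tot_mem)
 next
 fix f g assume f: "f .: tsygan_tot Z n" and g: "g .: tsygan_tot Z n"
 show "f +\<^sub>(tsygan_tot Z n) g = g +\<^sub>(tsygan_tot Z n) f"
  using f g by (intro tot_ext[of _ Z n] add) (auto simp: tsygan_tot_simps(3) abelian_groupE(4)[OF ab] tot_mem)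
 next
 fix f assume f: "f .: tsygan_tot Z n"
 show "0\<^sub>(tsygan_tot Z n) +\<^sub>(tsygan_tot Z n) f = f"
  using f by (intro tot_ext[of _ Z n] add zero) (auto simp: tsygan_tot_simps(2,3) abelian_groupE(5)[OF ab] tot_mem)
 let ?g = "\<lambda>q\<in>{..n}. -\<^sub>(chains Z q) f q"
 have g: "?g .: tsygan_tot Z n" using f by (intro tot_memI) (simp add: tot_mem abelian_group.a_inv_closed[OF ab])
 then show "\<exists>g\<in>carrier (tsygan_tot Z n). g +\<^sub>(tsygan_tot Z n) f = 0\<^sub>(tsygan_tot Z n)"
  using f by (intro bexI[of _ ?g] tot_ext[of _ Z n] add zero) (auto simp: tsygan_tot_simps(2,3) abelian_group.l_neg[OF ab] tot_mem)
 qed (use add zero in auto)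
next
 fix a b f assume a: "a .: k" and b: "b .: k" and f: "f .: tsygan_tot Z n"
 interpret k: cring k by (rule k)
 show "(a +\<^sub>k b) \<odot>\<^sub>(tsygan_tot Z n) f = a \<odot>\<^sub>(tsygan_tot Z n) f +\<^sub>(tsygan_tot Z n) b \<odot>\<^sub>(tsygan_tot Z n) f"
 using a b f by (intro tot_ext[of _ Z n] add smult) (auto simp: tsygan_tot_simps(3,4) module.smult_l_distr[OF Z] tot_mem)
 show "(a **\<^sub>k b) \<odot>\<^sub>(tsygan_tot Z n) f = a \<odot>\<^sub>(tsygan_tot Z n) (b \<odot>\<^sub>(tsygan_tot Z n) f)"
 using a b f by (intro tot_ext[of _ Z n] smult) (auto simp: tsygan_tot_simps(4) module.smult_assoc1[OF Z] tot_mem)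
next
 fix a f g assume a: "a .: k" and f: "f .: tsygan_tot Z n" and g: "g .: tsygan_tot Z n"
 show "a \<odot>\<^sub>(tsygan_tot Z n) (f +\<^sub>(tsygan_tot Z n) g) = a \<odot>\<^sub>(tsygan_tot Z n) f +\<^sub>(tsygan_tot Z n) a \<odot>\<^sub>(tsygan_tot Z n) g"
 using a f g by (intro tot_ext[of _ Z n] add smult) (auto simp: tsygan_tot_simps(3,4) module.smult_r_distr[OF Z] tot_mem)
next
 fix f assume f: "f .: tsygan_tot Z n"
 show "1\<^sub>k \<odot>\<^sub>(tsygan_tot Z n) f = f"
 using f cring.cring_simprules(6)[OF k] by (intro tot_ext[of _ Z n] smult) (auto simp: tsygan_tot_simps(4) module.smult_one[OF Z] tot_mem)
qed (rule smult)
qed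

text \<open>The vertical and horizontal components of the differential, with the column as first argument.\<close>

definition vert :: "('k, 'z) cyclic_object => nat => nat => 'z => 'z" where
"vert Z p q z = (if even p then cyc_b Z (Suc q) z else -\<^sub>(chains Z q) cyc_b' Z (Suc q) z)"

definition horiz :: "('k, 'z) cyclic_object => nat => nat => 'z => 'z" where
"horiz Z p q z = (if even p then cyc_norm Z q z else z -\<^sub>(chains Z q) cyc_t Z q z)"

lemma tsygan_diff_eq:
"q < n ==> tsygan_diff Z n f q = vert Z (n - 1 - q) q (f (Suc q)) +\<^sub>(chains Z q) horiz Z (n - q) q (f q)"
by (simp add: tsygan_diff_def vert_def horiz_def)

lemma vert_lin: "cyclic_data k Z ==> vert Z p q : lin_hom k (chains Z (Suc q)) (chains Z q)"
unfolding vert_def[abs_def] using cyclic_operators_lin[of k Z q] cyclic_dataD(1)[of k Z q] by (cases "even p") (simp_all add: lin_neg)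

lemma horiz_lin: "cyclic_data k Z ==> horiz Z p q : lin_hom k (chains Z q) (chains Z q)"
unfolding horiz_def[abs_def] using cyclic_operators_lin[of k Z q] cyclic_dataD(1)[of k Z q] by (cases "even p") (simp_all add: lin_minus_map)

lemma tsygan_diff_lin:
assumes Z: "cyclic_data k Z"
shows "tsygan_diff Z (Suc n) : lin_hom k (tsygan_tot Z (Suc n)) (tsygan_tot Z n)"
proof -
note V = vert_lin[OF Z] and W = horiz_lin[OF Z] and m = cyclic_dataD(1)[OF Z]
have ab: "abelian_group (chains Z q)" for q using module.axioms(2)[OF m] .
have cl: "tsygan_diff Z (Suc n) f .: tsygan_tot Z n" if f: "f .: tsygan_tot Z (Suc n)" for f
proof -
 have "tsygan_diff Z (Suc n) f = (\<lambda>q\<in>{..n}. tsygan_diff Z (Suc n) f q)" by (auto simp: tsygan_diff_def lessThan_Suc_atMost)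
 moreover have "tsygan_diff Z (Suc n) f q .: chains Z q" if "q \<le> n" for q
 using that f by (simp add: tsygan_diff_eq abelian_groupE(1)[OF ab] lin_in[OF V] lin_in[OF W] tot_mem)
 ultimately show ?thesis using tot_memI by metis
qed
show ?thesis
proof (rule lin_homI)
 fix f g assume f: "f .: tsygan_tot Z (Suc n)" and g: "g .: tsygan_tot Z (Suc n)"
 have k: "cring k" using module_cring[OF m] .
 note T = tot_module[OF k m]
 note ac = abelian_groupE(1)[OF module.axioms(2)[OF T]]
 show "tsygan_diff Z (Suc n) (f +\<^sub>(tsygan_tot Z (Suc n)) g) = tsygan_diff Z (Suc n) f +\<^sub>(tsygan_tot Z n) tsygan_diff Z (Suc n) g"
 proof (rule tot_ext[OF cl[OF ac[OF f g]] ac[OF cl[OF f] cl[OF g]]])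
 fix q assume q: "q \<le> n"
 interpret M: module k "chains Z q" by (rule m)
 have c: "f (Suc q) .: chains Z (Suc q)" "g (Suc q) .: chains Z (Suc q)"
  "f q .: chains Z q" "g q .: chains Z q" using f g q by (auto intro: tot_mem)
 note c' = lin_in[OF V c(1)] lin_in[OF V c(2)] lin_in[OF W c(3)] lin_in[OF W c(4)]
 show "tsygan_diff Z (Suc n) (f +\<^sub>(tsygan_tot Z (Suc n)) g) q = (tsygan_diff Z (Suc n) f +\<^sub>(tsygan_tot Z n) tsygan_diff Z (Suc n) g) q"
  using q c c' by (simp add: tsygan_diff_eq tsygan_tot_simps(3) lin_add[OF V] lin_add[OF W] M.a_ac)
 qed
next
 fix a f assume a: "a .: k" and f: "f .: tsygan_tot Z (Suc n)"
 have k: "cring k" using module_cring[OF m] .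
 note sm = module.smult_closed[OF tot_module[OF k m] a]
 show "tsygan_diff Z (Suc n) (a \<odot>\<^sub>(tsygan_tot Z (Suc n)) f) = a \<odot>\<^sub>(tsygan_tot Z n) tsygan_diff Z (Suc n) f"
 proof (rule tot_ext[OF cl[OF sm[OF f]] sm[OF cl[OF f]]])
 fix q assume q: "q \<le> n"
 interpret M: module k "chains Z q" by (rule m)
 have c: "f (Suc q) .: chains Z (Suc q)" "f q .: chains Z q" using f q by (auto intro: tot_mem)
 note c' = lin_in[OF V c(1)] lin_in[OF W c(2)]
 show "tsygan_diff Z (Suc n) (a \<odot>\<^sub>(tsygan_tot Z (Suc n)) f) q = (a \<odot>\<^sub>(tsygan_tot Z n) tsygan_diff Z (Suc n) f) q"
  using q c c' a by (simp add: tsygan_diff_eq tsygan_tot_simps(4) lin_smult[OF V] lin_smult[OF W] M.smult_r_distr)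
 qed
qed (rule cl)
qed

lemma cyclic_morphism_vert_horiz:
assumes U: "cyclic_data k U" and Z: "cyclic_data k Z" and f: "cyclic_morphism k U Z f"
shows "u .: chains U (Suc q) ==> f q (vert U p q u) = vert Z p q (f (Suc q) u)"
 and "v .: chains U q ==> f q (horiz U p q v) = horiz Z p q (f q v)"
proof -
note m = cyclic_dataD(1)[OF U] and m' = cyclic_dataD(1)[OF Z]
note op = cyclic_morphism_operators[OF assms] and L = cyclic_operators_lin[OF U]
have fl: "f n : lin_hom k (chains U n) (chains Z n)" for n using f by (simp add: cyclic_morphism_def)
show "u .: chains U (Suc q) ==> f q (vert U p q u) = vert Z p q (f (Suc q) u)"
 using lin_in[OF L(2)] by (simp add: vert_def op lin_minus[OF fl m m'])
show "v .: chains U q ==> f q (horiz U p q v) = horiz Z p q (f q v)" using lin_in[OF L(3)] by (simp add: horiz_def op lin_diff[OF fl m m'])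
qed

text \<open>A morphism of cyclic objects, applied componentwise, is a chain map of the total complexes.\<close>

definition tot_map :: "(nat => 'y => 'z) => nat => (nat => 'y) => nat => 'z" where
"tot_map f n g = (\<lambda>q\<in>{..n}. f q (g q))"

lemma tot_map_lin:
assumes "!!n. f n : lin_hom k (chains U n) (chains Z n)" and "!!n. module k (chains U n)"
shows "tot_map f n : lin_hom k (tsygan_tot U n) (tsygan_tot Z n)"
proof (rule lin_homI)
note fc = lin_in[OF assms(1)]
show "tot_map f n g .: tsygan_tot Z n" if "g .: tsygan_tot U n" for g unfolding tot_map_def using that by (intro tot_memI fc tot_mem)
show "tot_map f n (g +\<^sub>(tsygan_tot U n) h) = tot_map f n g +\<^sub>(tsygan_tot Z n) tot_map f n h"
 if "g .: tsygan_tot U n" "h .: tsygan_tot U n" for g h using that by (auto simp: tot_map_def tsygan_tot_simps(3) lin_add[OF assms(1)] tot_mem)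
show "tot_map f n (a \<odot>\<^sub>(tsygan_tot U n) g) = a \<odot>\<^sub>(tsygan_tot Z n) tot_map f n g"
 if "a .: k" "g .: tsygan_tot U n" for a g using that by (auto simp: tot_map_def tsygan_tot_simps(4) lin_smult[OF assms(1)] tot_mem)
qed

lemma tot_map_diff:
assumes U: "cyclic_data k U" and Z: "cyclic_data k Z" and f: "cyclic_morphism k U Z f"
 and g: "g .: tsygan_tot U (Suc n)"
shows "tot_map f n (tsygan_diff U (Suc n) g) = tsygan_diff Z (Suc n) (tot_map f (Suc n) g)"
proof -
have fl: "f n : lin_hom k (chains U n) (chains Z n)" for n using f by (simp add: cyclic_morphism_def)
note tl = tot_map_lin[where f = f, OF fl cyclic_dataD(1)[OF U]]
note V = vert_lin[OF U] and W = horiz_lin[OF U]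
show ?thesis
proof (rule tot_ext)
 show "tot_map f n (tsygan_diff U (Suc n) g) .: tsygan_tot Z n" by (intro lin_in[OF tl] lin_in[OF tsygan_diff_lin[OF U]] g)
 show "tsygan_diff Z (Suc n) (tot_map f (Suc n) g) .: tsygan_tot Z n" by (intro lin_in[OF tl] lin_in[OF tsygan_diff_lin[OF Z]] g)
 fix q assume q: "q \<le> n"
 have c: "g (Suc q) .: chains U (Suc q)" "g q .: chains U q" using g q by (auto intro: tot_mem)
 show "tot_map f n (tsygan_diff U (Suc n) g) q = tsygan_diff Z (Suc n) (tot_map f (Suc n) g) q" using q c lin_in[OF V c(1)] lin_in[OF W c(2)]
 by (simp add: tot_map_def tsygan_diff_eq lin_add[OF fl] cyclic_morphism_vert_horiz[OF U Z f])
qed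
qed

section \<open>The simplicial structure of the tensor powers\<close>

lemma alt_sign_Suc: "module k V ==> v .: V ==> alt_sign V (Suc i) v = -\<^sub>V alt_sign V i v"
by (simp add: alt_sign_def abelian_group.minus_minus[OF module.axioms(2)])

context hopf_algebra
begin

lemma counit_at_snoc:
assumes g: "g .: H"
shows "t .: tp n ==> eps n n (snc n t g) = counit H g \<odot>\<^sub>(tp n) t"
 and "i \<le> n ==> s .: tp (Suc n) ==>
 eps (Suc n) i (snc (Suc n) s g) = snc n (eps n i s) g"
proof -
show "eps n n (snc n t g) = counit H g \<odot>\<^sub>(tp n) t" if t: "t .: tp n"
proof (rule tpow_ext[OF Cm Tm _ _ _ t])
 show "(%t. eps n n (snc n t g)) : Hom (tp n) (tp n)" by (rule lin_comp[OF L_snoc1[OF lin_id g] counit_at(1)]) simp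
 show "(%t. counit H g \<odot>\<^sub>(tp n) t) : Hom (tp n) (tp n)" by (intro L_scale lin_id Tm counit_in g)
qed (use g in "simp add: tsnoc_pure[OF Cm] counit_at(2) nth_append")
assume i: "i \<le> n" and s: "s .: tp (Suc n)"
have i': "i \<le> Suc n" using i by simp
show "eps (Suc n) i (snc (Suc n) s g) = snc n (eps n i s) g"
proof (rule tpow_ext[OF Cm Tm lin_comp[OF L_snoc1[OF lin_id g] counit_at(1)[OF i']] L_snoc1[OF counit_at(1)[OF i] g] _ s])
 fix vs assume vs: "length vs = Suc n" "set vs <: H"
 then have c: "vs ! i .: H" "set (take i vs @ drop (Suc i) vs) <: H" "length (take i vs @ drop (Suc i) vs) = n"
 using i set_take_subset[of i vs] set_drop_subset[of "Suc i" vs] by (auto simp: subset_iff)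
 then show "eps (Suc n) i (snc (Suc n) (pur vs) g) = snc n (eps n i (pur vs)) g"
 using vs g i i' lin_smult[OF L_snoc1[OF lin_id g] counit_in[OF c(1)] pure_in[OF c(3,2)]] tsnoc_pure[OF Cm c(3,2) g]
 by (simp add: tsnoc_pure[OF Cm] counit_at(2) nth_append)
qed
qed

lemma counit_at_cons:
assumes g: "g .: H"
shows "t .: tp n ==> eps n 0 (cns n g t) = counit H g \<odot>\<^sub>(tp n) t"
 and "i \<le> n ==> s .: tp (Suc n) ==>
 eps (Suc n) (Suc i) (cns (Suc n) g s) = cns n g (eps n i s)"
proof -
show "eps n 0 (cns n g t) = counit H g \<odot>\<^sub>(tp n) t" if t: "t .: tp n"
proof (rule tpow_ext[OF Cm Tm _ _ _ t])
 show "(%t. eps n 0 (cns n g t)) : Hom (tp n) (tp n)" by (rule lin_comp[OF L_cons2[OF lin_id g] counit_at(1)]) simp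
 show "(%t. counit H g \<odot>\<^sub>(tp n) t) : Hom (tp n) (tp n)" by (intro L_scale lin_id Tm counit_in g)
qed (use g in "simp add: tcons_pure[OF Cm] counit_at(2)")
assume i: "i \<le> n" and s: "s .: tp (Suc n)"
have i': "Suc i \<le> Suc n" using i by simp
show "eps (Suc n) (Suc i) (cns (Suc n) g s) = cns n g (eps n i s)"
proof (rule tpow_ext[OF Cm Tm lin_comp[OF L_cons2[OF lin_id g] counit_at(1)[OF i']] L_cons2[OF counit_at(1)[OF i] g] _ s])
 fix vs assume vs: "length vs = Suc n" "set vs <: H"
 then have c: "vs ! i .: H" "set (take i vs @ drop (Suc i) vs) <: H" "length (take i vs @ drop (Suc i) vs) = n"
 using i set_take_subset[of i vs] set_drop_subset[of "Suc i" vs] by (auto simp: subset_iff)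
 then show "eps (Suc n) (Suc i) (cns (Suc n) g (pur vs)) = cns n g (eps n i (pur vs))"
 using vs g i i' lin_smult[OF L_cons2[OF lin_id g] counit_in[OF c(1)] pure_in[OF c(3,2)]] tcons_pure[OF Cm c(3,2) g]
 by (simp add: tcons_pure[OF Cm] counit_at(2))
qed
qed

lemma counit_at_act:
assumes "i \<le> n" "t .: tp (Suc n)" "h .: H"
shows "eps n i (act (Suc n) t h) = act n (eps n i t) h" using assms
proof (induction n arbitrary: t h i)
case (0 t h i)
then have i: "i = 0" by simp
have l: "eps 0 0 : Hom (tp (Suc 0)) (tp 0)" by (rule counit_at(1)) simp
note h = 0(3)
have "eps 0 0 (act (Suc 0) t h) = act 0 (eps 0 0 t) h"
proof (rule tpow_Suc_ext[OF Cm Tm lin_comp[OF L_act1[OF lin_id h] l] L_act1[OF l h] _ 0(2)])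
 fix s v assume s: "s .: tp 0" and v: "v .: H"
 interpret T: module k "tp 0" by (rule Tm)
 have "eps 0 0 (act (Suc 0) (snc 0 s v) h) = eps 0 0 (snc 0 s (v **\<^sub>H h))" by (simp only: tact_Suc_0[OF v h s])
 also have "... = counit H (v **\<^sub>H h) \<odot>\<^sub>(tp 0) s" by (rule counit_at_snoc(1)[OF mult_in[OF v h] s])
 also have "... = counit H h \<odot>\<^sub>(tp 0) (counit H v \<odot>\<^sub>(tp 0) s)"
 using s v h by (simp add: counit_mult counit_in T.smult_assoc1[symmetric] m_comm)
 also have "... = act 0 (eps 0 0 (snc 0 s v)) h" using counit_at_snoc(1)[OF v s] by simp
 finally show "eps 0 0 (act (Suc 0) (snc 0 s v) h) = act 0 (eps 0 0 (snc 0 s v)) h" .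
qed
then show ?case by (simp only: i)
next
case (Suc n t h i)
let ?T = "tp (Suc n)"
note l = counit_at(1)[OF Suc(2)] and h = Suc(4)
show ?case
proof (rule tpow_Suc_ext[OF Cm Tm lin_comp[OF L_act1[OF lin_id h] l] L_act1[OF l h] _ Suc(3)])
 fix s v assume s: "s .: ?T" and v: "v .: H"
 have b: "bilin k H H (tp (Suc (Suc n))) (%a b. snc (Suc n) (act (Suc n) s a) (v **\<^sub>H b))" by (intro bilinI lin_intros' closed_intros' s v)
 have "eps (Suc n) i (act (Suc (Suc n)) (snc (Suc n) s v) h)
  = sw k H ?T h (%a b. eps (Suc n) i (snc (Suc n) (act (Suc n) s a) (v **\<^sub>H b)))"
 unfolding tact_snoc[OF s v h] by (rule sw_post[OF Tm b h Tm l])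
 also have "... = act (Suc n) (eps (Suc n) i (snc (Suc n) s v)) h"
 proof (cases "i = Suc n")
 case True
 have "sw k H ?T h (%a b. eps (Suc n) i (snc (Suc n) (act (Suc n) s a) (v **\<^sub>H b)))
  = sw k H ?T h (%a b. counit H b \<odot>\<^sub>?T act (Suc n) (counit H v \<odot>\<^sub>?T s) a)"
 proof (rule sw_cong[OF Tm bilin_post[OF b l] h])
  interpret T: module k "?T" by (rule Tm)
  fix a b assume a: "a .: H" and b: "b .: H"
  note c = tact_in[OF s a]
  show "eps (Suc n) i (snc (Suc n) (act (Suc n) s a) (v **\<^sub>H b))
   = counit H b \<odot>\<^sub>?T act (Suc n) (counit H v \<odot>\<^sub>?T s) a"
  using s v a b c by (simp del: tact.simps add: True counit_at_snoc(1) mult_in counit_mult counit_in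
   lin_smult[OF bilin2[OF tact_bilin]] T.smult_assoc1[symmetric] m_comm)
 qed
 also have "... = act (Suc n) (counit H v \<odot>\<^sub>?T s) h"
  by (rule sw_counit2[OF Tm _ h]) (intro lin_intros' module.smult_closed[OF Tm] counit_in s v)
 finally show ?thesis using counit_at_snoc(1)[OF v s] by (simp only: True)
 next
 case False
 then have i: "i \<le> n" using Suc(2) by simp
 note cs = lin_in[OF counit_at(1)[OF i] s]
 have "sw k H ?T h (%a b. eps (Suc n) i (snc (Suc n) (act (Suc n) s a) (v **\<^sub>H b)))
  = sw k H ?T h (%a b. snc n (act n (eps n i s) a) (v **\<^sub>H b))"
 proof (rule sw_cong[OF Tm bilin_post[OF b l] h])
  fix a b assume a: "a .: H" and b: "b .: H"
  show "eps (Suc n) i (snc (Suc n) (act (Suc n) s a) (v **\<^sub>H b)) =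
   snc n (act n (eps n i s) a) (v **\<^sub>H b)" unfolding counit_at_snoc(2)[OF mult_in[OF v b] i tact_in[OF s a]] Suc.IH[OF i s a] ..
 qed
 also have "... = act (Suc n) (snc n (eps n i s) v) h" by (rule tact_snoc[OF cs v h, symmetric])
 finally show ?thesis unfolding counit_at_snoc(2)[OF v i s] .
 qed
 finally show "eps (Suc n) i (act (Suc (Suc n)) (snc (Suc n) s v) h) =
  act (Suc n) (eps (Suc n) i (snc (Suc n) s v)) h" .
qed
qed

text \<open>The alternating sum of all faces, also in degree \<open>0\<close> (the augmentation), and the one without the last face.\<close>

definition bd :: "nat => ('h list => 'k) set => ('h list => 'k) set" where
"bd n t = (\<Oplus>\<^bsub>tp n\<^esub>i\<in>{..n}. alt_sign (tp n) i (eps n i t))"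

definition bd' :: "nat => ('h list => 'k) set => ('h list => 'k) set" where
"bd' n t = (\<Oplus>\<^bsub>tp (Suc n)\<^esub>i\<in>{..n}. alt_sign (tp (Suc n)) i (eps (Suc n) i t))"

lemma bd_lin: "bd n : Hom (tp (Suc n)) (tp n)" unfolding bd_def[abs_def] by (intro lin_finsum_map alt_sign_lin Tm counit_at(1)) auto

lemma bd'_lin: "bd' n : Hom (tp (Suc (Suc n))) (tp (Suc n))" unfolding bd'_def[abs_def] by (intro lin_finsum_map alt_sign_lin Tm counit_at(1)) auto

lemma face_term_in:
"i \<le> n ==> t .: tp (Suc n) ==> alt_sign (tp n) i (eps n i t) .: tp n" by (intro alt_sign_in[OF Tm] lin_in[OF counit_at(1)])

lemma bd_0:
assumes s: "s .: tp (Suc 0)"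
shows "bd 0 s = eps 0 0 s"
proof -
interpret T: module k "tp 0" by (rule Tm)
have "eps 0 0 s .: tp 0" using lin_in[OF counit_at(1) s] by simp
then show ?thesis by (simp add: bd_def alt_sign_def)
qed

lemma bd'_snoc:
assumes t: "t .: tp (Suc n)" and g: "g .: H"
shows "bd' n (snc (Suc n) t g) = snc n (bd n t) g"
proof -
interpret T: module k "tp (Suc n)" by (rule Tm)
note L = L_snoc1[OF lin_id g, where n = n]
note c = lin_in[OF counit_at(1) t]
have "snc n (bd n t) g = (\<Oplus>\<^bsub>tp (Suc n)\<^esub>i\<in>{..n}. snc n (alt_sign (tp n) i (eps n i t)) g)"
 unfolding bd_def by (rule lin_finsum[OF L Tm Tm]) (auto intro: face_term_in t)
also have "... = bd' n (snc (Suc n) t g)" unfolding bd'_def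
proof (rule T.finsum_cong'[OF refl])
 fix i assume "i \<in> {..n}"
 then have i: "i \<le> n" by simp
 show "snc n (alt_sign (tp n) i (eps n i t)) g =
  alt_sign (tp (Suc n)) i (eps (Suc n) i (snc (Suc n) t g))" unfolding counit_at_snoc(2)[OF g i t] by (rule lin_alt_sign[OF Tm Tm L c[OF i]])
qed (auto intro!: face_term_in tsnoc_in t g)
finally show ?thesis by simp
qed

lemma bd_split_last:
assumes t: "t .: tp (Suc (Suc n))"
shows "bd (Suc n) t = bd' n t +\<^sub>(tp (Suc n)) alt_sign (tp (Suc n)) (Suc n) (eps (Suc n) (Suc n) t)"
proof -
interpret T: module k "tp (Suc n)" by (rule Tm)
note c = face_term_in[OF _ t]
have "bd (Suc n) t = alt_sign (tp (Suc n)) (Suc n) (eps (Suc n) (Suc n) t) +\<^sub>(tp (Suc n)) bd' n t"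
 unfolding bd_def bd'_def atMost_Suc by (rule T.finsum_insert) (auto intro: c)
also have "... = bd' n t +\<^sub>(tp (Suc n)) alt_sign (tp (Suc n)) (Suc n) (eps (Suc n) (Suc n) t)"
 by (intro T.M.a_comm c lin_in[OF bd'_lin t]) simp
finally show ?thesis .
qed

lemma bd_cons:
assumes t: "t .: tp (Suc n)" and g: "g .: H"
shows "bd (Suc n) (cns (Suc n) g t) = counit H g \<odot>\<^sub>(tp (Suc n)) t -\<^sub>(tp (Suc n)) cns n g (bd n t)"
proof -
let ?T = "tp (Suc n)"
interpret T: module k ?T by (rule Tm)
note y = tcons_in[OF t g]
note L = lin_neg[OF L_cons2[OF lin_id g, where n = n] Tm]
note c = lin_in[OF counit_at(1) t]
have "bd (Suc n) (cns (Suc n) g t) =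
 (\<Oplus>\<^bsub>?T\<^esub>i\<in>{..n}. alt_sign ?T (Suc i) (eps (Suc n) (Suc i) (cns (Suc n) g t))) +\<^sub>?T eps (Suc n) 0 (cns (Suc n) g t)"
 unfolding bd_def by (subst T.finsum_Suc2) (use face_term_in[OF _ y] in "auto simp: alt_sign_def")
also have "(\<Oplus>\<^bsub>?T\<^esub>i\<in>{..n}. alt_sign ?T (Suc i) (eps (Suc n) (Suc i) (cns (Suc n) g t)))
 = (\<Oplus>\<^bsub>?T\<^esub>i\<in>{..n}. -\<^sub>?T cns n g (alt_sign (tp n) i (eps n i t)))"
proof (rule T.finsum_cong'[OF refl])
 fix i assume "i \<in> {..n}"
 then have i: "i \<le> n" by simp
 show "alt_sign ?T (Suc i) (eps (Suc n) (Suc i) (cns (Suc n) g t)) =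
  -\<^sub>?T cns n g (alt_sign (tp n) i (eps n i t))" unfolding counit_at_cons(2)[OF g i t] alt_sign_Suc[OF Tm tcons_in[OF c[OF i] g]]
 using lin_alt_sign[OF Tm Tm L_cons2[OF lin_id g] c[OF i]] by simp
qed (auto intro!: face_term_in tcons_in t g)
also have "... = -\<^sub>?T cns n g (bd n t)" unfolding bd_def by (rule lin_finsum[OF L Tm Tm, symmetric]) (auto intro: face_term_in t)
finally show ?thesis using counit_at_cons(1)[OF g t] t g tcons_in[OF lin_in[OF bd_lin t] g] counit_in[OF g] by (simp add: T.M.a_comm a_minus_def)
qed

lemma bd_cons_0:
assumes t: "t .: tp 0" and g: "g .: H"
shows "bd 0 (cns 0 g t) = counit H g \<odot>\<^sub>(tp 0) t" using bd_0[OF tcons_in[OF t g]] counit_at_cons(1)[OF g t] by simp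

lemma bd_snoc:
assumes t: "t .: tp (Suc n)" and g: "g .: H"
shows "bd (Suc n) (snc (Suc n) t g) = snc n (bd n t) g +\<^sub>(tp (Suc n))
 alt_sign (tp (Suc n)) (Suc n) (counit H g \<odot>\<^sub>(tp (Suc n)) t)"
using bd_split_last[OF tsnoc_in[OF t g]] bd'_snoc[OF t g] counit_at_snoc(1)[OF g t] by simp

lemma bd_bd:
assumes "t .: tp (Suc (Suc n))"
shows "bd n (bd (Suc n) t) = 0\<^sub>(tp n)" using assms
proof (induction n arbitrary: t)
case 0
show ?case
proof (rule tcons_ext[OF Cm Tm lin_comp[OF bd_lin bd_lin] lin_zero_map[OF Tm] _ 0])
 fix s v assume s: "s .: tp (Suc 0)" and v: "v .: H"
 interpret T: module k "tp 0" by (rule Tm)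
 note bs = lin_in[OF bd_lin s]
 have "bd 0 (bd (Suc 0) (cns (Suc 0) v s)) = bd 0 (counit H v \<odot>\<^sub>(tp (Suc 0)) s) -\<^sub>(tp 0) bd 0 (cns 0 v (bd 0 s))"
 unfolding bd_cons[OF s v] by (intro lin_diff[OF bd_lin Tm Tm] module.smult_closed[OF Tm] counit_in s v tcons_in bs)
 also have "... = 0\<^sub>(tp 0)" using bs s v by (simp add: lin_smult[OF bd_lin] counit_in bd_cons_0 T.M.diff_eq_zero_iff)
 finally show "bd 0 (bd (Suc 0) (cns (Suc 0) v s)) = 0\<^sub>(tp 0)" .
qed
next
case (Suc n)
show ?case
proof (rule tcons_ext[OF Cm Tm lin_comp[OF bd_lin bd_lin] lin_zero_map[OF Tm] _ Suc(2)])
 fix s v assume s: "s .: tp (Suc (Suc n))" and v: "v .: H"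
 interpret T: module k "tp (Suc n)" by (rule Tm)
 note bs = lin_in[OF bd_lin s]
 note z = lin_zero[OF L_cons2[OF lin_id v] Tm Tm]
 have "bd (Suc n) (bd (Suc (Suc n)) (cns (Suc (Suc n)) v s)) =
  bd (Suc n) (counit H v \<odot>\<^sub>(tp (Suc (Suc n))) s) -\<^sub>(tp (Suc n)) bd (Suc n) (cns (Suc n) v (bd (Suc n) s))"
 unfolding bd_cons[OF s v] by (intro lin_diff[OF bd_lin Tm Tm] module.smult_closed[OF Tm] counit_in s v tcons_in bs)
 also have "... = 0\<^sub>(tp (Suc n))"
 using bs s v by (simp add: lin_smult[OF bd_lin] counit_in bd_cons Suc.IH z T.M.diff_eq_zero_iff T.M.diff_zero lin_in[OF bd_lin])
 finally show "bd (Suc n) (bd (Suc (Suc n)) (cns (Suc (Suc n)) v s)) = 0\<^sub>(tp (Suc n))" .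
qed
qed

lemma bd'_bd':
assumes t: "t .: tp (Suc (Suc (Suc n)))"
shows "bd' n (bd' (Suc n) t) = 0\<^sub>(tp (Suc n))"
proof (rule tpow_Suc_ext[OF Cm Tm lin_comp[OF bd'_lin bd'_lin] lin_zero_map[OF Tm] _ t])
fix s v assume s: "s .: tp (Suc (Suc n))" and v: "v .: H"
show "bd' n (bd' (Suc n) (snc (Suc (Suc n)) s v)) = 0\<^sub>(tp (Suc n))"
 using bd'_snoc[OF s v] bd'_snoc[OF lin_in[OF bd_lin s] v] bd_bd[OF s] lin_zero[OF L_snoc1[OF lin_id v] Tm Tm] by simp
qed

text \<open>Prepending \<open>1\<close> contracts the complex of all the tensor powers, augmented by the counit.\<close>

abbreviation "cons_one n t \<equiv> cns n 1\<^sub>H t"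

lemma bd_cons_one:
assumes t: "t .: tp (Suc n)"
shows "bd (Suc n) (cons_one (Suc n) t) = t -\<^sub>(tp (Suc n)) cons_one n (bd n t)"
proof -
interpret T: module k "tp (Suc n)" by (rule Tm)
show ?thesis using bd_cons[OF t one_closed'] t by (simp add: counit_one)
qed

lemma bd'_cons_one:
assumes t: "t .: tp (Suc (Suc n))"
shows "bd' (Suc n) (cons_one (Suc (Suc n)) t) = t -\<^sub>(tp (Suc (Suc n))) cons_one (Suc n) (bd' n t)"
proof (rule tpow_Suc_ext[OF Cm Tm _ _ _ t])
let ?T = "tp (Suc (Suc n))"
note C = L_cons2[OF _ one_closed']
show "(%t. bd' (Suc n) (cons_one (Suc (Suc n)) t)) : Hom ?T ?T" by (rule lin_comp[OF C[OF lin_id] bd'_lin])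
show "(%t. t -\<^sub>?T cons_one (Suc n) (bd' n t)) : Hom ?T ?T" by (intro lin_minus_map lin_id C bd'_lin Tm)
fix s v assume s: "s .: tp (Suc n)" and v: "v .: H"
note c = tcons_in[OF s one_closed'] and b = lin_in[OF bd_lin s]
have "bd' (Suc n) (cons_one (Suc (Suc n)) (snc (Suc n) s v)) = snc (Suc n) (bd (Suc n) (cons_one (Suc n) s)) v"
 unfolding tcons_tsnoc[OF Cm one_closed' v s] by (rule bd'_snoc[OF c v])
also have "... = snc (Suc n) s v -\<^sub>?T snc (Suc n) (cons_one n (bd n s)) v"
 unfolding bd_cons_one[OF s] by (rule lin_diff[OF L_snoc1[OF lin_id v] Tm Tm s tcons_in[OF b one_closed']])
also have "... = snc (Suc n) s v -\<^sub>?T cons_one (Suc n) (bd' n (snc (Suc n) s v))"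
 unfolding bd'_snoc[OF s v] tcons_tsnoc[OF Cm one_closed' v b] ..
finally show "bd' (Suc n) (cons_one (Suc (Suc n)) (snc (Suc n) s v)) =
 snc (Suc n) s v -\<^sub>?T cons_one (Suc n) (bd' n (snc (Suc n) s v))" .
qed

lemma bd'_cons_one_0:
assumes t: "t .: tp (Suc 0)"
shows "bd' 0 (cons_one (Suc 0) t) = t"
proof -
interpret T: module k "tp (Suc 0)" by (rule Tm)
have "eps (Suc 0) 0 (cons_one (Suc 0) t) = t" using counit_at_cons(1)[OF one_closed' t] t by (simp add: counit_one)
then show ?thesis using t by (simp add: bd'_def alt_sign_def)
qed

lemma bd_act:
assumes t: "t .: tp (Suc n)" and h: "h .: H"
shows "bd n (act (Suc n) t h) = act n (bd n t) h"
proof -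
interpret T: module k "tp n" by (rule Tm)
note L = L_act1[OF lin_id h, where n = n]
note c = lin_in[OF counit_at(1) t]
have "act n (bd n t) h = (\<Oplus>\<^bsub>tp n\<^esub>i\<in>{..n}. act n (alt_sign (tp n) i (eps n i t)) h)"
 unfolding bd_def by (rule lin_finsum[OF L Tm Tm]) (auto intro: face_term_in t)
also have "... = bd n (act (Suc n) t h)" unfolding bd_def
proof (rule T.finsum_cong'[OF refl])
 fix i assume "i \<in> {..n}"
 then have i: "i \<le> n" by simp
 show "act n (alt_sign (tp n) i (eps n i t)) h = alt_sign (tp n) i (eps n i (act (Suc n) t h))"
 unfolding counit_at_act[OF i t h] by (rule lin_alt_sign[OF Tm Tm L c[OF i]])
next
 show "(%i. alt_sign (tp n) i (eps n i (act (Suc n) t h))) \<in> {..n} \<rightarrow> carrier (tp n)"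
 using face_term_in[OF _ tact_in[OF t h]] by blast
qed
finally show ?thesis by simp
qed

end

declare tact.simps [simp del]

section \<open>The rotation and the double complex of the tensor powers\<close>

lemma alt_sign_add: "module k V ==> v .: V ==> alt_sign V i (alt_sign V j v) = alt_sign V (i + j) v"
by (auto simp: alt_sign_def abelian_group.minus_minus[OF module.axioms(2)])

lemma alt_sign_diff:
"module k V ==> u .: V ==> v .: V ==> alt_sign V i (u -\<^sub>V v) = alt_sign V i u -\<^sub>V alt_sign V i v"
by (rule lin_diff[OF alt_sign_lin[OF _ lin_id]])

lemma funpow_lin:
assumes "T : lin_hom k V V"
shows "(%v. (T ^^ i) v) : lin_hom k V V"
proof (induction i)
case (Suc i)
show ?case using lin_comp[OF Suc assms] by simp
qed simp

text \<open>Telescoping: \<open>(1 - T)(1 + T + \<cdots> + T\<^sup>m) = 1 - T\<^sup>m\<^sup>+\<^sup>1\<close>.\<close>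

lemma norm_telescope:
assumes V: "module k V" and T: "T : lin_hom k V V" and v: "v .: V"
shows "(\<Oplus>\<^bsub>V\<^esub>i\<in>{..m}. (T ^^ i) v) -\<^sub>V T (\<Oplus>\<^bsub>V\<^esub>i\<in>{..m}. (T ^^ i) v) = v -\<^sub>V (T ^^ Suc m) v"
 and "T (\<Oplus>\<^bsub>V\<^esub>i\<in>{..m}. (T ^^ i) v) = (\<Oplus>\<^bsub>V\<^esub>i\<in>{..m}. (T ^^ i) (T v))"
proof -
interpret V: module k V by (rule V)
note p = lin_in[OF funpow_lin[OF T] v] and Tc = lin_in[OF T]
let ?S = "%m. \<Oplus>\<^bsub>V\<^esub>i\<in>{..m}. (T ^^ i) v"
have S: "?S m .: V" for m using p by (intro V.finsum_closed) auto
show "?S m -\<^sub>V T (?S m) = v -\<^sub>V (T ^^ Suc m) v"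
proof (induction m)
 case 0
 show ?case using v Tc[OF v] by simp
next
 case (Suc m)
 define a b c s t where "a = (T ^^ Suc m) v" and "b = T a" and "c = v" and "s = ?S m" and "t = T s"
 have cl: "a .: V" "b .: V" "c .: V" "s .: V" "t .: V" using p[of "Suc m"] Tc S v unfolding a_def b_def c_def s_def t_def by auto
 have e: "?S (Suc m) = a +\<^sub>V s" unfolding atMost_Suc a_def s_def using p by (intro V.finsum_insert) (auto simp del: funpow.simps)
 have h: "s -\<^sub>V t = c -\<^sub>V a" using Suc unfolding a_def c_def s_def t_def .
 have "?S (Suc m) -\<^sub>V T (?S (Suc m)) = (a +\<^sub>V s) -\<^sub>V (b +\<^sub>V t)"
 unfolding e by (simp only: lin_add[OF T cl(1,4)] b_def t_def)
 also have "... = (s -\<^sub>V t) +\<^sub>V (a -\<^sub>V b)" using cl by (simp add: a_minus_def V.M.minus_add V.M.a_ac)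
 also have "... = c -\<^sub>V b" unfolding h using cl by (simp add: a_minus_def V.M.a_ac V.M.r_neg2 V.M.r_neg1)
 finally show ?case unfolding b_def c_def a_def by simp
qed
have "T (?S m) = (\<Oplus>\<^bsub>V\<^esub>i\<in>{..m}. T ((T ^^ i) v))" using p by (intro lin_finsum[OF T V V]) auto
then show "T (?S m) = (\<Oplus>\<^bsub>V\<^esub>i\<in>{..m}. (T ^^ i) (T v))" by (simp add: funpow_swap1)
qed

context hopf_algebra
begin

lemma twist_rotate_multilin:
assumes g: "g .: H"
shows "multilin k H (Suc n) (tp (Suc n)) (%hs. pur ((last hs **\<^sub>H g) # butlast hs))"
proof -
have F: "bilin k (tp n) H (tp (Suc n)) (%t h. cns n (h **\<^sub>H g) t)" by (intro bilinI lin_intros' closed_intros' g)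
show ?thesis
proof (rule multilin_cong[OF tlast_multilin[OF Cm F] _ Cm])
 fix vs assume vs: "length vs = Suc n" "set vs <: H"
 then have "vs ~= []" by auto
 then obtain ws v where "vs = ws @ [v]" by (metis append_butlast_last_id)
 then show "cns n (last vs **\<^sub>H g) (pur (butlast vs)) = pur ((last vs **\<^sub>H g) # butlast vs)"
 using vs g by (simp add: tcons_pure[OF Cm] mult_in)
qed
qed

lemma twist_rotate_lin: "g .: H ==> twist_rotate k H n g : Hom (tp (Suc n)) (tp (Suc n))"
unfolding twist_rotate_def by (rule tpow_lift(1)[OF Cm Tm twist_rotate_multilin])

lemma twist_rotate_linear_twist:
assumes t: "t .: tp (Suc n)"
shows "(%g. twist_rotate k H n g t) : Hom H (tp (Suc n))" unfolding twist_rotate_def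
proof (rule lin_lift_parameter[OF Cm Cm Tm twist_rotate_multilin _ t])
fix vs assume vs: "length vs = Suc n" "set vs <: H"
then have "vs ~= []" by auto
then obtain ws v where ws: "vs = ws @ [v]" by (metis append_butlast_last_id)
then have v: "v .: H" and w: "length ws = n" "set ws <: H" using vs by auto
have "(%g. pur ([] @ g # ws)) : Hom H (tp (Suc n))" by (rule multilin_slot[OF tpow_pure_multilin[OF Cm]]) (use w in auto)
then show "(%g. pur ((last vs **\<^sub>H g) # butlast vs)) : Hom H (tp (Suc n))" using lin_comp[OF L_mult2[OF lin_id v]] ws by simp
qed

end

text \<open>The tensor powers of \<open>H\<close>, with the twisted rotation as cyclic operator: a paracyclic object, since
the power \<open>n + 1\<close> of the rotation in degree \<open>n\<close> is the action of \<open>x\<close> and not the identity.\<close>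

definition paracyclic ::
 "('k, 'e) ring_scheme => ('k, 'h, 'f) hopf_scheme => 'h => ('k, ('h list => 'k) set) cyclic_object" where
"paracyclic k H x = \<lparr>chains = (%n. tpow k H (Suc n)), face = counit_at k H,
 degen = (%n. comult_at k H (Suc n)), cyc = (%n. twist_rotate k H n x)\<rparr>"

locale free_central_group_like = hopf_algebra k H
for k :: "('k, 'e) ring_scheme" and H :: "('k, 'h, 'f) hopf_scheme" +
fixes x :: 'h
assumes x_group_like: "group_like k H x"
 and x_central: "h .: H ==> x **\<^sub>H h = h **\<^sub>H x"
 and H_cocommutative: "cocommutative k H"
 and x_free: "h .: H ==> h **\<^sub>H x = h ==> h = 0\<^sub>H"
begin

abbreviation "PX \<equiv> paracyclic k H x"

abbreviation "rot n \<equiv> twist_rotate k H n x"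

lemma x_closed: "x .: H" and counit_x: "counit H x = 1\<^sub>k" using x_group_like by (auto simp: group_like_def)

lemma rot_lin: "rot n : Hom (tp (Suc n)) (tp (Suc n))" by (rule twist_rotate_lin[OF x_closed])

lemma rot_pure: "length vs = n ==> set vs <: H ==> g .: H ==>
 rot n (pur (vs @ [g])) = pur ((g **\<^sub>H x) # vs)"
using tpow_lift(2)[OF Cm Tm twist_rotate_multilin[OF x_closed], of "vs @ [g]"] by (simp add: twist_rotate_def)

lemma rot_snoc:
assumes t: "t .: tp n" and g: "g .: H"
shows "rot n (snc n t g) = cns n (g **\<^sub>H x) t"
by (rule tpow_ext[OF Cm Tm lin_comp[OF L_snoc1[OF lin_id g] rot_lin] L_cons2[OF lin_id mult_in[OF g x_closed]] _ t])
 (use g x_closed in "simp add: tsnoc_pure[OF Cm] tcons_pure[OF Cm] rot_pure mult_in")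

text \<open>Cocommutativity is what makes the rotation compatible with the diagonal action: it exchanges the parts of
  \<open>h\<close> that act on the moved factor and on the other ones.\<close>

lemma rot_act:
assumes y: "y .: tp (Suc n)" and h: "h .: H"
shows "rot n (act (Suc n) y h) = act (Suc n) (rot n y) h"
proof (rule tpow_Suc_ext[OF Cm Tm lin_comp[OF L_act1[OF lin_id h] rot_lin] L_act1[OF rot_lin h] _ y])
let ?T = "tp (Suc n)"
fix t g assume t: "t .: tp n" and g: "g .: H"
have b: "bilin k H H ?T (%a b. snc n (act n t a) (g **\<^sub>H b))" by (intro bilinI lin_intros' closed_intros' t g)
have b': "bilin k H H ?T (%a b. cns n ((g **\<^sub>H x) **\<^sub>H a) (act n t b))" by (intro bilinI lin_intros' closed_intros' t g x_closed)
have "rot n (act (Suc n) (snc n t g) h) = sw k H ?T h (%a b. rot n (snc n (act n t a) (g **\<^sub>H b)))"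
 unfolding tact_snoc[OF t g h] by (rule sw_post[OF Tm b h Tm rot_lin])
also have "... = sw k H ?T h (%a b. cns n ((g **\<^sub>H x) **\<^sub>H b) (act n t a))"
proof (rule sw_cong[OF Tm bilin_post[OF b rot_lin] h])
 fix a b assume a: "a .: H" and b: "b .: H"
 have "(g **\<^sub>H b) **\<^sub>H x = (g **\<^sub>H x) **\<^sub>H b" using x_central[OF b] by (simp add: mult_assoc g b x_closed)
 then show "rot n (snc n (act n t a) (g **\<^sub>H b)) = cns n ((g **\<^sub>H x) **\<^sub>H b) (act n t a)"
 using rot_snoc[OF tact_in[OF t a] mult_in[OF g b]] by simp
qed
also have "... = sw k H ?T h (%a b. cns n ((g **\<^sub>H x) **\<^sub>H a) (act n t b))" by (rule sw_cocommutative[OF Tm b' h H_cocommutative])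
also have "... = act (Suc n) (rot n (snc n t g)) h" unfolding rot_snoc[OF t g] by (rule tact_cons[OF t mult_in[OF g x_closed] h, symmetric])
finally show "rot n (act (Suc n) (snc n t g) h) = act (Suc n) (rot n (snc n t g)) h" .
qed

lemma rot_funpow_pure:
"length us + length vs = Suc n ==> set us <: H ==> set vs <: H ==> (rot n ^^ length vs) (pur (us @ vs)) = pur (map (%v. v **\<^sub>H x) vs @ us)"
proof (induction vs arbitrary: us rule: rev_induct)
case (snoc v vs)
have "rot n (pur ((us @ vs) @ [v])) = pur ((v **\<^sub>H x) # us @ vs)" using snoc(2-4) by (intro rot_pure) auto
then show ?case using snoc.IH[of "(v **\<^sub>H x) # us"] snoc(2-4) x_closed by (simp add: mult_in funpow_swap1)
qed simp

text \<open>A full turn multiplies every tensor factor by \<open>x\<close>.\<close>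

lemma rot_full_turn:
assumes y: "y .: tp (Suc n)"
shows "(rot n ^^ Suc n) y = act (Suc n) y x"
proof (rule tpow_ext[OF Cm Tm funpow_lin[OF rot_lin] L_act1[OF lin_id x_closed] _ y])
fix vs assume vs: "length vs = Suc n" "set vs <: H"
show "(rot n ^^ Suc n) (pur vs) = act (Suc n) (pur vs) x" using rot_funpow_pure[of "[]" vs n] vs tact_group_like[OF x_group_like vs] by simp
qed

lemma paracyclic_simps [simp]:
"chains PX n = tp (Suc n)" "face PX n i = eps n i" "cyc PX n = rot n" by (simp_all add: paracyclic_def)

lemma paracyclic_b: "cyc_b PX (Suc n) y = bd (Suc n) y" "cyc_b' PX (Suc n) y = bd' n y"
by (simp_all add: cyc_b_def bd_def cyc_b'_def bd'_def lessThan_Suc_atMost)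

lemma paracyclic_data: "cyclic_data k PX" by (simp add: cyclic_data_def Tm rot_lin counit_at(1))

lemma action_morphism: "h .: H ==> cyclic_morphism k PX PX (%n t. act (Suc n) t h)"
unfolding cyclic_morphism_def using L_act1[OF lin_id] counit_at_act rot_act by (simp del: tact.simps)

abbreviation "tt n \<equiv> cyc_t PX n"

abbreviation "nrm n \<equiv> cyc_norm PX n"

abbreviation "one_minus_x n v \<equiv> v -\<^sub>(tp (Suc n)) act (Suc n) v x"

lemma tt_lin: "tt n : Hom (tp (Suc n)) (tp (Suc n))"
and nrm_lin: "nrm n : Hom (tp (Suc n)) (tp (Suc n))" using cyclic_operators_lin[OF paracyclic_data] by simp_all

lemma tt_eq: "tt n y = alt_sign (tp (Suc n)) n (rot n y)" by (simp add: cyc_t_def)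

lemma tt_full_turn:
assumes y: "y .: tp (Suc n)"
shows "(tt n ^^ Suc n) y = act (Suc n) y x"
proof -
let ?T = "tp (Suc n)"
note rc = lin_in[OF funpow_lin[OF rot_lin] y]
have "(tt n ^^ j) y = alt_sign ?T (n * j) ((rot n ^^ j) y)" for j
proof (induction j)
 case (Suc j)
 have "(tt n ^^ Suc j) y = alt_sign ?T n (rot n (alt_sign ?T (n * j) ((rot n ^^ j) y)))" by (simp only: funpow.simps comp_def Suc tt_eq)
 also have "... = alt_sign ?T (n * Suc j) ((rot n ^^ Suc j) y)" using lin_alt_sign[OF Tm Tm rot_lin rc] alt_sign_add[OF Tm rc[of "Suc j"]] by simp
 finally show ?case .
qed (simp add: alt_sign_def)
from this[of "Suc n"] show ?thesis unfolding rot_full_turn[OF y] by (simp del: funpow.simps tact.simps add: alt_sign_def)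
qed

lemma norm_inverse:
assumes y: "y .: tp (Suc n)"
shows "nrm n y -\<^sub>(tp (Suc n)) tt n (nrm n y) = one_minus_x n y"
 and "nrm n (y -\<^sub>(tp (Suc n)) tt n y) = one_minus_x n y"
proof -
have N: "nrm n y = (\<Oplus>\<^bsub>tp (Suc n)\<^esub>i\<in>{..n}. (tt n ^^ i) y)" for y by (simp add: cyc_norm_def)
note t = norm_telescope[OF Tm tt_lin y, of n]
show 1: "nrm n y -\<^sub>(tp (Suc n)) tt n (nrm n y) = one_minus_x n y" using t(1) unfolding N tt_full_turn[OF y] .
have "nrm n (tt n y) = tt n (nrm n y)" using t(2) unfolding N by simp
then show "nrm n (y -\<^sub>(tp (Suc n)) tt n y) = one_minus_x n y" using 1 lin_diff[OF nrm_lin Tm Tm y lin_in[OF tt_lin y]] by simp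
qed

lemma one_minus_x_inj:
assumes y: "y .: tp (Suc n)" and z: "one_minus_x n y = 0\<^sub>(tp (Suc n))"
shows "y = 0\<^sub>(tp (Suc n))"
proof -
interpret T: module k "tp (Suc n)" by (rule Tm)
have "act (Suc n) y x = y" using z T.M.diff_eq_zero_iff[OF y tact_in[OF y x_closed]] by simp
from diag_no_fixed_vectors[OF x_free x_closed y this] show ?thesis .
qed

lemma tt_inj:
assumes y: "y .: tp (Suc n)" and z: "y -\<^sub>(tp (Suc n)) tt n y = 0\<^sub>(tp (Suc n))"
shows "y = 0\<^sub>(tp (Suc n))" using norm_inverse(2)[OF y] unfolding z by (intro one_minus_x_inj[OF y]) (simp add: lin_zero[OF nrm_lin Tm Tm])

text \<open>Here \<open>b t\<close> consists of the last face and of \<open>t b'\<close>, and \<open>b\<close> of \<open>b'\<close> and of the last face, which therefore cancels.\<close>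

lemma bd_one_minus_tt:
assumes y: "y .: tp (Suc (Suc n))"
shows "bd (Suc n) (y -\<^sub>(tp (Suc (Suc n))) tt (Suc n) y) = bd' n y -\<^sub>(tp (Suc n)) tt n (bd' n y)"
proof (rule tpow_Suc_ext[OF Cm Tm _ _ _ y])
let ?S = "tp (Suc n)" and ?T = "tp (Suc (Suc n))"
interpret S: module k ?S by (rule Tm)
show "(%y. bd (Suc n) (y -\<^sub>?T tt (Suc n) y)) : Hom ?T ?S" by (rule lin_comp[OF lin_minus_map[OF lin_id tt_lin Tm] bd_lin])
show "(%y. bd' n y -\<^sub>?S tt n (bd' n y)) : Hom ?T ?S" by (rule lin_minus_map[OF bd'_lin lin_comp[OF bd'_lin tt_lin] Tm])
fix t g assume t: "t .: ?S" and g: "g .: H"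
note gx = mult_in[OF g x_closed] and y = tsnoc_in[OF t g] and b = lin_in[OF bd_lin t]
have e: "counit H (g **\<^sub>H x) = counit H g" using g x_closed counit_x by (simp add: counit_mult counit_in)
define B where "B = snc n (bd n t) g"
define A where "A = alt_sign ?S (Suc n) (counit H g \<odot>\<^sub>?S t)"
define D where "D = alt_sign ?S n (cns n (g **\<^sub>H x) (bd n t))"
have cl: "A .: ?S" "B .: ?S" "D .: ?S"
 unfolding A_def B_def D_def by (intro alt_sign_in[OF Tm] S.smult_closed counit_in tsnoc_in tcons_in b t g gx)+
have 1: "bd (Suc n) (snc (Suc n) t g) = B +\<^sub>?S A" unfolding B_def A_def by (rule bd_snoc[OF t g])
have 2: "bd' n (snc (Suc n) t g) = B" unfolding B_def by (rule bd'_snoc[OF t g])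
have 3: "tt n B = D" unfolding B_def D_def tt_eq rot_snoc[OF b g] ..
have "bd (Suc n) (tt (Suc n) (snc (Suc n) t g)) = alt_sign ?S (Suc n) (bd (Suc n) (cns (Suc n) (g **\<^sub>H x) t))"
 unfolding tt_eq rot_snoc[OF t g] by (rule lin_alt_sign[OF Tm Tm bd_lin tcons_in[OF t gx]])
also have "... = A -\<^sub>?S alt_sign ?S (Suc n) (cns n (g **\<^sub>H x) (bd n t))"
 unfolding bd_cons[OF t gx] e A_def by (intro alt_sign_diff[OF Tm] S.smult_closed counit_in tcons_in b t g gx)
also have "... = A +\<^sub>?S D" unfolding alt_sign_Suc[OF Tm tcons_in[OF b gx]] a_minus_def using cl by (simp add: D_def[symmetric])
finally have 4: "bd (Suc n) (tt (Suc n) (snc (Suc n) t g)) = A +\<^sub>?S D" .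
show "bd (Suc n) (snc (Suc n) t g -\<^sub>?T tt (Suc n) (snc (Suc n) t g)) =
 bd' n (snc (Suc n) t g) -\<^sub>?S tt n (bd' n (snc (Suc n) t g))" unfolding lin_diff[OF bd_lin Tm Tm y lin_in[OF tt_lin y]] 1 2 3 4
 using cl by (simp add: a_minus_def S.M.minus_add S.M.a_assoc S.M.r_neg2)
qed

text \<open>The identity holds after applying \<open>1 - t\<close>, which is injective.\<close>

lemma bd'_norm:
assumes y: "y .: tp (Suc (Suc n))"
shows "bd' n (nrm (Suc n) y) = nrm n (bd (Suc n) y)"
proof -
let ?S = "tp (Suc n)"
interpret S: module k ?S by (rule Tm)
note Ny = lin_in[OF nrm_lin y] and b = lin_in[OF bd_lin y]
note u = lin_in[OF bd'_lin Ny] and v = lin_in[OF nrm_lin b]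
let ?w = "bd' n (nrm (Suc n) y) -\<^sub>?S nrm n (bd (Suc n) y)"
have w: "?w .: ?S" using u v by simp
have "bd' n (nrm (Suc n) y) -\<^sub>?S tt n (bd' n (nrm (Suc n) y)) = bd (Suc n) (one_minus_x (Suc n) y)"
 unfolding norm_inverse(1)[OF y, symmetric] by (rule bd_one_minus_tt[OF Ny, symmetric])
also have "... = one_minus_x n (bd (Suc n) y)" unfolding lin_diff[OF bd_lin Tm Tm y tact_in[OF y x_closed]] bd_act[OF y x_closed] ..
also have "... = nrm n (bd (Suc n) y) -\<^sub>?S tt n (nrm n (bd (Suc n) y))" by (rule norm_inverse(1)[OF b, symmetric])
finally have "(bd' n (nrm (Suc n) y) -\<^sub>?S tt n (bd' n (nrm (Suc n) y))) -\<^sub>?S (nrm n (bd (Suc n) y) -\<^sub>?S tt n (nrm n (bd (Suc n) y))) = 0\<^sub>?S"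
 using u v lin_in[OF tt_lin u] lin_in[OF tt_lin v] by (simp add: S.M.diff_eq_zero_iff)
then have "?w -\<^sub>?S tt n ?w = 0\<^sub>?S" using lin_diff[OF lin_minus_map[OF lin_id tt_lin Tm] Tm Tm u v] by simp
then have "?w = 0\<^sub>?S" by (rule tt_inj[OF w])
then show ?thesis using u v by (simp add: S.M.diff_eq_zero_iff)
qed

abbreviation "vv \<equiv> vert PX"

abbreviation "hh \<equiv> horiz PX"

lemma vv_lin: "vv p q : Hom (tp (Suc (Suc q))) (tp (Suc q))"
and hh_lin: "hh p q : Hom (tp (Suc q)) (tp (Suc q))" using vert_lin[OF paracyclic_data] horiz_lin[OF paracyclic_data] by simp_all

lemma hh_hh:
assumes y: "y .: tp (Suc q)"
shows "hh p q (hh (Suc p) q y) = one_minus_x q y" using norm_inverse[OF y] by (simp del: tact.simps add: horiz_def)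

lemma hh_inj:
assumes y: "y .: tp (Suc q)" and z: "hh p q y = 0\<^sub>(tp (Suc q))"
shows "y = 0\<^sub>(tp (Suc q))"
proof (rule one_minus_x_inj[OF y])
have e: "hh (Suc (Suc p)) q y = 0\<^sub>(tp (Suc q))" unfolding z[symmetric] by (simp add: horiz_def)
show "one_minus_x q y = 0\<^sub>(tp (Suc q))" unfolding hh_hh[OF y, of "Suc p", symmetric] e by (rule lin_zero[OF hh_lin Tm Tm])
qed

text \<open>Exactness of the rows modulo \<open>1 - x\<close>. Consecutive horizontal maps compose to \<open>1 - x\<close> and are injective, so a
  vector with horizontal image \<open>(1 - x) v\<close> is the horizontal image of \<open>v\<close>.\<close>

lemma hh_exact:
assumes y: "y .: tp (Suc q)" and v: "v .: tp (Suc q)" and e: "hh p q y = one_minus_x q v"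
shows "y = hh (Suc p) q v"
proof -
interpret T: module k "tp (Suc q)" by (rule Tm)
note c = lin_in[OF hh_lin[of "Suc p" q] v]
have "hh p q (y -\<^sub>(tp (Suc q)) hh (Suc p) q v) = hh p q y -\<^sub>(tp (Suc q)) hh p q y"
 unfolding lin_diff[OF hh_lin Tm Tm y c] hh_hh[OF v] e ..
also have "... = 0\<^sub>(tp (Suc q))" using T.M.diff_eq_zero_iff[OF lin_in[OF hh_lin y] lin_in[OF hh_lin y]] by (rule iffD2) (rule refl)
finally have "y -\<^sub>(tp (Suc q)) hh (Suc p) q v = 0\<^sub>(tp (Suc q))" by (rule hh_inj[OF T.M.minus_closed[OF y c]])
then show ?thesis using T.M.diff_eq_zero_iff[OF y c] by (rule iffD1[rotated])
qed

lemma vv_vv: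
assumes y: "y .: tp (Suc (Suc (Suc q)))"
shows "vv p q (vv p (Suc q) y) = 0\<^sub>(tp (Suc q))"
proof -
interpret T: module k "tp (Suc q)" by (rule Tm)
note b = lin_in[OF bd'_lin y]
show ?thesis using bd_bd[OF y] bd'_bd'[OF y] lin_minus[OF bd'_lin Tm Tm b] by (simp add: vert_def paracyclic_b)
qed

lemma vv_hh:
assumes y: "y .: tp (Suc (Suc q))"
shows "vv p q (hh (Suc p) (Suc q) y) = -\<^sub>(tp (Suc q)) hh (Suc p) q (vv (Suc p) q y)"
proof -
interpret T: module k "tp (Suc q)" by (rule Tm)
note b = lin_in[OF bd'_lin y]
note c = lin_in[OF lin_minus_map[OF lin_id tt_lin Tm] b]
show ?thesis using bd_one_minus_tt[OF y] bd'_norm[OF y] lin_minus[OF lin_minus_map[OF lin_id tt_lin Tm] Tm Tm b] c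
 by (simp add: vert_def horiz_def paracyclic_b)
qed

lemma vv_act:
"y .: tp (Suc (Suc q)) ==> h .: H ==> vv p q (act (Suc (Suc q)) y h) = act (Suc q) (vv p q y) h"
and hh_act:
"z .: tp (Suc q) ==> h .: H ==> hh p q (act (Suc q) z h) = act (Suc q) (hh p q z) h"
using cyclic_morphism_vert_horiz[OF paracyclic_data paracyclic_data action_morphism, of h] by (simp_all del: tact.simps)

end

section \<open>Exactness of the total complex modulo \<open>1 - x\<close>\<close>

lemma tot_eval: "q \<le> n ==> (%f. f q) : lin_hom k (tsygan_tot Z n) (chains Z q)" by (rule lin_homI) (auto simp: tsygan_tot_simps tot_mem)

lemma submodule_carrier: "module k V ==> submodule (carrier V) k V" using submodule_kernel[OF lin_zero_map, of k V V] by simp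

context free_central_group_like
begin

abbreviation "Tot n \<equiv> tsygan_tot PX n"

abbreviation "DD n \<equiv> tsygan_diff PX n"

definition JJ :: "nat => ('h list => 'k) set set" where
"JJ q = (%v. one_minus_x q v) ` carrier (tp (Suc q))"

lemma one_minus_x_lin: "(%v. one_minus_x q v) : Hom (tp (Suc q)) (tp (Suc q))" by (intro lin_minus_map lin_id L_act1 x_closed Tm)

lemma JJ_sub: "submodule (JJ q) k (tp (Suc q))" unfolding JJ_def by (rule submodule_image[OF one_minus_x_lin Tm Tm submodule_carrier[OF Tm]])

lemma Tot_module: "module k (Tot n)" by (rule tot_module[OF module_cring[OF Cm]]) (simp add: Tm)

lemma Tot_mem: "f .: Tot n ==> q \<le> n ==> f q .: tp (Suc q)" using tot_mem[of f PX n q] by simp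

lemma Tot_eval: "q \<le> n ==> (%f. f q) : Hom (Tot n) (tp (Suc q))" using tot_eval[of q n k PX] by simp

lemma DD_lin: "DD (Suc n) : Hom (Tot (Suc n)) (Tot n)" by (rule tsygan_diff_lin[OF paracyclic_data])

lemma DD_eq: "q \<le> n ==> DD (Suc n) f q = vv (n - q) q (f (Suc q)) +\<^sub>(tp (Suc q)) hh (Suc n - q) q (f q)"
using tsygan_diff_eq[of q "Suc n" PX f] by simp

lemma DD_DD:
assumes f: "f .: Tot (Suc (Suc n))" and q: "q \<le> n"
shows "DD (Suc n) (DD (Suc (Suc n)) f) q = one_minus_x q (f q)"
proof -
let ?T = "tp (Suc q)"
interpret T: module k ?T by (rule Tm)
have c: "f q .: ?T" "f (Suc q) .: tp (Suc (Suc q))" "f (Suc (Suc q)) .: tp (Suc (Suc (Suc q)))" using f q by (auto intro: Tot_mem)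
define p where "p = n - q"
have e: "n - q = p" "Suc n - q = Suc p" "Suc n - Suc q = p" "Suc (Suc n) - Suc q = Suc p" "Suc (Suc n) - q = Suc (Suc p)"
 using q by (auto simp: p_def)
note v1 = lin_in[OF vv_lin[of p "Suc q"] c(3)] and h1 = lin_in[OF hh_lin[of "Suc p" "Suc q"] c(2)]
 and v2 = lin_in[OF vv_lin[of "Suc p" q] c(2)] and h2 = lin_in[OF hh_lin[of "Suc (Suc p)" q] c(1)]
note h3 = lin_in[OF hh_lin[of "Suc p" q] v2] and h4 = lin_in[OF hh_lin[of "Suc p" q] h2]
have d1: "DD (Suc (Suc n)) f (Suc q) = vv p (Suc q) (f (Suc (Suc q))) +\<^sub>(tp (Suc (Suc q))) hh (Suc p) (Suc q) (f (Suc q))"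
 using DD_eq[of "Suc q" "Suc n" f] q unfolding e by simp
have d2: "DD (Suc (Suc n)) f q = vv (Suc p) q (f (Suc q)) +\<^sub>?T hh (Suc (Suc p)) q (f q)" using DD_eq[of q "Suc n" f] q unfolding e by simp
have "DD (Suc n) (DD (Suc (Suc n)) f) q = (vv p q (vv p (Suc q) (f (Suc (Suc q)))) +\<^sub>?T vv p q (hh (Suc p) (Suc q) (f (Suc q))))
 +\<^sub>?T (hh (Suc p) q (vv (Suc p) q (f (Suc q))) +\<^sub>?T hh (Suc p) q (hh (Suc (Suc p)) q (f q)))"
 unfolding DD_eq[OF q] e d1 d2 lin_add[OF vv_lin v1 h1] lin_add[OF hh_lin v2 h2] ..
also have "... = hh (Suc p) q (hh (Suc (Suc p)) q (f q))" unfolding vv_vv[OF c(3)] vv_hh[OF c(2)] using h3 h4 by (simp add: T.M.r_neg1)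
also have "... = one_minus_x q (f q)" by (rule hh_hh[OF c(1)])
finally show ?thesis .
qed

lemma vv_JJ: "y \<in> JJ (Suc q) ==> vv p q y \<in> JJ q"
proof -
assume "y \<in> JJ (Suc q)"
then obtain v where v: "v .: tp (Suc (Suc q))" and y: "y = one_minus_x (Suc q) v" unfolding JJ_def by (elim imageE)
have "vv p q y = one_minus_x q (vv p q v)" unfolding y lin_diff[OF vv_lin Tm Tm v tact_in[OF v x_closed]] vv_act[OF v x_closed] ..
then show ?thesis unfolding JJ_def using lin_in[OF vv_lin v] by (rule image_eqI)
qed

lemma DD_correct:
assumes f: "f .: Tot (Suc n)" and g: "g .: Tot (Suc (Suc n))"
 and Df: "\<forall>q\<le>n. DD (Suc n) f q \<in> JJ q"
defines "f' \<equiv> f -\<^sub>(Tot (Suc n)) DD (Suc (Suc n)) g"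
shows "f' .: Tot (Suc n)"
 and "q \<le> n ==> DD (Suc n) f' q \<in> JJ q"
 and "q \<le> Suc n ==> f' q = f q -\<^sub>(tp (Suc q)) DD (Suc (Suc n)) g q"
 and "\<exists>g'\<in>carrier (Tot (Suc (Suc n))). \<forall>q\<le>Suc n. f' q -\<^sub>(tp (Suc q)) DD (Suc (Suc n)) g' q \<in> JJ q ==>
 \<exists>g'\<in>carrier (Tot (Suc (Suc n))). \<forall>q\<le>Suc n. f q -\<^sub>(tp (Suc q)) DD (Suc (Suc n)) g' q \<in> JJ q"
proof -
interpret A: module k "Tot (Suc n)" by (rule Tot_module)
interpret B: module k "Tot (Suc (Suc n))" by (rule Tot_module)
note Dg = lin_in[OF DD_lin g]
show c: "f' .: Tot (Suc n)" unfolding f'_def using f Dg by simp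
show e: "f' q = f q -\<^sub>(tp (Suc q)) DD (Suc (Suc n)) g q" if "q \<le> Suc n" for q
 unfolding f'_def by (rule lin_diff[OF Tot_eval[OF that] Tot_module Tm f Dg])
show "DD (Suc n) f' q \<in> JJ q" if q: "q \<le> n"
proof -
 note c1 = lin_in[OF DD_lin f] and c2 = lin_in[OF DD_lin Dg]
 have "DD (Suc n) f' q = DD (Suc n) f q -\<^sub>(tp (Suc q)) one_minus_x q (g q)"
 unfolding f'_def lin_diff[OF DD_lin Tot_module Tot_module f Dg] lin_diff[OF Tot_eval[OF q] Tot_module Tm c1 c2]
  DD_DD[OF g q] ..
 moreover have "one_minus_x q (g q) \<in> JJ q" unfolding JJ_def using Tot_mem[OF g, of q] q by (intro imageI) simp
 ultimately show ?thesis using submodule_diff[OF Tm JJ_sub Df[rule_format, OF q]] by simp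
qed
assume "\<exists>g'\<in>carrier (Tot (Suc (Suc n))). \<forall>q\<le>Suc n. f' q -\<^sub>(tp (Suc q)) DD (Suc (Suc n)) g' q \<in> JJ q"
then obtain g' where g': "g' .: Tot (Suc (Suc n))"
 and ex: "!!q. q \<le> Suc n ==> f' q -\<^sub>(tp (Suc q)) DD (Suc (Suc n)) g' q \<in> JJ q" by auto
note Dg' = lin_in[OF DD_lin g']
have "f q -\<^sub>(tp (Suc q)) DD (Suc (Suc n)) (g +\<^sub>(Tot (Suc (Suc n))) g') q \<in> JJ q" if q: "q \<le> Suc n" for q
proof -
 interpret T: module k "tp (Suc q)" by (rule Tm)
 have cl: "f q .: tp (Suc q)" "DD (Suc (Suc n)) g q .: tp (Suc q)" "DD (Suc (Suc n)) g' q .: tp (Suc q)"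
 using Tot_mem[OF f q] Tot_mem[OF Dg q] Tot_mem[OF Dg' q] by auto
 have "f q -\<^sub>(tp (Suc q)) DD (Suc (Suc n)) (g +\<^sub>(Tot (Suc (Suc n))) g') q = f' q -\<^sub>(tp (Suc q)) DD (Suc (Suc n)) g' q"
 unfolding lin_add[OF DD_lin g g'] lin_add[OF Tot_eval[OF q] Dg Dg'] e[OF q] using cl by (simp add: a_minus_def T.M.minus_add T.M.a_assoc)
 then show ?thesis using ex[OF q] by simp
qed
then show "\<exists>g'\<in>carrier (Tot (Suc (Suc n))). \<forall>q\<le>Suc n. f q -\<^sub>(tp (Suc q)) DD (Suc (Suc n)) g' q \<in> JJ q"
 using B.M.add.m_closed[OF g g'] by blast
qed

text \<open>Descending induction over the rows: once the components above row \<open>m\<close> lie in the image of \<open>1 - x\<close>, so does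
  the horizontal image of the component in row \<open>m\<close>, and exactness of the row allows to remove it.\<close>

lemma DD_exact_below:
assumes "f .: Tot (Suc n)" and "!!q. q \<le> n ==> DD (Suc n) f q \<in> JJ q"
 and "!!q. m \<le> q ==> q \<le> Suc n ==> f q \<in> JJ q" and "m \<le> Suc n"
shows "\<exists>g\<in>carrier (Tot (Suc (Suc n))). \<forall>q\<le>Suc n. f q -\<^sub>(tp (Suc q)) DD (Suc (Suc n)) g q \<in> JJ q" using assms
proof (induction m arbitrary: f)
case 0
interpret B: module k "Tot (Suc (Suc n))" by (rule Tot_module)
have "f q -\<^sub>(tp (Suc q)) DD (Suc (Suc n)) 0\<^sub>(Tot (Suc (Suc n))) q \<in> JJ q" if q: "q \<le> Suc n" for q
proof -
 interpret T: module k "tp (Suc q)" by (rule Tm)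
 show ?thesis unfolding lin_zero[OF DD_lin Tot_module Tot_module] lin_zero[OF Tot_eval[OF q] Tot_module Tm]
 using 0(3)[OF _ q] Tot_mem[OF 0(1) q] by (simp add: T.M.diff_zero)
qed
then show ?case using B.M.zero_closed by blast
next
case (Suc m f)
have m: "m \<le> n" using Suc.prems(4) by simp
define p where "p = n - m"
have e: "Suc n - m = Suc p" "n - m = p" "Suc (Suc n) - m = Suc (Suc p)" using m by (auto simp: p_def)
let ?T = "%q. tp (Suc q)"
interpret Tm: module k "?T m" by (rule Tm)
have fc: "f m .: ?T m" "f (Suc m) .: ?T (Suc m)" using Tot_mem[OF Suc.prems(1)] m by auto
note vc = lin_in[OF vv_lin[of p m] fc(2)] and hc = lin_in[OF hh_lin[of "Suc p" m] fc(1)]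
have J: "vv p m (f (Suc m)) \<in> JJ m" using Suc.prems(3)[of "Suc m"] m by (intro vv_JJ) simp
have "hh (Suc p) m (f m) = DD (Suc n) f m -\<^sub>(?T m) vv p m (f (Suc m))"
 unfolding DD_eq[OF m] e using vc hc by (simp add: a_minus_def Tm.M.a_ac Tm.M.r_neg Tm.M.r_neg1 Tm.M.r_neg2)
then have "hh (Suc p) m (f m) \<in> JJ m" using submodule_diff[OF Tm JJ_sub Suc.prems(2)[OF m] J] by simp
then obtain w where w: "w .: ?T m" and hw: "hh (Suc p) m (f m) = one_minus_x m w" unfolding JJ_def by (elim imageE)
have fw: "f m = hh (Suc (Suc p)) m w" by (rule hh_exact[OF fc(1) w hw])
define g where "g = (\<lambda>q\<in>{..Suc (Suc n)}. if q = m then w else 0\<^sub>(?T q))"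
have g: "g .: Tot (Suc (Suc n))" unfolding g_def using w module.axioms(2)[OF Tm] by (intro tot_memI) (auto intro: abelian_groupE(2))
have "\<forall>q\<le>n. DD (Suc n) f q \<in> JJ q" using Suc.prems(2) by blast
note C = DD_correct[OF Suc.prems(1) g this]
show ?case
proof (rule C(4), rule Suc.IH)
 fix q assume q: "m \<le> q" "q \<le> Suc n"
 interpret T: module k "?T q" by (rule Tm)
 have g1: "g (Suc q) = 0\<^sub>(?T (Suc q))" using q by (auto simp: g_def)
 have D: "DD (Suc (Suc n)) g q = hh (Suc (Suc n) - q) q (g q)"
 unfolding DD_eq[OF q(2)] g1 lin_zero[OF vv_lin Tm Tm] using lin_in[OF hh_lin Tot_mem[OF g, of q]] q by simp
 show "(f -\<^sub>(Tot (Suc n)) DD (Suc (Suc n)) g) q \<in> JJ q"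
 proof (cases "q = m")
 case True
 have "DD (Suc (Suc n)) g q = f q" unfolding D using m True e fw by (simp add: g_def)
 then have "(f -\<^sub>(Tot (Suc n)) DD (Suc (Suc n)) g) q = 0\<^sub>(?T q)"
  unfolding C(3)[OF q(2)] using T.M.diff_eq_zero_iff Tot_mem[OF Suc.prems(1) q(2)] by simp
 then show ?thesis using submodule_zero[OF Tm JJ_sub] by simp
 next
 case False
 then have "g q = 0\<^sub>(?T q)" using q by (simp add: g_def)
 then have "DD (Suc (Suc n)) g q = 0\<^sub>(?T q)" unfolding D by (simp add: lin_zero[OF hh_lin Tm Tm])
 then have "(f -\<^sub>(Tot (Suc n)) DD (Suc (Suc n)) g) q = f q"
  unfolding C(3)[OF q(2)] using Tot_mem[OF Suc.prems(1) q(2)] by (simp add: T.M.diff_zero)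
 then show ?thesis using Suc.prems(3)[of q] q False by simp
 qed
qed (use C(1,2) m in auto)
qed

text \<open>The top component is removed first. Its image under \<open>b\<close> has the form \<open>(1 - t) y\<close> with \<open>b' y = 0\<close>, and
prepending \<open>1\<close> to \<open>y\<close> corrects it to a cycle for \<open>b\<close>; such a cycle bounds because of the same
contraction.\<close>

theorem DD_exact:
assumes f: "f .: Tot (Suc n)" and Df: "!!q. q \<le> n ==> DD (Suc n) f q \<in> JJ q"
shows "\<exists>g\<in>carrier (Tot (Suc (Suc n))). \<forall>q\<le>Suc n. f q -\<^sub>(tp (Suc q)) DD (Suc (Suc n)) g q \<in> JJ q"
proof -
let ?T = "%q. tp (Suc q)"
interpret T: module k "?T n" by (rule Tm)
interpret U: module k "?T (Suc n)" by (rule Tm)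
have fc: "f n .: ?T n" "f (Suc n) .: ?T (Suc n)" using Tot_mem[OF f] by auto
note bf = lin_in[OF bd_lin fc(2)] and tf = lin_in[OF tt_lin fc(1)]
define P where "P y = y -\<^sub>(?T n) tt n y" for y
define R where "R y = y -\<^sub>(?T (Suc n)) tt (Suc n) y" for y
have P: "P : Hom (?T n) (?T n)" unfolding P_def[abs_def] by (intro lin_minus_map lin_id tt_lin Tm)
have R: "R : Hom (?T (Suc n)) (?T (Suc n))" unfolding R_def[abs_def] by (intro lin_minus_map lin_id tt_lin Tm)
have bR: "bd (Suc n) (R y) = P (bd' n y)" if "y .: ?T (Suc n)" for y unfolding P_def R_def by (rule bd_one_minus_tt[OF that])
have "DD (Suc n) f n = bd (Suc n) (f (Suc n)) +\<^sub>(?T n) P (f n)" using DD_eq[of n n f] by (simp add: vert_def horiz_def paracyclic_b P_def)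
moreover obtain v where v: "v .: ?T n" and "DD (Suc n) f n = one_minus_x n v" using Df[of n] unfolding JJ_def by auto
ultimately have e: "bd (Suc n) (f (Suc n)) +\<^sub>(?T n) P (f n) = P (nrm n v)" using norm_inverse(1)[OF v] by (simp add: P_def)
note Nv = lin_in[OF nrm_lin v]
define y where "y = nrm n v -\<^sub>(?T n) f n"
have y: "y .: ?T n" unfolding y_def using Nv fc(1) by simp
have by1: "bd (Suc n) (f (Suc n)) = P y" unfolding y_def lin_diff[OF P Tm Tm Nv fc(1)] e[symmetric]
 using bf lin_in[OF P fc(1)] by (simp add: a_minus_def T.M.a_assoc T.M.r_neg)
define s where "s = cons_one (Suc n) y"
have s: "s .: ?T (Suc n)" unfolding s_def by (rule tcons_in[OF y one_closed'])
have bs: "bd' n s = y"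
proof (cases n)
 case 0
 then show ?thesis using bd'_cons_one_0 y by (simp add: s_def)
next
 case (Suc m)
 have y': "y .: tp (Suc (Suc m))" using y Suc by simp
 have "bd (Suc m) (P y) = 0\<^sub>(?T m)" unfolding by1[symmetric] using bd_bd[of "f (Suc n)" "Suc m"] fc(2) Suc by simp
 then have "bd' m y -\<^sub>(?T m) tt m (bd' m y) = 0\<^sub>(?T m)" unfolding P_def Suc bd_one_minus_tt[OF y'] .
 then have z: "bd' m y = 0\<^sub>(?T m)" by (rule tt_inj[OF lin_in[OF bd'_lin y']])
 interpret S: module k "tp (Suc (Suc m))" by (rule Tm)
 show ?thesis unfolding s_def Suc bd'_cons_one[OF y'] z lin_zero[OF L_cons2[OF lin_id one_closed'] Tm Tm] using y' by (simp add: S.M.diff_zero)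
qed
define u where "u = f (Suc n) -\<^sub>(?T (Suc n)) R s"
note Rs = lin_in[OF R s]
have u: "u .: ?T (Suc n)" unfolding u_def using fc(2) Rs by simp
have bu: "bd (Suc n) u = 0\<^sub>(?T n)" unfolding u_def lin_diff[OF bd_lin Tm Tm fc(2) Rs] bR[OF s] bs by1
 using lin_in[OF P y] by (simp add: T.M.diff_eq_zero_iff)
define c where "c = cons_one (Suc (Suc n)) u"
have c: "c .: ?T (Suc (Suc n))" unfolding c_def by (rule tcons_in[OF u one_closed'])
have bc: "bd (Suc (Suc n)) c = u" unfolding c_def bd_cons_one[OF u] bu lin_zero[OF L_cons2[OF lin_id one_closed'] Tm Tm]
 using u by (simp add: U.M.diff_zero)
define g where "g = (\<lambda>q\<in>{..Suc (Suc n)}. if q = Suc (Suc n) then c else if q = Suc n then s else 0\<^sub>(?T q))"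
have g: "g .: Tot (Suc (Suc n))" unfolding g_def using c s module.axioms(2)[OF Tm] by (intro tot_memI) (auto intro: abelian_groupE(2))
have Dg: "DD (Suc (Suc n)) g (Suc n) = f (Suc n)"
proof -
 have "DD (Suc (Suc n)) g (Suc n) = bd (Suc (Suc n)) c +\<^sub>(?T (Suc n)) R s"
 using DD_eq[of "Suc n" "Suc n" g] by (simp add: vert_def horiz_def paracyclic_b R_def g_def)
 then show ?thesis unfolding bc u_def using fc(2) Rs by (simp add: a_minus_def U.M.a_assoc U.M.l_neg)
qed
have "\<forall>q\<le>n. DD (Suc n) f q \<in> JJ q" using Df by blast
note C = DD_correct[OF f g this]
show ?thesis
proof (rule C(4), rule DD_exact_below[where m = "Suc n"])
 fix q assume "Suc n \<le> q" "q \<le> Suc n"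
 then have q: "q = Suc n" by simp
 have "(f -\<^sub>(Tot (Suc n)) DD (Suc (Suc n)) g) (Suc n) = 0\<^sub>(?T (Suc n))"
 unfolding C(3)[OF order_refl] Dg using fc(2) by (simp add: U.M.diff_eq_zero_iff)
 then show "(f -\<^sub>(Tot (Suc n)) DD (Suc (Suc n)) g) q \<in> JJ q" using submodule_zero[OF Tm JJ_sub] q by simp
qed (use C(1,2) in auto)
qed

text \<open>The augmentation of the total complex: the counit on \<open>H\<close>, in degree \<open>0\<close>.\<close>

definition eps1 :: "('h list => 'k) set => 'k" where
"eps1 = pres_lift k (base_mod k) (%vs. counit H (vs ! 0))"

lemma eps1_lin: "eps1 : Hom (tp (Suc 0)) (base_mod k)"
and eps1_pure: "v .: H ==> eps1 (pur [v]) = counit H v" using tpow_lift[OF Cm kmod lin_on_vector[OF counit_linear]] by (simp_all add: eps1_def)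

lemma tpow1_ext:
assumes W: "module k W" and f: "f : Hom (tp (Suc 0)) W" and g: "g : Hom (tp (Suc 0)) W"
 and eq: "!!v. v .: H ==> f (pur [v]) = g (pur [v])" and t: "t .: tp (Suc 0)"
shows "f t = g t" by (rule tpow_ext[OF Cm W f g _ t]) (use eq in "auto simp: length_Suc_conv")

lemma nil_in: "pur [] .: tp 0" by (rule pure_in) auto

lemma single_pure: "v .: H ==> cns 0 v (pur []) = pur [v]" by (simp add: tcons_pure[OF Cm])

lemma bd_0_eps1:
assumes y: "y .: tp (Suc 0)"
shows "bd 0 y = eps1 y \<odot>\<^sub>(tp 0) pur []" by (rule tpow1_ext[OF Tm bd_lin lin_smult_vec[OF Tm nil_in eps1_lin] _ y])
 (use bd_cons_0[OF nil_in] in "simp add: single_pure eps1_pure")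

lemma eps1_bd:
assumes "y .: tp (Suc (Suc 0))"
shows "eps1 (bd (Suc 0) y) = 0\<^sub>k"
proof -
have "eps1 (bd (Suc 0) y) = 0\<^sub>(base_mod k)"
proof (rule tcons_ext[OF Cm kmod lin_comp[OF bd_lin eps1_lin] lin_zero_map[OF kmod] _ assms])
 fix s u assume s: "s .: tp (Suc 0)" and u: "u .: H"
 interpret K: module k "base_mod k" by (rule kmod)
 have es: "eps1 s .: k" using lin_in[OF eps1_lin s] by simp
 note c1 = module.smult_closed[OF Tm counit_in[OF u] s] and c2 = lin_in[OF bd_lin s]
 have "eps1 (bd (Suc 0) (cns (Suc 0) u s)) = eps1 (counit H u \<odot>\<^sub>(tp (Suc 0)) s) -\<^sub>(base_mod k) eps1 (cns 0 u (bd 0 s))"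
 unfolding bd_cons[OF s u] by (rule lin_diff[OF eps1_lin Tm kmod c1 tcons_in[OF c2 u]])
 also have "eps1 (cns 0 u (bd 0 s)) = eps1 s **\<^sub>k counit H u"
 unfolding bd_0_eps1[OF s] lin_smult[OF L_cons2[OF lin_id u] es nil_in] single_pure[OF u]
 using lin_smult[OF eps1_lin es, of "pur [u]"] pure_in[of "[u]" "Suc 0"] u by (simp add: eps1_pure)
 also have "eps1 (counit H u \<odot>\<^sub>(tp (Suc 0)) s) = eps1 s **\<^sub>k counit H u"
 using lin_smult[OF eps1_lin counit_in[OF u] s] es counit_in[OF u] by (simp add: m_comm)
 finally have "eps1 (bd (Suc 0) (cns (Suc 0) u s)) = eps1 s **\<^sub>k counit H u -\<^sub>(base_mod k) eps1 s **\<^sub>k counit H u" .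
 moreover have c: "eps1 s **\<^sub>k counit H u .: base_mod k" using es counit_in[OF u] by simp
 ultimately show "eps1 (bd (Suc 0) (cns (Suc 0) u s)) = 0\<^sub>(base_mod k)" using K.M.diff_eq_zero_iff[OF c c] by (simp only:)
qed
then show ?thesis by simp
qed

lemma eps1_act:
assumes y: "y .: tp (Suc 0)" and h: "h .: H"
shows "eps1 (act (Suc 0) y h) = eps1 y **\<^sub>k counit H h"
proof (rule tpow1_ext[OF kmod lin_comp[OF L_act1[OF lin_id h] eps1_lin] _ _ y])
have "(%y. counit H h \<odot>\<^sub>(base_mod k) eps1 y) : Hom (tp (Suc 0)) (base_mod k)" by (rule lin_scale[OF eps1_lin kmod counit_in[OF h]])
moreover have "counit H h \<odot>\<^sub>(base_mod k) eps1 y = eps1 y **\<^sub>k counit H h" if "y .: tp (Suc 0)" for y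
 using lin_in[OF eps1_lin that] counit_in[OF h] by (simp add: m_comm)
ultimately show "(%y. eps1 y **\<^sub>k counit H h) : Hom (tp (Suc 0)) (base_mod k)" using lin_cong[OF _ Tm] by (metis (no_types, lifting))
fix v assume v: "v .: H"
have "act (Suc 0) (pur [v]) h = pur [v **\<^sub>H h]" using tact_Suc_0[OF v h nil_in] tsnoc_pure[OF Cm, of "[]" 0] v h by (simp add: mult_in)
then show "eps1 (act (Suc 0) (pur [v]) h) = eps1 (pur [v]) **\<^sub>k counit H h" using v h by (simp add: eps1_pure mult_in counit_mult)
qed

lemma eps1_one_minus_x:
assumes y: "y .: tp (Suc 0)"
shows "eps1 (one_minus_x 0 y) = 0\<^sub>k"
proof -
interpret K: module k "base_mod k" by (rule kmod)
have e: "eps1 y .: base_mod k" by (rule lin_in[OF eps1_lin y])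
have "eps1 (act (Suc 0) y x) = eps1 y" using e by (simp add: eps1_act[OF y x_closed] counit_x)
then show ?thesis using lin_diff[OF eps1_lin Tm kmod y tact_in[OF y x_closed]] K.M.diff_eq_zero_iff[OF e e] by simp
qed

lemma DD_augmented:
assumes f: "f .: Tot (Suc 0)"
shows "eps1 (DD (Suc 0) f 0) = 0\<^sub>k"
proof -
interpret K: module k "base_mod k" by (rule kmod)
have c: "f 0 .: tp (Suc 0)" "f (Suc 0) .: tp (Suc (Suc 0))" using Tot_mem[OF f] by auto
have t: "tt 0 (f 0) = act (Suc 0) (f 0) x" using tt_full_turn[OF c(1)] by simp
note om = lin_in[OF one_minus_x_lin c(1)]
have "DD (Suc 0) f 0 = bd (Suc 0) (f (Suc 0)) +\<^sub>(tp (Suc 0)) one_minus_x 0 (f 0)"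
 using DD_eq[of 0 0 f] by (simp add: vert_def horiz_def paracyclic_b t)
then have "eps1 (DD (Suc 0) f 0) = eps1 (bd (Suc 0) (f (Suc 0))) +\<^sub>k eps1 (one_minus_x 0 (f 0))"
 using lin_add[OF eps1_lin lin_in[OF bd_lin c(2)] om] by simp
then show ?thesis by (simp add: eps1_bd[OF c(2)] eps1_one_minus_x[OF c(1)])
qed

lemma DD_exact_0:
assumes f: "f .: Tot 0" and z: "eps1 (f 0) = 0\<^sub>k"
shows "\<exists>g\<in>carrier (Tot (Suc 0)). DD (Suc 0) g 0 = f 0"
proof -
let ?T = "tp (Suc 0)"
interpret T: module k ?T by (rule Tm)
interpret T0: module k "tp 0" by (rule Tm)
have c: "f 0 .: ?T" using Tot_mem[OF f] by simp
define g where "g = (\<lambda>q\<in>{..Suc 0}. if q = 0 then 0\<^sub>?T else cons_one (Suc 0) (f 0))"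
have g: "g .: Tot (Suc 0)" unfolding g_def using c tcons_in[OF c one_closed'] by (intro tot_memI) (auto simp: le_Suc_eq)
have b: "bd (Suc 0) (cons_one (Suc 0) (f 0)) = f 0"
 unfolding bd_cons_one[OF c] bd_0_eps1[OF c] z using c lin_zero[OF L_cons2[OF lin_id one_closed'] Tm Tm] nil_in by (simp add: T.M.diff_zero)
have t: "tt 0 0\<^sub>?T = 0\<^sub>?T" by (rule lin_zero[OF tt_lin Tm Tm])
have "DD (Suc 0) g 0 = bd (Suc 0) (cons_one (Suc 0) (f 0))"
 using DD_eq[of 0 0 g] c b by (simp add: vert_def horiz_def paracyclic_b g_def t T.M.diff_zero)
then show ?thesis using g b by (intro bexI[of _ g]) simp_all
qed

lemma eps1_surj: "a .: k ==> \<exists>f\<in>carrier (Tot 0). eps1 (f 0) = a"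
proof -
assume a: "a .: k"
let ?e = "pur [1\<^sub>H]" and ?T = "tp (Suc 0)"
have e: "?e .: ?T" using one_closed' by (intro pure_in) auto
let ?f = "\<lambda>q\<in>{..0::nat}. a \<odot>\<^sub>?T ?e"
have "?f .: Tot 0" using module.smult_closed[OF Tm a e] by (intro tot_memI) auto
moreover have "eps1 (?f 0) = a" using lin_smult[OF eps1_lin a e] a by (simp add: eps1_pure one_closed' counit_one)
ultimately show ?thesis by blast
qed

end

section \<open>Reduction of modules modulo \<open>1 - x\<close>\<close>

definition shift_image :: "'r => ('k, 'r, 'v, 'g) right_mod_scheme => 'v set" where
"shift_image x V = (%v. v -\<^sub>V ract V v x) ` carrier V"

text \<open>The module \<open>V / V(1 - x)\<close> over \<open>H / (1 - x)H\<close>.\<close>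

definition reduct ::
 "('r, 'f) ring_scheme => 'r => ('k, 'r, 'v, 'g) right_mod_scheme => ('k, 'r set, 'v set) right_mod" where
"reduct R x V = module.extend (quot_mod V (shift_image x V)) (right_mod.fields
 (%C D. the_elem ((%(v, r). shift_image x V +>\<^sub>V ract V v r) ` (C \<times> D))))"

definition reduct_map ::
 "'r => ('k, 'r, 'w, 'g) right_mod_scheme => ('v => 'w) => 'v set => 'w set" where
"reduct_map x W f C = the_elem ((%v. shift_image x W +>\<^sub>W f v) ` C)"

lemma reduct_simps [simp]:
"carrier (reduct R x V) = carrier (quot_mod V (shift_image x V))" "0\<^sub>(reduct R x V) = 0\<^sub>(quot_mod V (shift_image x V))"
"C +\<^sub>(reduct R x V) D = C +\<^sub>(quot_mod V (shift_image x V)) D" "a \<odot>\<^sub>(reduct R x V) C = a \<odot>\<^sub>(quot_mod V (shift_image x V)) C"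
by (simp_all add: reduct_def module.defs)

locale central_element = assoc_algebra k R
for k :: "('k, 'e) ring_scheme" and R :: "('k, 'r, 'f) module_scheme" +
fixes x :: 'r
assumes x_in: "x .: R" and x_comm: "r .: R ==> x **\<^sub>R r = r **\<^sub>R x"
 and quot_algebra: "assoc_algebra k (quot_mod R (one_minus_ideal R x))"
begin

abbreviation "II \<equiv> one_minus_ideal R x"

abbreviation "RR \<equiv> quot_mod R II"

lemma Rm: "module k R" by (rule Am)

lemma II_eq: "II = (%r. r -\<^sub>R r **\<^sub>R x) ` carrier R"
proof -
have "(1\<^sub>R -\<^sub>R x) **\<^sub>R r = r -\<^sub>R r **\<^sub>R x" if r: "r .: R" for r
 using r x_in x_comm[OF r] by (simp add: a_minus_def ALG.l_distr ALG.l_minus)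
moreover have "II = (%r. (1\<^sub>R -\<^sub>R x) **\<^sub>R r) ` carrier R" by (auto simp: one_minus_ideal_def)
ultimately show ?thesis by (simp cong: image_cong_simp)
qed

lemma II_sub: "submodule II k R" unfolding II_eq
by (intro submodule_image[OF _ Rm Rm submodule_carrier[OF Rm]] lin_minus_map lin_id bilin_comp2[OF mult_bilin] x_in Rm)

lemma II_ideal: "ideal II R"
proof (rule idealI[OF ALG.ring_axioms])
show "subgroup II (add_monoid R)" using II_sub by (simp add: submodule_def)
fix a r assume "a \<in> II" and r: "r .: R"
then obtain s where s: "s .: R" and a: "a = s -\<^sub>R s **\<^sub>R x" unfolding II_eq by (elim imageE)
have c: "s **\<^sub>R x .: R" using s x_in by simp
have "r **\<^sub>R a = (r **\<^sub>R s) -\<^sub>R (r **\<^sub>R s) **\<^sub>R x"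
 unfolding a using r s x_in c by (simp add: a_minus_def ALG.r_distr ALG.r_minus ALG.m_assoc)
then show "r **\<^sub>R a \<in> II" unfolding II_eq using ALG.m_closed[OF r s] by (rule image_eqI)
have "(s **\<^sub>R x) **\<^sub>R r = (s **\<^sub>R r) **\<^sub>R x" using x_comm[OF r] r s x_in by (simp add: ALG.m_assoc)
then have "a **\<^sub>R r = (s **\<^sub>R r) -\<^sub>R (s **\<^sub>R r) **\<^sub>R x"
 unfolding a using r s x_in c by (simp add: a_minus_def ALG.l_distr ALG.l_minus)
then show "a **\<^sub>R r \<in> II" unfolding II_eq using ALG.m_closed[OF s r] by (rule image_eqI)
qed

lemma RR_mult: "a .: R ==> b .: R ==> (II +>\<^sub>R a) **\<^sub>RR (II +>\<^sub>R b) = II +>\<^sub>R (a **\<^sub>R b)"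
using ideal.rcoset_mult_add[OF II_ideal] by (simp add: quot_mod_def ring.defs FactRing_def)

lemma RR_one: "1\<^sub>RR = II +>\<^sub>R 1\<^sub>R" by (simp add: quot_mod_def ring.defs FactRing_def)

lemma RR_cases: "D .: RR ==> (!!r. r .: R ==> D = II +>\<^sub>R r ==> P) ==> P" unfolding quot_carrier by (elim imageE)

lemma RR_proj: "(%r. II +>\<^sub>R r) : lin_hom k R RR" by (rule quot_proj[OF Rm II_sub])

context
fixes V :: "('k, 'r, 'v, 'g) right_mod_scheme"
assumes V: "right_module k R V"
begin

abbreviation "N \<equiv> shift_image x V"

abbreviation "VV \<equiv> reduct R x V"

lemma Vm: "module k V" by (rule rmod_module[OF V])

lemma N_sub: "submodule N k V" unfolding shift_image_def
by (intro submodule_image[OF _ Vm Vm submodule_carrier[OF Vm]] lin_minus_map lin_id ract_lin1[OF V x_in] Vm)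

lemma N_ract:
assumes v: "v .: V" and r: "r .: R"
shows "v \<in> N ==> ract V v r \<in> N" and "r \<in> II ==> ract V v r \<in> N"
proof -
interpret Vk: module k V by (rule Vm)
interpret V: right_module k R V by (rule V)
have com: "ract V (ract V u x) s = ract V (ract V u s) x" if "u .: V" "s .: R" for u s
 using V.ract_assoc[OF that(1) x_in that(2)] V.ract_assoc[OF that x_in] x_comm[OF that(2)] by simp
show "ract V v r \<in> N" if vN: "v \<in> N"
proof -
 obtain u where u: "u .: V" "v = u -\<^sub>V ract V u x" using vN unfolding shift_image_def by (elim imageE)
 have "ract V v r = ract V u r -\<^sub>V ract V (ract V u r) x"
 unfolding u(2) lin_diff[OF ract_lin1[OF V r] Vm Vm u(1) V.ract_closed[OF u(1) x_in]] com[OF u(1) r] ..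
 then show ?thesis unfolding shift_image_def using V.ract_closed[OF u(1) r] by (rule image_eqI)
qed
show "ract V v r \<in> N" if rI: "r \<in> II"
proof -
 obtain s where s: "s .: R" "r = s -\<^sub>R s **\<^sub>R x" using rI unfolding II_eq by (elim imageE)
 have "ract V v r = ract V v s -\<^sub>V ract V (ract V v s) x"
 unfolding s(2) lin_diff[OF ract_lin2[OF V v] Rm Vm s(1) ALG.m_closed[OF s(1) x_in]] V.ract_assoc[OF v s(1) x_in] ..
 then show ?thesis unfolding shift_image_def using V.ract_closed[OF v s(1)] by (rule image_eqI)
qed
qed

lemma VV_module: "module k VV"
proof -
have q: "module k (quot_mod V N)" by (rule quot_module[OF Vm N_sub])
then show ?thesis by (rule module_surj_image[where q = "%C. C"]) (simp_all add: lin_hom_def)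
qed

lemma VV_proj: "(%v. N +>\<^sub>V v) : lin_hom k V VV" using quot_proj[OF Vm N_sub] by (simp add: lin_hom_def)

lemma VV_cases: "C .: VV ==> (!!v. v .: V ==> C = N +>\<^sub>V v ==> P) ==> P" unfolding reduct_simps quot_carrier by (elim imageE)

lemma VV_in: "v .: V ==> N +>\<^sub>V v .: VV" by (rule lin_in[OF VV_proj])

lemma VV_ract:
assumes v: "v .: V" and r: "r .: R"
shows "ract VV (N +>\<^sub>V v) (II +>\<^sub>R r) = N +>\<^sub>V ract V v r"
proof -
interpret Vk: module k V by (rule Vm)
interpret V: right_module k R V by (rule V)
have eq: "N +>\<^sub>V ract V v' r' = N +>\<^sub>V ract V v r" if v': "v' \<in> N +>\<^sub>V v" and r': "r' \<in> II +>\<^sub>R r" for v' r'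
proof -
 have vc: "v' .: V" "v' -\<^sub>V v \<in> N" using v' coset_mem[OF Vm N_sub v] by auto
 have rc: "r' .: R" "r' -\<^sub>R r \<in> II" using r' coset_mem[OF Rm II_sub r] by auto
 have c: "v' -\<^sub>V v .: V" "r' -\<^sub>R r .: R" using vc rc v r by auto
 have cl: "ract V v' r' .: V" "ract V v r' .: V" "ract V v r .: V" using V.ract_closed v r vc(1) rc(1) by auto
 have "ract V (v' -\<^sub>V v) r' +\<^sub>V ract V v (r' -\<^sub>R r) = ract V v' r' -\<^sub>V ract V v r"
 unfolding lin_diff[OF ract_lin1[OF V rc(1)] Vm Vm vc(1) v] lin_diff[OF ract_lin2[OF V v] Rm Vm rc(1) r]
 using cl by (simp add: a_minus_def Vk.M.a_assoc Vk.M.r_neg1)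
 moreover have "ract V (v' -\<^sub>V v) r' +\<^sub>V ract V v (r' -\<^sub>R r) \<in> N"
 by (rule Vk.submoduleE(5)[OF N_sub N_ract(1)[OF c(1) rc(1) vc(2)] N_ract(2)[OF v c(2) rc(2)]])
 ultimately show ?thesis using coset_eq[OF Vm N_sub cl(1,3)] by simp
qed
have "(%(v, r). N +>\<^sub>V ract V v r) ` ((N +>\<^sub>V v) \<times> (II +>\<^sub>R r)) = {N +>\<^sub>V ract V v r}"
proof (intro equalityI subsetI)
 fix C assume "C \<in> (%(v, r). N +>\<^sub>V ract V v r) ` ((N +>\<^sub>V v) \<times> (II +>\<^sub>R r))"
 then obtain v' r' where "C = N +>\<^sub>V ract V v' r'" and "v' \<in> N +>\<^sub>V v" "r' \<in> II +>\<^sub>R r" by (elim imageE) auto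
 then show "C \<in> {N +>\<^sub>V ract V v r}" using eq by simp
next
 fix C assume "C \<in> {N +>\<^sub>V ract V v r}"
 then show "C \<in> (%(v, r). N +>\<^sub>V ract V v r) ` ((N +>\<^sub>V v) \<times> (II +>\<^sub>R r))"
 using coset_self[OF Vm N_sub v] coset_self[OF Rm II_sub r] by (intro image_eqI[of _ _ "(v, r)"]) auto
qed
then show ?thesis by (simp add: reduct_def module.defs right_mod.defs)
qed

lemma VV_rmod: "right_module k RR VV"
proof -
interpret V: right_module k R V by (rule V)
interpret Q: assoc_algebra k RR by (rule quot_algebra)
interpret W: module k VV by (rule VV_module)
note p = VV_proj and q = RR_proj
note pc = lin_in[OF p] and pa = lin_add[OF p, symmetric] and ps = lin_smult[OF p, symmetric]
 and qa = lin_add[OF q, symmetric] and qs = lin_smult[OF q, symmetric]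
have cl: "v +\<^sub>V w .: V" if "v .: V" "w .: V" for v w using that abelian_groupE(1)[OF module.axioms(2)[OF Vm]] by simp
have cr: "r +\<^sub>R s .: R" if "r .: R" "s .: R" for r s using that abelian_groupE(1)[OF module.axioms(2)[OF Rm]] by simp
note sv = module.smult_closed[OF Vm] and sr = module.smult_closed[OF Rm]
show ?thesis
proof (intro right_module.intro right_module_axioms.intro quot_algebra VV_module)
 fix C D assume "C .: VV" "D .: RR"
 then show "ract VV C D .: VV" by (elim VV_cases RR_cases) (simp only: VV_ract V.ract_closed VV_in)
next
 fix C C' D assume "C .: VV" "C' .: VV" "D .: RR"
 then show "ract VV (C +\<^sub>VV C') D = ract VV C D +\<^sub>VV ract VV C' D"
 by (elim VV_cases RR_cases) (simp only: VV_ract V.ract_closed pa cl V.ract_l_distr)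
next
 fix C D D' assume "C .: VV" "D .: RR" "D' .: RR"
 then show "ract VV C (D +\<^sub>RR D') = ract VV C D +\<^sub>VV ract VV C D'"
 by (elim VV_cases RR_cases) (simp only: VV_ract V.ract_closed pa qa cr V.ract_r_distr)
next
 fix a C D assume "a .: k" "C .: VV" "D .: RR"
 then show "ract VV (a \<odot>\<^sub>VV C) D = a \<odot>\<^sub>VV ract VV C D"
 by (elim VV_cases RR_cases) (simp only: VV_ract V.ract_closed ps sv V.ract_smult_l)
next
 fix a C D assume "a .: k" "C .: VV" "D .: RR"
 then show "ract VV C (a \<odot>\<^sub>RR D) = a \<odot>\<^sub>VV ract VV C D"
 by (elim VV_cases RR_cases) (simp only: VV_ract V.ract_closed ps qs sr V.ract_smult_r)
next
 fix C D D' assume "C .: VV" "D .: RR" "D' .: RR"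
 then show "ract VV C (D **\<^sub>RR D') = ract VV (ract VV C D) D'"
 by (elim VV_cases RR_cases) (simp only: VV_ract V.ract_closed RR_mult ALG.m_closed V.ract_assoc)
next
 fix C assume "C .: VV"
 then show "ract VV C 1\<^sub>RR = C" by (elim VV_cases) (simp only: RR_one VV_ract ALG.one_closed V.ract_one)
qed
qed

lemma N_finsum:
assumes "finite J" "g \<in> J \<rightarrow> carrier V"
shows "N +>\<^sub>V (\<Oplus>\<^bsub>V\<^esub>i\<in>J. g i) = (\<Oplus>\<^bsub>VV\<^esub>i\<in>J. N +>\<^sub>V g i)"
by (rule lin_finsum[OF VV_proj Vm VV_module assms])

text \<open>The functionals send \<open>V(1 - x)\<close> into \<open>(1 - x)R\<close>, so they descend.\<close>

lemma reduct_dual_basis: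
assumes db: "dual_basis k R V J e \<phi>"
shows "\<exists>\<psi>. dual_basis k RR VV J (%i. N +>\<^sub>V e i) \<psi>"
proof -
interpret V: right_module k R V by (rule V)
interpret W: module k VV by (rule VV_module)
note D = dual_basisD[OF db]
define \<psi> where "\<psi> i C = the_elem ((%v. II +>\<^sub>R \<phi> i v) ` C)" for i C
have RRm: "module k RR" by (rule quot_module[OF Rm II_sub])
have g: "(%v. II +>\<^sub>R \<phi> i v) : lin_hom k V RR" if "i \<in> J" for i by (rule lin_comp[OF D(2)[OF that] RR_proj])
have kill: "II +>\<^sub>R \<phi> i n = 0\<^sub>RR" if i: "i \<in> J" and n: "n \<in> N" for i n
proof -
 obtain u where u: "u .: V" "n = u -\<^sub>V ract V u x" using n unfolding shift_image_def by (elim imageE)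
 note c = lin_in[OF D(2)[OF i] u(1)]
 have "\<phi> i n = \<phi> i u -\<^sub>R \<phi> i u **\<^sub>R x"
 unfolding u(2) lin_diff[OF D(2)[OF i] Vm Rm u(1) V.ract_closed[OF u(1) x_in]] D(3)[OF i u(1) x_in] ..
 then have "\<phi> i n \<in> II" unfolding II_eq using c by (rule image_eqI)
 then show ?thesis using quot_eq_zero[OF Rm II_sub lin_in[OF D(2)[OF i] submodule_sub[OF Vm N_sub n]]] by simp
qed
note l = quot_lift[OF Vm N_sub RRm g kill]
have \<psi>: "\<psi> i : lin_hom k VV RR" and \<psi>v: "v .: V ==> \<psi> i (N +>\<^sub>V v) = II +>\<^sub>R \<phi> i v" if i: "i \<in> J" for i v
proof -
 show "\<psi> i : lin_hom k VV RR" using l(1)[OF i i] unfolding \<psi>_def[abs_def] by (simp add: lin_hom_def)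
 show "v .: V ==> \<psi> i (N +>\<^sub>V v) = II +>\<^sub>R \<phi> i v" unfolding \<psi>_def by (rule l(2)[OF i i])
qed
have "dual_basis k RR VV J (%i. N +>\<^sub>V e i) \<psi>" unfolding dual_basis_def
proof (intro conjI ballI)
 fix i assume i: "i \<in> J"
 show "N +>\<^sub>V e i .: VV" by (rule VV_in[OF D(1)[OF i]])
 show "\<psi> i : lin_hom k VV RR" by (rule \<psi>[OF i])
 fix C D' assume "C .: VV" "D' .: RR"
 then show "\<psi> i (ract VV C D') = \<psi> i C **\<^sub>RR D'" by (elim VV_cases RR_cases)
  (simp only: VV_ract V.ract_closed \<psi>v[OF i] D(3)[OF i] RR_mult lin_in[OF D(2)[OF i]])
next
 fix C assume "C .: VV"
 then obtain v where v: "v .: V" and C: "C = N +>\<^sub>V v" by (rule VV_cases)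
 obtain E where E: "finite E" "E \<subseteq> J" "\<forall>i\<in>J - E. \<phi> i v = 0\<^sub>R" and ex: "v = (\<Oplus>\<^bsub>V\<^esub>i\<in>E. ract V (e i) (\<phi> i v))"
 using dual_basis_expansion[OF db v] by (elim exE conjE)
 have c: "ract V (e i) (\<phi> i v) .: V" if "i \<in> E" for i using that E(2) V.ract_closed[OF D(1) lin_in[OF D(2) v]] by auto
 have "C = N +>\<^sub>V (\<Oplus>\<^bsub>V\<^esub>i\<in>E. ract V (e i) (\<phi> i v))" unfolding C using ex by simp
 also have "... = (\<Oplus>\<^bsub>VV\<^esub>i\<in>E. N +>\<^sub>V ract V (e i) (\<phi> i v))" using c by (intro N_finsum E(1)) auto
 also have "... = (\<Oplus>\<^bsub>VV\<^esub>i\<in>E. ract VV (N +>\<^sub>V e i) (\<psi> i C))"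
 proof (rule W.finsum_cong'[OF refl])
 fix i assume "i \<in> E"
 then have i: "i \<in> J" using E(2) by auto
 show "N +>\<^sub>V ract V (e i) (\<phi> i v) = ract VV (N +>\<^sub>V e i) (\<psi> i C)"
  unfolding C \<psi>v[OF i v] by (rule VV_ract[OF D(1)[OF i] lin_in[OF D(2)[OF i] v], symmetric])
 next
 show "(%i. ract VV (N +>\<^sub>V e i) (\<psi> i C)) \<in> E \<rightarrow> carrier VV"
 proof
  fix i assume "i \<in> E"
  then have i: "i \<in> J" using E(2) by auto
  show "ract VV (N +>\<^sub>V e i) (\<psi> i C) .: VV" unfolding C \<psi>v[OF i v] VV_ract[OF D(1)[OF i] lin_in[OF D(2)[OF i] v]]
  by (rule VV_in[OF V.ract_closed[OF D(1)[OF i] lin_in[OF D(2)[OF i] v]]])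
 qed
 qed
 finally have "C = (\<Oplus>\<^bsub>VV\<^esub>i\<in>E. ract VV (N +>\<^sub>V e i) (\<psi> i C))" .
 moreover have "\<psi> i C = 0\<^sub>RR" if "i \<in> J - E" for i using that E(3) lin_zero[OF RR_proj Rm RRm] unfolding C by (simp add: \<psi>v v)
 ultimately show "\<exists>E. finite E & E \<subseteq> J & (\<forall>i\<in>J - E. \<psi> i C = 0\<^sub>RR) & C = (\<Oplus>\<^bsub>VV\<^esub>i\<in>E. ract VV (N +>\<^sub>V e i) (\<psi> i C))"
 using E(1,2) by blast
qed
then show ?thesis by blast
qed

end

text \<open>An equivariant map sends \<open>V(1 - x)\<close> into \<open>W(1 - x)\<close>.\<close>

lemma reduct_map:
assumes V: "right_module k R V" and W: "right_module k R W" and f: "f : right_hom k R V W"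
shows "reduct_map x W f : right_hom k RR (reduct R x V) (reduct R x W)"
 and "v .: V ==> reduct_map x W f (shift_image x V +>\<^sub>V v) = shift_image x W +>\<^sub>W f v"
proof -
let ?W = "reduct R x W" and ?V = "reduct R x V"
interpret V: right_module k R V by (rule V)
note Vm = rmod_module[OF V] and Wm = rmod_module[OF W]
note fl = rhom_lin[OF f]
have g: "(%v. shift_image x W +>\<^sub>W f v) : lin_hom k V ?W" by (rule lin_comp[OF fl VV_proj[OF W]])
have kill: "shift_image x W +>\<^sub>W f n = 0\<^sub>?W" if n: "n \<in> shift_image x V" for n
proof -
 obtain u where u: "u .: V" "n = u -\<^sub>V ract V u x" using n unfolding shift_image_def by (elim imageE)
 have "f n = f u -\<^sub>W ract W (f u) x" unfolding u(2) lin_diff[OF fl Vm Wm u(1) V.ract_closed[OF u(1) x_in]] rhom_ract[OF f u(1) x_in] ..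
 then have "f n \<in> shift_image x W" unfolding shift_image_def using lin_in[OF fl u(1)] by (rule image_eqI)
 then show ?thesis using quot_eq_zero[OF Wm N_sub[OF W] lin_in[OF fl submodule_sub[OF Vm N_sub[OF V] n]]] by simp
qed
note l = quot_lift[OF Vm N_sub[OF V] VV_module[OF W] g kill]
show v: "reduct_map x W f (shift_image x V +>\<^sub>V v) = shift_image x W +>\<^sub>W f v" if "v .: V" for v
 unfolding reduct_map_def by (rule l(2)[OF _ that])
show "reduct_map x W f : right_hom k RR ?V ?W"
proof (rule rhomI)
 show "reduct_map x W f : lin_hom k ?V ?W" using l(1) unfolding reduct_map_def[abs_def] by (simp add: lin_hom_def)
 fix C D assume "C .: ?V" "D .: RR"
 then show "reduct_map x W f (ract ?V C D) = ract ?W (reduct_map x W f C) D" by (elim VV_cases[OF V] RR_cases)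
  (simp only: VV_ract[OF V] V.ract_closed v rhom_ract[OF f] VV_ract[OF W] lin_in[OF fl])
qed
qed

end

section \<open>A projective resolution of the trivial module\<close>

lemma (in abelian_monoid) finsum_Sigma:
assumes A: "finite A" and B: "!!a. a \<in> A ==> finite (B a)"
 and f: "!!a b. a \<in> A ==> b \<in> B a ==> f a b .: G"
shows "(\<Oplus>p\<in>Sigma A B. f (fst p) (snd p)) = (\<Oplus>a\<in>A. \<Oplus>b\<in>B a. f a b)" using A B f
proof (induction A)
case (insert a A)
have S: "Sigma (insert a A) B = Pair a ` B a \<union> Sigma A B" by auto
have c1: "(%p. f (fst p) (snd p)) \<in> Pair a ` B a \<rightarrow> carrier G" and c2: "(%p. f (fst p) (snd p)) \<in> Sigma A B \<rightarrow> carrier G"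
 using insert.prems(2) by auto
have c3: "(%a. \<Oplus>b\<in>B a. f a b) \<in> A \<rightarrow> carrier G" "(\<Oplus>b\<in>B a. f a b) .: G"
 using insert.prems(2) by (auto intro!: finsum_closed)
have "(\<Oplus>p\<in>Sigma (insert a A) B. f (fst p) (snd p)) = (\<Oplus>p\<in>Pair a ` B a. f (fst p) (snd p)) \<oplus> (\<Oplus>p\<in>Sigma A B. f (fst p) (snd p))"
 unfolding S using insert.hyps insert.prems(1) c1 c2 by (intro finsum_Un_disjoint) auto
also have "(\<Oplus>p\<in>Pair a ` B a. f (fst p) (snd p)) = (\<Oplus>b\<in>B a. f (fst (a, b)) (snd (a, b)))"
 by (rule finsum_reindex[OF c1]) (simp add: inj_on_def)
also have "(\<Oplus>p\<in>Sigma A B. f (fst p) (snd p)) = (\<Oplus>a\<in>A. \<Oplus>b\<in>B a. f a b)" using insert.prems by (intro insert.IH) auto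
finally show ?case using insert.hyps finsum_insert[OF insert.hyps c3] by simp
qed simp

text \<open>Dual bases of the summands combine to one of a finite direct sum.\<close>

lemma dual_basis_direct_sum:
assumes V: "right_module k R V" and W: "!!q. right_module k R (W q)" and A: "finite A"
 and inc: "!!q. q \<in> A ==> inc q : right_hom k R (W q) V" and pr: "!!q. q \<in> A ==> pr q : right_hom k R V (W q)"
 and sum: "!!v. v .: V ==> v = (\<Oplus>\<^bsub>V\<^esub>q\<in>A. inc q (pr q v))"
 and db: "!!q. q \<in> A ==> dual_basis k R (W q) (J q) (e q) (\<phi> q)"
shows "dual_basis k R V (Sigma A J) (%p. inc (fst p) (e (fst p) (snd p))) (%p v. \<phi> (fst p) (snd p) (pr (fst p) v))"
proof -
note Vm = rmod_module[OF V] and Wm = rmod_module[OF W]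
interpret V: module k V by (rule Vm)
note D = dual_basisD[OF db]
note prc = rhom_in[OF pr] and incc = rhom_in[OF inc]
have exp: "\<exists>E. finite E & E \<subseteq> Sigma A J & (\<forall>p\<in>Sigma A J - E. \<phi> (fst p) (snd p) (pr (fst p) v) = 0\<^sub>R) &
 v = (\<Oplus>\<^bsub>V\<^esub>p\<in>E. ract V (inc (fst p) (e (fst p) (snd p))) (\<phi> (fst p) (snd p) (pr (fst p) v)))" if v: "v .: V" for v
proof -
 have "\<forall>q\<in>A. \<exists>E. finite E & E \<subseteq> J q & (\<forall>i\<in>J q - E. \<phi> q i (pr q v) = 0\<^sub>R) &
 pr q v = (\<Oplus>\<^bsub>W q\<^esub>i\<in>E. ract (W q) (e q i) (\<phi> q i (pr q v)))" using dual_basis_expansion[OF db prc[OF _ v]] by blast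
 then obtain E where "\<forall>q\<in>A. finite (E q) & E q \<subseteq> J q & (\<forall>i\<in>J q - E q. \<phi> q i (pr q v) = 0\<^sub>R) &
 pr q v = (\<Oplus>\<^bsub>W q\<^esub>i\<in>E q. ract (W q) (e q i) (\<phi> q i (pr q v)))" by (elim bchoice[THEN exE])
 then have E: "finite (E q)" "E q \<subseteq> J q" "\<forall>i\<in>J q - E q. \<phi> q i (pr q v) = 0\<^sub>R"
 "pr q v = (\<Oplus>\<^bsub>W q\<^esub>i\<in>E q. ract (W q) (e q i) (\<phi> q i (pr q v)))" if "q \<in> A" for q using that by auto
 have ec: "e q i .: W q" "\<phi> q i (pr q v) .: R" if q: "q \<in> A" and i: "i \<in> E q" for q i
 proof -
 have iJ: "i \<in> J q" using E(2)[OF q] i by auto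
 show "e q i .: W q" by (rule D(1)[OF q iJ])
 show "\<phi> q i (pr q v) .: R" by (rule lin_in[OF D(2)[OF q iJ] prc[OF q v]])
 qed
 have cl: "ract (W q) (e q i) (\<phi> q i (pr q v)) .: W q" if "q \<in> A" "i \<in> E q" for q i using right_module.ract_closed[OF W ec[OF that]] .
 have cl': "ract V (inc q (e q i)) (\<phi> q i (pr q v)) .: V" if "q \<in> A" "i \<in> E q" for q i
 using right_module.ract_closed[OF V incc[OF that(1) ec(1)[OF that]] ec(2)[OF that]] .
 have c: "(\<Oplus>\<^bsub>V\<^esub>i\<in>E q. ract V (inc q (e q i)) (\<phi> q i (pr q v))) .: V" if "q \<in> A" for q
 using cl'[OF that] by (intro V.finsum_closed) auto
 have "v = (\<Oplus>\<^bsub>V\<^esub>q\<in>A. inc q (pr q v))" by (rule sum[OF v])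
 also have "... = (\<Oplus>\<^bsub>V\<^esub>q\<in>A. \<Oplus>\<^bsub>V\<^esub>i\<in>E q. ract V (inc q (e q i)) (\<phi> q i (pr q v)))"
 proof (rule V.finsum_cong'[OF refl])
 fix q assume q: "q \<in> A"
 have "inc q (pr q v) = inc q (\<Oplus>\<^bsub>W q\<^esub>i\<in>E q. ract (W q) (e q i) (\<phi> q i (pr q v)))" using E(4)[OF q] by simp
 also have "... = (\<Oplus>\<^bsub>V\<^esub>i\<in>E q. inc q (ract (W q) (e q i) (\<phi> q i (pr q v))))"
  using cl[OF q] by (intro lin_finsum[OF rhom_lin[OF inc[OF q]] Wm Vm E(1)[OF q]]) auto
 also have "... = (\<Oplus>\<^bsub>V\<^esub>i\<in>E q. ract V (inc q (e q i)) (\<phi> q i (pr q v)))"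
  using cl'[OF q] rhom_ract[OF inc[OF q] ec[OF q]] by (intro V.finsum_cong') auto
 finally show "inc q (pr q v) = (\<Oplus>\<^bsub>V\<^esub>i\<in>E q. ract V (inc q (e q i)) (\<phi> q i (pr q v)))" .
 qed (use c in auto)
 also have "... = (\<Oplus>\<^bsub>V\<^esub>p\<in>Sigma A E. ract V (inc (fst p) (e (fst p) (snd p))) (\<phi> (fst p) (snd p) (pr (fst p) v)))"
 by (rule V.finsum_Sigma[symmetric]) (use A E(1) cl' in auto)
 finally have "v = (\<Oplus>\<^bsub>V\<^esub>p\<in>Sigma A E. ract V (inc (fst p) (e (fst p) (snd p))) (\<phi> (fst p) (snd p) (pr (fst p) v)))" .
 moreover have "\<phi> (fst p) (snd p) (pr (fst p) v) = 0\<^sub>R" if "p \<in> Sigma A J - Sigma A E" for p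
 using that E(3)[of "fst p"] by (cases p) simp
 moreover have "finite (Sigma A E)" using A E(1) by simp
 moreover have "Sigma A E \<subseteq> Sigma A J" using E(2) by (intro Sigma_mono) auto
 ultimately show ?thesis by (intro exI[of _ "Sigma A E"] conjI ballI) assumption+
qed
show ?thesis unfolding dual_basis_def
proof (intro conjI ballI)
 fix p assume "p \<in> Sigma A J"
 then have p: "fst p \<in> A" "snd p \<in> J (fst p)" by auto
 show "inc (fst p) (e (fst p) (snd p)) .: V" by (rule incc[OF p(1) D(1)[OF p]])
 show "(%v. \<phi> (fst p) (snd p) (pr (fst p) v)) : lin_hom k V R" by (rule lin_comp[OF rhom_lin[OF pr[OF p(1)]] D(2)[OF p]])
 fix v r assume v: "v .: V" and r: "r .: R"
 show "\<phi> (fst p) (snd p) (pr (fst p) (ract V v r)) = \<phi> (fst p) (snd p) (pr (fst p) v) **\<^sub>R r"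
 unfolding rhom_ract[OF pr[OF p(1)] v r] by (rule D(3)[OF p prc[OF p(1) v] r])
qed (rule exp)
qed

definition tot_incl :: "('k, 'z) cyclic_object => nat => nat => 'z => nat => 'z" where
"tot_incl Z n q y = (\<lambda>r\<in>{..n}. if r = q then y else 0\<^sub>(chains Z r))"

lemma tot_incl_lin:
assumes Z: "!!n. module k (chains Z n)" and q: "q \<le> n"
shows "tot_incl Z n q : lin_hom k (chains Z q) (tsygan_tot Z n)"
proof (rule lin_homI)
have z: "0\<^sub>(chains Z r) .: chains Z r" for r using abelian_groupE(2)[OF module.axioms(2)[OF Z]] .
have za: "0\<^sub>(chains Z r) +\<^sub>(chains Z r) 0\<^sub>(chains Z r) = 0\<^sub>(chains Z r)" for r
 using abelian_groupE(5)[OF module.axioms(2)[OF Z] z] .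
show "tot_incl Z n q y .: tsygan_tot Z n" if "y .: chains Z q" for y unfolding tot_incl_def using that z by (intro tot_memI) auto
show "tot_incl Z n q (y +\<^sub>(chains Z q) y') = tot_incl Z n q y +\<^sub>(tsygan_tot Z n) tot_incl Z n q y'" for y y'
 by (auto simp: tot_incl_def tsygan_tot_simps za)
show "tot_incl Z n q (a \<odot>\<^sub>(chains Z q) y) = a \<odot>\<^sub>(tsygan_tot Z n) tot_incl Z n q y" if "a .: k" for a y
 using that by (auto simp: tot_incl_def tsygan_tot_simps module.smult_r_null[OF Z])
qed

lemma tot_incl_sum:
assumes k: "cring k" and Z: "!!n. module k (chains Z n)" and f: "f .: tsygan_tot Z n"
shows "f = (\<Oplus>\<^bsub>tsygan_tot Z n\<^esub>q\<in>{..n}. tot_incl Z n q (f q))"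
proof (rule tot_ext[OF f])
note T = tot_module[OF k Z]
interpret T: module k "tsygan_tot Z n" by (rule T)
have c: "(%q. tot_incl Z n q (f q)) \<in> {..n} \<rightarrow> carrier (tsygan_tot Z n)" using lin_in[OF tot_incl_lin[OF Z] tot_mem[OF f]] by auto
show "(\<Oplus>\<^bsub>tsygan_tot Z n\<^esub>q\<in>{..n}. tot_incl Z n q (f q)) .: tsygan_tot Z n" by (rule T.finsum_closed[OF c])
fix r assume r: "r \<le> n"
interpret R: module k "chains Z r" by (rule Z)
have "(\<Oplus>\<^bsub>tsygan_tot Z n\<^esub>q\<in>{..n}. tot_incl Z n q (f q)) r = (\<Oplus>\<^bsub>chains Z r\<^esub>q\<in>{..n}. tot_incl Z n q (f q) r)"
 by (rule lin_finsum[OF tot_eval[OF r] T Z _ c]) simp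
also have "... = (\<Oplus>\<^bsub>chains Z r\<^esub>q\<in>{..n}. if r = q then f r else 0\<^sub>(chains Z r))"
 using r tot_mem[OF f r] by (intro R.finsum_cong') (auto simp: tot_incl_def)
also have "... = f r" using R.finsum_singleton[of r "{..n}" "%q. f r"] r tot_mem[OF f r] by simp
finally show "f r = (\<Oplus>\<^bsub>tsygan_tot Z n\<^esub>q\<in>{..n}. tot_incl Z n q (f q)) r" by simp
qed

locale reduced_hopf_algebra = free_central_group_like k H x
for k :: "('k, 'e) ring_scheme" and H :: "('k, 'h, 'f) hopf_scheme" and x :: 'h +
assumes quot_alg: "assoc_algebra k (quot_mod H (one_minus_ideal H x))"

sublocale reduced_hopf_algebra \<subseteq> CE: central_element k H x
by (intro central_element.intro central_element_axioms.intro assoc_algebra_axioms x_closed x_central quot_alg)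

context free_central_group_like
begin

definition tot_right :: "nat => ('k, 'h, nat => ('h list => 'k) set) right_mod" where
"tot_right n = module.extend (Tot n) (right_mod.fields (%f h. tot_map (%q t. act (Suc q) t h) n f))"

lemma tot_right_simps [simp]:
"carrier (tot_right n) = carrier (Tot n)" "0\<^sub>(tot_right n) = 0\<^sub>(Tot n)"
"f +\<^sub>(tot_right n) g = f +\<^sub>(Tot n) g" "a \<odot>\<^sub>(tot_right n) f = a \<odot>\<^sub>(Tot n) f"
"ract (tot_right n) f h = tot_map (%q t. act (Suc q) t h) n f" by (simp_all add: tot_right_def module.defs right_mod.defs)

lemma tot_right_lin: "f : Hom (tot_right n) W \<longleftrightarrow> f : Hom (Tot n) W"
"g : Hom W (tot_right n) \<longleftrightarrow> g : Hom W (Tot n)" by (simp_all add: lin_hom_def)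

lemma tot_rmod: "module k (tot_right n)" by (rule module_surj_image[where V = "Tot n" and q = "%v. v"]) (auto simp: Tot_module intro!: lin_homI)

lemma tot_act_lin: "h .: H ==> tot_map (%q t. act (Suc q) t h) n : Hom (Tot n) (Tot n)" by (rule tot_map_lin) (simp_all add: L_act1 Tm)

lemma tot_right_rmod: "right_module k H (tot_right n)"
proof -
have c: "tot_map (%q t. act (Suc q) t h) n f .: Tot n" if "f .: Tot n" "h .: H" for f h by (rule lin_in[OF tot_act_lin[OF that(2)] that(1)])
interpret T: module k "Tot n" by (rule Tot_module)
interpret H: module k H by (rule Cm)
have m: "f q .: tp (Suc q)" if "f .: Tot n" "q \<le> n" for f q using Tot_mem that by simp
note b1 = bilin1[OF tact_bilin]
show ?thesis
proof (intro right_module.intro right_module_axioms.intro assoc_algebra_axioms tot_rmod; unfold tot_right_simps)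
 fix f g h assume f: "f .: Tot n" and g: "g .: Tot n" and h: "h .: H"
 show "tot_map (%q t. act (Suc q) t h) n f .: Tot n" by (rule c[OF f h])
 show "tot_map (%q t. act (Suc q) t h) n (f +\<^sub>(Tot n) g) =
  tot_map (%q t. act (Suc q) t h) n f +\<^sub>(Tot n) tot_map (%q t. act (Suc q) t h) n g" by (rule lin_add[OF tot_act_lin[OF h] f g])
next
 fix f r s assume f: "f .: Tot n" and r: "r .: H" and s: "s .: H"
 have rs: "r +\<^sub>H s .: H" using r s abelian_groupE(1)[OF module.axioms(2)[OF Cm]] by simp
 show "tot_map (%q t. act (Suc q) t (r +\<^sub>H s)) n f =
  tot_map (%q t. act (Suc q) t r) n f +\<^sub>(Tot n) tot_map (%q t. act (Suc q) t s) n f"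
 using m[OF f] by (auto simp: tot_map_def tsygan_tot_simps lin_add[OF b1 r s] intro!: restrict_ext)
 show "tot_map (%q t. act (Suc q) t (r **\<^sub>H s)) n f =
  tot_map (%q t. act (Suc q) t s) n (tot_map (%q t. act (Suc q) t r) n f)"
 using m[OF f] by (auto simp: tot_map_def tact_mult r s intro!: restrict_ext)
next
 fix a f h assume a: "a .: k" and f: "f .: Tot n" and h: "h .: H"
 show "tot_map (%q t. act (Suc q) t h) n (a \<odot>\<^sub>(Tot n) f) = a \<odot>\<^sub>(Tot n) tot_map (%q t. act (Suc q) t h) n f"
 by (rule lin_smult[OF tot_act_lin[OF h] a f])
 show "tot_map (%q t. act (Suc q) t (a \<odot>\<^sub>H h)) n f = a \<odot>\<^sub>(Tot n) tot_map (%q t. act (Suc q) t h) n f"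
 using m[OF f] by (auto simp: tot_map_def tsygan_tot_simps lin_smult[OF b1 a h] intro!: restrict_ext)
next
 fix f assume f: "f .: Tot n"
 show "tot_map (%q t. act (Suc q) t 1\<^sub>H) n f = f" by (rule tot_ext[OF c[OF f one_closed'] f]) (simp add: tot_map_def tact_one m[OF f])
qed
qed

lemma tot_right_eval: "q \<le> n ==> (%f. f q) : right_hom k H (tot_right n) (diag_mod k H (Suc q))"
by (rule rhomI) (use Tot_eval[of q n] Tot_mem in "auto simp: lin_hom_def tot_map_def")

lemma tot_right_incl: "q \<le> n ==> tot_incl PX n q : right_hom k H (diag_mod k H (Suc q)) (tot_right n)"
proof (rule rhomI)
assume q: "q \<le> n"
show "tot_incl PX n q : Hom (diag_mod k H (Suc q)) (tot_right n)" using tot_incl_lin[of k PX q n] Tm q by (simp add: lin_hom_def)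
fix y h assume "y .: diag_mod k H (Suc q)" and h: "h .: H"
then show "tot_incl PX n q (ract (diag_mod k H (Suc q)) y h) = ract (tot_right n) (tot_incl PX n q y) h"
 by (auto simp: tot_incl_def tot_map_def lin_zero[OF L_act1[OF lin_id h] Tm Tm] intro!: restrict_ext)
qed

lemma tot_right_sum:
assumes "f .: tot_right n"
shows "f = (\<Oplus>\<^bsub>tot_right n\<^esub>q\<in>{..n}. tot_incl PX n q (f q))"
proof -
have "(\<Oplus>\<^bsub>tot_right n\<^esub>q\<in>{..n}. tot_incl PX n q (f q)) = (\<Oplus>\<^bsub>Tot n\<^esub>q\<in>{..n}. tot_incl PX n q (f q))"
 by (simp add: finsum_def finprod_def tot_right_def module.defs)
then show ?thesis using tot_incl_sum[OF module_cring[OF Cm], of PX f n] assms Tm by simp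
qed

lemma tot_right_dual_basis: "\<exists>J e \<phi>. dual_basis k H (tot_right n) (J :: (nat \<times> ('h list => 'k) set) set) e \<phi>"
proof -
have "\<forall>q. \<exists>\<phi>. dual_basis k H (diag_mod k H (Suc q)) (carrier (tp q)) (%e. snc q e 1\<^sub>H) \<phi>"
 using diag_dual_basis by blast
then obtain \<phi> where \<phi>: "!!q. dual_basis k H (diag_mod k H (Suc q)) (carrier (tp q)) (%e. snc q e 1\<^sub>H) (\<phi> q)" by metis
have "dual_basis k H (tot_right n) (Sigma {..n} (%q. carrier (tp q)))
 (%p. tot_incl PX n (fst p) (snc (fst p) (snd p) 1\<^sub>H)) (%p f. \<phi> (fst p) (snd p) (f (fst p)))"
proof (rule dual_basis_direct_sum[OF tot_right_rmod diag_rmod])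
 show "f = (\<Oplus>\<^bsub>tot_right n\<^esub>q\<in>{..n}. tot_incl PX n q (f q))" if "f .: tot_right n" for f by (rule tot_right_sum[OF that])
qed (use tot_right_incl tot_right_eval \<phi> in simp_all)
then show ?thesis by (intro exI)
qed

lemma DD_rhom: "DD (Suc n) : right_hom k H (tot_right (Suc n)) (tot_right n)"
proof (rule rhomI)
show "DD (Suc n) : Hom (tot_right (Suc n)) (tot_right n)" using DD_lin by (simp add: lin_hom_def)
fix f h assume "f .: tot_right (Suc n)" "h .: H"
then show "DD (Suc n) (ract (tot_right (Suc n)) f h) = ract (tot_right n) (DD (Suc n) f) h"
 using tot_map_diff[OF paracyclic_data paracyclic_data action_morphism, of h f n] by simp
qed

lemma shift_image_tot:
assumes f: "f .: Tot n"
shows "f \<in> shift_image x (tot_right n) \<longleftrightarrow> (\<forall>q\<le>n. f q \<in> JJ q)"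
proof -
interpret T: module k "tot_right n" by (rule tot_rmod)
have ev: "(%f. f q) : Hom (tot_right n) (tp (Suc q))" if "q \<le> n" for q using Tot_eval[OF that] by (simp add: tot_right_lin)
have rc: "ract (tot_right n) v x .: tot_right n" if "v .: tot_right n" for v by (rule right_module.ract_closed[OF tot_right_rmod that x_closed])
have e: "(v -\<^sub>(tot_right n) ract (tot_right n) v x) q = one_minus_x q (v q)" if "v .: tot_right n" "q \<le> n" for v q
 using lin_diff[OF ev[OF that(2)] tot_rmod Tm that(1) rc[OF that(1)]] that(2) by (simp add: tot_map_def)
show ?thesis
proof
 assume "f \<in> shift_image x (tot_right n)"
 then obtain v where v: "f = v -\<^sub>(tot_right n) ract (tot_right n) v x" "v .: tot_right n" unfolding shift_image_def by (elim imageE)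
 show "\<forall>q\<le>n. f q \<in> JJ q" unfolding v(1) JJ_def using e[OF v(2)] Tot_mem v(2) by auto
next
 assume "\<forall>q\<le>n. f q \<in> JJ q"
 then have "\<forall>q. \<exists>w. q \<le> n --> w .: tp (Suc q) & f q = one_minus_x q w" unfolding JJ_def by auto
 then obtain w where w: "!!q. q \<le> n ==> w q .: tp (Suc q)" "!!q. q \<le> n ==> f q = one_minus_x q (w q)" by metis
 define v where "v = (\<lambda>q\<in>{..n}. w q)"
 have v: "v .: tot_right n" unfolding v_def tot_right_simps using w(1) by (intro tot_memI) simp
 have "f = v -\<^sub>(tot_right n) ract (tot_right n) v x"
 proof (rule tot_ext[OF f])
 show "v -\<^sub>(tot_right n) ract (tot_right n) v x .: Tot n" using T.M.minus_closed[OF v rc[OF v]] by simp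
 show "f q = (v -\<^sub>(tot_right n) ract (tot_right n) v x) q" if "q \<le> n" for q
  unfolding e[OF v that] w(2)[OF that] using that by (simp add: v_def)
 qed
 then show "f \<in> shift_image x (tot_right n)" unfolding shift_image_def using v by (rule image_eqI)
qed
qed

end

context reduced_hopf_algebra
begin

abbreviation "SI n \<equiv> shift_image x (tot_right n)"

definition res :: "nat => ('k, 'h set, (nat => ('h list => 'k) set) set) right_mod" where
"res n = reduct H x (tot_right n)"

definition res_diff :: "nat => (nat => ('h list => 'k) set) set => (nat => ('h list => 'k) set) set" where
"res_diff n = reduct_map x (tot_right (n - 1)) (DD n)"

definition res_aug :: "(nat => ('h list => 'k) set) set => 'k" where
"res_aug C = the_elem ((%f. eps1 (f 0)) ` C)"

abbreviation "cls n f \<equiv> SI n +>\<^sub>(tot_right n) f"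

lemmas res_module = CE.VV_module[OF tot_right_rmod, folded res_def]
lemmas res_rmod = CE.VV_rmod[OF tot_right_rmod, folded res_def]
lemmas res_cases = CE.VV_cases[OF tot_right_rmod, folded res_def, unfolded tot_right_simps]
lemmas res_in = CE.VV_in[OF tot_right_rmod, folded res_def, unfolded tot_right_simps]
lemmas cls_lin = CE.VV_proj[OF tot_right_rmod, folded res_def, unfolded tot_right_lin]
lemmas SI_sub = CE.N_sub[OF tot_right_rmod]

lemma cls_ract:
"f .: Tot n ==> h .: H ==>
 ract (res n) (cls n f) (one_minus_ideal H x +>\<^sub>H h) = cls n (tot_map (%q t. act (Suc q) t h) n f)"
using CE.VV_ract[OF tot_right_rmod, of f n h] by (simp add: res_def)

lemma cls_zero: "f .: Tot n ==> cls n f = 0\<^sub>(res n) \<longleftrightarrow> (\<forall>q\<le>n. f q \<in> JJ q)"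
using quot_eq_zero[OF tot_rmod SI_sub, of f n] shift_image_tot[of f n] by (simp add: res_def)

lemma cls_eq:
assumes f: "f .: Tot n" and g: "g .: Tot n"
shows "cls n f = cls n g \<longleftrightarrow> (\<forall>q\<le>n. f q -\<^sub>(tp (Suc q)) g q \<in> JJ q)"
proof -
interpret T: module k "tot_right n" by (rule tot_rmod)
have m: "f -\<^sub>(tot_right n) g .: Tot n" using T.M.minus_closed[of f g] f g by simp
have ev: "(%f. f q) : Hom (tot_right n) (tp (Suc q))" if "q \<le> n" for q using Tot_eval[OF that] by (simp add: tot_right_lin)
have "(f -\<^sub>(tot_right n) g) q = f q -\<^sub>(tp (Suc q)) g q" if "q \<le> n" for q using lin_diff[OF ev[OF that] tot_rmod Tm] f g by simp
moreover have "cls n f = cls n g \<longleftrightarrow> f -\<^sub>(tot_right n) g \<in> SI n"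
 using coset_eq[OF tot_rmod SI_sub, of f n g] f g by simp
ultimately show ?thesis unfolding shift_image_tot[OF m] by simp
qed

lemma res_diff_rhom: "res_diff (Suc n) : right_hom k CE.RR (res (Suc n)) (res n)"
and res_diff_cls: "f .: Tot (Suc n) ==> res_diff (Suc n) (cls (Suc n) f) = cls n (DD (Suc n) f)"
using CE.reduct_map[OF tot_right_rmod tot_right_rmod DD_rhom[of n]] by (simp_all add: res_def res_diff_def)

lemma res_dual_basis: "\<exists>J e \<psi>. dual_basis k CE.RR (res n) (J :: (nat \<times> ('h list => 'k) set) set) e \<psi>"
proof -
obtain J :: "(nat \<times> ('h list => 'k) set) set" and e \<phi> where db: "dual_basis k H (tot_right n) J e \<phi>"
 using tot_right_dual_basis by blast
from CE.reduct_dual_basis[OF tot_right_rmod db] show ?thesis unfolding res_def by blast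
qed

lemma counit_coset:
assumes h: "h .: H"
shows "the_elem (counit H ` (one_minus_ideal H x +>\<^sub>H h)) = counit H h"
proof (rule the_elem_coset[OF Cm CE.II_sub h])
fix w assume w: "w .: H" and "w -\<^sub>H h \<in> one_minus_ideal H x"
then obtain r where r: "r .: H" "w -\<^sub>H h = r -\<^sub>H r **\<^sub>H x" unfolding CE.II_eq by (elim imageE)
interpret K: module k "base_mod k" by (rule kmod)
note rx = mult_in[OF r(1) x_closed] and cc = lin_in[OF counit_linear]
have "counit H w -\<^sub>(base_mod k) counit H h = counit H r -\<^sub>(base_mod k) counit H (r **\<^sub>H x)"
 using arg_cong[OF r(2), of "counit H"] lin_diff[OF counit_linear Cm kmod w h] lin_diff[OF counit_linear Cm kmod r(1) rx] by simp
also have "counit H (r **\<^sub>H x) = counit H r" using counit_mult[OF r(1) x_closed] counit_in[OF r(1)] by (simp add: counit_x)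
also have "counit H r -\<^sub>(base_mod k) counit H r = 0\<^sub>(base_mod k)" using K.M.diff_eq_zero_iff[OF cc[OF r(1)] cc[OF r(1)]] by simp
finally show "counit H w = counit H h" using K.M.diff_eq_zero_iff[OF cc[OF w] cc[OF h]] by simp
qed

lemma trivial_simps [simp]:
"carrier (quot_trivial_right_mod k H) = carrier k" "0\<^sub>(quot_trivial_right_mod k H) = 0\<^sub>k"
"a +\<^sub>(quot_trivial_right_mod k H) b = a +\<^sub>k b" "a \<odot>\<^sub>(quot_trivial_right_mod k H) b = a **\<^sub>k b"
"ract (quot_trivial_right_mod k H) a C = a **\<^sub>k the_elem (counit H ` C)"
by (simp_all add: quot_trivial_right_mod_def module.defs right_mod.defs base_mod_def)

lemma res_aug_lin: "res_aug : Hom (res 0) (base_mod k)"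
and res_aug_cls: "f .: Tot 0 ==> res_aug (cls 0 f) = eps1 (f 0)"
proof -
have g: "(%f. eps1 (f 0)) : Hom (tot_right 0) (base_mod k)" using lin_comp[OF Tot_eval[of 0 0] eps1_lin] by (simp add: tot_right_lin)
have kill: "eps1 (n 0) = 0\<^sub>(base_mod k)" if n: "n \<in> SI 0" for n
proof -
 have "n .: Tot 0" using submodule_sub[OF tot_rmod SI_sub n] by simp
 then have "n 0 \<in> JJ 0" using n shift_image_tot[of n 0] by simp
 then show ?thesis unfolding JJ_def using eps1_one_minus_x by auto
qed
note l = quot_lift[where g = "%f. eps1 (f 0)", OF tot_rmod[of 0] SI_sub[of 0] kmod g]
have "(%C. the_elem ((%f. eps1 (f 0)) ` C)) : Hom (quot_mod (tot_right 0) (SI 0)) (base_mod k)" by (rule l(1)) (rule kill)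
then show "res_aug : Hom (res 0) (base_mod k)" unfolding res_aug_def[abs_def] res_def by (simp add: lin_hom_def)
show "f .: Tot 0 ==> res_aug (cls 0 f) = eps1 (f 0)" unfolding res_aug_def by (rule l(2)) (simp_all add: kill)
qed

text \<open>The total complex modulo \<open>1 - x\<close> resolves \<open>k\<close>.\<close>

theorem res_exact_resolution:
assumes triv: "right_module k CE.RR (quot_trivial_right_mod k H)"
shows "exact_resolution k CE.RR (quot_trivial_right_mod k H) res res_diff res_aug" unfolding exact_resolution_def
proof (intro conjI allI triv res_rmod res_diff_rhom)
note Dc = lin_in[OF DD_lin]
show "res_aug : right_hom k CE.RR (res 0) (quot_trivial_right_mod k H)"
proof (rule rhomI)
 show "res_aug : Hom (res 0) (quot_trivial_right_mod k H)" using res_aug_lin by (simp add: lin_hom_def)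
 fix C D assume "C .: res 0" "D .: CE.RR"
 then obtain f h where f: "f .: Tot 0" "C = cls 0 f" and h: "h .: H" "D = one_minus_ideal H x +>\<^sub>H h" by (elim res_cases CE.RR_cases)
 have "tot_map (%q t. act (Suc q) t h) 0 f .: Tot 0" by (rule lin_in[OF tot_act_lin[OF h(1)] f(1)])
 then show "res_aug (ract (res 0) C D) = ract (quot_trivial_right_mod k H) (res_aug C) D" unfolding f(2) h(2) cls_ract[OF f(1) h(1)]
 using Tot_mem[OF f(1), of 0] by (simp add: res_aug_cls f(1) counit_coset h(1) eps1_act tot_map_def)
qed
show "res_aug ` carrier (res 0) = carrier (quot_trivial_right_mod k H)"
proof (intro equalityI subsetI)
 fix a assume "a \<in> res_aug ` carrier (res 0)"
 then show "a .: quot_trivial_right_mod k H" using lin_in[OF res_aug_lin] by auto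
next
 fix a assume "a .: quot_trivial_right_mod k H"
 then obtain f where f: "f .: Tot 0" "eps1 (f 0) = a" using eps1_surj by auto
 have "a = res_aug (cls 0 f)" using res_aug_cls[OF f(1)] f(2) by simp
 then show "a \<in> res_aug ` carrier (res 0)" using res_in[OF f(1)] by (rule image_eqI)
qed
show "{C \<in> carrier (res 0). res_aug C = 0\<^sub>(quot_trivial_right_mod k H)} = res_diff 1 ` carrier (res 1)"
proof (intro equalityI subsetI)
 fix C assume "C \<in> {C \<in> carrier (res 0). res_aug C = 0\<^sub>(quot_trivial_right_mod k H)}"
 then have "C .: res 0" and z: "res_aug C = 0\<^sub>k" by auto
 then obtain f where f: "f .: Tot 0" "C = cls 0 f" by (elim res_cases)
 have "eps1 (f 0) = 0\<^sub>k" using z res_aug_cls[OF f(1)] f(2) by simp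
 from DD_exact_0[OF f(1) this] obtain g where g: "g .: Tot (Suc 0)" "DD (Suc 0) g 0 = f 0" by auto
 have "DD (Suc 0) g = f" by (rule tot_ext[OF Dc[OF g(1)] f(1)]) (use g(2) in simp)
 then have "C = res_diff (Suc 0) (cls (Suc 0) g)" using res_diff_cls[OF g(1)] f(2) by simp
 then show "C \<in> res_diff 1 ` carrier (res 1)" using res_in[OF g(1)] unfolding One_nat_def by (rule image_eqI)
next
 fix C assume "C \<in> res_diff 1 ` carrier (res 1)"
 then obtain E where E: "E .: res (Suc 0)" "C = res_diff (Suc 0) E" unfolding One_nat_def by (elim imageE)
 then obtain g where g: "g .: Tot (Suc 0)" "E = cls (Suc 0) g" by (elim res_cases)
 have C: "C = cls 0 (DD (Suc 0) g)" using E(2) g res_diff_cls by simp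
 show "C \<in> {C \<in> carrier (res 0). res_aug C = 0\<^sub>(quot_trivial_right_mod k H)}"
 unfolding C using res_in[OF Dc[OF g(1)]] res_aug_cls[OF Dc[OF g(1)]] DD_augmented[OF g(1)] by simp
qed
fix n
show "{C \<in> carrier (res (Suc n)). res_diff (Suc n) C = 0\<^sub>(res n)} = res_diff (Suc (Suc n)) ` carrier (res (Suc (Suc n)))"
proof (intro equalityI subsetI)
 fix C assume "C \<in> {C \<in> carrier (res (Suc n)). res_diff (Suc n) C = 0\<^sub>(res n)}"
 then have "C .: res (Suc n)" and z: "res_diff (Suc n) C = 0\<^sub>(res n)" by auto
 then obtain f where f: "f .: Tot (Suc n)" "C = cls (Suc n) f" by (elim res_cases)
 have "cls n (DD (Suc n) f) = 0\<^sub>(res n)" using z res_diff_cls[OF f(1)] f(2) by simp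
 then have D0: "DD (Suc n) f q \<in> JJ q" if "q \<le> n" for q using cls_zero[OF Dc[OF f(1)]] that by simp
 have "\<exists>g\<in>carrier (Tot (Suc (Suc n))). \<forall>q\<le>Suc n. f q -\<^sub>(tp (Suc q)) DD (Suc (Suc n)) g q \<in> JJ q"
 by (rule DD_exact[OF f(1)]) (rule D0)
 then obtain g where g: "g .: Tot (Suc (Suc n))"
 and e: "\<forall>q\<le>Suc n. f q -\<^sub>(tp (Suc q)) DD (Suc (Suc n)) g q \<in> JJ q" by (elim bexE)
 have "C = res_diff (Suc (Suc n)) (cls (Suc (Suc n)) g)" unfolding f(2) res_diff_cls[OF g] using cls_eq[OF f(1) Dc[OF g]] e by simp
 then show "C \<in> res_diff (Suc (Suc n)) ` carrier (res (Suc (Suc n)))" using res_in[OF g] by (rule image_eqI)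
next
 fix C assume "C \<in> res_diff (Suc (Suc n)) ` carrier (res (Suc (Suc n)))"
 then obtain E where E: "E .: res (Suc (Suc n))" "C = res_diff (Suc (Suc n)) E" by (elim imageE)
 then obtain g where g: "g .: Tot (Suc (Suc n))" "E = cls (Suc (Suc n)) g" by (elim res_cases)
 have C: "C = cls (Suc n) (DD (Suc (Suc n)) g)" using E(2) g res_diff_cls by simp
 have "DD (Suc n) (DD (Suc (Suc n)) g) q \<in> JJ q" if q: "q \<le> n" for q
 unfolding DD_DD[OF g(1) q] JJ_def using Tot_mem[OF g(1), of q] q by auto
 then have "cls n (DD (Suc n) (DD (Suc (Suc n)) g)) = 0\<^sub>(res n)" using cls_zero[OF Dc[OF Dc[OF g(1)]]] by simp
 then show "C \<in> {C \<in> carrier (res (Suc n)). res_diff (Suc n) C = 0\<^sub>(res n)}"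
 unfolding C using res_in[OF Dc[OF g(1)]] res_diff_cls[OF Dc[OF g(1)]] by simp
qed
qed

end

section \<open>Comparison with the cyclic object of the crossed module\<close>

lemma lin_iso_trans:
assumes "lin_iso k U V" and "lin_iso k V W"
shows "lin_iso k U W"
proof -
obtain f g where f: "f : lin_hom k U V" "bij_betw f (carrier U) (carrier V)"
 and g: "g : lin_hom k V W" "bij_betw g (carrier V) (carrier W)" using assms unfolding lin_iso_def by (elim bexE)
have "(%u. g (f u)) : lin_hom k U W" by (rule lin_comp[OF f(1) g(1)])
moreover have "bij_betw (%u. g (f u)) (carrier U) (carrier W)" using bij_betw_trans[OF f(2) g(2)] by (simp add: comp_def)
ultimately show ?thesis unfolding lin_iso_def by (intro bexI[of _ "%u. g (f u)"])
qed

lemma bilin_cong: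
assumes F: "bilin k U V W F" and U: "module k U" and V: "module k V"
 and eq: "!!u v. u .: U ==> v .: V ==> G u v = F u v"
shows "bilin k U V W G"
proof (rule bilinI)
show "(%v. G u v) : lin_hom k V W" if u: "u .: U" for u using lin_cong[of V "%v. G u v" "%v. F u v" k W, OF eq[OF u] V] bilin1[OF F u] by simp
show "(%u. G u v) : lin_hom k U W" if v: "v .: V" for v using lin_cong[of U "%u. G u v" "%u. F u v" k W, OF eq[OF _ v] U] bilin2[OF F v] by simp
qed

lemma lact_lin1: "left_module k R V ==> v .: V ==> (%r. lact V r v) : lin_hom k R V"
by (rule lin_homI) (simp_all add: left_module.lact_closed left_module.lact_l_distr left_module.lact_smult_l)

lemma lact_lin2: "left_module k R V ==> r .: R ==> (%v. lact V r v) : lin_hom k V V"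
by (rule lin_homI) (simp_all add: left_module.lact_closed left_module.lact_r_distr left_module.lact_smult_r)

text \<open>A degreewise isomorphism that is a chain map; its inverse is a chain map as well.\<close>

lemma homology_iso_inverse:
assumes C: "!!n. module k (C n)" and d: "!!n. d (Suc n) : lin_hom k (C (Suc n)) (C n)"
 and dd: "!!n z. z .: C (Suc (Suc n)) ==> d (Suc n) (d (Suc (Suc n)) z) = 0\<^sub>(C n)"
 and C': "!!n. module k (C' n)" and d': "!!n. d' (Suc n) : lin_hom k (C' (Suc n)) (C' n)"
 and F: "!!n. F n : lin_hom k (C n) (C' n)" and G: "!!n. G n : lin_hom k (C' n) (C n)"
 and dF: "!!n z. z .: C (Suc n) ==> F n (d (Suc n) z) = d' (Suc n) (F (Suc n) z)"
 and GF: "!!n z. z .: C n ==> G n (F n z) = z"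
 and FG: "!!n z. z .: C' n ==> F n (G n z) = z"
shows "lin_iso k (homology C' d' n) (homology C d n)"
proof -
have dG: "G n (d' (Suc n) z) = d (Suc n) (G (Suc n) z)" if z: "z .: C' (Suc n)" for n z
proof -
 note Gz = lin_in[OF G z]
 have "G n (d' (Suc n) z) = G n (d' (Suc n) (F (Suc n) (G (Suc n) z)))" by (simp only: FG[OF z])
 also have "... = G n (F n (d (Suc n) (G (Suc n) z)))" by (simp only: dF[OF Gz])
 also have "... = d (Suc n) (G (Suc n) z)" by (rule GF[OF lin_in[OF d Gz]])
 finally show ?thesis .
qed
have dd': "d' (Suc n) (d' (Suc (Suc n)) z) = 0\<^sub>(C' n)" if z: "z .: C' (Suc (Suc n))" for n z
proof -
 note Gz = lin_in[OF G z]
 have "d' (Suc n) (d' (Suc (Suc n)) z) = d' (Suc n) (d' (Suc (Suc n)) (F (Suc (Suc n)) (G (Suc (Suc n)) z)))" by (simp only: FG[OF z])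
 also have "... = F n (d (Suc n) (d (Suc (Suc n)) (G (Suc (Suc n)) z)))" by (simp only: dF[OF Gz, symmetric] dF[OF lin_in[OF d Gz], symmetric])
 also have "... = 0\<^sub>(C' n)" unfolding dd[OF Gz] by (rule lin_zero[OF F C C'])
 finally show ?thesis .
qed
have bd: "z -\<^sub>(V n) z \<in> e (Suc n) ` carrier (V (Suc n))"
 if V: "!!n. module k (V n)" and e: "!!n. e (Suc n) : lin_hom k (V (Suc n)) (V n)" and z: "z .: V n"
 for V :: "nat => ('x, 'y, 'z) module_scheme" and k :: "('x, 'w) ring_scheme" and e n z
proof -
 interpret A: module k "V n" by (rule V)
 interpret B: module k "V (Suc n)" by (rule V)
 have "z -\<^sub>(V n) z = e (Suc n) 0\<^sub>(V (Suc n))" using A.M.diff_eq_zero_iff[OF z z] lin_zero[OF e V V] by simp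
 then show ?thesis using B.M.zero_closed by (rule image_eqI)
qed
show ?thesis
proof (rule homology_iso[where F = G and G = F, OF C' d' dd' C d dd G F dG dF])
 show "F n (G n z) -\<^sub>(C' n) z \<in> d' (Suc n) ` carrier (C' (Suc n))" if "z \<in> cycles C' d' n" for n z
 proof -
 have z: "z .: C' n" using that by (simp add: cycles_def)
 show ?thesis unfolding FG[OF z] by (rule bd[OF C' d' z])
 qed
 show "G n (F n z) -\<^sub>(C n) z \<in> d (Suc n) ` carrier (C (Suc n))" if "z \<in> cycles C d n" for n z
 proof -
 have z: "z .: C n" using that by (simp add: cycles_def)
 show ?thesis unfolding GF[OF z] by (rule bd[OF C d z])
 qed
qed
qed

context reduced_hopf_algebra
begin

context
fixes M :: "('k, 'h, 'm, 'g) crossed_mod_scheme"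
assumes M: "left_module k H M" and x_acts: "m .: M ==> lact M x m = m"
 and M_coact: "m .: M ==> coact M m = tensor_pure k M H m x"
begin

abbreviation "qM \<equiv> quot_left_mod M"

abbreviation "ZM \<equiv> hopf_cyclic k H M"

abbreviation "pu n t m \<equiv> tensor_over_pure k H (diag_mod k H (Suc n)) M t m"

lemma Mm: "module k M" by (rule left_module_module[OF M])

lemma qM_simps [simp]:
"carrier qM = carrier M" "0\<^sub>qM = 0\<^sub>M" "m +\<^sub>qM m' = m +\<^sub>M m'" "a \<odot>\<^sub>qM m = a \<odot>\<^sub>M m"
by (simp_all add: quot_left_mod_def module.defs)

text \<open>Since \<open>x\<close> acts as the identity on \<open>M\<close>, the ideal \<open>(1 - x)H\<close> annihilates \<open>M\<close>.\<close>

lemma qM_lact: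
assumes h: "h .: H" and m: "m .: M"
shows "lact qM (one_minus_ideal H x +>\<^sub>H h) m = lact M h m"
proof -
note l = lact_lin1[OF M m] and lc = left_module.lact_closed[OF M]
interpret Mk: module k M by (rule Mm)
have "the_elem ((%h. lact M h m) ` (one_minus_ideal H x +>\<^sub>H h)) = lact M h m"
proof (rule the_elem_coset[where g = "%h. lact M h m", OF Cm CE.II_sub h])
 fix w assume w: "w .: H" and "w -\<^sub>H h \<in> one_minus_ideal H x"
 then obtain r where r: "r .: H" "w -\<^sub>H h = r -\<^sub>H r **\<^sub>H x" unfolding CE.II_eq by (elim imageE)
 note rx = mult_in[OF r(1) x_closed]
 have "lact M w m -\<^sub>M lact M h m = lact M (w -\<^sub>H h) m" by (rule lin_diff[OF l Cm Mm w h, symmetric])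
 also have "... = lact M r m -\<^sub>M lact M (r **\<^sub>H x) m" unfolding r(2) by (rule lin_diff[OF l Cm Mm r(1) rx])
 also have "lact M (r **\<^sub>H x) m = lact M r m" unfolding left_module.lact_assoc[OF M r(1) x_closed m] x_acts[OF m] ..
 also have "lact M r m -\<^sub>M lact M r m = 0\<^sub>M" using Mk.M.diff_eq_zero_iff[OF lc[OF r(1) m] lc[OF r(1) m]] by simp
 finally show "lact M w m = lact M h m" using Mk.M.diff_eq_zero_iff[OF lc[OF w m] lc[OF h m]] by simp
qed
then show ?thesis by (simp add: quot_left_mod_def module.defs left_mod.defs)
qed

lemma qM_left_module: "left_module k CE.RR qM"
proof -
note p = CE.RR_proj
interpret Mk: left_module k H M by (rule M)
have qm: "module k qM" by (rule module_surj_image[where V = M and q = "%v. v", OF Mm]) (auto intro!: lin_homI)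
have hc: "a +\<^sub>H b .: H" if "a .: H" "b .: H" for a b using that abelian_groupE(1)[OF module.axioms(2)[OF Cm]] by simp
have mc: "a +\<^sub>M b .: M" if "a .: M" "b .: M" for a b using that abelian_groupE(1)[OF module.axioms(2)[OF Mm]] by simp
note sh = module.smult_closed[OF Cm] and sm = module.smult_closed[OF Mm]
show ?thesis
proof (intro left_module.intro left_module_axioms.intro quot_alg qm; unfold qM_simps)
 fix D v assume "D .: CE.RR" "v .: M"
 then show "lact qM D v .: M" by (elim CE.RR_cases) (simp only: qM_lact Mk.lact_closed)
next
 fix D E v assume "D .: CE.RR" "E .: CE.RR" "v .: M"
 then show "lact qM (D +\<^sub>CE.RR E) v = lact qM D v +\<^sub>M lact qM E v"
 by (elim CE.RR_cases) (simp only: lin_add[OF p, symmetric] qM_lact hc Mk.lact_l_distr)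
next
 fix D v w assume "D .: CE.RR" "v .: M" "w .: M"
 then show "lact qM D (v +\<^sub>M w) = lact qM D v +\<^sub>M lact qM D w" by (elim CE.RR_cases) (simp only: qM_lact mc Mk.lact_r_distr)
next
 fix a D v assume "a .: k" "D .: CE.RR" "v .: M"
 then show "lact qM (a \<odot>\<^sub>CE.RR D) v = a \<odot>\<^sub>M lact qM D v"
 by (elim CE.RR_cases) (simp only: lin_smult[OF p, symmetric] qM_lact sh Mk.lact_smult_l)
next
 fix a D v assume "a .: k" "D .: CE.RR" "v .: M"
 then show "lact qM D (a \<odot>\<^sub>M v) = a \<odot>\<^sub>M lact qM D v" by (elim CE.RR_cases) (simp only: qM_lact sm Mk.lact_smult_r)
next
 fix D E v assume "D .: CE.RR" "E .: CE.RR" "v .: M"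
 then show "lact qM (D **\<^sub>CE.RR E) v = lact qM D (lact qM E v)"
 by (elim CE.RR_cases) (simp only: CE.RR_mult qM_lact mult_in Mk.lact_closed Mk.lact_assoc)
next
 fix v assume "v .: M"
 then show "lact qM 1\<^sub>CE.RR v = v" by (simp only: CE.RR_one qM_lact one_closed' Mk.lact_one)
qed
qed

lemma ZM_chains: "chains ZM n = tensor_over k H (diag_mod k H (Suc n)) M" by (simp add: hopf_cyclic_def hopf_chains_def)

lemma ZM_module: "module k (chains ZM n)" unfolding ZM_chains by (rule tensor_over_module[OF diag_rmod M])

lemma pu_bilin: "bilin k (tp (Suc n)) M (chains ZM n) (%t m. pu n t m)"
using tensor_over_pure_bilin[OF diag_rmod[of n] M] unfolding ZM_chains by (simp add: bilin_def lin_hom_def)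

lemma pu_balanced: "t .: tp (Suc n) ==> h .: H ==> m .: M ==>
 pu n (act (Suc n) t h) m = pu n t (lact M h m)" using tensor_over_pure_balanced[OF diag_rmod[of n] M, of t h m] by simp

lemma ZM_lift:
assumes T: "module k T" and f: "bilin k (tp (Suc n)) M T (%t m. f (t, m))"
 and bal: "!!t h m. t .: tp (Suc n) ==> h .: H ==> m .: M ==> f (act (Suc n) t h, m) = f (t, lact M h m)"
shows "pres_lift k T f : Hom (chains ZM n) T"
 and "t .: tp (Suc n) ==> m .: M ==> pres_lift k T f (pu n t m) = f (t, m)"
proof -
have b: "bilin k (diag_mod k H (Suc n)) M T (%t m. f (t, m))" using f by (simp add: bilin_def lin_hom_def)
have bal': "f (ract (diag_mod k H (Suc n)) t h, m) = f (t, lact M h m)"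
 if "t .: diag_mod k H (Suc n)" "h .: H" "m .: M" for t h m using bal that by simp
note l = tensor_over_lift[OF diag_rmod M T b bal']
show "pres_lift k T f : Hom (chains ZM n) T" unfolding ZM_chains by (rule l(1))
show "t .: tp (Suc n) ==> m .: M ==> pres_lift k T f (pu n t m) = f (t, m)" by (rule l(2)) simp_all
qed

lemma ZM_ext:
assumes T: "module k T" and f: "f : Hom (chains ZM n) T" and g: "g : Hom (chains ZM n) T"
 and eq: "!!t m. t .: tp (Suc n) ==> m .: M ==> f (pu n t m) = g (pu n t m)"
 and z: "z .: chains ZM n"
shows "f z = g z" by (rule tensor_over_ext[OF diag_rmod M T f[unfolded ZM_chains] g[unfolded ZM_chains] _ z[unfolded ZM_chains]]) (simp add: eq)

lemma pu_morphism_lift: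
assumes f: "f : Hom (tp (Suc n)) (tp (Suc p))"
 and eqv: "!!t h. t .: tp (Suc n) ==> h .: H ==> f (act (Suc n) t h) = act (Suc p) (f t) h"
 and F: "!!t m. t .: tp (Suc n) ==> m .: M ==> F (t, m) = pu p (f t) m"
shows "pres_lift k (chains ZM p) F : Hom (chains ZM n) (chains ZM p)"
 and "t .: tp (Suc n) ==> m .: M ==> pres_lift k (chains ZM p) F (pu n t m) = pu p (f t) m"
proof -
note fc = lin_in[OF f]
have b0: "bilin k (tp (Suc n)) M (chains ZM p) (%t m. pu p (f t) m)" by (intro bilinI bilin1[OF pu_bilin] bilin_comp2[OF pu_bilin f] fc)
have b: "bilin k (tp (Suc n)) M (chains ZM p) (%t m. F (t, m))" by (rule bilin_cong[OF b0 Tm Mm F])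
have bal: "F (act (Suc n) t h, m) = F (t, lact M h m)"
 if "t .: tp (Suc n)" "h .: H" "m .: M" for t h m using that by (simp add: F tact_in left_module.lact_closed[OF M] eqv pu_balanced fc)
note l = ZM_lift[OF ZM_module b bal]
show "pres_lift k (chains ZM p) F : Hom (chains ZM n) (chains ZM p)" by (rule l(1))
show "t .: tp (Suc n) ==> m .: M ==> pres_lift k (chains ZM p) F (pu n t m) = pu p (f t) m" using l(2)[of t m] by (simp add: F)
qed

lemma ZM_face:
assumes i: "i \<le> Suc n"
shows "face ZM (Suc n) i : Hom (chains ZM (Suc n)) (chains ZM n)"
 and "t .: tp (Suc (Suc n)) ==> m .: M ==> face ZM (Suc n) i (pu (Suc n) t m) = pu n (eps (Suc n) i t) m"
proof -
have e: "face ZM (Suc n) i = pres_lift k (chains ZM n) (%(t, m). pu n (eps (Suc n) i t) m)" by (simp add: hopf_cyclic_def)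
note l = pu_morphism_lift[OF counit_at(1)[OF i] counit_at_act[OF i], where F = "%(t, m). pu n (eps (Suc n) i t) m", simplified]
show "face ZM (Suc n) i : Hom (chains ZM (Suc n)) (chains ZM n)" unfolding e by (rule l(1))
show "t .: tp (Suc (Suc n)) ==> m .: M ==> face ZM (Suc n) i (pu (Suc n) t m) = pu n (eps (Suc n) i t) m" unfolding e by (rule l(2))
qed

lemma ZM_cyc:
shows "cyc ZM n : Hom (chains ZM n) (chains ZM n)"
 and "t .: tp (Suc n) ==> m .: M ==> cyc ZM n (pu n t m) = pu n (rot n t) m"
proof -
let ?F = "%(t, m). pres_lift k (chains ZM n) (%(m0, m1). pu n (twist_rotate k H n m1 t) m0) (coact M m)"
have e: "cyc ZM n = pres_lift k (chains ZM n) ?F" by (simp add: hopf_cyclic_def)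
have F: "?F (t, m) = pu n (rot n t) m" if t: "t .: tp (Suc n)" and m: "m .: M" for t m
proof -
 have "bilin k M H (chains ZM n) (%m0 m1. pu n (twist_rotate k H n m1 t) m0)"
 by (intro bilinI bilin_comp2[OF pu_bilin twist_rotate_linear_twist[OF t]] bilin1[OF pu_bilin] lin_in[OF twist_rotate_lin t])
 then have "pres_lift k (chains ZM n) (%(m0, m1). pu n (twist_rotate k H n m1 t) m0) (tensor_pure k M H m x) = pu n (rot n t) m"
 using tensor_lift_pure[OF Mm Cm ZM_module, of n "%(m0, m1). pu n (twist_rotate k H n m1 t) m0" m x] m x_closed by simp
 then show ?thesis using M_coact[OF m] by simp
qed
note l = pu_morphism_lift[where F = ?F, OF rot_lin rot_act F]
show "cyc ZM n : Hom (chains ZM n) (chains ZM n)" unfolding e by (rule l(1))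
show "t .: tp (Suc n) ==> m .: M ==> cyc ZM n (pu n t m) = pu n (rot n t) m" unfolding e by (rule l(2))
qed

lemma ZM_data: "cyclic_data k ZM" unfolding cyclic_data_def using ZM_module ZM_face(1) ZM_cyc(1) by blast

lemma pu_morphism:
assumes m: "m .: M"
shows "cyclic_morphism k PX ZM (%n t. pu n t m)" unfolding cyclic_morphism_def paracyclic_simps
by (intro conjI allI impI ballI bilin2[OF pu_bilin m]) (simp_all add: ZM_face(2) ZM_cyc(2) m)

lemma ZM_tot_module: "module k (tsygan_tot ZM n)" by (rule tot_module[OF module_cring[OF Cm] ZM_module])

text \<open>The chain isomorphism sends \<open>[f] \<otimes> m\<close> to \<open>(f\<^sub>q \<otimes> m)\<^sub>q\<close>.\<close>

definition Phi :: "nat => (nat => ('h list => 'k) set) => 'm => nat => (('h list => 'k) set \<times> 'm => 'k) set" where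
"Phi n f m = tot_map (%q t. pu q t m) n f"

lemma Phi_bilin: "bilin k (Tot n) M (tsygan_tot ZM n) (%f m. Phi n f m)"
proof (rule bilinI)
show "(%f. Phi n f m) : Hom (Tot n) (tsygan_tot ZM n)" if "m .: M" for m
 unfolding Phi_def using that by (intro tot_map_lin) (simp_all add: bilin2[OF pu_bilin] Tm)
fix f assume f: "f .: Tot n"
note l = bilin1[OF pu_bilin Tot_mem[OF f]]
show "(%m. Phi n f m) : Hom M (tsygan_tot ZM n)"
proof (rule lin_homI)
 show "Phi n f m .: tsygan_tot ZM n" if "m .: M" for m unfolding Phi_def tot_map_def using that lin_in[OF l] by (intro tot_memI) simp
 show "Phi n f (m +\<^sub>M m') = Phi n f m +\<^sub>(tsygan_tot ZM n) Phi n f m'" if "m .: M" "m' .: M" for m m'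
 using that lin_add[OF l] by (auto simp: Phi_def tot_map_def tsygan_tot_simps intro!: restrict_ext)
 show "Phi n f (a \<odot>\<^sub>M m) = a \<odot>\<^sub>(tsygan_tot ZM n) Phi n f m" if "a .: k" "m .: M" for a m
 using that lin_smult[OF l] by (auto simp: Phi_def tot_map_def tsygan_tot_simps intro!: restrict_ext)
qed
qed

lemma Phi_balanced:
assumes f: "f .: Tot n" and h: "h .: H" and m: "m .: M"
shows "Phi n (tot_map (%q t. act (Suc q) t h) n f) m = Phi n f (lact M h m)"
using pu_balanced[OF Tot_mem[OF f] h m] by (auto simp: Phi_def tot_map_def intro!: restrict_ext)

definition to_ZM :: "nat => ((nat => ('h list => 'k) set) set \<times> 'm => 'k) set => nat => (('h list => 'k) set \<times> 'm => 'k) set" where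
"to_ZM n = pres_lift k (tsygan_tot ZM n) (%(C, m). the_elem ((%f. Phi n f m) ` C))"

abbreviation "TQ n \<equiv> tensor_over k CE.RR (res n) qM"

abbreviation "pq n C m \<equiv> tensor_over_pure k CE.RR (res n) qM C m"

lemma TQ_module: "module k (TQ n)" by (rule tensor_over_module[OF res_rmod qM_left_module])

lemma pq_bilin: "bilin k (res n) M (TQ n) (%C m. pq n C m)"
using tensor_over_pure_bilin[OF res_rmod[of n] qM_left_module] by (simp add: bilin_def lin_hom_def)

lemma Phi_coset:
assumes m: "m .: M"
shows "(%C. the_elem ((%f. Phi n f m) ` C)) : Hom (res n) (tsygan_tot ZM n)"
 and "f .: Tot n ==> the_elem ((%f. Phi n f m) ` cls n f) = Phi n f m"
proof -
have g: "(%f. Phi n f m) : Hom (tot_right n) (tsygan_tot ZM n)" using bilin2[OF Phi_bilin m] by (simp add: tot_right_lin)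
interpret Z: module k "tsygan_tot ZM n" by (rule ZM_tot_module)
have kill: "Phi n f m = 0\<^sub>(tsygan_tot ZM n)" if f: "f \<in> SI n" for f
proof -
 obtain v where v: "f = v -\<^sub>(tot_right n) ract (tot_right n) v x" "v .: tot_right n" using f unfolding shift_image_def by (elim imageE)
 note rc = right_module.ract_closed[OF tot_right_rmod v(2) x_closed]
 have v': "v .: Tot n" using v(2) by simp
 have "Phi n f m = Phi n v m -\<^sub>(tsygan_tot ZM n) Phi n (ract (tot_right n) v x) m"
 unfolding v(1) by (rule lin_diff[OF g tot_rmod ZM_tot_module v(2) rc])
 also have "Phi n (ract (tot_right n) v x) m = Phi n v m" using Phi_balanced[OF v' x_closed m] x_acts[OF m] by simp
 also have "Phi n v m -\<^sub>(tsygan_tot ZM n) Phi n v m = 0\<^sub>(tsygan_tot ZM n)"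
 using Z.M.diff_eq_zero_iff[OF bilin_in[OF Phi_bilin v' m] bilin_in[OF Phi_bilin v' m]] by simp
 finally show ?thesis .
qed
note l = quot_lift[where g = "%f. Phi n f m", OF tot_rmod[of n] SI_sub[of n] ZM_tot_module g]
have "(%C. the_elem ((%f. Phi n f m) ` C)) : Hom (quot_mod (tot_right n) (SI n)) (tsygan_tot ZM n)" by (rule l(1)) (rule kill)
then show "(%C. the_elem ((%f. Phi n f m) ` C)) : Hom (res n) (tsygan_tot ZM n)" unfolding res_def by (simp add: lin_hom_def)
show "f .: Tot n ==> the_elem ((%f. Phi n f m) ` cls n f) = Phi n f m" by (rule l(2)) (simp_all add: kill)
qed

lemma to_ZM:
shows "to_ZM n : Hom (TQ n) (tsygan_tot ZM n)"
 and "f .: Tot n ==> m .: M ==> to_ZM n (pq n (cls n f) m) = Phi n f m"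
proof -
let ?f = "%(C, m). the_elem ((%f. Phi n f m) ` C)"
have b: "bilin k (res n) qM (tsygan_tot ZM n) (%C m. ?f (C, m))"
proof (rule bilinI)
 show "(%C. ?f (C, m)) : Hom (res n) (tsygan_tot ZM n)" if "m .: qM" for m using Phi_coset(1)[of m n] that by simp
 fix C assume "C .: res n"
 then obtain f where f: "f .: Tot n" "C = cls n f" by (elim res_cases)
 have "?f (C, m) = Phi n f m" if "m .: M" for m using Phi_coset(2)[OF that f(1)] f(2) by simp
 from iffD2[OF lin_cong[OF this Mm] bilin1[OF Phi_bilin f(1)]]
 have "(%m. ?f (C, m)) : Hom M (tsygan_tot ZM n)" .
 then show "(%m. ?f (C, m)) : Hom qM (tsygan_tot ZM n)" by (simp add: lin_hom_def)
qed
have bal: "?f (ract (res n) C D, m) = ?f (C, lact qM D m)"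
 if CD: "C .: res n" "D .: CE.RR" and m: "m .: qM" for C D m
proof -
 obtain f h where f: "f .: Tot n" "C = cls n f" and h: "h .: H" "D = one_minus_ideal H x +>\<^sub>H h" using CD by (elim res_cases CE.RR_cases)
 have m': "m .: M" using m by simp
 show ?thesis unfolding f(2) h(2) cls_ract[OF f(1) h(1)] qM_lact[OF h(1) m'] prod.case
  Phi_coset(2)[OF m' lin_in[OF tot_act_lin[OF h(1)] f(1)]]
  Phi_coset(2)[OF left_module.lact_closed[OF M h(1) m'] f(1)] by (rule Phi_balanced[OF f(1) h(1) m'])
qed
note l = tensor_over_lift[OF res_rmod qM_left_module ZM_tot_module b]
show "to_ZM n : Hom (TQ n) (tsygan_tot ZM n)" unfolding to_ZM_def by (rule l(1)) (rule bal)
show "to_ZM n (pq n (cls n f) m) = Phi n f m" if f: "f .: Tot n" and m: "m .: M"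
proof -
 have "to_ZM n (pq n (cls n f) m) = ?f (cls n f, m)" unfolding to_ZM_def by (rule l(2)) (erule (2) bal, rule res_in[OF f], simp add: m)
 then show ?thesis using Phi_coset(2)[OF m f] by simp
qed
qed

lemma TQ_ext:
assumes T: "module k T" and f: "f : Hom (TQ n) T" and g: "g : Hom (TQ n) T"
 and eq: "!!v m. v .: Tot n ==> m .: M ==> f (pq n (cls n v) m) = g (pq n (cls n v) m)"
 and z: "z .: TQ n"
shows "f z = g z"
proof (rule tensor_over_ext[OF res_rmod qM_left_module T f g _ z])
fix C m assume "C .: res n" "m .: qM"
then show "f (pq n C m) = g (pq n C m)" by (elim res_cases) (simp add: eq)
qed

definition from_comp :: "nat => nat => (('h list => 'k) set \<times> 'm => 'k) set => ((nat => ('h list => 'k) set) set \<times> 'm => 'k) set" where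
"from_comp n q = pres_lift k (TQ n) (%(t, m). pq n (cls n (tot_incl PX n q t)) m)"

definition from_ZM :: "nat => (nat => (('h list => 'k) set \<times> 'm => 'k) set) => ((nat => ('h list => 'k) set) set \<times> 'm => 'k) set" where
"from_ZM n c = (\<Oplus>\<^bsub>TQ n\<^esub>q\<in>{..n}. from_comp n q (c q))"

lemma incl_lin: "q \<le> n ==> tot_incl PX n q : Hom (tp (Suc q)) (Tot n)" using tot_incl_lin[of k PX q n] by (simp add: Tm)

lemma cls_linear': "(%f. cls n f) : Hom (Tot n) (res n)" by (rule cls_lin)

lemma from_comp:
assumes q: "q \<le> n"
shows "from_comp n q : Hom (chains ZM q) (TQ n)"
 and "t .: tp (Suc q) ==> m .: M ==> from_comp n q (pu q t m) = pq n (cls n (tot_incl PX n q t)) m"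
proof -
note il = lin_comp[OF incl_lin[OF q] cls_linear'] and ic = lin_in[OF incl_lin[OF q]]
let ?f = "%(t, m). pq n (cls n (tot_incl PX n q t)) m"
have b: "bilin k (tp (Suc q)) M (TQ n) (%t m. ?f (t, m))"
 unfolding prod.case by (intro bilinI bilin1[OF pq_bilin] bilin_comp2[OF pq_bilin il] lin_in[OF il])
have bal: "?f (act (Suc q) t h, m) = ?f (t, lact M h m)"
 if t: "t .: tp (Suc q)" and h: "h .: H" and m: "m .: M" for t h m
proof -
 have e: "tot_incl PX n q (act (Suc q) t h) = tot_map (%q t. act (Suc q) t h) n (tot_incl PX n q t)"
 using rhom_ract[OF tot_right_incl[OF q], of t h] t h by simp
 have hc: "one_minus_ideal H x +>\<^sub>H h .: CE.RR" by (rule lin_in[OF CE.RR_proj h])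
 show ?thesis unfolding prod.case e cls_ract[OF ic[OF t] h, symmetric]
 using tensor_over_pure_balanced[OF res_rmod qM_left_module res_in[OF ic[OF t]] hc, of m] m by (simp add: qM_lact[OF h m])
qed
note l = ZM_lift[OF TQ_module b bal]
show "from_comp n q : Hom (chains ZM q) (TQ n)" unfolding from_comp_def by (rule l(1))
show "t .: tp (Suc q) ==> m .: M ==> from_comp n q (pu q t m) = pq n (cls n (tot_incl PX n q t)) m"
 unfolding from_comp_def using l(2)[of t m] by simp
qed

lemma from_ZM_lin: "from_ZM n : Hom (tsygan_tot ZM n) (TQ n)"
unfolding from_ZM_def[abs_def] by (rule lin_finsum_map[OF TQ_module]) (auto intro: lin_comp[OF tot_eval from_comp(1)])

lemma from_to_ZM:
assumes z: "z .: TQ n"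
shows "from_ZM n (to_ZM n z) = z"
proof (rule TQ_ext[OF TQ_module lin_comp[OF to_ZM(1) from_ZM_lin] lin_id _ z])
fix f m assume f: "f .: Tot n" and m: "m .: M"
interpret T: module k "TQ n" by (rule TQ_module)
have g: "(%f. pq n (cls n f) m) : Hom (Tot n) (TQ n)" by (rule bilin_comp2[OF pq_bilin cls_linear' m])
have ic: "tot_incl PX n q (f q) .: Tot n" if "q \<le> n" for q by (rule lin_in[OF incl_lin[OF that] Tot_mem[OF f that]])
have "from_ZM n (to_ZM n (pq n (cls n f) m)) = (\<Oplus>\<^bsub>TQ n\<^esub>q\<in>{..n}. from_comp n q (Phi n f m q))"
 by (simp add: to_ZM(2)[OF f m] from_ZM_def)
also have "... = (\<Oplus>\<^bsub>TQ n\<^esub>q\<in>{..n}. pq n (cls n (tot_incl PX n q (f q))) m)"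
proof (rule T.finsum_cong'[OF refl])
 show "from_comp n q (Phi n f m q) = pq n (cls n (tot_incl PX n q (f q))) m" if "q \<in> {..n}" for q
 using that from_comp(2)[of q n "f q" m] Tot_mem[OF f, of q] m by (simp add: Phi_def tot_map_def)
qed (use lin_in[OF g ic] in auto)
also have "... = pq n (cls n (\<Oplus>\<^bsub>Tot n\<^esub>q\<in>{..n}. tot_incl PX n q (f q))) m"
 by (rule lin_finsum[OF g Tot_module TQ_module, symmetric]) (use ic in auto)
also have "(\<Oplus>\<^bsub>Tot n\<^esub>q\<in>{..n}. tot_incl PX n q (f q)) = f" using tot_incl_sum[OF module_cring[OF Cm], of PX f n] f Tm by simp
finally show "from_ZM n (to_ZM n (pq n (cls n f) m)) = pq n (cls n f) m" .
qed

lemma to_from_ZM: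
assumes c: "c .: tsygan_tot ZM n"
shows "to_ZM n (from_ZM n c) = c"
proof -
interpret Z: module k "tsygan_tot ZM n" by (rule ZM_tot_module)
have e: "to_ZM n (from_comp n q z) = tot_incl ZM n q z" if q: "q \<le> n" and z: "z .: chains ZM q" for q z
proof (rule ZM_ext[OF ZM_tot_module lin_comp[OF from_comp(1)[OF q] to_ZM(1)] tot_incl_lin[OF ZM_module q] _ z])
 fix t m assume t: "t .: tp (Suc q)" and m: "m .: M"
 have z: "pu r 0\<^sub>(tp (Suc r)) m = 0\<^sub>(chains ZM r)" for r by (rule lin_zero[OF bilin2[OF pu_bilin m] Tm ZM_module])
 have "to_ZM n (from_comp n q (pu q t m)) = Phi n (tot_incl PX n q t) m"
 unfolding from_comp(2)[OF q t m] by (rule to_ZM(2)[OF lin_in[OF incl_lin[OF q] t] m])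
 also have "... = tot_incl ZM n q (pu q t m)" by (auto simp: Phi_def tot_map_def tot_incl_def z intro!: restrict_ext)
 finally show "to_ZM n (from_comp n q (pu q t m)) = tot_incl ZM n q (pu q t m)" .
qed
have fc: "from_comp n q (c q) .: TQ n" if "q \<le> n" for q by (rule lin_in[OF from_comp(1)[OF that] tot_mem[OF c that]])
have "to_ZM n (from_ZM n c) = (\<Oplus>\<^bsub>tsygan_tot ZM n\<^esub>q\<in>{..n}. to_ZM n (from_comp n q (c q)))"
 unfolding from_ZM_def by (rule lin_finsum[OF to_ZM(1) TQ_module ZM_tot_module]) (use fc in auto)
also have "... = (\<Oplus>\<^bsub>tsygan_tot ZM n\<^esub>q\<in>{..n}. tot_incl ZM n q (c q))"
 using e tot_mem[OF c] lin_in[OF tot_incl_lin[OF ZM_module] tot_mem[OF c]] by (intro Z.finsum_cong'[OF refl]) auto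
also have "... = c" by (rule tot_incl_sum[OF module_cring[OF Cm] ZM_module c, symmetric])
finally show ?thesis .
qed

abbreviation "TD n \<equiv> tensor_map k CE.RR (res (n - 1)) qM (res_diff n)"

lemma TD_lin: "TD (Suc n) : Hom (TQ (Suc n)) (TQ n)"
and TD_pure: "f .: Tot (Suc n) ==> m .: M ==> TD (Suc n) (pq (Suc n) (cls (Suc n) f) m) = pq n (cls n (DD (Suc n) f)) m"
using tensor_map[OF res_rmod res_rmod qM_left_module res_diff_rhom[of n]] res_in by (simp_all add: res_diff_cls)

lemma to_ZM_diff:
assumes z: "z .: TQ (Suc n)"
shows "to_ZM n (TD (Suc n) z) = tsygan_diff ZM (Suc n) (to_ZM (Suc n) z)"
proof (rule TQ_ext[OF ZM_tot_module lin_comp[OF TD_lin to_ZM(1)] lin_comp[OF to_ZM(1) tsygan_diff_lin[OF ZM_data]] _ z])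
fix f m assume f: "f .: Tot (Suc n)" and m: "m .: M"
show "to_ZM n (TD (Suc n) (pq (Suc n) (cls (Suc n) f) m)) = tsygan_diff ZM (Suc n) (to_ZM (Suc n) (pq (Suc n) (cls (Suc n) f) m))"
 unfolding TD_pure[OF f m] to_ZM(2)[OF f m] to_ZM(2)[OF lin_in[OF DD_lin f] m] Phi_def
 by (rule tot_map_diff[OF paracyclic_data ZM_data pu_morphism[OF m] f])
qed

text \<open>The maps between both complexes are inverse to each other in every degree, and one of them is a chain map,
  because \<open>- \<otimes> m\<close> is a morphism of cyclic objects for each \<open>m\<close>.\<close>

theorem HC_as_homology_of_resolution:
assumes triv: "right_module k CE.RR (quot_trivial_right_mod k H)"
shows "lin_iso k (HC ZM n) (homology TQ TD n)"
proof -
note res = res_exact_resolution[OF triv]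
show ?thesis unfolding HC_def
proof (rule homology_iso_inverse[where F = to_ZM and G = from_ZM, OF TQ_module TD_lin _ ZM_tot_module tsygan_diff_lin[OF ZM_data]
  to_ZM(1) from_ZM_lin to_ZM_diff from_to_ZM to_from_ZM])
 fix n z assume z: "z .: TQ (Suc (Suc n))"
 have "TD (Suc n) (TD (Suc (Suc n)) z) = tensor_map k CE.RR (res n) qM (%v. 0\<^sub>(res n)) z"
 using tensor_map_comp[OF res_rmod res_rmod res_rmod qM_left_module
  res_diff_rhom[of "Suc n"] res_diff_rhom[of n] rhom_zero_map[OF res_rmod] exact_resolutionD(9)[OF res] z] by simp
 also have "... = 0\<^sub>(TQ n)" by (rule tensor_map_zero[OF res_rmod res_rmod qM_left_module z])
 finally show "TD (Suc n) (TD (Suc (Suc n)) z) = 0\<^sub>(TQ n)" .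
qed
qed

end

end

theorem proposition5p8:
  fixes k :: "'k ring"
    and H :: "('k, 'h) hopf"
    and M :: "('k, 'h, 'm) crossed_mod"
    and x :: 'h
    and P :: "nat \<Rightarrow> ('k, 'h set, 'p) right_mod"
    and d :: "nat \<Rightarrow> 'p \<Rightarrow> 'p"
    and aug :: "'p \<Rightarrow> 'k"
    and n :: nat
  defines "Hbar \<equiv> quot_mod H (one_minus_ideal H x)"
  assumes "field k"
    and char_0: "\<And>i::nat. i > 0 \<Longrightarrow> [i] \<cdot>\<^bsub>k\<^esub> \<one>\<^bsub>k\<^esub> \<noteq> \<zero>\<^bsub>k\<^esub>"
    and "hopf_algebra k H" and "cocommutative k H" and "pointed k H"
    and "group_like k H x"
    and central: "\<And>h. h \<in> carrier H \<Longrightarrow> x \<otimes>\<^bsub>H\<^esub> h = h \<otimes>\<^bsub>H\<^esub> x"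
    and infinite_order: "\<And>i::nat. i > 0 \<Longrightarrow> x [^]\<^bsub>H\<^esub> i \<noteq> \<one>\<^bsub>H\<^esub>"
    and "crossed_module k H M" and "modular k M"
    and coact_x: "\<And>m. m \<in> carrier M \<Longrightarrow> coact M m = tensor_pure k M H m x"
    and "projective_resolution k Hbar (quot_trivial_right_mod k H) P d aug"
  shows "lin_iso k (HC (hopf_cyclic k H M) n) (Tor k Hbar P d (quot_left_mod M) n)"
proof -
have proj: "!!n. projective k Hbar (P n)" and triv: "right_module k Hbar (quot_trivial_right_mod k H)"
 using \<open>projective_resolution k Hbar (quot_trivial_right_mod k H) P d aug\<close> by (simp_all add: projective_resolution_def)
have P: "exact_resolution k Hbar (quot_trivial_right_mod k H) P d aug"
 using \<open>projective_resolution k Hbar (quot_trivial_right_mod k H) P d aug\<close>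
 by (simp add: projective_resolution_def exact_resolution_def projective_def)
interpret H: hopf_algebra k H by fact
interpret R: reduced_hopf_algebra k H x
proof (intro reduced_hopf_algebra.intro free_central_group_like.intro free_central_group_like_axioms.intro reduced_hopf_algebra_axioms.intro)
 show "h = 0\<^sub>H" if "h .: H" "h **\<^sub>H x = h" for h
 by (rule H.no_fixed_vectors[OF \<open>cocommutative k H\<close> \<open>pointed k H\<close> \<open>group_like k H x\<close> infinite_order that])
 show "assoc_algebra k (quot_mod H (one_minus_ideal H x))" using triv unfolding Hbar_def right_module_def by (elim conjE)
qed (fact | rule central)+
have M: "left_module k H M" using \<open>crossed_module k H M\<close> by (simp add: crossed_module_def)
note Mm = left_module_module[OF M]
have x_acts: "lact M x m = m" if m: "m .: M" for m
proof -
 have "bilin k M H M (%m0 m1. lact M m1 m0)" by (intro bilinI lact_lin1[OF M] lact_lin2[OF M])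
 then have "pres_lift k M (%(m0, m1). lact M m1 m0) (tensor_pure k M H m x) = lact M x m"
 using tensor_lift_pure[OF Mm H.Cm Mm, of "%(m0, m1). lact M m1 m0" m x] m R.x_closed by simp
 moreover have "pres_lift k M (%(m0, m1). lact M m1 m0) (coact M m) = m" using \<open>modular k M\<close> m by (simp add: modular_def)
 ultimately show ?thesis unfolding coact_x[OF m] by simp
qed
have "\<forall>n. \<exists>J e \<psi>. dual_basis k Hbar (R.res n) (J :: (nat \<times> ('h list => 'k) set) set) e \<psi>"
 using R.res_dual_basis unfolding Hbar_def by blast
then obtain J :: "nat => (nat \<times> ('h list => 'k) set) set" and e \<psi> where dbQ: "!!n. dual_basis k Hbar (R.res n) (J n) (e n) (\<psi> n)"
 by metis
have "\<forall>n. \<exists>\<phi>. dual_basis k Hbar (P n) (carrier (P n)) (%p. p) \<phi>" using projective_dual_basis[OF proj] by blast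
then obtain \<phi> where dbP: "!!n. dual_basis k Hbar (P n) (carrier (P n)) (%p. p) (\<phi> n)" by metis
have qM: "left_module k Hbar (quot_left_mod M)" unfolding Hbar_def by (rule R.qM_left_module[OF M x_acts coact_x])
have "lin_iso k (HC (hopf_cyclic k H M) n)
 (homology (%n. tensor_over k Hbar (R.res n) (quot_left_mod M)) (%n. tensor_map k Hbar (R.res (n - 1)) (quot_left_mod M) (R.res_diff n)) n)"
 unfolding Hbar_def by (rule R.HC_as_homology_of_resolution[OF M x_acts coact_x triv[unfolded Hbar_def]])
moreover have "lin_iso k
 (homology (%n. tensor_over k Hbar (R.res n) (quot_left_mod M)) (%n. tensor_map k Hbar (R.res (n - 1)) (quot_left_mod M) (R.res_diff n)) n)
 (homology (%n. tensor_over k Hbar (P n) (quot_left_mod M)) (%n. tensor_map k Hbar (P (n - 1)) (quot_left_mod M) (d n)) n)"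
 by (rule comparison[OF R.res_exact_resolution[OF triv[unfolded Hbar_def], folded Hbar_def] P qM dbQ dbP])
ultimately show ?thesis unfolding Tor_def tensor_map_def by (rule lin_iso_trans)
qed

end
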